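(* Let $Q=Q(d,d_0)$ be any compact connected two-point homogeneous space (normalized as in the context). If $\eta\in W(d,d_0)$, $\eta\ne0$, then there are positive constants $c(\eta),C(\eta),c_1(\eta),C_1(\eta)$ independent of $N$ such that for every $N$ $$\langle\theta^{\Delta}(\eta)\rangle N^2-c(\eta)N^{1-\frac1d}>\theta^{\Delta}_N(\eta)>\langle\theta^{\Delta}(\eta)\rangle N^2-C(\eta)N^{1-\frac1d},$$ $$c_1(\eta)N^{1-\frac1d}<\lambda_N(\eta)<C_1(\eta)N^{1-\frac1d}.$$ In particular, for the chordal metric $\tau$ on $Q$, for every $N$, $$\langle\tau\rangle N^2-cN^{1-\frac1d}>\tau_N>\langle\tau\rangle N^2-CN^{1-\frac1d}$$ with the constants $c=c(\eta^{\natural})$ and $C=C(\eta^{\natural})$, where $\eta^{\natural}(r)=\sin r$, $r\in[0,\pi]$.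
   Context: Spaces. $Q=Q(d,d_0)$ is one of the following: the sphere $S^d$, $d\ge 1$, with the convention $d_0=d$; or a projective space $\mathbb{F}P^n$ with $\mathbb F=\mathbb R,\mathbb C,\mathbb H$, $n\ge2$, or the octonionic projective plane $\mathbb{O}P^2$ ($\mathbb F=\mathbb O$, $n=2$), where $d_0=\dim_{\mathbb R}\mathbb F=1,2,4,8$ for $\mathbb F=\mathbb R,\mathbb C,\mathbb H,\mathbb O$ respectively and $d=nd_0$. $Q$ carries the isometry-invariant Riemannian distance $\theta$, rescaled so that $\operatorname{diam}(Q,\theta)=\pi$, and the isometry-invariant Riemannian measure $\mu$ with $\mu(Q)=1$. Concretely, $S^d=\{x\in\mathbb R^{d+1}:\|x\|=1\}$ with $\cos\theta(x_1,x_2)=(x_1,x_2)$; and $\mathbb{F}P^n$ is the set of Hermitian $(n+1)\times(n+1)$ matrices $\Pi$ over $\mathbb F$ with $\Pi^2=\Pi$, $\operatorname{Tr}\Pi=1$, with $\sin\frac12\theta(\Pi_1,\Pi_2)=\frac1{\sqrt2}\|\Pi_1-\Pi_2\|$, $0\le\theta\le\pi$, where $\|A\|^2=\sum_{i,j}|a_{ij}|^2$. Chordal metric: $\tau(x_1,x_2)=\sin\frac12\theta(x_1,x_2)$. Weight classes: for $a\ge b\ge1$, $W(a,b)$ is the class of (measurable) functions $\eta\ge0$ on $[0,\pi]$ with $\|\eta\|_{a,b}=\int_0^\pi(\sin\frac12r)^{a-1}(\cos\frac12r)^{b-1}\eta(r)\,dr<\infty$; $\eta\neq0$ means that $\eta$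 is not almost everywhere zero. Balls: $B_r(y)=\{x\in Q:\theta(x,y)<r\}$, $r\in[0,\pi]$; $v_r=\mu(B_r(y))$ (independent of $y$). $N$-point subsets $\mathcal D_N$ consist of $N$ not necessarily different points (sums and cardinalities count multiplicity). Discrepancies: $\Lambda[B_r(y),\mathcal D_N]=\#\{B_r(y)\cap\mathcal D_N\}-Nv_r$, $\lambda_r[\mathcal D_N]=\int_Q\Lambda[B_r(y),\mathcal D_N]^2\,d\mu(y)$, $\lambda[\eta,\mathcal D_N]=\int_0^\pi\lambda_r[\mathcal D_N]\,\eta(r)\,dr$, $\lambda_N(\eta)=\inf_{\mathcal D_N}\lambda[\eta,\mathcal D_N]$ over all $N$-point subsets of $Q$. Metrics: for a metric $\rho$ on $Q$, $\rho[\mathcal D_N]=\sum_{x_1,x_2\in\mathcal D_N}\rho(x_1,x_2)$, $\rho_N=\sup_{\mathcal D_N}\rho[\mathcal D_N]$ over all $N$-point subsets, $\langle\rho\rangle=\iint_{Q\times Q}\rho\,d\mu\,d\mu$. Symmetric difference metrics: $\theta^{\Delta}_r(y_1,y_2)=\frac12\mu\big(B_r(y_1)\Delta B_r(y_2)\big)$ and $\theta^{\Delta}(\eta,y_1,y_2)=\int_0^\pi\theta^{\Delta}_r(y_1,y_2)\,\eta(r)\,dr$; $\theta^{\Delta}_N(\eta)$ denotes $\rho_N$ for $\rho=\theta^{\Delta}(\eta)$. *)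

theory Defs
  imports "HOL-Probability.Probability" "HOL-Library.Multiset"
begin

text \<open>A purely operational class, so that it also covers the non-associative octonions.\<close>

class conjugation_algebra = ab_group_add + one + times +
  fixes conjugate :: "'a \<Rightarrow> 'a"
    and modulus :: "'a \<Rightarrow> real"

instantiation real :: conjugation_algebra
begin
definition conjugate_real :: "real \<Rightarrow> real" where "conjugate_real x = x"
definition modulus_real :: "real \<Rightarrow> real" where "modulus_real x = \<bar>x\<bar>"
instance ..
end

instantiation complex :: conjugation_algebra
begin
definition conjugate_complex :: "complex \<Rightarrow> complex" where "conjugate_complex = cnj"
definition modulus_complex :: "complex \<Rightarrow> real" where "modulus_complex = norm"
instance ..
end

text \<open>Cayley-Dickson doubling; H is the double of C and O is the double of H.\<close>

datatype 'a cayley_dickson = CD (cd1: 'a) (cd2: 'a)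

instantiation cayley_dickson :: (conjugation_algebra) conjugation_algebra
begin

definition "0 = CD 0 0"
definition "1 = CD 1 0"
definition "x + y = CD (cd1 x + cd1 y) (cd2 x + cd2 y)"
definition "- x = CD (- cd1 x) (- cd2 x)"
definition "x - y = CD (cd1 x - cd1 y) (cd2 x - cd2 y)"
definition "x * y = CD (cd1 x * cd1 y - conjugate (cd2 y) * cd2 x)
                       (cd2 y * cd1 x + cd2 x * conjugate (cd1 y))"
definition "conjugate x = CD (conjugate (cd1 x)) (- cd2 x)"
definition "modulus x = sqrt ((modulus (cd1 x))\<^sup>2 + (modulus (cd2 x))\<^sup>2)"

instance
  by standard
    (auto simp: zero_cayley_dickson_def plus_cayley_dickson_def uminus_cayley_dickson_def
      minus_cayley_dickson_def algebra_simps intro: cayley_dickson.expand)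

end

type_synonym quaternion = "complex cayley_dickson"
type_synonym octonion = "quaternion cayley_dickson"

definition frobenius_norm :: "('f::conjugation_algebra)^'n^'n \<Rightarrow> real" where
  "frobenius_norm A = sqrt (\<Sum>i\<in>UNIV. \<Sum>j\<in>UNIV. (modulus (A $ i $ j))\<^sup>2)"

text \<open>The product \<open>A ** A\<close> is written out because \<open>**\<close> demands an associative ring of entries.\<close>

definition projective_space :: "(('f::conjugation_algebra)^'n^'n) set" where
  "projective_space = {A.
     (\<forall>i j. A $ j $ i = conjugate (A $ i $ j)) \<and>
     (\<forall>i j. (\<Sum>k\<in>UNIV. A $ i $ k * A $ k $ j) = A $ i $ j) \<and>
     (\<Sum>i\<in>UNIV. A $ i $ i) = 1}"

definition sphere_model ::
  "('a \<Rightarrow> real^'n) \<Rightarrow> 'a set \<Rightarrow> ('a \<Rightarrow> 'a \<Rightarrow> real) \<Rightarrow> bool" where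
  "sphere_model f Q \<theta> \<longleftrightarrow> bij_betw f Q (sphere 0 1) \<and>
     (\<forall>x\<in>Q. \<forall>y\<in>Q. 0 \<le> \<theta> x y \<and> \<theta> x y \<le> pi \<and> cos (\<theta> x y) = f x \<bullet> f y)"

definition projective_model ::
  "('a \<Rightarrow> ('f::conjugation_algebra)^'n^'n) \<Rightarrow> 'a set \<Rightarrow> ('a \<Rightarrow> 'a \<Rightarrow> real) \<Rightarrow> bool" where
  "projective_model f Q \<theta> \<longleftrightarrow> bij_betw f Q projective_space \<and>
     (\<forall>x\<in>Q. \<forall>y\<in>Q. 0 \<le> \<theta> x y \<and> \<theta> x y \<le> pi \<and>
        sin (\<theta> x y / 2) = 1 / sqrt 2 * frobenius_norm (f x - f y))"

text \<open>\<open>(Q, \<theta>)\<close> is, up to the labelling \<open>f\<close> of its points, one of the compact connected two-point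
  homogeneous spaces \<open>Q(d,d0)\<close>. The type \<open>'n\<close> indexes the coordinates, so \<open>CARD('n)\<close> is
  \<open>d + 1\<close> for the sphere and \<open>n + 1\<close> for a projective space of \<open>F\<close>-dimension \<open>n\<close>.\<close>

definition two_point_homogeneous_space ::
  "'n::finite itself \<Rightarrow> nat \<Rightarrow> nat \<Rightarrow> 'a set \<Rightarrow> ('a \<Rightarrow> 'a \<Rightarrow> real) \<Rightarrow> bool" where
  "two_point_homogeneous_space (_ :: 'n itself) d d0 Q \<theta> \<longleftrightarrow>
     CARD('n) \<ge> 2 \<and> d0 = d \<and> d = CARD('n) - 1 \<and>
       (\<exists>f :: 'a \<Rightarrow> real^'n. sphere_model f Q \<theta>)
   \<or> CARD('n) \<ge> 3 \<and> d0 = 1 \<and> d = (CARD('n) - 1) * d0 \<and>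
       (\<exists>f :: 'a \<Rightarrow> real^'n^'n. projective_model f Q \<theta>)
   \<or> CARD('n) \<ge> 3 \<and> d0 = 2 \<and> d = (CARD('n) - 1) * d0 \<and>
       (\<exists>f :: 'a \<Rightarrow> complex^'n^'n. projective_model f Q \<theta>)
   \<or> CARD('n) \<ge> 3 \<and> d0 = 4 \<and> d = (CARD('n) - 1) * d0 \<and>
       (\<exists>f :: 'a \<Rightarrow> quaternion^'n^'n. projective_model f Q \<theta>)
   \<or> CARD('n) = 3 \<and> d0 = 8 \<and> d = (CARD('n) - 1) * d0 \<and>
       (\<exists>f :: 'a \<Rightarrow> octonion^'n^'n. projective_model f Q \<theta>)"

definition geo_ball :: "'a set \<Rightarrow> ('a \<Rightarrow> 'a \<Rightarrow> real) \<Rightarrow> real \<Rightarrow> 'a \<Rightarrow> 'a set" where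
  "geo_ball Q \<theta> r y = {x\<in>Q. \<theta> x y < r}"

text \<open>The Borel sets of the metric topology, spelled out because \<open>\<theta>\<close> is unconstrained outside \<open>Q\<close>
  and so need not satisfy the locale \<open>Metric_space\<close>.\<close>

definition geo_borel :: "'a set \<Rightarrow> ('a \<Rightarrow> 'a \<Rightarrow> real) \<Rightarrow> 'a measure" where
  "geo_borel Q \<theta> = sigma Q {U. U \<subseteq> Q \<and> (\<forall>x\<in>U. \<exists>e>0. geo_ball Q \<theta> e x \<subseteq> U)}"

definition isometry_of :: "'a set \<Rightarrow> ('a \<Rightarrow> 'a \<Rightarrow> real) \<Rightarrow> ('a \<Rightarrow> 'a) \<Rightarrow> bool" where
  "isometry_of Q \<theta> g \<longleftrightarrow> bij_betw g Q Q \<and> (\<forall>x\<in>Q. \<forall>y\<in>Q. \<theta> (g x) (g y) = \<theta> x y)"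

text \<open>As the isometry group of \<open>Q\<close> is compact and transitive, the normalized Riemannian measure is
  the only isometry-invariant Borel probability measure.\<close>

definition invariant_measure :: "'a set \<Rightarrow> ('a \<Rightarrow> 'a \<Rightarrow> real) \<Rightarrow> 'a measure \<Rightarrow> bool" where
  "invariant_measure Q \<theta> \<mu> \<longleftrightarrow> prob_space \<mu> \<and> space \<mu> = Q \<and> sets \<mu> = sets (geo_borel Q \<theta>) \<and>
     (\<forall>g. isometry_of Q \<theta> g \<longrightarrow> (\<forall>A\<in>sets \<mu>. emeasure \<mu> (g ` A) = emeasure \<mu> A))"

definition weight_class :: "nat \<Rightarrow> nat \<Rightarrow> (real \<Rightarrow> real) set" where
  "weight_class a b = {\<eta>. \<eta> \<in> borel_measurable (lebesgue_on {0..pi}) \<and> (\<forall>r\<in>{0..pi}. 0 \<le> \<eta> r) \<and>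
     set_integrable lebesgue {0..pi} (\<lambda>r. sin (r / 2) ^ (a - 1) * cos (r / 2) ^ (b - 1) * \<eta> r)}"

definition point_sets :: "'a set \<Rightarrow> nat \<Rightarrow> 'a multiset set" where
  "point_sets Q N = {D. size D = N \<and> set_mset D \<subseteq> Q}"

definition discrepancy ::
  "'a set \<Rightarrow> ('a \<Rightarrow> 'a \<Rightarrow> real) \<Rightarrow> 'a measure \<Rightarrow> real \<Rightarrow> 'a \<Rightarrow> 'a multiset \<Rightarrow> real" where
  "discrepancy Q \<theta> \<mu> r y D =
     real (size {#x \<in># D. x \<in> geo_ball Q \<theta> r y#}) - real (size D) * measure \<mu> (geo_ball Q \<theta> r y)"

definition quad_discrepancy_r ::
  "'a set \<Rightarrow> ('a \<Rightarrow> 'a \<Rightarrow> real) \<Rightarrow> 'a measure \<Rightarrow> real \<Rightarrow> 'a multiset \<Rightarrow> real" where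
  "quad_discrepancy_r Q \<theta> \<mu> r D = (\<integral>y. (discrepancy Q \<theta> \<mu> r y D)\<^sup>2 \<partial>\<mu>)"

definition quad_discrepancy ::
  "'a set \<Rightarrow> ('a \<Rightarrow> 'a \<Rightarrow> real) \<Rightarrow> 'a measure \<Rightarrow> (real \<Rightarrow> real) \<Rightarrow> 'a multiset \<Rightarrow> real" where
  "quad_discrepancy Q \<theta> \<mu> \<eta> D = (LINT r:{0..pi}|lebesgue. quad_discrepancy_r Q \<theta> \<mu> r D * \<eta> r)"

definition min_discrepancy ::
  "'a set \<Rightarrow> ('a \<Rightarrow> 'a \<Rightarrow> real) \<Rightarrow> 'a measure \<Rightarrow> (real \<Rightarrow> real) \<Rightarrow> nat \<Rightarrow> real" where
  "min_discrepancy Q \<theta> \<mu> \<eta> N = (INF D\<in>point_sets Q N. quad_discrepancy Q \<theta> \<mu> \<eta> D)"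

definition dist_sum :: "('a \<Rightarrow> 'a \<Rightarrow> real) \<Rightarrow> 'a multiset \<Rightarrow> real" where
  "dist_sum \<rho> D = (\<Sum>x1\<in>#D. \<Sum>x2\<in>#D. \<rho> x1 x2)"

definition max_dist_sum :: "'a set \<Rightarrow> ('a \<Rightarrow> 'a \<Rightarrow> real) \<Rightarrow> nat \<Rightarrow> real" where
  "max_dist_sum Q \<rho> N = (SUP D\<in>point_sets Q N. dist_sum \<rho> D)"

definition mean_dist :: "'a measure \<Rightarrow> ('a \<Rightarrow> 'a \<Rightarrow> real) \<Rightarrow> real" where
  "mean_dist \<mu> \<rho> = (\<integral>x. (\<integral>y. \<rho> x y \<partial>\<mu>) \<partial>\<mu>)"

definition symdiff_metric_r ::
  "'a set \<Rightarrow> ('a \<Rightarrow> 'a \<Rightarrow> real) \<Rightarrow> 'a measure \<Rightarrow> real \<Rightarrow> 'a \<Rightarrow> 'a \<Rightarrow> real" where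
  "symdiff_metric_r Q \<theta> \<mu> r y1 y2 = 1 / 2 * measure \<mu>
     ((geo_ball Q \<theta> r y1 - geo_ball Q \<theta> r y2) \<union> (geo_ball Q \<theta> r y2 - geo_ball Q \<theta> r y1))"

definition symdiff_metric ::
  "'a set \<Rightarrow> ('a \<Rightarrow> 'a \<Rightarrow> real) \<Rightarrow> 'a measure \<Rightarrow> (real \<Rightarrow> real) \<Rightarrow> 'a \<Rightarrow> 'a \<Rightarrow> real" where
  "symdiff_metric Q \<theta> \<mu> \<eta> y1 y2 =
     (LINT r:{0..pi}|lebesgue. symdiff_metric_r Q \<theta> \<mu> r y1 y2 * \<eta> r)"

definition chordal_metric :: "('a \<Rightarrow> 'a \<Rightarrow> real) \<Rightarrow> 'a \<Rightarrow> 'a \<Rightarrow> real" where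
  "chordal_metric \<theta> x1 x2 = sin (\<theta> x1 x2 / 2)"

end

theory Submission
  imports Defs "HOL-Computational_Algebra.Polynomial"
begin

text \<open>By Stolarsky's invariance principle the discrepancy of \<open>D\<close> is \<open>m N\<^sup>2\<close> minus the sum of distances, where
  \<open>m\<close> is the mean of \<open>\<theta>\<^sup>\<Delta>(\<eta>)\<close>; and \<open>\<theta>\<^sup>\<Delta>(sin)\<close> is a multiple of the chordal metric. So it suffices to
  bound discrepancies from below for all \<open>D\<close> and from above for one \<open>D\<close>.

  Each space is embedded isometrically for the chordal metric, every projective one into octonionic
  matrices. Along a geodesic \<open>e \<phi>\<close> the function \<open>T x y = cos\<^sup>2(\<theta>(x, y) / 2)\<close> is a quadratic form in
  \<open>(cos \<phi>, sin \<phi>)\<close>; with the two-point homogeneity this determines the law of the distance and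
  gives the Funk-Hecke formula for Jacobi polynomials in \<open>T\<close>.

  Lower bound: by Bessel's inequality the discrepancy dominates a sum over degrees up to \<open>L\<close>, of order
  \<open>N\<^sup>1\<^sup>/\<^sup>d\<close>, of Jacobi sums over \<open>D\<close>, and a nonnegative polynomial of degree \<open>L\<close> concentrated at \<open>T = 1\<close>
  bounds that sum through its diagonal terms. The Fourier coefficients of balls are themselves derivatives of Jacobi
  polynomials, not small in the mean because these oscillate. Upper bound: \<open>N\<close> probability densities with
  sum \<open>N\<close> and supports of diameter \<open>O(N\<^sup>-\<^sup>1\<^sup>/\<^sup>d)\<close> replace a partition into cells of equal measure, and some choice of
  one point from each support is at least as good as the average.\<close>

text \<open>A weight \<open>\<eta>\<close> need only be integrable against \<open>wt\<close>, so it
  may blow up at both ends of \<open>[0, pi]\<close>. Hence every estimate for balls of radius r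
  must carry a factor \<open>wt r\<close>, and radial integrals are taken against the finite measure
  \<open>nu \<eta>\<close>. Two kinds of isometries are enough for two-point homogeneity and for the
  moments: real Householder reflections, since real numbers associate with everything, and entrywise
  multiplications by units, which respect products by Moufang's identities. The exponent arises as
  follows. In the mean, the squared ball coefficients of degree l are at least of order
  \<open>l powr (- (d + 1))\<close>, and up to degree L of order \<open>N powr (1 / d)\<close> the
  normalised Jacobi sums add up to at least \<open>N^2\<close>; so the discrepancy is at least of
  order \<open>N^2 * L powr (- (d + 1))\<close>, which is \<open>N powr (1 - 1 / d)\<close>. From
  above, the sum over pairs of random points falls short of its mean only by N diagonal terms, each
  of order \<open>N powr (- 1 / d)\<close>.\<close>

lemmas bochner_cong = Bochner_Integration.integral_cong
lemmas bochner_sum = Bochner_Integration.integral_sum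
lemmas bochner_nonneg = Bochner_Integration.integral_nonneg

section \<open>Jacobi weights and Jacobi polynomials\<close>

text \<open>The substitution \<open>t = (cos (u/2))^2\<close> maps \<open>[0, pi]\<close>
  homeomorphically onto \<open>[0, 1]\<close>, so by Weierstrass the polynomials in t are uniformly
  dense in the continuous functions of u. Equal moments thus force equal characteristic
  functions.\<close>

lemma real_distribution_eqI_cos_moments:
 fixes M N :: "real measure"
 assumes M: "real_distribution M" "AE u in M. u \<in> {0..pi}" and N: "real_distribution N" "AE u in N. u \<in> {0..pi}"
  and moments: "\<And>k. (\<integral>u. ((cos (u/2))^2) ^ k \<partial>M) = (\<integral>u. ((cos (u/2))^2) ^ k \<partial>N)"
 shows "M = N"
proof -
 interpret M: real_distribution M by fact
 interpret N: real_distribution N by fact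
 have int: "integrable L f" if "real_distribution L" "AE u in L. u \<in> {0..pi}"
   "f \<in> borel_measurable borel" "\<And>u. u \<in> {0..pi} \<Longrightarrow> \<bar>f u\<bar> \<le> bd" for L f and bd :: real
 proof -
  interpret L: real_distribution L by fact
  have "AE u in L. norm (f u) \<le> bd" using that(2) by eventually_elim (use that(4) in simp)
  then show ?thesis using that by (intro L.integrable_const_bound[where B=bd]) auto
 qed
 have poly: "(\<integral>u. (\<Sum>i\<le>n. a i * ((cos (u/2))^2) ^ i) \<partial>M) = (\<integral>u. (\<Sum>i\<le>n. a i * ((cos (u/2))^2) ^ i) \<partial>N)"
  for a :: "nat \<Rightarrow> real" and n
 proof -
  have "integrable L (\<lambda>u. a i * ((cos (u/2))^2) ^ i)" if "real_distribution L" "AE u in L. u \<in> {0..pi}" for L i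
   by (rule int[OF that, of _ "\<bar>a i\<bar>"])
     (auto simp: abs_mult power_abs intro!: mult_left_le power_le_one abs_square_le_1[THEN iffD2] simp flip: power_abs)
  then show ?thesis using M N moments by (simp add: bochner_sum)
 qed
 have cont: "(\<integral>u. f u \<partial>M) = (\<integral>u. f u \<partial>N)" if f: "continuous_on UNIV f" "\<And>u. \<bar>f u\<bar> \<le> B" for f :: "real \<Rightarrow> real" and B
 proof -
  have fm [measurable]: "f \<in> borel_measurable borel" using f(1) by (simp add: borel_measurable_continuous_onI)
  have c: "continuous_on {0..1} (\<lambda>t. f (2 * arccos (sqrt t)))"
   by (intro continuous_on_compose2[OF f(1)] continuous_intros) (auto intro: order_trans[of _ 0])
  have "\<bar>(\<integral>u. f u \<partial>M) - (\<integral>u. f u \<partial>N)\<bar> \<le> 2 * e" if e: "e > 0" for e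
  proof -
   obtain g where g: "real_polynomial_function g" "\<And>x. x \<in> {0..1} \<Longrightarrow> \<bar>f (2 * arccos (sqrt x)) - g x\<bar> < e"
    using Stone_Weierstrass_real_polynomial_function[OF compact_Icc c e] by blast
   from g(1) obtain a n where an: "g = (\<lambda>x. \<Sum>i\<le>n. a i * x ^ i)" unfolding real_polynomial_function_iff_sum by auto
   let ?h = "\<lambda>u. g ((cos (u/2))^2)"
   have hm [measurable]: "?h \<in> borel_measurable borel" unfolding an by measurable
   have near: "\<bar>f u - ?h u\<bar> \<le> e" if "u \<in> {0..pi}" for u
   proof -
    have "cos (u/2) \<ge> 0" using that by (intro cos_ge_zero) auto
    then have "2 * arccos (sqrt ((cos (u/2))^2)) = u" using that by (simp add: arccos_cos)
    with g(2)[of "(cos (u/2))^2"] show ?thesis by (simp add: abs_square_le_1)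
   qed
   have hb: "\<bar>?h u\<bar> \<le> B + e" if "u \<in> {0..pi}" for u using near[OF that] f(2)[of u] by linarith
   have d: "\<bar>(\<integral>u. f u \<partial>L) - (\<integral>u. ?h u \<partial>L)\<bar> \<le> e" if L: "real_distribution L" "AE u in L. u \<in> {0..pi}" for L
   proof -
    interpret L: real_distribution L by fact
    have i1: "integrable L f" by (rule int[OF L fm, of B]) (use f in auto)
    have i2: "integrable L ?h" by (rule int[OF L hm hb])
    have "\<bar>\<integral>u. f u - ?h u \<partial>L\<bar> \<le> (\<integral>u. \<bar>f u - ?h u\<bar> \<partial>L)" by (rule integral_abs_bound)
    also have "\<dots> \<le> (\<integral>u. e \<partial>L)"
    proof (rule integral_mono_AE)
     show "AE u in L. \<bar>f u - ?h u\<bar> \<le> e" using L(2) by eventually_elim (rule near)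
    qed (use i1 i2 in auto)
    finally show ?thesis using i1 i2 L.prob_space by simp
   qed
   have "(\<integral>u. ?h u \<partial>M) = (\<integral>u. ?h u \<partial>N)" unfolding an by (rule poly)
   with d[OF M] d[OF N] show ?thesis by linarith
  qed
  \<comment> \<open>With e a quarter of the difference, the bound \<open>2 * e\<close> is half of
    it, so the difference vanishes.\<close>
  from this[of "\<bar>(\<integral>u. f u \<partial>M) - (\<integral>u. f u \<partial>N)\<bar> / 4"] show ?thesis by (cases "(\<integral>u. f u \<partial>M) = (\<integral>u. f u \<partial>N)") auto
 qed
 have "char L t = Complex (\<integral>u. cos (t * u) \<partial>L) (\<integral>u. sin (t * u) \<partial>L)" if "real_distribution L" for L t
 proof -
  interpret L: real_distribution L by fact
  have i: "integrable L (\<lambda>u. iexp (t * u))" by (rule L.integrable_iexp) auto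
  show ?thesis unfolding char_def complex_eq_iff complex.sel integral_Re[OF i, symmetric] integral_Im[OF i, symmetric] by (simp add: Re_exp Im_exp)
 qed
 moreover have "(\<integral>u. cos (t * u) \<partial>M) = (\<integral>u. cos (t * u) \<partial>N)" "(\<integral>u. sin (t * u) \<partial>M) = (\<integral>u. sin (t * u) \<partial>N)" for t
  by (rule cont[of _ 1]; auto intro!: continuous_intros)+
 ultimately have "char M = char N" using M N by auto
 then show ?thesis by (rule Levy_uniqueness[OF M(1) N(1)])
qed

lemma integral_sum2:
 fixes f :: "'i \<Rightarrow> 'j \<Rightarrow> 'b \<Rightarrow> real"
 assumes "\<And>i j. i \<in> A \<Longrightarrow> j \<in> B \<Longrightarrow> integrable M (f i j)"
 shows "integrable M (\<lambda>y. \<Sum>i\<in>A. \<Sum>j\<in>B. f i j y)"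
  and "(\<integral>y. (\<Sum>i\<in>A. \<Sum>j\<in>B. f i j y) \<partial>M) = (\<Sum>i\<in>A. \<Sum>j\<in>B. \<integral>y. f i j y \<partial>M)"
 using assms by simp_all

text \<open>In the variable \<open>t = (cos (u/2))^2\<close> the density \<open>wt\<close> becomes
  the Jacobi weight \<open>(1 - t) powr (d/2 - 1) * t powr (d0/2 - 1)\<close>. The angle u is kept
  as the variable because it will be the distance between two random points.\<close>

locale jacobi_weight =
 fixes d d0 :: nat
 assumes d_pos: "d \<ge> 1" and d0_pos: "d0 \<ge> 1"
begin

definition wt :: "real \<Rightarrow> real" where
 "wt u = sin (u/2) ^ (d - 1) * cos (u/2) ^ (d0 - 1)"

text \<open>This is \<open>wt\<close> times the derivative of \<open>poly q ((cos (u/2))^2)\<close>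
  in u, the inner expression of the Sturm-Liouville form of the Jacobi equation.\<close>

definition flux :: "real poly \<Rightarrow> real \<Rightarrow> real" where
 "flux q u = - (sin (u/2) ^ d * cos (u/2) ^ d0 * poly (pderiv q) ((cos (u/2))^2))"

text \<open>The radial part of the Laplacian written in t, up to scaling: the hypergeometric
  operator whose polynomial eigenfunctions are the Jacobi polynomials.\<close>

definition jac_op :: "real poly \<Rightarrow> real poly" where
 "jac_op q = [:0, 1, -1:] * pderiv (pderiv q) + [:d0 / 2, - ((d + d0) / 2):] * pderiv q"

lemma wt_continuous [continuous_intros]: "continuous_on A wt" unfolding wt_def by (intro continuous_intros) auto

lemma wt_measurable [measurable]: "wt \<in> borel_measurable borel" by (intro borel_measurable_continuous_onI wt_continuous)

lemma wt_nonneg: "u \<in> {0..pi} \<Longrightarrow> 0 \<le> wt u"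
 unfolding wt_def by (auto intro!: mult_nonneg_nonneg zero_le_power sin_ge_zero cos_ge_zero)

lemma wt_pos: "u \<in> {0<..<pi} \<Longrightarrow> 0 < wt u" unfolding wt_def by (auto intro!: mult_pos_pos zero_less_power sin_gt_zero cos_gt_zero)

lemma wt_le_1: "u \<in> {0..pi} \<Longrightarrow> wt u \<le> 1"
 unfolding wt_def by (intro mult_le_one power_le_one zero_le_power) (auto intro!: sin_ge_zero cos_ge_zero)

lemma poly_deriv_cos:
 "((\<lambda>u. poly q ((cos (u/2))^2)) has_real_derivative - (sin (u/2) * cos (u/2) * poly (pderiv q) ((cos (u/2))^2))) (at u)"
 by (rule derivative_eq_intros poly_DERIV[THEN DERIV_chain2] refl | simp add: power2_eq_square)+

lemma flux_eq_wt: "flux q u = wt u * - (sin (u/2) * cos (u/2) * poly (pderiv q) ((cos (u/2))^2))"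
 using d_pos d0_pos by (simp add: flux_def wt_def power_eq_if mult_ac)

lemma flux_deriv: "(flux q has_real_derivative wt u * poly (jac_op q) ((cos (u/2))^2)) (at u)"
proof -
 obtain d' d0' where s: "d = Suc d'" "d0 = Suc d0'" using d_pos d0_pos by (metis Suc_le_D One_nat_def)
 define S C where "S = sin (u/2)" and "C = cos (u/2)"
 have SC: "S * S = 1 - C * C" unfolding S_def C_def by (metis sin_squared_eq power2_eq_square)
 have "(flux q has_real_derivative
   - ((real d * S ^ d' * (C/2) * C ^ d0 - S ^ d * (real d0 * C ^ d0' * (S/2))) * poly (pderiv q) (C^2)
    + S ^ d * C ^ d0 * (- (S * C * poly (pderiv (pderiv q)) (C^2))))) (at u)"
  unfolding flux_def[abs_def] S_def C_def unfolding s by (rule derivative_eq_intros poly_deriv_cos refl | simp)+ (simp add: algebra_simps)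
 also have "- ((real d * S ^ d' * (C/2) * C ^ d0 - S ^ d * (real d0 * C ^ d0' * (S/2))) * poly (pderiv q) (C^2)
    + S ^ d * C ^ d0 * (- (S * C * poly (pderiv (pderiv q)) (C^2))))
   = S ^ d' * C ^ d0' * ((d0 / 2 * (S * S) - d / 2 * C^2) * poly (pderiv q) (C^2)
    + (S * S) * C^2 * poly (pderiv (pderiv q)) (C^2))"
  unfolding s by (simp add: algebra_simps power2_eq_square add_divide_distrib)
 also have "\<dots> = wt u * poly (jac_op q) ((cos (u/2))^2)"
  unfolding SC unfolding jac_op_def wt_def S_def[symmetric] C_def[symmetric] unfolding s
  by (simp add: algebra_simps power2_eq_square add_divide_distrib diff_divide_distrib)
 finally show ?thesis .
qed

lemma flux_0 [simp]: "flux q 0 = 0" and flux_pi [simp]: "flux q pi = 0" using d_pos d0_pos by (auto simp: flux_def)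

definition mass :: real where "mass = (LBINT u:{0..pi}. wt u)"

lemma wt_integrable: "set_integrable lborel {0..pi} wt" by (intro borel_integrable_atLeastAtMost' wt_continuous)

lemma mass_pos: "mass > 0"
proof -
 have 1: "wt (pi/2) > 0" by (rule wt_pos) auto
 have "isCont wt (pi/2)" using wt_continuous[of UNIV] by (simp add: continuous_on_eq_continuous_at)
 then have "\<forall>\<^sub>F u in at (pi/2). wt u > wt (pi/2) / 2" unfolding isCont_def by (rule order_tendstoD) (use 1 in auto)
 have "(LBINT u:{0..pi}. wt u) \<noteq> 0"
 proof
  assume "(LBINT u:{0..pi}. wt u) = 0"
  then have "integral {0..pi} wt = 0" using set_borel_integral_eq_integral(2)[OF wt_integrable] by simp
  then have "\<And>x. x \<in> {0..pi} \<Longrightarrow> wt x = 0" by (subst (asm) integral_eq_0_iff) (auto intro: wt_continuous wt_nonneg)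
  with 1 show False by (metis atLeastAtMost_iff less_irrefl pi_half_ge_zero pi_half_le_two pi_ge_zero
   field_sum_of_halves add_increasing2 le_add_same_cancel1)
 qed
 moreover have "(LBINT u:{0..pi}. wt u) \<ge> 0"
  unfolding set_lebesgue_integral_def using wt_nonneg by (intro bochner_nonneg) (auto simp: indicator_def)
 ultimately show ?thesis unfolding mass_def by linarith
qed

definition law :: "real measure" where
 "law = density lborel (\<lambda>u. ennreal (indicator {0..pi} u * wt u / mass))"

lemma space_law [simp]: "space law = UNIV" and sets_law [simp, measurable_cong]: "sets law = sets borel" by (auto simp: law_def)

lemma dens_nonneg: "0 \<le> indicator {0..pi} u * wt u / mass" using mass_pos wt_nonneg by (auto simp: indicator_def)

lemma integral_law:
 assumes [measurable]: "f \<in> borel_measurable borel" shows "(\<integral>u. f u \<partial>law) = (LBINT u:{0..pi}. wt u * f u) / mass"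
proof -
 have "(\<integral>u. f u \<partial>law) = (\<integral>u. (indicator {0..pi} u * wt u / mass) * f u \<partial>lborel)"
  unfolding law_def by (subst integral_density) (use dens_nonneg in auto)
 also have "\<dots> = (\<integral>u. (indicator {0..pi} u * (wt u * f u)) / mass \<partial>lborel)" by (simp add: mult_ac)
 finally show ?thesis by (simp add: set_lebesgue_integral_def)
qed

lemma real_distribution_law: "real_distribution law"
proof -
 have "emeasure law UNIV = (\<integral>\<^sup>+u. ennreal (indicator {0..pi} u * wt u / mass) \<partial>lborel)"
  unfolding law_def by (subst emeasure_density) auto
 also have "\<dots> = ennreal (\<integral>u. indicator {0..pi} u * wt u / mass \<partial>lborel)" by (rule nn_integral_eq_integral)
    (use wt_integrable dens_nonneg in \<open>auto simp: set_integrable_def\<close>)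
 also have "(\<integral>u. indicator {0..pi} u * wt u / mass \<partial>lborel) = 1" using mass_pos by (simp add: mass_def set_lebesgue_integral_def)
 finally have "prob_space law" by (intro prob_spaceI) simp
 then show ?thesis by (simp add: real_distribution_def real_distribution_axioms_def)
qed

sublocale law: real_distribution law by (rule real_distribution_law)

lemma AE_law: "AE u in law. u \<in> {0..pi}" unfolding law_def by (subst AE_density) (auto simp: indicator_def)

definition E :: "real poly \<Rightarrow> real" where
 "E q = (\<integral>u. poly q ((cos (u/2))^2) \<partial>law)"

lemma poly_cos_measurable [measurable]: "(\<lambda>u::real. poly q ((cos (u/2))^2)) \<in> borel_measurable borel"
 by (intro borel_measurable_continuous_onI continuous_intros) auto

lemma poly_cos_integrable: "integrable law (\<lambda>u. poly q ((cos (u/2))^2))"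
proof -
 have "continuous_on {0..1} (poly q)" by (intro continuous_intros)
 then have "bounded (poly q ` {0..1})" by (intro compact_imp_bounded compact_continuous_image) auto
 then obtain B where B: "\<And>t. t \<in> {0..1} \<Longrightarrow> \<bar>poly q t\<bar> \<le> B" unfolding bounded_iff by fastforce
 show ?thesis by (intro law.integrable_const_bound[where B=B]) (auto intro!: AE_I2 B simp: abs_square_le_1)
qed

lemma E_add: "E (q + r) = E q + E r" and E_diff: "E (q - r) = E q - E r" and E_smult: "E (smult c q) = c * E q"
 and E_uminus: "E (- q) = - E q" and E_0 [simp]: "E 0 = 0" by (auto simp: E_def poly_cos_integrable)

lemma E_sum: "E (sum f A) = (\<Sum>i\<in>A. E (f i))" by (induction A rule: infinite_finite_induct) (auto simp: E_add)

lemma E_1 [simp]: "E 1 = 1" using law.prob_space by (simp add: E_def)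

text \<open>Integration by parts. The boundary terms vanish because \<open>flux\<close> is 0 at both
  ends, and the product of the two derivatives contributes
  \<open>(sin (u/2) * cos (u/2))^2 = t * (1 - t)\<close>. With r = 1 this yields a moment recursion,
  with general r the symmetry of \<open>jac_op\<close>.\<close>

lemma E_jac_op: "E (jac_op q * r) = - E ([:0, 1, -1:] * pderiv q * pderiv r)"
proof -
 let ?t = "\<lambda>u::real. (cos (u/2))^2"
 let ?h = "\<lambda>u. wt u * poly (jac_op q * r) (?t u) + wt u * poly ([:0, 1, -1:] * pderiv q * pderiv r) (?t u)"
 have "((\<lambda>u. flux q u * poly r (?t u)) has_real_derivative ?h u) (at u)" for u
 proof -
  have "sin (u / 2) * cos (u / 2) * (sin (u / 2) * cos (u / 2)) = ?t u * (1 - ?t u)"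
   by (simp add: power2_eq_square[symmetric] power_mult_distrib sin_squared_eq)
  note sc = this
  have "((\<lambda>u. flux q u * poly r (?t u)) has_real_derivative
    flux q u * (- (sin (u/2) * cos (u/2) * poly (pderiv r) (?t u))) + wt u * poly (jac_op q) (?t u) * poly r (?t u)) (at u)"
   by (rule DERIV_mult'[OF flux_deriv poly_deriv_cos])
  also have "flux q u * (- (sin (u/2) * cos (u/2) * poly (pderiv r) (?t u))) =
    wt u * ((sin (u / 2) * cos (u / 2) * (sin (u / 2) * cos (u / 2))) * poly (pderiv q) (?t u) * poly (pderiv r) (?t u))"
   unfolding flux_eq_wt by (simp add: mult_ac)
  finally show ?thesis unfolding sc by (simp add: algebra_simps)
 qed
 moreover have "continuous_on UNIV ?h" by (intro continuous_intros) auto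
 ultimately have "(\<integral>u. ?h u * indicator {0..pi} u \<partial>lborel) = flux q pi * poly r (?t pi) - flux q 0 * poly r (?t 0)"
  by (intro integral_FTC_Icc_real) (auto simp: continuous_on_eq_continuous_at)
 then have 0: "(LBINT u:{0..pi}. ?h u) = 0" by (simp add: set_lebesgue_integral_def mult.commute)
 have i: "set_integrable lborel {0..pi} (\<lambda>u. wt u * poly s (?t u))" for s by (intro borel_integrable_atLeastAtMost' continuous_intros) auto
 have "(LBINT u:{0..pi}. ?h u) = (LBINT u:{0..pi}. wt u * poly (jac_op q * r) (?t u)) +
   (LBINT u:{0..pi}. wt u * poly ([:0, 1, -1:] * pderiv q * pderiv r) (?t u))"
  by (rule set_integral_add(2)[OF i i])
 with 0 have "(LBINT u:{0..pi}. wt u * poly (jac_op q * r) (?t u)) / mass = - ((LBINT u:{0..pi}. wt u * poly ([:0, 1, -1:] * pderiv q * pderiv r) (?t u)) / mass)"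
  by (simp only: add_eq_0_iff2 minus_divide_left)
 then show ?thesis unfolding E_def integral_law[OF poly_cos_measurable] .
qed

text \<open>In the monomial basis \<open>jac_op\<close> is triangular with diagonal entries
  \<open>- ev l\<close>, so these are its eigenvalues.\<close>

definition ev :: "nat \<Rightarrow> real" where
 "ev l = real l * (real l - 1 + (real d + real d0) / 2)"

lemma coeff_jac_op: "coeff (jac_op q) k =
  (real k + 1) * (real k + real d0 / 2) * coeff q (Suc k) - ev k * coeff q k"
 by (cases k) (auto simp: jac_op_def coeff_pderiv coeff_pCons ev_def algebra_simps add_divide_distrib split: nat.splits)

text \<open>The moment recursion of a beta law, from \<open>E (jac_op q) = 0\<close> for the power
  \<open>t ^ Suc K\<close>. The powers of T on the space will satisfy the same recursion, which
  identifies the law of the distance.\<close>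

lemma E_power: "(real d + real d0 + 2 * real K) * E ([:0, 1:] ^ Suc K) = (real d0 + 2 * real K) * E ([:0, 1:] ^ K)"
proof -
 have "E (jac_op ([:0,1:] ^ Suc K)) = 0" using E_jac_op[of "[:0,1:] ^ Suc K" 1] by (simp add: pderiv_1)
 moreover have "jac_op ([:0,1:] ^ Suc K) = smult (real (Suc K)) (smult (real K + d0 / 2) ([:0,1:] ^ K) - smult (real K + (d + d0)/2) ([:0,1:] ^ Suc K))"
 proof (rule poly_eqI)
  fix n
  have X: "coeff ([:0,1:] ^ k) m = (if k = m then 1 else 0 :: real)" for k m using coeff_monom[of "1::real" k m] unfolding monom_altdef by simp
  show "coeff (jac_op ([:0,1:] ^ Suc K)) n = coeff (smult (real (Suc K)) (smult (real K + d0 / 2) ([:0,1:] ^ K) - smult (real K + (d + d0)/2) ([:0,1:] ^ Suc K))) n"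
   unfolding coeff_jac_op coeff_smult coeff_diff X by (cases "n = K"; cases "n = Suc K") (auto simp: ev_def algebra_simps add_divide_distrib)
 qed
 ultimately have "(real (Suc K)) * ((real K + d0 / 2) * E ([:0,1:] ^ K) - (real K + (d + d0)/2) * E ([:0,1:] ^ Suc K)) = 0"
  by (simp only: E_smult E_diff)
 then have "(real K + d0 / 2) * E ([:0,1:] ^ K) = (real K + (d + d0)/2) * E ([:0,1:] ^ Suc K)"
  by (simp only: mult_eq_0_iff of_nat_eq_0_iff nat.distinct right_minus_eq simp_thms)
 then show ?thesis by (simp only: of_nat_add) (simp add: algebra_simps add_divide_distrib)
qed

text \<open>Comparison of coefficients in the eigenvalue equation gives this two-term recursion,
  which terminates by itself after degree l. The normalisation is at t = 0: that the value at t = 1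
  is nonzero is known only once convolutions on the space are available.\<close>

primrec jac_coeff :: "nat \<Rightarrow> nat \<Rightarrow> real" where
 "jac_coeff l 0 = 1"
| "jac_coeff l (Suc k) = jac_coeff l k * (ev k - ev l) / ((real k + 1) * (real k + real d0 / 2))"

definition jac0 :: "nat \<Rightarrow> real poly" where
 "jac0 l = (\<Sum>k\<le>l. monom (jac_coeff l k) k)"

lemma ev_0 [simp]: "ev 0 = 0" by (simp add: ev_def)

lemma ev_strict_mono: "k < l \<Longrightarrow> ev k < ev l"
proof -
 assume "k < l"
 moreover have "ev l - ev k = (real l - real k) * (real l + real k - 1 + (real d + real d0) / 2)"
  unfolding ev_def by (simp add: algebra_simps add_divide_distrib diff_divide_distrib)
 moreover have "real l \<ge> 1" using \<open>k < l\<close> by simp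
 moreover have "(real d + real d0) / 2 > 0" using d_pos by simp
 ultimately show ?thesis by (smt (verit) mult_pos_pos of_nat_0_le_iff of_nat_less_iff)
qed

lemma ev_inj: "ev k = ev l \<longleftrightarrow> k = l" by (metis ev_strict_mono less_irrefl linorder_neqE_nat)

lemma ev_pos: "l \<ge> 1 \<Longrightarrow> 0 < ev l" using ev_strict_mono[of 0 l] by simp

lemma jac_coeff_nz: "k \<le> l \<Longrightarrow> jac_coeff l k \<noteq> 0"
proof (induction k)
 case (Suc k)
 then have "ev k \<noteq> ev l" by (simp add: ev_inj)
 moreover have "real k + real d0 / 2 > 0" using d0_pos by (simp add: add_nonneg_pos)
 ultimately show ?case using Suc by auto
qed simp

lemma coeff_jac0: "coeff (jac0 l) k = (if k \<le> l then jac_coeff l k else 0)" by (simp add: jac0_def coeff_sum)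

lemma degree_jac0 [simp]: "degree (jac0 l) = l" by (intro antisym degree_le le_degree) (auto simp: coeff_jac0 jac_coeff_nz)

lemma jac_op_jac0: "jac_op (jac0 l) = smult (- ev l) (jac0 l)"
proof (rule poly_eqI)
 fix k
 have "real k + real d0 / 2 > 0" using d0_pos by (simp add: add_nonneg_pos)
 moreover have "real k + 1 > 0" by simp
 ultimately have *: "(real k + 1) * (real k + real d0 / 2) * jac_coeff l (Suc k) = jac_coeff l k * (ev k - ev l)" by simp
 consider "k < l" | "k = l" | "k > l" by linarith
 then show "coeff (jac_op (jac0 l)) k = coeff (smult (- ev l) (jac0 l)) k"
 proof cases
  case 1
  then show ?thesis by (simp only: coeff_jac_op coeff_jac0 coeff_smult Suc_leI if_True less_imp_le *) (simp add: algebra_simps)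
 qed (auto simp: coeff_jac_op coeff_jac0)
qed

section \<open>Orthogonality and completeness of the eigenpolynomials\<close>

lemma E_sym: "E (jac_op q * r) = E (q * jac_op r)" using E_jac_op[of q r] E_jac_op[of r q]
 by (simp only: mult.commute[of q "jac_op r"] mult.assoc mult.commute[of "pderiv q" "pderiv r"])

lemma jac0_orth: "k \<noteq> l \<Longrightarrow> E (jac0 k * jac0 l) = 0"
proof -
 assume "k \<noteq> l"
 have "- ev k * E (jac0 k * jac0 l) = - ev l * E (jac0 k * jac0 l)"
  using E_sym[of "jac0 k" "jac0 l"] by (simp only: jac_op_jac0 E_smult mult_smult_right mult_smult_left)
 with \<open>k \<noteq> l\<close> show ?thesis using ev_inj by auto
qed

lemma E_nonneg: "(\<And>t. t \<in> {0..1} \<Longrightarrow> 0 \<le> poly q t) \<Longrightarrow> 0 \<le> E q"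
 unfolding E_def by (intro bochner_nonneg) (simp add: abs_square_le_1)

lemma E_eq_0D:
 assumes nn: "\<And>t. t \<in> {0..1} \<Longrightarrow> 0 \<le> poly q t" and "E q = 0" shows "q = 0"
proof -
 let ?f = "\<lambda>u. wt u * poly q ((cos (u/2))^2)"
 have c: "continuous_on {0..pi} ?f" by (intro continuous_intros) auto
 have "(LBINT u:{0..pi}. ?f u) = 0" using \<open>E q = 0\<close> mass_pos unfolding E_def integral_law[OF poly_cos_measurable] by simp
 then have "integral {0..pi} ?f = 0" using set_borel_integral_eq_integral(2)[OF borel_integrable_atLeastAtMost'[OF c]] by simp
 then have z: "?f u = 0" if "u \<in> {0..pi}" for u
  using that by (subst (asm) integral_eq_0_iff) (auto intro!: c mult_nonneg_nonneg wt_nonneg nn simp: abs_square_le_1)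
 have "poly q t = 0" if "t \<in> {0<..<1}" for t
 proof -
  let ?u = "2 * arccos (sqrt t)"
  have t: "0 < sqrt t" "sqrt t < 1" using that by auto
  have "arccos (sqrt t) < pi / 2" "0 < arccos (sqrt t)"
   using t arccos_less_arccos[of 0 "sqrt t"] arccos_less_arccos[of "sqrt t" 1] by (auto simp del: real_sqrt_gt_0_iff)
  then have "?u \<in> {0<..<pi}" by auto
  moreover have "cos (arccos (sqrt t)) = sqrt t" using t by (intro cos_arccos) linarith+
  then have "(cos (?u / 2))^2 = t" using that by simp
  ultimately show ?thesis using z[of ?u] wt_pos[of ?u] by auto
 qed
 then have "infinite {t. poly q t = 0}" by (intro infinite_super[of "{0<..<1}" "{t. poly q t = 0}"] infinite_Ioo) auto
 then show ?thesis using poly_roots_finite by blast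
qed

lemma E_square_pos: "q \<noteq> 0 \<Longrightarrow> 0 < E (q * q)" using E_nonneg[of "q * q"] E_eq_0D[of "q * q"] by (force simp: less_le)

lemma jac0_nz: "jac0 l \<noteq> 0" by (metis coeff_jac0 jac_coeff_nz order_refl coeff_0)

lemma jac0_orth_lower: "degree r < l \<Longrightarrow> E (jac0 l * r) = 0"
proof (induction "degree r" arbitrary: r rule: less_induct)
 case less
 let ?k = "degree r"
 define c where "c = lead_coeff r / lead_coeff (jac0 ?k)"
 define r' where "r' = r - smult c (jac0 ?k)"
 have nz: "lead_coeff (jac0 ?k) \<noteq> 0" by (simp only: leading_coeff_0_iff jac0_nz simp_thms)
 have "coeff r' ?k = 0" using nz unfolding r'_def c_def by simp
 moreover have "degree r' \<le> ?k" unfolding r'_def by (intro degree_diff_le) (auto intro: order_trans[OF degree_smult_le])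
 ultimately have "r' = 0 \<or> degree r' < ?k" by (metis le_neq_implies_less leading_coeff_0_iff)
 then have "E (jac0 l * r') = 0" using less by auto
 moreover have "E (jac0 l * jac0 ?k) = 0" using less.prems by (intro jac0_orth) auto
 moreover have "jac0 l * r = jac0 l * r' + smult c (jac0 l * jac0 ?k)" unfolding r'_def by (simp add: algebra_simps)
 ultimately show ?case by (simp add: E_add E_smult)
qed

text \<open>After the leading coefficients are matched, the remainder has lower degree and is
  orthogonal to both polynomials, hence to itself.\<close>

lemma eq_smult_jac0:
 assumes "degree q \<le> l" and orth: "\<And>r. degree r < l \<Longrightarrow> E (q * r) = 0" shows "\<exists>c. q = smult c (jac0 l)"
proof -
 define c where "c = coeff q l / lead_coeff (jac0 l)"
 define r where "r = q - smult c (jac0 l)"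
 have nz: "lead_coeff (jac0 l) \<noteq> 0" by (simp only: leading_coeff_0_iff jac0_nz simp_thms)
 have "coeff r l = 0" using nz unfolding r_def c_def by simp
 moreover have "degree r \<le> l" unfolding r_def using assms(1) by (intro degree_diff_le) (auto intro: order_trans[OF degree_smult_le])
 ultimately consider "r = 0" | "degree r < l" by (metis le_neq_implies_less leading_coeff_0_iff)
 then show ?thesis
 proof cases
  case 1 then show ?thesis unfolding r_def by auto
 next
  case 2
  have "r * r = q * r - smult c (jac0 l * r)" by (subst (1) r_def) (simp add: algebra_simps)
  then have "E (r * r) = 0" using orth[OF 2] jac0_orth_lower[OF 2] by (simp add: E_diff E_smult)
  then have "r = 0" using E_square_pos by force
  then show ?thesis unfolding r_def by auto
 qed
qed

lemma poly_jac0_expansion: "\<exists>a. q = (\<Sum>l\<le>degree q. smult (a l) (jac0 l))"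
proof (induction "degree q" arbitrary: q rule: less_induct)
 case less
 let ?k = "degree q"
 define c where "c = lead_coeff q / lead_coeff (jac0 ?k)"
 define r where "r = q - smult c (jac0 ?k)"
 have nz: "lead_coeff (jac0 ?k) \<noteq> 0" by (simp only: leading_coeff_0_iff jac0_nz simp_thms)
 have "coeff r ?k = 0" using nz unfolding r_def c_def by simp
 moreover have "degree r \<le> ?k" unfolding r_def by (intro degree_diff_le) (auto intro: order_trans[OF degree_smult_le])
 ultimately have "r = 0 \<or> degree r < ?k" by (metis le_neq_implies_less leading_coeff_0_iff)
 then have "\<exists>a. r = (\<Sum>l<?k. smult (a l) (jac0 l))"
 proof
  assume "r = 0" then show ?thesis by (intro exI[of _ "\<lambda>_. 0"]) simp
 next
  assume k: "degree r < ?k"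
  from less[OF this] obtain a where a: "r = (\<Sum>l\<le>degree r. smult (a l) (jac0 l))" by blast
  have "(\<Sum>l\<le>degree r. smult (a l) (jac0 l)) = (\<Sum>l<?k. smult (if l \<le> degree r then a l else 0) (jac0 l))"
   by (rule sum.mono_neutral_cong_left) (use k in auto)
  with a show ?thesis by metis
 qed
 then obtain a where a: "r = (\<Sum>l<?k. smult (a l) (jac0 l))" by blast
 have "q = smult c (jac0 ?k) + (\<Sum>l<?k. smult (a l) (jac0 l))" using a unfolding r_def by (simp add: algebra_simps)
 also have "\<dots> = (\<Sum>l\<le>?k. smult ((a(?k := c)) l) (jac0 l))" by (simp add: lessThan_Suc_atMost[symmetric])
 finally show ?case by blast
qed

lemma flux_jac0_deriv: "(flux (jac0 l) has_real_derivative - ev l * (wt u * poly (jac0 l) ((cos (u/2))^2))) (at u)"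
 using flux_deriv[of "jac0 l" u] by (simp add: jac_op_jac0 mult_ac)

text \<open>The derivative of \<open>flux (jac0 l)\<close> is \<open>- ev l\<close> times the
  integrand, so the integral over a ball is a boundary value. The Fourier coefficients of balls are
  therefore values of \<open>flux\<close>.\<close>

lemma integral_wt_jac0:
 assumes "l \<ge> 1" "r \<ge> 0" shows "(LBINT u:{0..r}. wt u * poly (jac0 l) ((cos (u/2))^2)) = - flux (jac0 l) r / ev l"
proof -
 have c: "continuous_on UNIV (\<lambda>u. - ev l * (wt u * poly (jac0 l) ((cos (u/2))^2)))" by (intro continuous_intros) auto
 have "(\<integral>u. - ev l * (wt u * poly (jac0 l) ((cos (u/2))^2)) * indicator {0..r} u \<partial>lborel) = flux (jac0 l) r - flux (jac0 l) 0"
  by (rule integral_FTC_Icc_real) (use assms c in \<open>auto intro!: flux_jac0_deriv[THEN DERIV_cong] simp: continuous_on_eq_continuous_at\<close>)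
 also have "(\<integral>u. - ev l * (wt u * poly (jac0 l) ((cos (u/2))^2)) * indicator {0..r} u \<partial>lborel) =
  - ev l * (LBINT u:{0..r}. wt u * poly (jac0 l) ((cos (u/2))^2))"
  unfolding set_lebesgue_integral_def by (simp add: mult_ac flip: integral_mult_right_zero)
 finally show ?thesis using ev_pos[OF assms(1)] by (simp add: field_simps)
qed

end

section \<open>Lower bounds for Jacobi polynomials in the mean\<close>

text \<open>Integrating factors: \<open>F * exp G\<close> increases and \<open>F * exp (- G)\<close>
  decreases.\<close>

lemma gronwall_two_sided:
 fixes F F' G G' :: "real \<Rightarrow> real"
 assumes F: "\<And>u. u \<in> {a..b} \<Longrightarrow> (F has_real_derivative F' u) (at u)"
  and G: "\<And>u. u \<in> {a..b} \<Longrightarrow> (G has_real_derivative G' u) (at u)"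
  and le: "\<And>u. u \<in> {a..b} \<Longrightarrow> \<bar>F' u\<bar> \<le> G' u * F u" and ab: "a \<le> b"
 shows "F a * exp (- (G b - G a)) \<le> F b" and "F b \<le> F a * exp (G b - G a)"
proof -
 have "F a * exp (G a) \<le> F b * exp (G b)"
 proof (rule DERIV_nonneg_imp_nondecreasing[OF ab])
  fix u assume "a \<le> u" "u \<le> b"
  then have "((\<lambda>u. F u * exp (G u)) has_real_derivative (F' u + F u * G' u) * exp (G u)) (at u)"
   by (auto intro!: derivative_eq_intros F G simp: algebra_simps)
  moreover have "0 \<le> (F' u + F u * G' u) * exp (G u)"
   using le[of u] \<open>a \<le> u\<close> \<open>u \<le> b\<close> by (intro mult_nonneg_nonneg) (auto simp: mult.commute)
  ultimately show "\<exists>y. ((\<lambda>u. F u * exp (G u)) has_real_derivative y) (at u) \<and> 0 \<le> y" by blast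
 qed
 then have "F a * exp (G a) * exp (- G b) \<le> F b * exp (G b) * exp (- G b)" by (intro mult_right_mono) auto
 then show "F a * exp (- (G b - G a)) \<le> F b" by (simp add: mult.assoc flip: exp_add)
 have "F a * exp (- G a) \<ge> F b * exp (- G b)"
 proof (rule DERIV_nonpos_imp_nonincreasing[OF ab])
  fix u assume "a \<le> u" "u \<le> b"
  then have "((\<lambda>u. F u * exp (- G u)) has_real_derivative (F' u - F u * G' u) * exp (- G u)) (at u)"
   by (auto intro!: derivative_eq_intros F G simp: algebra_simps)
  moreover have "(F' u - F u * G' u) * exp (- G u) \<le> 0"
   using le[of u] \<open>a \<le> u\<close> \<open>u \<le> b\<close> by (intro mult_nonpos_nonneg) (auto simp: mult.commute)
  ultimately show "\<exists>y. ((\<lambda>u. F u * exp (- G u)) has_real_derivative y) (at u) \<and> y \<le> 0" by blast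
 qed
 then have "F a * exp (- G a) * exp (G b) \<ge> F b * exp (- G b) * exp (G b)" by (intro mult_right_mono) auto
 then show "F b \<le> F a * exp (G b - G a)" by (simp add: mult.assoc flip: exp_add)
qed

section \<open>Energy and phase of a perturbed harmonic oscillator\<close>

locale oscillator =
 fixes z z1 Q :: "real \<Rightarrow> real" and \<omega> a b :: real
 assumes \<omega>_pos: "\<omega> > 0" and z_deriv: "\<And>u. u \<in> {a..b} \<Longrightarrow> (z has_real_derivative z1 u) (at u)"
  and z1_deriv: "\<And>u. u \<in> {a..b} \<Longrightarrow> (z1 has_real_derivative - (\<omega>^2 - Q u) * z u) (at u)"
begin

text \<open>The squared radius in the phase plane \<open>(z, z1 / \<omega>)\<close>; it would be
  constant if Q were 0.\<close>

definition energy :: "real \<Rightarrow> real" where "energy u = (z u)^2 + (z1 u / \<omega>)^2"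

lemma energy_nonneg: "0 \<le> energy u" by (simp add: energy_def)

lemma energy_deriv: "u \<in> {a..b} \<Longrightarrow> (energy has_real_derivative 2 * z u * (z1 u / \<omega>) * (Q u / \<omega>)) (at u)"
 unfolding energy_def[abs_def] power2_eq_square using \<omega>_pos
 by (auto intro!: derivative_eq_intros z_deriv z1_deriv simp: field_simps power2_eq_square)

lemma energy_deriv_bound: "\<bar>2 * z u * (z1 u / \<omega>) * (Q u / \<omega>)\<bar> \<le> \<bar>Q u\<bar> / \<omega> * energy u"
proof -
 have "\<bar>2 * z u * (z1 u / \<omega>)\<bar> \<le> energy u"
  unfolding energy_def using sum_squares_bound[of "z u" "z1 u / \<omega>"] sum_squares_bound[of "z u" "- (z1 u / \<omega>)"] by (simp add: abs_le_iff)
 then have "\<bar>2 * z u * (z1 u / \<omega>)\<bar> * \<bar>Q u / \<omega>\<bar> \<le> energy u * \<bar>Q u / \<omega>\<bar>" by (rule mult_right_mono) auto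
 then show ?thesis using \<omega>_pos by (simp add: abs_mult mult_ac)
qed

text \<open>Only Q changes the energy, at relative rate at most
  \<open>\<bar>Q\<bar> / \<omega>\<close>; G is a primitive of a bound for
  \<open>\<bar>Q\<bar>\<close>. The division by \<open>\<omega>\<close> is what will keep the total
  change bounded although Q blows up near 0.\<close>

lemma energy_growth:
 assumes G: "\<And>u. u \<in> {a..b} \<Longrightarrow> (G has_real_derivative G' u) (at u)"
  and Q: "\<And>u. u \<in> {a..b} \<Longrightarrow> \<bar>Q u\<bar> \<le> G' u" and "a \<le> u" "u \<le> v" "v \<le> b"
 shows "energy u * exp (- (G v - G u) / \<omega>) \<le> energy v" and "energy v \<le> energy u * exp ((G v - G u) / \<omega>)"
proof -
 have 1: "((\<lambda>u. G u / \<omega>) has_real_derivative G' x / \<omega>) (at x)" if "x \<in> {u..v}" for x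
  using that assms \<omega>_pos by (auto intro!: derivative_eq_intros G)
 have 2: "\<bar>2 * z x * (z1 x / \<omega>) * (Q x / \<omega>)\<bar> \<le> G' x / \<omega> * energy x" if "x \<in> {u..v}" for x
 proof -
  have "\<bar>Q x\<bar> / \<omega> * energy x \<le> G' x / \<omega> * energy x"
   using that assms \<omega>_pos by (intro mult_right_mono divide_right_mono Q energy_nonneg) auto
  with energy_deriv_bound[of x] show ?thesis by linarith
 qed
 note * = gronwall_two_sided[OF energy_deriv 1 2, of u v, simplified]
 show "energy u * exp (- (G v - G u) / \<omega>) \<le> energy v" "energy v \<le> energy u * exp ((G v - G u) / \<omega>)"
  using * assms by (auto simp: diff_divide_distrib)
qed

text \<open>In the frame rotating with frequency \<open>\<omega>\<close> the pair \<open>(z, z1 / \<omega>)\<close> is almost at rest.\<close>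
lemma phase:
 assumes ab: "a \<le> b" and Q: "\<And>u. u \<in> {a..b} \<Longrightarrow> \<bar>Q u\<bar> \<le> K"
  and M: "\<And>u. u \<in> {a..b} \<Longrightarrow> energy u \<le> 4 * energy a"
 obtains \<psi> where "\<And>u. u \<in> {a..b} \<Longrightarrow>
   \<bar>z1 u / \<omega> - sqrt (energy a) * sin (\<omega> * u + \<psi>)\<bar> \<le> 4 * K * (b - a) / \<omega> * sqrt (energy a)"
proof -
 \<comment> \<open>A and B are the coordinates of the pair in the rotating frame: the terms with
   \<open>\<omega>\<close> cancel in their derivatives and only those with Q remain.\<close>
 define A where "A u = z u * cos (\<omega> * u) - z1 u / \<omega> * sin (\<omega> * u)" for u
 define B where "B u = z u * sin (\<omega> * u) + z1 u / \<omega> * cos (\<omega> * u)" for u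
 have dA: "(A has_real_derivative - sin (\<omega> * u) * (Q u * z u / \<omega>)) (at u)" if "u \<in> {a..b}" for u
  unfolding A_def[abs_def] using that \<omega>_pos by (auto intro!: derivative_eq_intros z_deriv z1_deriv simp: field_simps power2_eq_square)
 have dB: "(B has_real_derivative cos (\<omega> * u) * (Q u * z u / \<omega>)) (at u)" if "u \<in> {a..b}" for u
  unfolding B_def[abs_def] using that \<omega>_pos by (auto intro!: derivative_eq_intros z_deriv z1_deriv simp: field_simps power2_eq_square)
 have zle: "\<bar>z u\<bar> \<le> 2 * sqrt (energy a)" if "u \<in> {a..b}" for u
 proof -
  have "\<bar>z u\<bar> \<le> sqrt (energy u)" unfolding energy_def by (rule real_le_rsqrt) simp
  also have "\<dots> \<le> sqrt (4 * energy a)" using M[OF that] by simp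
  finally show ?thesis by (simp add: real_sqrt_mult)
 qed
 have K0: "0 \<le> K" using Q[of a] ab by auto
 have bnd: "\<bar>s * (Q u * z u / \<omega>)\<bar> \<le> 2 * K / \<omega> * sqrt (energy a)" if "u \<in> {a..b}" "\<bar>s\<bar> \<le> 1" for u s
 proof -
  have "\<bar>s\<bar> * (\<bar>Q u\<bar> * \<bar>z u\<bar> / \<omega>) \<le> 1 * (K * (2 * sqrt (energy a)) / \<omega>)"
   using that Q zle K0 \<omega>_pos by (intro mult_mono divide_right_mono) auto
  then show ?thesis using \<omega>_pos by (simp add: abs_mult mult_ac)
 qed
 have near: "\<bar>X u - X a\<bar> \<le> 2 * K / \<omega> * sqrt (energy a) * (b - a)"
  if X: "\<And>u. u \<in> {a..b} \<Longrightarrow> (X has_real_derivative X' u * (Q u * z u / \<omega>)) (at u)"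
    "\<And>u. \<bar>X' u\<bar> \<le> 1" and u: "u \<in> {a..b}" for X X' u
 proof -
  have "norm (X u - X a) \<le> (2 * K / \<omega> * sqrt (energy a)) * norm (u - a)"
   by (rule field_differentiable_bound[where S="{a..b}" and f'="\<lambda>u. X' u * (Q u * z u / \<omega>)"])
     (use X u ab bnd in \<open>auto intro: has_field_derivative_at_within\<close>)
  also have "\<dots> \<le> 2 * K / \<omega> * sqrt (energy a) * (b - a)"
   using u K0 \<omega>_pos by (intro mult_left_mono) (auto intro!: mult_nonneg_nonneg simp: energy_nonneg)
  finally show ?thesis by simp
 qed
 have AB: "(A a)^2 + (B a)^2 = energy a"
 proof -
  have "(A a)^2 + (B a)^2 = ((z a)^2 + (z1 a / \<omega>)^2) * ((sin (\<omega> * a))^2 + (cos (\<omega> * a))^2)"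
   unfolding A_def B_def by algebra
  then show ?thesis unfolding energy_def by simp
 qed
 \<comment> \<open>Polar coordinates of the initial pair; at zero energy any angle will do.\<close>
 obtain \<psi> where \<psi>: "- A a = sqrt (energy a) * cos \<psi>" "B a = sqrt (energy a) * sin \<psi>"
 proof (cases "energy a = 0")
  case True
  then show ?thesis using AB that[of 0] by (auto simp: sum_power2_eq_zero_iff)
 next
  case False
  then have pos: "energy a > 0" using energy_nonneg[of a] by linarith
  have "(- A a / sqrt (energy a))^2 + (B a / sqrt (energy a))^2 = ((A a)^2 + (B a)^2) / energy a"
   using pos by (simp add: power_divide add_divide_distrib)
  then have "(- A a / sqrt (energy a))^2 + (B a / sqrt (energy a))^2 = 1" using AB pos by simp
  then obtain t where t: "- A a / sqrt (energy a) = cos t" "B a / sqrt (energy a) = sin t" using sincos_total_2pi by metis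
  show ?thesis by (rule that[of t]) (use t pos in \<open>auto simp: field_simps\<close>)
 qed
 show ?thesis
 proof (rule that)
  fix u assume u: "u \<in> {a..b}"
  have nA: "\<bar>A u - A a\<bar> \<le> 2 * K / \<omega> * sqrt (energy a) * (b - a)" by (rule near[OF dA _ u]) auto
  have nB: "\<bar>B u - B a\<bar> \<le> 2 * K / \<omega> * sqrt (energy a) * (b - a)" by (rule near[OF dB _ u]) auto
  have "z1 u / \<omega> = z1 u / \<omega> * ((sin (\<omega> * u))^2 + (cos (\<omega> * u))^2)" by simp
  also have "\<dots> = - A u * sin (\<omega> * u) + B u * cos (\<omega> * u)" unfolding A_def B_def by algebra
  finally have 1: "z1 u / \<omega> = - A u * sin (\<omega> * u) + B u * cos (\<omega> * u)" .
  have 2: "sqrt (energy a) * sin (\<omega> * u + \<psi>) = - A a * sin (\<omega> * u) + B a * cos (\<omega> * u)"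
   unfolding sin_add \<psi> by (simp add: algebra_simps)
  have "\<bar>z1 u / \<omega> - sqrt (energy a) * sin (\<omega> * u + \<psi>)\<bar> = \<bar>(B u - B a) * cos (\<omega> * u) - (A u - A a) * sin (\<omega> * u)\<bar>"
   unfolding 1 2 by (simp add: algebra_simps)
  also have "\<dots> \<le> \<bar>B u - B a\<bar> * \<bar>cos (\<omega> * u)\<bar> + \<bar>A u - A a\<bar> * \<bar>sin (\<omega> * u)\<bar>"
   by (simp add: abs_triangle_ineq4[THEN order_trans] flip: abs_mult)
  also have "\<dots> \<le> \<bar>B u - B a\<bar> * 1 + \<bar>A u - A a\<bar> * 1" by (intro add_mono mult_left_mono) auto
  also have "\<dots> \<le> 2 * K / \<omega> * sqrt (energy a) * (b - a) + 2 * K / \<omega> * sqrt (energy a) * (b - a)"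
   using add_mono[OF nB nA] by (simp only: mult_1_right)
  finally show "\<bar>z1 u / \<omega> - sqrt (energy a) * sin (\<omega> * u + \<psi>)\<bar> \<le> 4 * K * (b - a) / \<omega> * sqrt (energy a)"
   by (simp add: algebra_simps)
 qed
qed

end

text \<open>Jordan's inequality: a concave function lies above its chord, here from 0 to
  \<open>pi / 2\<close>.\<close>

lemma sin_ge_linear: "0 \<le> y \<Longrightarrow> y \<le> pi / 2 \<Longrightarrow> 2 / pi * y \<le> sin y" for y :: real
proof -
 assume y: "0 \<le> y" "y \<le> pi / 2"
 have "convex_on {0..pi} (\<lambda>x::real. - sin x)" by (rule f''_ge0_imp_convex[where f'="\<lambda>x. - cos x" and f''="sin"])
    (auto intro!: derivative_eq_intros sin_ge_zero)
 from convex_onD[OF this, of "2 * y / pi" 0 "pi / 2"] y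
 show ?thesis by (simp add: field_simps)
qed

text \<open>By Jordan's inequality the set near each zero of the sine lies in an interval of length
  \<open>\<delta> * pi / \<omega>\<close>, and at most about
  \<open>\<omega> * (\<beta> - \<alpha>) / pi + 3\<close> zeros matter. The product is bounded
  uniformly in the phase and in \<open>\<omega> \<ge> 1\<close>.\<close>

lemma measure_sin_small:
 fixes \<omega> \<psi> \<delta> \<alpha> \<beta> :: real
 assumes "\<omega> \<ge> 1" "0 < \<delta>" "\<alpha> \<le> \<beta>"
 shows "measure lebesgue {u \<in> {\<alpha>..\<beta>}. \<bar>sin (\<omega> * u + \<psi>)\<bar> < \<delta>} \<le> \<delta> * (\<beta> - \<alpha> + 4 * pi)"
proof -
 define m where "m = \<lfloor>(\<omega> * \<alpha> + \<psi>) / pi\<rfloor>"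
 define n where "n = \<lfloor>(\<omega> * \<beta> + \<psi>) / pi\<rfloor> + 1"
 let ?I = "\<lambda>k::int. {(k * pi - \<psi>) / \<omega> - \<delta> * pi / (2 * \<omega>)..(k * pi - \<psi>) / \<omega> + \<delta> * pi / (2 * \<omega>)}"
 have sub: "{u \<in> {\<alpha>..\<beta>}. \<bar>sin (\<omega> * u + \<psi>)\<bar> < \<delta>} \<subseteq> (\<Union>k\<in>{m..n}. ?I k)"
 proof
  fix u assume "u \<in> {u \<in> {\<alpha>..\<beta>}. \<bar>sin (\<omega> * u + \<psi>)\<bar> < \<delta>}"
  then have u: "\<alpha> \<le> u" "u \<le> \<beta>" "\<bar>sin (\<omega> * u + \<psi>)\<bar> < \<delta>" by auto
  define x where "x = \<omega> * u + \<psi>"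
  define k where "k = round (x / pi)"
  define y where "y = x - k * pi"
  have "\<bar>x / pi - k\<bar> \<le> 1 / 2" unfolding k_def by (metis of_int_round_abs_le abs_minus_commute)
  moreover have "x / pi - k = y / pi" unfolding y_def by (simp add: field_simps)
  ultimately have y: "\<bar>y\<bar> \<le> pi / 2" by (simp add: field_simps)
  have "\<bar>sin x\<bar> = \<bar>sin y\<bar>"
   unfolding y_def sin_diff by (simp add: abs_mult sin_times_pi_eq_0 cos_int_times_real mult.commute[of _ pi])
  moreover have "2 / pi * \<bar>y\<bar> \<le> \<bar>sin y\<bar>"
  proof -
   have "2 / pi * \<bar>y\<bar> \<le> sin \<bar>y\<bar>" using y by (intro sin_ge_linear) auto
   also have "\<dots> \<le> \<bar>sin y\<bar>" by (simp add: abs_if)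
   finally show ?thesis .
  qed
  ultimately have "2 / pi * \<bar>y\<bar> < \<delta>" using u(3) unfolding x_def by simp
  then have "\<bar>y\<bar> \<le> \<delta> * pi / 2" by (simp add: field_simps)
  then have "\<bar>y / \<omega>\<bar> \<le> \<delta> * pi / (2 * \<omega>)" using assms(1) by (simp add: field_simps)
  moreover have "u = (k * pi - \<psi>) / \<omega> + y / \<omega>" unfolding y_def x_def using assms(1) by (simp add: field_simps)
  ultimately have "u \<in> ?I k" using abs_le_D1 abs_le_D2 by (smt (verit) atLeastAtMost_iff)
  moreover have "k \<in> {m..n}"
  proof -
   have "(\<omega> * \<alpha> + \<psi>) / pi \<le> x / pi" "x / pi \<le> (\<omega> * \<beta> + \<psi>) / pi"
    unfolding x_def using u assms by (auto intro!: divide_right_mono)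
   then have "m \<le> \<lfloor>x / pi\<rfloor>" "\<lfloor>x / pi\<rfloor> + 1 \<le> n" unfolding m_def n_def by (auto intro: floor_mono)
   moreover have "\<lfloor>x / pi\<rfloor> \<le> k" "k \<le> \<lfloor>x / pi\<rfloor> + 1" unfolding k_def round_def by linarith+
   ultimately show ?thesis by auto
  qed
  ultimately show "u \<in> (\<Union>k\<in>{m..n}. ?I k)" by blast
 qed
 have "measure lebesgue {u \<in> {\<alpha>..\<beta>}. \<bar>sin (\<omega> * u + \<psi>)\<bar> < \<delta>} \<le> measure lebesgue (\<Union>k\<in>{m..n}. ?I k)"
  by (intro measure_mono_fmeasurable sub) (auto intro!: fmeasurable.finite_UN)
 also have "\<dots> \<le> (\<Sum>k\<in>{m..n}. measure lebesgue (?I k))" by (intro measure_UNION_le) auto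
 also have "\<dots> = (\<Sum>k\<in>{m..n}. \<delta> * pi / \<omega>)" using assms by (intro sum.cong) (auto simp: measure_completion)
 also have "\<dots> = nat (n - m + 1) * (\<delta> * pi / \<omega>)" by simp
 also have "\<dots> \<le> ((\<omega> * \<beta> + \<psi>) / pi - (\<omega> * \<alpha> + \<psi>) / pi + 3) * (\<delta> * pi / \<omega>)"
 proof (rule mult_right_mono)
  have "(\<omega> * \<alpha> + \<psi>) / pi \<le> (\<omega> * \<beta> + \<psi>) / pi"
   using assms by (intro divide_right_mono add_right_mono mult_left_mono) auto
  then have "m \<le> n" unfolding m_def n_def by linarith
  then show "real (nat (n - m + 1)) \<le> (\<omega> * \<beta> + \<psi>) / pi - (\<omega> * \<alpha> + \<psi>) / pi + 3"
   unfolding m_def n_def by linarith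
 qed (use assms in auto)
 also have "\<dots> = \<delta> * (\<beta> - \<alpha> + 3 * pi / \<omega>)" using assms by (simp add: field_simps)
 also have "\<dots> \<le> \<delta> * (\<beta> - \<alpha> + 4 * pi)"
 proof -
  have "3 * pi / \<omega> \<le> 3 * pi" using assms by (simp add: field_simps)
  then have "3 * pi / \<omega> \<le> 4 * pi" by (rule order_trans) simp
  then show ?thesis using assms by (intro mult_left_mono) auto
 qed
 finally show ?thesis .
qed

text \<open>The sets where \<open>\<eta>\<close> is at least \<open>1 / (n + 1)\<close>, at distance
  at least \<open>1 / (n + 1)\<close> from the ends, exhaust the positivity set of
  \<open>\<eta>\<close> up to the two end points, so one of them is not null. Staying away from the
  ends keeps \<open>wt\<close> and the potential under control there.\<close>

lemma nonzero_weight_bounded_below: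
 fixes \<eta> :: "real \<Rightarrow> real"
 assumes meas: "\<eta> \<in> borel_measurable (lebesgue_on {0..pi})" and nn: "\<And>r. r \<in> {0..pi} \<Longrightarrow> 0 \<le> \<eta> r"
  and nz: "\<not> (AE r in lebesgue_on {0..pi}. \<eta> r = 0)"
 obtains \<alpha> \<beta> \<epsilon> S where "0 < \<alpha>" "\<alpha> \<le> \<beta>" "\<beta> < pi" "0 < \<epsilon>" "S \<in> sets lebesgue" "S \<subseteq> {\<alpha>..\<beta>}"
  "measure lebesgue S > 0" "\<And>r. r \<in> S \<Longrightarrow> \<epsilon> \<le> \<eta> r"
proof -
 define S where "S n = {r \<in> {0..pi}. 1 / real (Suc n) \<le> \<eta> r} \<inter> {1 / real (Suc n)..pi - 1 / real (Suc n)}" for n :: nat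
 have sets: "S n \<in> sets lebesgue" for n
 proof -
  have "{r \<in> space (lebesgue_on {0..pi}). 1 / real (Suc n) \<le> \<eta> r} \<in> sets (lebesgue_on {0..pi})" using meas by measurable
  then have "{r \<in> {0..pi}. 1 / real (Suc n) \<le> \<eta> r} \<in> sets lebesgue" by (subst (asm) sets_restrict_space_iff) auto
  then show ?thesis unfolding S_def by (intro sets.Int) simp_all
 qed
 have "\<exists>n. emeasure lebesgue (S n) \<noteq> 0"
 proof (rule ccontr)
  assume "\<not> ?thesis"
  then have "(\<Union>n. S n) \<in> null_sets lebesgue" using sets by (intro null_sets_UN) (auto intro: null_setsI)
  moreover have "{0, pi} \<in> null_sets lebesgue" by (metis finite.emptyI finite.insertI finite_imp_null_set_lborel null_sets_completionI)
  ultimately have null: "(\<Union>n. S n) \<union> {0, pi} \<in> null_sets lebesgue" by (rule null_sets.Un)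
  have "{r \<in> {0..pi}. \<eta> r \<noteq> 0} \<subseteq> (\<Union>n. S n) \<union> {0, pi}"
  proof
   fix r assume "r \<in> {r \<in> {0..pi}. \<eta> r \<noteq> 0}"
   then have r: "r \<in> {0..pi}" "\<eta> r > 0" using nn[of r] by auto
   show "r \<in> (\<Union>n. S n) \<union> {0, pi}"
   proof (cases "r = 0 \<or> r = pi")
    case False
    then have "min (\<eta> r) (min r (pi - r)) > 0" using r by auto
    then obtain n where "1 / real (Suc n) < min (\<eta> r) (min r (pi - r))" using nat_approx_posE by blast
    then have "r \<in> S n" unfolding S_def using r by auto
    then show ?thesis by blast
   qed auto
  qed
  then have "AE r in lebesgue. r \<in> {0..pi} \<longrightarrow> \<eta> r = 0" by (intro AE_I'[OF null]) auto
  then show False using nz by (subst (asm) AE_restrict_space_iff) auto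
 qed
 then obtain n where n: "emeasure lebesgue (S n) \<noteq> 0" by blast
 have sub: "S n \<subseteq> {1 / real (Suc n)..pi - 1 / real (Suc n)}" unfolding S_def by auto
 then have "S n \<noteq> {}" using n by auto
 then have le: "1 / real (Suc n) \<le> pi - 1 / real (Suc n)" using sub by fastforce
 have "S n \<in> lmeasurable" using sub by (intro bounded_set_imp_lmeasurable sets) (rule bounded_subset[OF bounded_closed_interval])
 then have pos: "measure lebesgue (S n) > 0" using n by (simp add: emeasure_eq_measure2 zero_less_measure_iff)
 show ?thesis
 proof (rule that)
  show "0 < 1 / real (Suc n)" "0 < 1 / real (Suc n)" "pi - 1 / real (Suc n) < pi" by simp_all
  show "\<And>r. r \<in> S n \<Longrightarrow> 1 / real (Suc n) \<le> \<eta> r" unfolding S_def by blast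
 qed fact+
qed

section \<open>Liouville normal form of the Jacobi equation and the size of its solutions\<close>

context jacobi_weight begin

text \<open>Half the logarithmic derivative of \<open>wt\<close>, that is the logarithmic derivative
  of \<open>sqrt wt\<close>.\<close>

definition logd :: "real \<Rightarrow> real" where
 "logd u = (real (d - 1) * (cos (u/2) / sin (u/2)) - real (d0 - 1) * (sin (u/2) / cos (u/2))) / 4"

text \<open>The potential of the Liouville normal form: the second derivative of
  \<open>sqrt wt\<close> divided by \<open>sqrt wt\<close>.\<close>

definition pot :: "real \<Rightarrow> real" where
 "pot u = (logd u)^2 - (real (d - 1) / (sin (u/2))^2 + real (d0 - 1) / (cos (u/2))^2) / 8"

lemma sin_cos_half_pos: "u \<in> {0<..<pi} \<Longrightarrow> 0 < sin (u/2) \<and> 0 < cos (u/2)" by (auto intro!: sin_gt_zero cos_gt_zero)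

lemma wt_deriv:
 assumes "u \<in> {0<..<pi}" shows "(wt has_real_derivative 2 * logd u * wt u) (at u)"
proof -
 obtain d' d0' where s: "d = Suc d'" "d0 = Suc d0'" using d_pos d0_pos by (metis Suc_le_D One_nat_def)
 have p: "sin (u/2) > 0" "cos (u/2) > 0" using sin_cos_half_pos[OF assms] by auto
 have a: "real n * x ^ (n - 1) * y = real n * x ^ n * (y / x)" if "x > 0" for x y :: real and n using that by (cases n) (auto simp: field_simps)
 have "(wt has_real_derivative (real d' * sin (u/2) ^ (d' - 1) * (cos (u/2) / 2)) * cos (u/2) ^ d0' +
   sin (u/2) ^ d' * (real d0' * cos (u/2) ^ (d0' - 1) * (- (sin (u/2) / 2)))) (at u)"
  unfolding wt_def[abs_def] unfolding s by (rule derivative_eq_intros refl | simp)+ (simp add: mult_ac)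
 also have "(real d' * sin (u/2) ^ (d' - 1) * (cos (u/2) / 2)) * cos (u/2) ^ d0' +
   sin (u/2) ^ d' * (real d0' * cos (u/2) ^ (d0' - 1) * (- (sin (u/2) / 2))) = 2 * logd u * wt u"
  unfolding a[OF p(1)] a[OF p(2)] logd_def wt_def unfolding s by (simp add: field_simps)
 finally show ?thesis .
qed

lemma logd_deriv:
 assumes "u \<in> {0<..<pi}" shows "(logd has_real_derivative pot u - (logd u)^2) (at u)"
proof -
 have p: "sin (u/2) > 0" "cos (u/2) > 0" using sin_cos_half_pos[OF assms] by auto
 have sc: "(cos (u/2))^2 + (sin (u/2))^2 = 1" by simp
 have "((\<lambda>u. cos (u/2) / sin (u/2)) has_real_derivative
   (- (sin (u/2) / 2) * sin (u/2) - cos (u/2) * (cos (u/2) / 2)) / (sin (u/2) * sin (u/2))) (at u)"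
  using p by (auto intro!: derivative_eq_intros)
 also have "- (sin (u/2) / 2) * sin (u/2) - cos (u/2) * (cos (u/2) / 2) = - 1 / 2" using sc by (simp add: power2_eq_square field_simps)
 finally have 1: "((\<lambda>u. cos (u/2) / sin (u/2)) has_real_derivative - 1 / 2 / (sin (u/2) * sin (u/2))) (at u)" .
 have "((\<lambda>u. sin (u/2) / cos (u/2)) has_real_derivative
   (cos (u/2) / 2 * cos (u/2) - sin (u/2) * - (sin (u/2) / 2)) / (cos (u/2) * cos (u/2))) (at u)"
  using p by (auto intro!: derivative_eq_intros)
 also have "cos (u/2) / 2 * cos (u/2) - sin (u/2) * - (sin (u/2) / 2) = 1 / 2" using sc by (simp add: power2_eq_square field_simps)
 finally have 2: "((\<lambda>u. sin (u/2) / cos (u/2)) has_real_derivative 1 / 2 / (cos (u/2) * cos (u/2))) (at u)" .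
 have "(logd has_real_derivative (real (d - 1) * (- 1 / 2 / (sin (u/2) * sin (u/2))) - real (d0 - 1) * (1 / 2 / (cos (u/2) * cos (u/2)))) / 4) (at u)"
  unfolding logd_def[abs_def] by (intro DERIV_cdivide DERIV_diff DERIV_cmult 1 2)
 also have "(real (d - 1) * (- 1 / 2 / (sin (u/2) * sin (u/2))) - real (d0 - 1) * (1 / 2 / (cos (u/2) * cos (u/2)))) / 4
   = pot u - (logd u)^2"
  unfolding pot_def by (simp add: power2_eq_square diff_divide_distrib add_divide_distrib)
 finally show ?thesis .
qed

text \<open>When the interval stops at \<open>b < pi\<close>, only the singularity at 0 is left:
  there the cotangent is of order \<open>1 / u\<close>, and its square and its derivative are of
  order \<open>1 / u^2\<close>.\<close>

lemma logd_bound: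
 assumes "b < pi"
 obtains C where "C > 0" "\<And>u. 0 < u \<Longrightarrow> u \<le> b \<Longrightarrow> \<bar>logd u\<bar> \<le> C / u" "\<And>u. 0 < u \<Longrightarrow> u \<le> b \<Longrightarrow> \<bar>pot u\<bar> \<le> C / u^2"
proof -
 define m where "m = (if b \<le> 0 then 1 else cos (b/2))"
 have m: "m > 0" unfolding m_def using assms by (auto intro!: cos_gt_zero)
 define C1 where "C1 = real d * pi + real d0 * pi / m"
 define C where "C = C1^2 + C1 + real d * pi^2 + real d0 * pi^2 / m^2"
 have C1: "C1 > 0" unfolding C1_def using d_pos d0_pos m by (intro add_pos_pos) auto
 have C: "C1 \<le> C" "C1^2 + (real d * pi^2 + real d0 * pi^2 / m^2) \<le> C" unfolding C_def using C1 by auto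
 have *: "u / pi \<le> sin (u/2)" "m \<le> cos (u/2)" "0 < u" "u < pi" if "0 < u" "u \<le> b" for u
 proof -
  show "u / pi \<le> sin (u/2)" using sin_ge_linear[of "u/2"] that assms by (simp add: field_simps)
  show "m \<le> cos (u/2)" unfolding m_def using that assms by (auto intro!: cos_monotone_0_pi_le)
 qed (use that assms in auto)
 have l1: "\<bar>logd u\<bar> \<le> C1 / u" if u: "0 < u" "u \<le> b" for u
 proof -
  note u' = *[OF u]
  have p: "sin (u/2) > 0" "cos (u/2) > 0" using sin_cos_half_pos[of u] u' by auto
  have "cos (u/2) / sin (u/2) \<le> 1 / (u / pi)" using u' by (intro frac_le) auto
  then have 1: "real (d - 1) * (cos (u/2) / sin (u/2)) \<le> real d * (pi / u)" using p by (intro mult_mono) auto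
  have "sin (u/2) / cos (u/2) \<le> 1 / m" using u' m by (intro frac_le) auto
  also have "\<dots> \<le> (1 / m) * (pi / u)" using u' m by (simp add: field_simps)
  finally have 2: "real (d0 - 1) * (sin (u/2) / cos (u/2)) \<le> real d0 * ((1 / m) * (pi / u))" using p by (intro mult_mono) auto
  have "\<bar>logd u\<bar> \<le> real (d - 1) * (cos (u/2) / sin (u/2)) + real (d0 - 1) * (sin (u/2) / cos (u/2))"
   unfolding logd_def using p by (intro abs_leI) (auto simp: field_simps intro!: add_nonneg_nonneg)
  also have "\<dots> \<le> C1 / u" using add_mono[OF 1 2] unfolding C1_def by (simp add: add_divide_distrib)
  finally show ?thesis .
 qed
 show ?thesis
 proof (rule that[of C])
  show "C > 0" using C C1 by linarith
  show "\<bar>logd u\<bar> \<le> C / u" if "0 < u" "u \<le> b" for u using l1[OF that] C that by (meson divide_right_mono less_imp_le order_trans)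
  show "\<bar>pot u\<bar> \<le> C / u^2" if u: "0 < u" "u \<le> b" for u
  proof -
   note u' = *[OF u]
   have p: "sin (u/2) > 0" "cos (u/2) > 0" using sin_cos_half_pos[of u] u' by auto
   have "(logd u)^2 \<le> (C1 / u)^2" using l1[OF u] by (metis abs_ge_zero power2_abs power_mono)
   then have 0: "(logd u)^2 \<le> C1^2 / u^2" by (simp add: power_divide)
   have "(u / pi)^2 \<le> (sin (u/2))^2" using u' by (intro power_mono) auto
   then have "real (d - 1) / (sin (u/2))^2 \<le> real d / (u / pi)^2" using u' by (intro frac_le) auto
   then have 1: "real (d - 1) / (sin (u/2))^2 \<le> real d * pi^2 / u^2" by (simp add: field_simps)
   have "m^2 \<le> (cos (u/2))^2" using u' m by (intro power_mono) auto
   then have "real (d0 - 1) / (cos (u/2))^2 \<le> real d0 / m^2" using m by (intro frac_le) auto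
   also have "\<dots> \<le> real d0 / m^2 * (pi^2 / u^2)"
   proof -
    have "u^2 \<le> pi^2" using u' by (intro power_mono) auto
    then have "1 \<le> pi^2 / u^2" using u' by simp
    from mult_left_mono[OF this, of "real d0 / m^2"] show ?thesis by simp
   qed
   finally have 2: "real (d0 - 1) / (cos (u/2))^2 \<le> real d0 * pi^2 / m^2 / u^2" by (simp add: field_simps)
   have n: "0 \<le> real (d - 1) / (sin (u/2))^2" "0 \<le> real (d0 - 1) / (cos (u/2))^2" "0 \<le> (logd u)^2" by auto
   have "\<bar>pot u\<bar> \<le> (logd u)^2 + (real (d - 1) / (sin (u/2))^2 + real (d0 - 1) / (cos (u/2))^2)"
   proof -
    have "\<bar>L - (X + Y) / 8\<bar> \<le> L + (X + Y)" if "0 \<le> X" "0 \<le> Y" "0 \<le> L" for X Y L :: real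
     proof -
     have "0 \<le> (X + Y) / 8" "(X + Y) / 8 \<le> X + Y" using that by (auto simp: field_simps)
     with that(3) show ?thesis by (intro abs_leI) linarith+
    qed
    from this[OF n] show ?thesis unfolding pot_def .
   qed
   also have "\<dots> \<le> C1^2 / u^2 + (real d * pi^2 / u^2 + real d0 * pi^2 / m^2 / u^2)" using 0 1 2 by linarith
   also have "\<dots> = (C1^2 + (real d * pi^2 + real d0 * pi^2 / m^2)) / u^2" by (simp add: add_divide_distrib)
   also have "\<dots> \<le> C / u^2" using C by (intro divide_right_mono) auto
   finally show ?thesis .
  qed
 qed
qed

definition zl :: "real poly \<Rightarrow> real \<Rightarrow> real" where
 "zl q u = sqrt (wt u) * poly q ((cos (u/2))^2)"

text \<open>The derivative of \<open>zl\<close>, arranged so that \<open>flux\<close> can be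
  recovered from it: \<open>flux^2 = wt * (zl1 - logd * zl)^2\<close>.\<close>

definition zl1 :: "real poly \<Rightarrow> real \<Rightarrow> real" where
 "zl1 q u = flux q u / sqrt (wt u) + logd u * zl q u"

text \<open>The Liouville transformation turns the Jacobi equation into a perturbed harmonic oscillator.\<close>
lemma oscillator_zl:
 assumes eig: "jac_op q = smult (- lam) q" and lam: "lam > 0" and ab: "0 < a" "b < pi" shows "oscillator (zl q) (zl1 q) pot (sqrt lam) a b"
proof
 show "sqrt lam > 0" using lam by simp
 fix u assume "u \<in> {a..b}"
 then have u: "u \<in> {0<..<pi}" using ab by auto
 have w: "wt u > 0" using wt_pos[OF u] .
 then have s: "sqrt (wt u) > 0" and ss: "sqrt (wt u) * sqrt (wt u) = wt u" by auto
 have ds: "((\<lambda>u. sqrt (wt u)) has_real_derivative logd u * sqrt (wt u)) (at u)"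
 proof -
  have "((\<lambda>u. sqrt (wt u)) has_real_derivative (inverse (sqrt (wt u)) / 2) * (2 * logd u * wt u)) (at u)"
   by (rule DERIV_chain2[OF DERIV_real_sqrt[OF w] wt_deriv[OF u]])
  also have "(inverse (sqrt (wt u)) / 2) * (2 * logd u * wt u) = logd u * sqrt (wt u)" using s by (subst ss[symmetric]) (simp add: field_simps)
  finally show ?thesis .
 qed
 have fl: "- (sin (u/2) * cos (u/2) * poly (pderiv q) ((cos (u/2))^2)) = flux q u / wt u" unfolding flux_eq_wt using w by simp
 have "(zl q has_real_derivative sqrt (wt u) * (flux q u / wt u) + logd u * sqrt (wt u) * poly q ((cos (u/2))^2)) (at u)"
  unfolding zl_def[abs_def] using DERIV_mult'[OF ds poly_deriv_cos[of q u]] unfolding fl .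
 also have "sqrt (wt u) * (flux q u / wt u) + logd u * sqrt (wt u) * poly q ((cos (u/2))^2) = zl1 q u"
  unfolding zl1_def zl_def using s by (subst (2) ss[symmetric]) (simp add: field_simps)
 finally show dz: "(zl q has_real_derivative zl1 q u) (at u)" .
 have df: "(flux q has_real_derivative - lam * (wt u * poly q ((cos (u/2))^2))) (at u)" using flux_deriv[of q u] by (simp add: eig mult_ac)
 have "(zl1 q has_real_derivative (- lam * (wt u * poly q ((cos (u/2))^2)) * sqrt (wt u) - flux q u * (logd u * sqrt (wt u))) / (sqrt (wt u) * sqrt (wt u))
   + (logd u * zl1 q u + (pot u - (logd u)^2) * zl q u)) (at u)"
  unfolding zl1_def[abs_def] by (rule DERIV_add[OF DERIV_divide[OF df ds] DERIV_mult'[OF logd_deriv[OF u] dz[unfolded zl1_def]]]) (use s in simp)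
 also have "(- lam * (wt u * poly q ((cos (u/2))^2)) * sqrt (wt u) - flux q u * (logd u * sqrt (wt u))) / (sqrt (wt u) * sqrt (wt u))
   = - lam * zl q u - logd u * (flux q u / sqrt (wt u))"
  unfolding zl_def using s by (subst ss[symmetric]) (simp add: field_simps)
 also have "- lam * zl q u - logd u * (flux q u / sqrt (wt u)) + (logd u * zl1 q u + (pot u - (logd u)^2) * zl q u)
   = - ((sqrt lam)^2 - pot u) * zl q u"
  unfolding zl1_def using lam by (simp add: algebra_simps power2_eq_square)
 finally show "(zl1 q has_real_derivative - ((sqrt lam)^2 - pot u) * zl q u) (at u)" .
qed

text \<open>Two mean value steps. The derivative of \<open>flux\<close> is bounded by
  \<open>lam * wt\<close>, so \<open>flux\<close> at v is at most \<open>lam * v\<close> times a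
  bound for \<open>wt\<close> on \<open>[0, v]\<close>; division by \<open>wt v\<close> bounds the
  slope of the solution by \<open>lam * v / m\<close>. Hence the solution departs from its value 1
  by at most \<open>lam * u^2 / m \<le> 1/2\<close>, that is, it stays large up to a distance of
  order \<open>1 / sqrt lam\<close> from the pole.\<close>

lemma near_pole:
 assumes eig: "jac_op q = smult (- lam) q" and lam: "lam > 0"
  and q1: "poly q 1 = 1" and qb: "\<And>t. t \<in> {0..1} \<Longrightarrow> \<bar>poly q t\<bar> \<le> 1"
  and u: "0 < u" "u \<le> pi / 2" "2 * lam * u^2 \<le> cos (pi/4) ^ (d0 - 1)" shows "poly q ((cos (u/2))^2) \<ge> 1 / 2"
proof -
 let ?f = "\<lambda>u. poly q ((cos (u/2))^2)"
 define m where "m = cos (pi/4) ^ (d0 - 1)"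
 have m: "m > 0" unfolding m_def by (simp add: cos_45)
 have fb: "\<bar>?f v\<bar> \<le> 1" for v by (rule qb) (simp add: abs_square_le_1)
 have df: "(flux q has_real_derivative - lam * (wt u * ?f u)) (at u)" for u using flux_deriv[of q u] by (simp add: eig mult_ac)
 have b: "\<bar>sin (v/2) * cos (v/2) * poly (pderiv q) ((cos (v/2))^2)\<bar> \<le> lam * v / m" if v: "0 < v" "v \<le> pi/2" for v
 proof -
  have p: "sin (v/2) > 0" "cos (v/2) > 0" using sin_cos_half_pos[of v] v by auto
  obtain \<xi> where \<xi>: "0 < \<xi>" "\<xi> < v" "flux q v - flux q 0 = (v - 0) * (- lam * (wt \<xi> * ?f \<xi>))"
   using MVT2[OF v(1), of "flux q", OF df] by blast
  have px: "sin (\<xi>/2) > 0" "cos (\<xi>/2) > 0" using sin_cos_half_pos[of \<xi>] v \<xi> by auto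
  have "sin (\<xi>/2) \<le> sin (v/2)" using v \<xi> by (intro sin_monotone_2pi_le) auto
  then have "wt \<xi> \<le> sin (v/2) ^ (d - 1) * 1" unfolding wt_def using px by (intro mult_mono power_mono power_le_one) auto
  then have "\<bar>wt \<xi> * ?f \<xi>\<bar> \<le> sin (v/2) ^ (d - 1) * 1"
   unfolding abs_mult using wt_nonneg[of \<xi>] \<xi> v fb[of \<xi>] p by (intro mult_mono) auto
  then have "lam * v * \<bar>wt \<xi> * ?f \<xi>\<bar> \<le> lam * v * sin (v/2) ^ (d - 1)" using lam v by (intro mult_left_mono) auto
  then have 1: "\<bar>flux q v\<bar> \<le> lam * v * sin (v/2) ^ (d - 1)" using \<xi>(3) lam v by (simp add: abs_mult mult_ac)
  have "cos (pi/4) \<le> cos (v/2)" using v by (intro cos_monotone_0_pi_le) auto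
  then have "m \<le> cos (v/2) ^ (d0 - 1)" unfolding m_def by (intro power_mono) (auto simp: cos_45)
  then have "sin (v/2) ^ (d - 1) * m \<le> wt v" unfolding wt_def using p by (intro mult_left_mono) auto
  then have "\<bar>sin (v/2) * cos (v/2) * poly (pderiv q) ((cos (v/2))^2)\<bar> * (sin (v/2) ^ (d - 1) * m) \<le> \<bar>flux q v\<bar>"
  proof -
   have "\<bar>flux q v\<bar> = \<bar>sin (v/2) * cos (v/2) * poly (pderiv q) ((cos (v/2))^2)\<bar> * wt v"
    unfolding flux_eq_wt abs_mult[of "wt v"] abs_minus_cancel using wt_nonneg[of v] v by simp
   with mult_left_mono[OF \<open>sin (v/2) ^ (d - 1) * m \<le> wt v\<close> abs_ge_zero] show ?thesis by metis
  qed
  also note 1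
  finally have "(\<bar>sin (v/2) * cos (v/2) * poly (pderiv q) ((cos (v/2))^2)\<bar> * m) * sin (v/2) ^ (d - 1) \<le> (lam * v) * sin (v/2) ^ (d - 1)"
   by (simp add: mult_ac)
  then have "\<bar>sin (v/2) * cos (v/2) * poly (pderiv q) ((cos (v/2))^2)\<bar> * m \<le> lam * v"
   by (rule mult_right_le_imp_le) (use p in auto)
  then show ?thesis using m by (simp add: field_simps)
 qed
 obtain \<xi> where \<xi>: "0 < \<xi>" "\<xi> < u" "?f u - ?f 0 = (u - 0) * (- (sin (\<xi>/2) * cos (\<xi>/2) * poly (pderiv q) ((cos (\<xi>/2))^2)))"
  using MVT2[OF u(1), of ?f, OF poly_deriv_cos] by blast
 have "\<bar>?f u - 1\<bar> = u * \<bar>sin (\<xi>/2) * cos (\<xi>/2) * poly (pderiv q) ((cos (\<xi>/2))^2)\<bar>"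
  using \<xi>(3) q1 u by (simp add: abs_mult)
 also have "\<dots> \<le> u * (lam * \<xi> / m)" using b[of \<xi>] \<xi> u by (intro mult_left_mono) auto
 also have "\<dots> \<le> u * (lam * u / m)" using \<xi> u lam m by (intro mult_left_mono divide_right_mono) auto
 also have "\<dots> \<le> 1 / 2" using u(3) m unfolding m_def[symmetric] by (simp add: field_simps power2_eq_square)
 finally show ?thesis by linarith
qed

text \<open>The energy is known at \<open>u1 = k / \<omega>\<close>, where \<open>near_pole\<close>
  makes it at least of order \<open>wt u1\<close>, that is \<open>\<omega> powr (1 - d)\<close>.
  From there to \<open>\<alpha>\<close> the potential costs at most a factor
  \<open>exp (- (C / u1) / \<omega>) = exp (- (C / k))\<close>, independent of
  \<open>\<omega>\<close>. On \<open>[\<alpha>, \<beta>]\<close> the potential is bounded, so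
  \<open>phase\<close> applies, and \<open>flux^2\<close> is at least of order
  \<open>\<omega>^2\<close> times the energy wherever the sine is not small.\<close>

lemma flux_lower_bound:
 assumes \<alpha>\<beta>: "0 < \<alpha>" "\<alpha> \<le> \<beta>" "\<beta> < pi" and \<delta>: "0 < \<delta>"
 obtains c \<omega>0 where "c > 0" "\<omega>0 \<ge> 1"
  "\<And>q lam. jac_op q = smult (- lam) q \<Longrightarrow> poly q 1 = 1 \<Longrightarrow> (\<And>t. t \<in> {0..1} \<Longrightarrow> \<bar>poly q t\<bar> \<le> 1) \<Longrightarrow>
    lam > 0 \<Longrightarrow> \<omega>0 \<le> sqrt lam \<Longrightarrow>
    \<exists>\<psi>. \<forall>u\<in>{\<alpha>..\<beta>}. \<delta> \<le> \<bar>sin (sqrt lam * u + \<psi>)\<bar> \<longrightarrow> c * sqrt lam powr (3 - real d) \<le> (flux q u)^2"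
proof -
 obtain C where C: "C > 0" "\<And>u. 0 < u \<Longrightarrow> u \<le> \<beta> \<Longrightarrow> \<bar>logd u\<bar> \<le> C / u" "\<And>u. 0 < u \<Longrightarrow> u \<le> \<beta> \<Longrightarrow> \<bar>pot u\<bar> \<le> C / u^2"
  using logd_bound[OF \<alpha>\<beta>(3)] by metis
 define m0 where "m0 = cos (pi/4) ^ (d0 - 1)"
 have c45: "0 \<le> cos (pi/4)" by (simp add: cos_45)
 have m0: "m0 > 0" unfolding m0_def by (simp add: cos_45)
 have "m0 \<le> 1" unfolding m0_def using c45 by (intro power_le_one) auto
 note m0 = m0 this
 \<comment> \<open>With this k the point \<open>u1 = k / \<omega>\<close> satisfies
   \<open>2 * lam * u1^2 = m0\<close>, the limit of validity of \<open>near_pole\<close>.\<close>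
 define k where "k = sqrt (m0 / 2)"
 have k: "k > 0" "k^2 = m0 / 2" unfolding k_def using m0 by auto
 have k1: "k \<le> 1" using k m0 by (intro power2_le_imp_le[of k 1]) auto
 note k = k k1
 have "\<exists>x\<in>{\<alpha>..\<beta>}. \<forall>y\<in>{\<alpha>..\<beta>}. wt x \<le> wt y"
  using \<alpha>\<beta> by (intro continuous_attains_inf wt_continuous) auto
 then obtain x where x: "x \<in> {\<alpha>..\<beta>}" "\<And>y. y \<in> {\<alpha>..\<beta>} \<Longrightarrow> wt x \<le> wt y" by blast
 define m where "m = wt x"
 have m: "m > 0" "\<And>y. y \<in> {\<alpha>..\<beta>} \<Longrightarrow> m \<le> wt y" unfolding m_def using x \<alpha>\<beta> by (auto intro!: wt_pos)
 define c2 where "c2 = (k / pi) ^ (d - 1) * m0 / 4 * exp (- (C / k))"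
 have c2: "c2 > 0" unfolding c2_def using k m0 by auto
 define c where "c = m * \<delta>^2 / 4 * c2"
 define K where "K = C / \<alpha>^2"
 \<comment> \<open>The summands secure, in turn, \<open>\<omega> \<ge> 1\<close>,
   \<open>u1 \<le> \<alpha>\<close>, growth of the energy by at most a factor 4 on
   \<open>[\<alpha>, \<beta>]\<close>, a phase error of at most \<open>\<delta> / 4\<close>, and a
   \<open>logd\<close> term of at most \<open>\<omega> * \<delta> / 4\<close>, the last two relative
   to the amplitude.\<close>
 define \<omega>0 where "\<omega>0 = 1 + 1 / \<alpha> + C / \<alpha> + 16 * K * (\<beta> - \<alpha>) / \<delta> + 8 * C / (\<alpha> * \<delta>)"
 have K: "K > 0" unfolding K_def using C \<alpha>\<beta> by auto
 have nn: "0 \<le> 1 / \<alpha>" "0 \<le> C / \<alpha>" "0 \<le> 16 * K * (\<beta> - \<alpha>) / \<delta>" "0 \<le> 8 * C / (\<alpha> * \<delta>)"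
  using C \<alpha>\<beta> K \<delta> by auto
 show ?thesis
 proof (rule that[of c \<omega>0])
  show "c > 0" unfolding c_def using m c2 \<delta> by auto
  show "\<omega>0 \<ge> 1" unfolding \<omega>0_def using nn by linarith
  fix q lam assume q: "jac_op q = smult (- lam) q" "poly q 1 = 1" "\<And>t. t \<in> {0..1} \<Longrightarrow> \<bar>poly q t\<bar> \<le> 1"
   and lam: "lam > 0" "\<omega>0 \<le> sqrt lam"
  define \<omega> where "\<omega> = sqrt lam"
  have \<omega>: "\<omega> \<ge> 1" "\<omega> \<ge> 1 / \<alpha>" "\<omega> \<ge> C / \<alpha>" "\<omega> \<ge> 16 * K * (\<beta> - \<alpha>) / \<delta>" "\<omega> \<ge> 8 * C / (\<alpha> * \<delta>)"
   using lam(2) nn unfolding \<omega>_def \<omega>0_def by linarith+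
  define u1 where "u1 = k / \<omega>"
  have u1: "u1 > 0" "u1 \<le> \<alpha>" "u1 \<le> 1"
  proof -
   show "u1 > 0" unfolding u1_def using k \<omega> by auto
   have "k / \<omega> \<le> 1 / (1 / \<alpha>)" using k \<omega> \<alpha>\<beta> by (intro frac_le) auto
   then show "u1 \<le> \<alpha>" unfolding u1_def by simp
   show "u1 \<le> 1" unfolding u1_def using k \<omega> by (simp add: field_simps)
  qed
  have pihalf: "1 \<le> pi / 2" using pi_ge_two by simp
  interpret o1: oscillator "zl q" "zl1 q" pot \<omega> u1 \<beta>
   unfolding \<omega>_def by (rule oscillator_zl[OF q(1) lam(1) u1(1) \<alpha>\<beta>(3)])
  interpret o2: oscillator "zl q" "zl1 q" pot \<omega> \<alpha> \<beta>
   unfolding \<omega>_def by (rule oscillator_zl[OF q(1) lam(1) \<alpha>\<beta>(1) \<alpha>\<beta>(3)])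
  have f1: "poly q ((cos (u1/2))^2) \<ge> 1 / 2"
  proof (rule near_pole[OF q(1) lam(1) q(2) q(3)])
   have "lam = \<omega>^2" unfolding \<omega>_def using lam by simp
   then have "2 * lam * u1^2 = m0" unfolding u1_def using \<omega> k by (simp add: power_divide)
   then show "2 * lam * u1^2 \<le> cos (pi / 4) ^ (d0 - 1)" unfolding m0_def by simp
  qed (use u1 pihalf in auto)
  have w1: "wt u1 \<ge> (k / (pi * \<omega>)) ^ (d - 1) * m0"
  proof -
   have "k / (pi * \<omega>) = 2 / pi * (u1 / 2)" unfolding u1_def by simp
   also have "\<dots> \<le> sin (u1 / 2)" using u1 pihalf by (intro sin_ge_linear) auto
   finally have 1: "k / (pi * \<omega>) \<le> sin (u1 / 2)" .
   have 2: "cos (pi / 4) \<le> cos (u1 / 2)" using u1 pihalf by (intro cos_monotone_0_pi_le) auto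
   have "0 \<le> k / (pi * \<omega>)" using k \<omega> by simp
   with 1 have A: "(k / (pi * \<omega>)) ^ (d - 1) \<le> sin (u1 / 2) ^ (d - 1)" by (rule power_mono)
   have B: "m0 \<le> cos (u1 / 2) ^ (d0 - 1)" unfolding m0_def by (rule power_mono[OF 2 c45])
   show ?thesis unfolding wt_def
    using A B \<open>0 \<le> k / (pi * \<omega>)\<close> m0 by (intro mult_mono) (auto intro: order_trans[OF zero_le_power])
  qed
  have E1: "(k / (pi * \<omega>)) ^ (d - 1) * m0 / 4 \<le> o1.energy u1"
  proof -
   have w0: "0 \<le> wt u1" using u1 pihalf by (intro wt_nonneg) auto
   have "(1/2)^2 \<le> (poly q ((cos (u1/2))^2))^2" using f1 by (rule power_mono) simp
   then have "wt u1 * (1/2)^2 \<le> wt u1 * (poly q ((cos (u1/2))^2))^2" using w0 by (rule mult_left_mono)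
   also have "\<dots> = (zl q u1)^2" unfolding zl_def using w0 by (simp add: power_mult_distrib)
   also have "\<dots> \<le> o1.energy u1" unfolding o1.energy_def by simp
   finally have "wt u1 * (1/2)^2 \<le> o1.energy u1" .
   moreover have "wt u1 * (1/2)^2 = wt u1 / 4" by (simp add: power2_eq_square)
   ultimately show ?thesis using w1 by linarith
  qed
  have dG: "((\<lambda>u. - (C / u)) has_real_derivative C / u^2) (at u)" if "0 < u" for u
   using that by (auto intro!: derivative_eq_intros simp: power2_eq_square)
  have E2: "c2 * \<omega> powr (1 - real d) \<le> o2.energy \<alpha>"
  proof -
   have "o1.energy u1 * exp (- (- (C / \<alpha>) - - (C / u1)) / \<omega>) \<le> o1.energy \<alpha>"
    by (rule o1.energy_growth(1)[where G'="\<lambda>u. C / u^2"]) (use u1 \<alpha>\<beta> C dG in auto)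
   moreover have "exp (- (C / k)) \<le> exp (- (- (C / \<alpha>) - - (C / u1)) / \<omega>)"
   proof -
    have "(C / u1) / \<omega> = C / k" unfolding u1_def using \<omega> k by simp
    then have "- (C / k) \<le> - (- (C / \<alpha>) - - (C / u1)) / \<omega>" using \<omega> \<alpha>\<beta> C by (simp add: diff_divide_distrib)
    then show ?thesis by simp
   qed
   moreover have "(k / (pi * \<omega>)) ^ (d - 1) * m0 / 4 * exp (- (C / k)) = c2 * \<omega> powr (1 - real d)"
   proof -
    have "(k / (pi * \<omega>)) ^ (d - 1) = (k / pi) ^ (d - 1) * inverse (\<omega> ^ (d - 1))"
     by (simp add: power_divide power_mult_distrib field_simps)
    also have "inverse (\<omega> ^ (d - 1)) = \<omega> powr (1 - real d)"
    proof -
     have e: "1 - real d = - real (d - 1)" using d_pos by (simp add: of_nat_diff)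
     have "\<omega> > 0" using \<omega> by linarith
     then show ?thesis unfolding e powr_minus by (simp only: powr_realpow)
    qed
    finally show ?thesis unfolding c2_def by simp
   qed
   moreover have "(k / (pi * \<omega>)) ^ (d - 1) * m0 / 4 * exp (- (C / k)) \<le> o1.energy u1 * exp (- (- (C / \<alpha>) - - (C / u1)) / \<omega>)"
    using E1 calculation(2) by (intro mult_mono o1.energy_nonneg) auto
   ultimately show ?thesis unfolding o1.energy_def o2.energy_def by linarith
  qed
  have E3: "o2.energy v \<le> 4 * o2.energy \<alpha>" if v: "v \<in> {\<alpha>..\<beta>}" for v
  proof -
   have "o2.energy v \<le> o2.energy \<alpha> * exp ((- (C / v) - - (C / \<alpha>)) / \<omega>)"
    by (rule o2.energy_growth(2)[where G'="\<lambda>u. C / u^2"]) (use v \<alpha>\<beta> C dG in auto)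
   also have "\<dots> \<le> o2.energy \<alpha> * exp 1"
   proof (intro mult_left_mono o2.energy_nonneg)
    have "(- (C / v) - - (C / \<alpha>)) / \<omega> \<le> (C / \<alpha>) / \<omega>" using v \<alpha>\<beta> C \<omega> by (intro divide_right_mono) auto
    also have "\<dots> \<le> 1" using \<omega>(1,3) by (subst divide_le_eq_1_pos) auto
    finally show "exp ((- (C / v) - - (C / \<alpha>)) / \<omega>) \<le> exp 1" by simp
   qed
   also have "\<dots> \<le> o2.energy \<alpha> * 4" using exp_le by (intro mult_left_mono o2.energy_nonneg) simp
   finally show ?thesis by simp
  qed
  have Kb: "\<bar>pot u\<bar> \<le> K" if "u \<in> {\<alpha>..\<beta>}" for u
  proof -
   have "\<bar>pot u\<bar> \<le> C / u^2" using that \<alpha>\<beta> by (intro C) auto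
   also have "\<dots> \<le> K" unfolding K_def using that \<alpha>\<beta> C by (intro divide_left_mono power_mono) auto
   finally show ?thesis .
  qed
  obtain \<psi> where \<psi>: "\<And>u. u \<in> {\<alpha>..\<beta>} \<Longrightarrow>
    \<bar>zl1 q u / \<omega> - sqrt (o2.energy \<alpha>) * sin (\<omega> * u + \<psi>)\<bar> \<le> 4 * K * (\<beta> - \<alpha>) / \<omega> * sqrt (o2.energy \<alpha>)"
   using o2.phase[OF \<alpha>\<beta>(2) Kb E3] by metis
  show "\<exists>\<psi>. \<forall>u\<in>{\<alpha>..\<beta>}. \<delta> \<le> \<bar>sin (sqrt lam * u + \<psi>)\<bar> \<longrightarrow> c * sqrt lam powr (3 - real d) \<le> (flux q u)^2"
  proof (intro exI[of _ \<psi>] ballI impI)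
   fix u assume u: "u \<in> {\<alpha>..\<beta>}" and s: "\<delta> \<le> \<bar>sin (sqrt lam * u + \<psi>)\<bar>"
   let ?e = "sqrt (o2.energy \<alpha>)"
   have e: "?e \<ge> 0" by (simp add: o2.energy_nonneg)
   \<comment> \<open>Of the share \<open>\<delta>\<close> of the amplitude, a quarter is lost here
     to the phase error and a quarter below to the \<open>logd\<close> term; half of it
     survives.\<close>
   have "4 * K * (\<beta> - \<alpha>) / \<omega> \<le> \<delta> / 4" using \<omega>(1,4) \<delta> by (simp add: field_simps)
   then have "4 * K * (\<beta> - \<alpha>) / \<omega> * ?e \<le> \<delta> / 4 * ?e" using e by (rule mult_right_mono)
   moreover have "\<delta> * ?e \<le> \<bar>?e * sin (\<omega> * u + \<psi>)\<bar>"
    using mult_right_mono[OF s e] e unfolding \<omega>_def by (simp add: abs_mult mult.commute)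
   ultimately have "3 / 4 * \<delta> * ?e \<le> \<bar>zl1 q u / \<omega>\<bar>" using \<psi>[OF u] by linarith
   then have 1: "\<omega> * (3 / 4 * \<delta> * ?e) \<le> \<bar>zl1 q u\<bar>" using \<omega>(1) by (simp add: field_simps)
   have "\<bar>logd u * zl q u\<bar> \<le> (C / \<alpha>) * (2 * ?e)" unfolding abs_mult
   proof (rule mult_mono)
    have "\<bar>logd u\<bar> \<le> C / u" using u \<alpha>\<beta> by (intro C) auto
    also have "\<dots> \<le> C / \<alpha>" using u \<alpha>\<beta> C by (intro divide_left_mono) auto
    finally show "\<bar>logd u\<bar> \<le> C / \<alpha>" .
    have "\<bar>zl q u\<bar> \<le> sqrt (o2.energy u)" unfolding o2.energy_def by (rule real_le_rsqrt) simp
    also have "\<dots> \<le> sqrt (4 * o2.energy \<alpha>)" using E3[OF u] by simp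
    finally show "\<bar>zl q u\<bar> \<le> 2 * ?e" by (simp add: real_sqrt_mult)
   qed (use C \<alpha>\<beta> in auto)
   also have "\<dots> \<le> \<omega> * \<delta> / 4 * ?e"
   proof -
    have "2 * (C / \<alpha>) \<le> \<omega> * \<delta> / 4" using \<omega>(5) \<alpha>\<beta> \<delta> by (simp add: field_simps)
    from mult_right_mono[OF this e] show ?thesis by simp
   qed
   finally have "\<bar>logd u * zl q u\<bar> \<le> \<omega> * \<delta> / 4 * ?e" .
   moreover have "\<omega> * (\<delta> / 2 * ?e) = \<omega> * (3 / 4 * \<delta> * ?e) - \<omega> * \<delta> / 4 * ?e" by (simp add: algebra_simps)
   ultimately have 2: "\<omega> * (\<delta> / 2 * ?e) \<le> \<bar>zl1 q u - logd u * zl q u\<bar>"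
    using 1 abs_triangle_ineq2[of "zl1 q u" "logd u * zl q u"] by linarith
   have "0 \<le> \<omega> * (\<delta> / 2 * ?e)" using \<omega>(1) \<delta> e by (intro mult_nonneg_nonneg) auto
   from power_mono[OF 2 this, of 2] have "(\<omega> * (\<delta> / 2 * ?e))^2 \<le> (zl1 q u - logd u * zl q u)^2" by simp
   then have "\<omega>^2 * (\<delta>^2 / 4 * o2.energy \<alpha>) \<le> (zl1 q u - logd u * zl q u)^2"
    by (simp add: power_mult_distrib power_divide o2.energy_nonneg)
   moreover have "\<omega>^2 * (\<delta>^2 / 4 * (c2 * \<omega> powr (1 - real d))) \<le> \<omega>^2 * (\<delta>^2 / 4 * o2.energy \<alpha>)"
    using E2 by (intro mult_left_mono) auto
   ultimately have "\<omega>^2 * (\<delta>^2 / 4 * (c2 * \<omega> powr (1 - real d))) \<le> (zl1 q u - logd u * zl q u)^2" by linarith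
   then have "m * (\<omega>^2 * (\<delta>^2 / 4 * (c2 * \<omega> powr (1 - real d)))) \<le> wt u * (zl1 q u - logd u * zl q u)^2"
    using m u c2 by (intro mult_mono) (auto intro: order_trans[OF less_imp_le])
   also have "wt u * (zl1 q u - logd u * zl q u)^2 = (flux q u)^2"
   proof -
    have "wt u > 0" using u \<alpha>\<beta> by (intro wt_pos) auto
    then show ?thesis unfolding zl1_def by (simp add: power_divide)
   qed
   also have "m * (\<omega>^2 * (\<delta>^2 / 4 * (c2 * \<omega> powr (1 - real d)))) = c * \<omega> powr (3 - real d)"
   proof -
    have "\<omega>^2 * \<omega> powr (1 - real d) = \<omega> powr (3 - real d)" using \<omega>(1) by (simp flip: powr_numeral powr_add)
    then show ?thesis unfolding c_def by (simp add: mult_ac)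
   qed
   finally show "c * sqrt lam powr (3 - real d) \<le> (flux q u)^2" unfolding \<omega>_def .
  qed
 qed
qed

lemma ev_ge: "real l ^ 2 \<le> ev l" and ev_le: "ev l \<le> (real d + real d0) * real l ^ 2"
proof -
 have 1: "(real d + real d0) / 2 \<ge> 1" using d_pos d0_pos by simp
 have "real l * real l \<le> real l * (real l - 1 + (real d + real d0) / 2)" using 1 by (intro mult_left_mono) auto
 then show "real l ^ 2 \<le> ev l" unfolding ev_def by (simp add: power2_eq_square)
 define s where "s = (real d + real d0) / 2"
 have s1: "s \<ge> 1" and dd: "real d + real d0 = 2 * s" using 1 unfolding s_def by auto
 show "ev l \<le> (real d + real d0) * real l ^ 2"
 proof (cases l)
  case (Suc n)
  have "real n * 1 \<le> real n * (2 * s)" using s1 by (intro mult_left_mono) auto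
  then have "real n + s \<le> 2 * s * (real n + 1)" using s1 by (simp add: algebra_simps)
  then have "real l * (real n + s) \<le> real l * (2 * s * (real n + 1))" by (intro mult_left_mono) auto
  then show ?thesis unfolding ev_def dd Suc by (simp add: power2_eq_square mult_ac add_ac)
 qed simp
qed

text \<open>The square of \<open>flux\<close> contains \<open>wt\<close> twice: one factor makes
  \<open>\<eta>\<close> integrable, and the rest is continuous.\<close>

lemma flux_square_integrable:
 assumes "\<eta> \<in> weight_class d d0" shows "set_integrable lebesgue {0..pi} (\<lambda>r. (flux q r)^2 * \<eta> r)"
proof -
 let ?g = "\<lambda>r. wt r * (sin (r/2) * cos (r/2) * poly (pderiv q) ((cos (r/2))^2))^2"
 have c: "continuous_on {0..pi} ?g" by (intro continuous_intros) auto
 have eq: "(flux q r)^2 * \<eta> r = ?g r * (wt r * \<eta> r)" for r unfolding flux_eq_wt by (simp add: power2_eq_square mult_ac)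
 show ?thesis unfolding eq
 proof (rule absolutely_integrable_bounded_measurable_product_real)
  show "?g \<in> borel_measurable (lebesgue_on {0..pi})" using c by (rule continuous_imp_measurable_on_sets_lebesgue) simp
  show "bounded (?g ` {0..pi})" using c by (intro compact_imp_bounded compact_continuous_image) auto
  show "set_integrable lebesgue {0..pi} (\<lambda>r. wt r * \<eta> r)" using assms by (simp add: weight_class_def wt_def)
 qed simp
qed

lemma flux_nonzero:
 assumes "q \<noteq> 0" "degree q \<noteq> 0" shows "finite {r \<in> {0<..<pi}. flux q r = 0}"
proof -
 have "pderiv q \<noteq> 0" using assms by (simp add: pderiv_eq_0_iff)
 then have "finite {t. poly (pderiv q) t = 0}" by (rule poly_roots_finite)
 then have "finite ((\<lambda>t. 2 * arccos (sqrt t)) ` {t. poly (pderiv q) t = 0})" by simp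
 moreover have "{r \<in> {0<..<pi}. flux q r = 0} \<subseteq> (\<lambda>t. 2 * arccos (sqrt t)) ` {t. poly (pderiv q) t = 0}"
 proof
  fix r assume "r \<in> {r \<in> {0<..<pi}. flux q r = 0}"
  then have r: "r \<in> {0<..<pi}" "flux q r = 0" by auto
  have p: "sin (r/2) > 0" "cos (r/2) > 0" using sin_cos_half_pos[OF r(1)] by auto
  have "poly (pderiv q) ((cos (r/2))^2) = 0" using r(2) p unfolding flux_def by auto
  moreover have "2 * arccos (sqrt ((cos (r/2))^2)) = r" using r p by (simp add: arccos_cos)
  ultimately show "r \<in> (\<lambda>t. 2 * arccos (sqrt t)) ` {t. poly (pderiv q) t = 0}" by (intro rev_image_eqI[of "(cos (r/2))^2"]) auto
 qed
 ultimately show ?thesis by (rule finite_subset[rotated])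
qed

text \<open>For large l, \<open>flux_lower_bound\<close> is used on a set where
  \<open>\<eta>\<close> is bounded below, minus the places where the sine is small, which take at
  most half of its measure. For the finitely many remaining l the integral is merely positive,
  because \<open>flux\<close> has finitely many zeros; a minimum of finitely many quotients joins
  the two cases.\<close>

theorem flux_weighted_lower_bound:
 assumes \<eta>: "\<eta> \<in> weight_class d d0" and nz: "\<not> (AE r in lebesgue_on {0..pi}. \<eta> r = 0)"
  and q: "\<And>l. l \<ge> 1 \<Longrightarrow> jac_op (q l) = smult (- ev l) (q l)" "\<And>l. poly (q l) 1 = 1"
   "\<And>l t. t \<in> {0..1} \<Longrightarrow> \<bar>poly (q l) t\<bar> \<le> 1" "\<And>l. l \<ge> 1 \<Longrightarrow> degree (q l) \<noteq> 0"
 shows "\<exists>c>0. \<forall>l\<ge>1. c * sqrt (ev l) powr (3 - real d) \<le> (LINT r:{0..pi}|lebesgue. (flux (q l) r)^2 * \<eta> r)"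
proof -
 have nn: "\<And>r. r \<in> {0..pi} \<Longrightarrow> 0 \<le> \<eta> r" and meas: "\<eta> \<in> borel_measurable (lebesgue_on {0..pi})"
  using \<eta> by (auto simp: weight_class_def)
 obtain \<alpha> \<beta> \<epsilon> S where S: "0 < \<alpha>" "\<alpha> \<le> \<beta>" "\<beta> < pi" "0 < \<epsilon>" "S \<in> sets lebesgue" "S \<subseteq> {\<alpha>..\<beta>}"
  "measure lebesgue S > 0" "\<And>r. r \<in> S \<Longrightarrow> \<epsilon> \<le> \<eta> r"
  using nonzero_weight_bounded_below[OF meas nn nz] by metis
 have S_fin: "S \<in> lmeasurable" using S by (intro bounded_set_imp_lmeasurable) (auto intro: bounded_subset[OF bounded_closed_interval])
 \<comment> \<open>With this value \<open>measure_sin_small\<close> bounds the exceptional set by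
   half the measure of S, whatever the frequency and the phase.\<close>
 define \<delta> where "\<delta> = measure lebesgue S / (2 * (\<beta> - \<alpha> + 4 * pi))"
 have den: "\<beta> - \<alpha> + 4 * pi > 0" using S pi_gt_zero by linarith
 have \<delta>: "\<delta> > 0" unfolding \<delta>_def using S den by auto
 obtain c \<omega>0 where c: "c > 0" "\<omega>0 \<ge> 1" and low:
  "\<And>q lam. jac_op q = smult (- lam) q \<Longrightarrow> poly q 1 = 1 \<Longrightarrow> (\<And>t. t \<in> {0..1} \<Longrightarrow> \<bar>poly q t\<bar> \<le> 1) \<Longrightarrow>
    lam > 0 \<Longrightarrow> \<omega>0 \<le> sqrt lam \<Longrightarrow>
    \<exists>\<psi>. \<forall>u\<in>{\<alpha>..\<beta>}. \<delta> \<le> \<bar>sin (sqrt lam * u + \<psi>)\<bar> \<longrightarrow> c * sqrt lam powr (3 - real d) \<le> (flux q u)^2"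
  using flux_lower_bound[OF S(1-3) \<delta>] by metis
 define I where "I l = (LINT r:{0..pi}|lebesgue. (flux (q l) r)^2 * \<eta> r)" for l
 have I_ge: "measure lebesgue T * (b * \<epsilon>) \<le> I l"
  if T: "T \<in> sets lebesgue" "T \<subseteq> S" "\<And>r. r \<in> T \<Longrightarrow> b \<le> (flux (q l) r)^2" and b: "b \<ge> 0" for T b l
 proof -
  have "T \<in> lmeasurable" using T S_fin by (meson fmeasurableI2)
  then have i: "integrable lebesgue (\<lambda>r. indicator T r * (b * \<epsilon>))" by (intro integrable_mult_left integrable_real_indicator) (auto simp: fmeasurable_def)
  have "measure lebesgue T * (b * \<epsilon>) = (\<integral>r. indicator T r * (b * \<epsilon>) \<partial>lebesgue)"
   by (simp only: integral_mult_left_zero integral_indicator) simp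
  also have "\<dots> \<le> I l" unfolding I_def set_lebesgue_integral_def
  proof (rule integral_mono[OF i flux_square_integrable[OF \<eta>, unfolded set_integrable_def]])
   fix r
   show "indicator T r * (b * \<epsilon>) \<le> indicat_real {0..pi} r *\<^sub>R ((flux (q l) r)^2 * \<eta> r)"
   proof (cases "r \<in> T")
    case True
    then have "r \<in> {0..pi}" using T S by force
    moreover have "b * \<epsilon> \<le> (flux (q l) r)^2 * \<eta> r" using True T S b by (intro mult_mono) auto
    ultimately show ?thesis using True by simp
   next
    case False
    then show ?thesis using nn by (simp add: indicator_def)
   qed
  qed
  finally show ?thesis .
 qed
 have big: "measure lebesgue S / 2 * (c * sqrt (ev l) powr (3 - real d) * \<epsilon>) \<le> I l" if l: "l \<ge> 1" "\<omega>0 \<le> sqrt (ev l)" for l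
 proof -
  obtain \<psi> where \<psi>: "\<And>u. u \<in> {\<alpha>..\<beta>} \<Longrightarrow> \<delta> \<le> \<bar>sin (sqrt (ev l) * u + \<psi>)\<bar> \<Longrightarrow> c * sqrt (ev l) powr (3 - real d) \<le> (flux (q l) u)^2"
   using low[OF q(1)[OF l(1)] q(2) q(3) ev_pos[OF l(1)] l(2)] by blast
  define B where "B = {u \<in> {\<alpha>..\<beta>}. \<bar>sin (sqrt (ev l) * u + \<psi>)\<bar> < \<delta>}"
  have Bs: "B \<in> sets lebesgue"
  proof -
   have "B = {u \<in> space lborel. \<alpha> \<le> u \<and> u \<le> \<beta> \<and> \<bar>sin (sqrt (ev l) * u + \<psi>)\<bar> < \<delta>}" unfolding B_def by auto
   also have "\<dots> \<in> sets lborel" by measurable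
   finally show ?thesis by (rule sets_completionI_sets)
  qed
  have Bf: "B \<in> lmeasurable"
   using Bs by (intro bounded_set_imp_lmeasurable) (auto intro: bounded_subset[OF bounded_closed_interval[of \<alpha> \<beta>]] simp: B_def)
  have "1 \<le> sqrt (ev l)" using l c by linarith
  from measure_sin_small[OF this \<delta> S(2)] have "measure lebesgue B \<le> \<delta> * (\<beta> - \<alpha> + 4 * pi)" unfolding B_def .
  also have "\<dots> = measure lebesgue S / 2"
  proof -
   have "M / (2 * D) * D = M / 2" if "D > 0" for M D :: real using that by simp
   from this[OF den] show ?thesis unfolding \<delta>_def .
  qed
  finally have 1: "measure lebesgue B \<le> measure lebesgue S / 2" .
  have "measure lebesgue S \<le> measure lebesgue ((S - B) \<union> B)"
   by (rule measure_mono_fmeasurable[OF _ S(5) fmeasurable.Un[OF fmeasurable_Diff[OF S_fin Bs] Bf]]) blast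
  also have "\<dots> \<le> measure lebesgue (S - B) + measure lebesgue B" by (intro measure_Un_le sets.Diff S Bs)
  finally have "measure lebesgue S / 2 \<le> measure lebesgue (S - B)" using 1 by linarith
  then have "measure lebesgue S / 2 * (c * sqrt (ev l) powr (3 - real d) * \<epsilon>) \<le> measure lebesgue (S - B) * (c * sqrt (ev l) powr (3 - real d) * \<epsilon>)"
   using c S by (intro mult_right_mono) auto
  also have "\<dots> \<le> I l"
  proof (rule I_ge)
   fix r assume "r \<in> S - B"
   then show "c * sqrt (ev l) powr (3 - real d) \<le> (flux (q l) r)^2" using S(6) unfolding B_def by (intro \<psi>) auto
  qed (use S Bs c in auto)
  finally show ?thesis .
 qed
 have small: "I l > 0" if l: "l \<ge> 1" for l
 proof (rule ccontr)
  assume "\<not> I l > 0"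
  moreover have "I l \<ge> 0" using I_ge[of "{}" 0 l] by simp
  ultimately have "I l = 0" by simp
  then have "AE r in lebesgue. indicat_real {0..pi} r *\<^sub>R ((flux (q l) r)^2 * \<eta> r) = 0"
   unfolding I_def set_lebesgue_integral_def using flux_square_integrable[OF \<eta>, unfolded set_integrable_def]
   by (subst (asm) integral_nonneg_eq_0_iff_AE) (auto simp: indicator_def nn)
  moreover have "finite {r \<in> {0<..<pi}. flux (q l) r = 0}" using q(4)[OF l] by (intro flux_nonzero) auto
  then have "{r \<in> {0<..<pi}. flux (q l) r = 0} \<in> null_sets lebesgue" by (simp add: finite_imp_null_set_lborel null_sets_completionI)
  then have "AE r in lebesgue. r \<notin> {r \<in> {0<..<pi}. flux (q l) r = 0}" by (rule AE_not_in)
  ultimately have "AE r in lebesgue. r \<notin> S"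
  proof eventually_elim
   case (elim r)
   show ?case
   proof
    assume r: "r \<in> S"
    have "r \<in> {\<alpha>..\<beta>}" using r S(6) by blast
    then have "r \<in> {0<..<pi}" using S(1,3) by auto
    moreover have "\<eta> r > 0" using S(8)[OF r] S(4) by linarith
    ultimately show False using elim by auto
   qed
  qed
  then have "S \<in> null_sets lebesgue" using AE_iff_null_sets[OF S(5)] by blast
  then show False using S(7) measure_eq_0_null_sets[of S lebesgue] by linarith
 qed
 define L0 where "L0 = nat \<lceil>\<omega>0\<rceil>"
 define X where "X l = sqrt (ev l) powr (3 - real d)" for l
 have Xpos: "X l > 0" if "l \<ge> 1" for l unfolding X_def using ev_pos[OF that] by simp
 define c3 where "c3 = Min (insert (measure lebesgue S / 2 * (c * \<epsilon>)) ((\<lambda>l. I l / X l) ` {1..L0}))"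
 have c3: "c3 > 0" unfolding c3_def using S c small Xpos by (subst Min_gr_iff) (auto intro!: divide_pos_pos)
 have "c3 * X l \<le> I l" if l: "l \<ge> 1" for l
 proof (cases "l \<le> L0")
  case True
  then have "c3 \<le> I l / X l" unfolding c3_def using l by (intro Min_le) auto
  then show ?thesis using Xpos[OF l] by (simp add: field_simps)
 next
  case False
  then have "\<omega>0 \<le> real l" unfolding L0_def by linarith
  also have "\<dots> \<le> sqrt (ev l)" using ev_ge[of l] by (intro real_le_rsqrt)
  finally have "measure lebesgue S / 2 * (c * X l * \<epsilon>) \<le> I l" unfolding X_def by (intro big l)
  moreover have "c3 \<le> measure lebesgue S / 2 * (c * \<epsilon>)" unfolding c3_def by (intro Min_le) auto
  then have "c3 * X l \<le> measure lebesgue S / 2 * (c * \<epsilon>) * X l" using Xpos[OF l] by (intro mult_right_mono) auto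
  ultimately show ?thesis by (simp add: mult_ac)
 qed
 with c3 show ?thesis unfolding X_def I_def by blast
qed

end

section \<open>Nonnegative bump polynomials\<close>

text \<open>The Dirichlet kernel \<open>sin ((2 * n + 1) * x) / sin x\<close> as a polynomial in
  \<open>(cos x)^2\<close>; the recursion is the addition formula for
  \<open>sin (y + 2 * x) + sin (y - 2 * x)\<close>.\<close>

fun dirichlet_poly :: "nat \<Rightarrow> real poly" where
 "dirichlet_poly 0 = 1"
| "dirichlet_poly (Suc 0) = [:-1, 4:]"
| "dirichlet_poly (Suc (Suc n)) = [:-2, 4:] * dirichlet_poly (Suc n) - dirichlet_poly n"

lemma degree_dirichlet_poly: "degree (dirichlet_poly n) \<le> n"
proof (induction n rule: dirichlet_poly.induct)
 case (3 n)
 have "degree ([:-2, 4:] * dirichlet_poly (Suc n)) \<le> 1 + Suc n" using 3 by (intro degree_mult_le[THEN order_trans] add_mono) auto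
 with 3 show ?case by (auto intro!: degree_diff_le)
qed auto

lemma dirichlet_poly_1: "poly (dirichlet_poly n) 1 = 2 * real n + 1" by (induction n rule: dirichlet_poly.induct) (auto simp: algebra_simps)

lemma dirichlet_poly_sin:
 "poly (dirichlet_poly n) ((cos x)^2) * sin x = sin (real (2 * n + 1) * x)" for x :: real
proof (induction n rule: dirichlet_poly.induct)
 case 2
 have "sin (3 * x) = sin (2 * x + x)" by simp
 also have "\<dots> = (4 * (cos x)^2 - 1) * sin x" unfolding sin_add sin_double cos_double_cos by (simp add: power2_eq_square algebra_simps)
 finally show ?case by simp
next
 case (3 n)
 define y where "y = real (2 * Suc n + 1) * x"
 have "sin (real (2 * Suc (Suc n) + 1) * x) = sin (y + 2 * x)" "sin (real (2 * n + 1) * x) = sin (y - 2 * x)"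
  unfolding y_def by (simp_all add: algebra_simps)
 moreover have "sin (y + 2 * x) = (4 * (cos x)^2 - 2) * sin y - sin (y - 2 * x)"
  unfolding sin_add sin_diff cos_double_cos by (simp add: algebra_simps)
 moreover have "poly (dirichlet_poly (Suc (Suc n))) ((cos x)^2) * sin x =
   (4 * (cos x)^2 - 2) * (poly (dirichlet_poly (Suc n)) ((cos x)^2) * sin x) - poly (dirichlet_poly n) ((cos x)^2) * sin x"
  by (simp add: algebra_simps)
 ultimately show ?case using 3 unfolding y_def by (simp only:)
qed auto

lemma abs_sin_multiple_le: "\<bar>sin (real k * x)\<bar> \<le> real k * \<bar>sin x\<bar>"
proof (induction k)
 case (Suc k)
 have "\<bar>sin (real (Suc k) * x)\<bar> = \<bar>sin x * cos (real k * x) + cos x * sin (real k * x)\<bar>" by (simp add: algebra_simps sin_add)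
 also have "\<dots> \<le> \<bar>sin x\<bar> * \<bar>cos (real k * x)\<bar> + \<bar>cos x\<bar> * \<bar>sin (real k * x)\<bar>"
  by (metis abs_mult abs_triangle_ineq)
 also have "\<dots> \<le> \<bar>sin x\<bar> * 1 + 1 * \<bar>sin (real k * x)\<bar>" by (intro add_mono mult_mono) auto
 also have "\<dots> \<le> real (Suc k) * \<bar>sin x\<bar>" using Suc by (simp add: algebra_simps)
 finally show ?case .
qed simp

text \<open>Two bounds merged into one: \<open>3 * n\<close> everywhere and \<open>pi / u\<close>
  away from 0. The constant 20 exceeds \<open>9 + pi^2\<close>.\<close>

lemma dirichlet_poly_bound:
 assumes u: "0 < u" "u \<le> pi" and n: "n \<ge> 1"
 shows "(poly (dirichlet_poly n) ((cos (u/2))^2))^2 \<le> real n ^ 2 * (20 / (1 + (real n * u)^2))"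
proof -
 let ?D = "\<bar>poly (dirichlet_poly n) ((cos (u/2))^2)\<bar>"
 have s: "sin (u/2) > 0" "sin (u/2) \<ge> u / pi" using sin_ge_linear[of "u/2"] u by (auto intro: sin_gt_zero)
 have D: "?D * sin (u/2) = \<bar>sin (real (2 * n + 1) * (u/2))\<bar>" using dirichlet_poly_sin[of n "u/2"] s by (metis abs_mult abs_of_pos)
 have "?D * sin (u/2) \<le> real (2 * n + 1) * sin (u/2)" unfolding D using abs_sin_multiple_le[of "2 * n + 1" "u/2"] s by simp
 then have D1: "?D \<le> 3 * real n" using s n by simp
 have "?D * (u / pi) \<le> ?D * sin (u/2)" using s by (intro mult_left_mono) auto
 also have "\<dots> \<le> 1" unfolding D by simp
 finally have D2: "?D * u \<le> pi" by (simp add: field_simps)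
 have pi2: "pi^2 \<le> 10"
 proof -
  have "pi \<le> 3.15" using pi_approx by simp
  then have "pi^2 \<le> 3.15^2" by (intro power_mono) auto
  then show ?thesis by (simp add: power2_eq_square)
 qed
 have pos: "1 + (real n * u)^2 > 0" by (simp add: add_pos_nonneg)
 have "?D^2 * (1 + (real n * u)^2) = ?D^2 + real n ^ 2 * (?D * u)^2" by (simp add: algebra_simps power_mult_distrib)
 also have "\<dots> \<le> (3 * real n)^2 + real n ^ 2 * pi^2" using D1 D2 u by (intro add_mono mult_left_mono power_mono) auto
 also have "\<dots> \<le> (3 * real n)^2 + real n ^ 2 * 10" using pi2 by (intro add_left_mono mult_left_mono) auto
 also have "\<dots> \<le> real n ^ 2 * 20" by (simp add: power_mult_distrib)
 finally have "?D^2 \<le> real n ^ 2 * 20 / (1 + (real n * u)^2)" using pos by (simp add: pos_le_divide_eq)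
 then show ?thesis by simp
qed

context jacobi_weight begin

text \<open>A power of the Dirichlet kernel. The exponent \<open>2 * d\<close> makes it nonnegative
  and lets it decay, relative to its maximum, like \<open>1 / (n * u) ^ (2 * d)\<close>; against a
  density of order \<open>u ^ (d - 1)\<close> this still leaves the integrable factor
  \<open>1 / (1 + (n * u)^2)\<close>. So the mean is at most of order \<open>n ^ d\<close>, while
  the value at 1 is at least \<open>n ^ (2 * d)\<close>.\<close>

lemma bump_polynomial:
 obtains c where "c > 0"
  "\<And>n. n \<ge> 1 \<Longrightarrow> \<exists>G. degree G \<le> 2 * d * n \<and> (\<forall>t. 0 \<le> poly G t) \<and> E G > 0 \<and> c * real n ^ d * E G \<le> poly G 1"
proof
 define c where "c = mass / (20 ^ d * 2)"
 show "c > 0" unfolding c_def using mass_pos by simp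
 fix n :: nat assume n: "n \<ge> 1"
 let ?N = "real n"
 define G where "G = dirichlet_poly n ^ (2 * d)"
 have G_nn: "0 \<le> poly G t" for t unfolding G_def by (simp add: power_mult poly_power)
 have G1: "poly G 1 \<ge> ?N ^ (2 * d)" unfolding G_def poly_power dirichlet_poly_1 by (intro power_mono) auto
 have "G \<noteq> 0" using G1 n by (metis not_less one_le_power of_nat_1 of_nat_le_iff order_trans poly_0 zero_less_one)
 then have "E G \<noteq> 0" using E_eq_0D[of G] G_nn by blast
 then have EG: "E G > 0" using E_nonneg[of G] G_nn by (simp add: less_le)
 let ?h = "\<lambda>u::real. 20 ^ d * ?N ^ (d + 1) / (1 + (?N * u)^2)"
 let ?f = "\<lambda>u. wt u * poly G ((cos (u/2))^2)"
 have bound: "?f u \<le> ?h u" if u: "0 < u" "u \<le> pi" for u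
 proof -
  define X where "X = ?N * u"
  have X: "X \<ge> 0" unfolding X_def using u by simp
  have Xp: "1 + X^2 > 0" by (simp add: add_pos_nonneg)
  have "poly G ((cos (u/2))^2) = ((poly (dirichlet_poly n) ((cos (u/2))^2))^2) ^ d" unfolding G_def by (simp add: poly_power power_mult)
  also have "\<dots> \<le> (?N ^ 2 * (20 / (1 + X^2))) ^ d" unfolding X_def by (intro power_mono dirichlet_poly_bound u n) auto
  finally have 1: "poly G ((cos (u/2))^2) \<le> (?N ^ 2 * (20 / (1 + X^2))) ^ d" .
  have "sin (u/2) \<le> u / 2" using u by (intro sin_x_le_x) auto
  then have "sin (u/2) \<le> u" using u by simp
  moreover have "0 \<le> sin (u/2)" using u by (intro sin_ge_zero) auto
  moreover have "0 \<le> cos (u/2)" using u by (intro cos_ge_zero) auto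
  ultimately have "wt u \<le> u ^ (d - 1) * 1" unfolding wt_def by (intro mult_mono power_mono power_le_one) auto
  then have 2: "wt u \<le> u ^ (d - 1)" by simp
  have "X \<le> 1 + X^2" using sum_squares_bound[of 1 X] X by (simp add: power2_eq_square)
  then have 3: "X ^ (d - 1) \<le> (1 + X^2) ^ (d - 1)" using X by (intro power_mono) auto
  have "?f u \<le> u ^ (d - 1) * (?N ^ 2 * (20 / (1 + X^2))) ^ d" using 1 2 u wt_nonneg[of u] G_nn by (intro mult_mono) auto
  also have "\<dots> = 20 ^ d * ?N ^ (d + 1) * (X ^ (d - 1) / (1 + X^2) ^ d)"
  proof -
   have "2 * d = (d + 1) + (d - 1)" using d_pos by simp
   then have e2: "?N ^ (2 * d) = ?N ^ (d + 1) * ?N ^ (d - 1)" by (metis power_add)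
   have e3: "(?N ^ 2 * (20 / (1 + X^2))) ^ d = 20 ^ d * ?N ^ (2 * d) / (1 + X^2) ^ d"
    by (simp add: power_mult_distrib power_divide power_mult)
   have e4: "X ^ (d - 1) = ?N ^ (d - 1) * u ^ (d - 1)" unfolding X_def by (rule power_mult_distrib)
   show ?thesis unfolding e3 e2 e4 by (simp only: mult_ac times_divide_eq_right times_divide_eq_left)
  qed
  also have "\<dots> \<le> 20 ^ d * ?N ^ (d + 1) * ((1 + X^2) ^ (d - 1) / (1 + X^2) ^ d)"
   using 3 Xp by (intro mult_left_mono divide_right_mono) auto
  also have "(1 + X^2) ^ (d - 1) / (1 + X^2) ^ d = 1 / (1 + X^2)"
  proof -
   have "(1 + X^2) ^ d = (1 + X^2) * (1 + X^2) ^ (d - 1)" using d_pos by (simp add: power_eq_if)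
   then show ?thesis using Xp by simp
  qed
  finally show ?thesis unfolding X_def by simp
 qed
 have pos: "1 + (?N * u)^2 \<noteq> 0" for u by (metis add_pos_nonneg less_irrefl zero_le_power2 zero_less_one)
 have ch: "continuous_on UNIV ?h" using pos by (intro continuous_intros) auto
 have i1: "set_integrable lborel {0..pi} ?f" by (intro borel_integrable_atLeastAtMost' continuous_intros) auto
 have i2: "set_integrable lborel {0..pi} ?h" by (intro borel_integrable_atLeastAtMost' continuous_on_subset[OF ch]) auto
 have "E G * mass = (LBINT u:{0..pi}. ?f u)" unfolding E_def integral_law[OF poly_cos_measurable] using mass_pos by simp
 also have "\<dots> \<le> (LBINT u:{0..pi}. ?h u)" unfolding set_lebesgue_integral_def
 proof (rule integral_mono_AE[OF i1[unfolded set_integrable_def] i2[unfolded set_integrable_def]])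
  have "AE u in lborel. u \<noteq> (0::real)" by (simp add: AE_lborel_singleton)
  then show "AE u in lborel. indicat_real {0..pi} u *\<^sub>R ?f u \<le> indicat_real {0..pi} u *\<^sub>R ?h u"
   by eventually_elim (use bound in \<open>auto simp: indicator_def\<close>)
 qed
 also have "(LBINT u:{0..pi}. ?h u) = 20 ^ d * ?N ^ d * arctan (?N * pi) - 20 ^ d * ?N ^ d * arctan (?N * 0)"
 proof -
  have "(\<integral>u. ?h u * indicator {0..pi} u \<partial>lborel) = 20 ^ d * ?N ^ d * arctan (?N * pi) - 20 ^ d * ?N ^ d * arctan (?N * 0)"
  proof (rule integral_FTC_Icc_real)
   fix u :: real
   show "((\<lambda>u. 20 ^ d * ?N ^ d * arctan (?N * u)) has_real_derivative ?h u) (at u)"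
    by (rule derivative_eq_intros refl | simp)+ (simp add: field_simps)
   show "isCont ?h u" using ch by (simp add: continuous_on_eq_continuous_at)
  qed simp
  then show ?thesis by (simp add: set_lebesgue_integral_def mult.commute)
 qed
 also have "\<dots> \<le> 20 ^ d * ?N ^ d * 2"
 proof -
  have "arctan (?N * pi) \<le> 2" using arctan_ubound[of "?N * pi"] pi_less_4 by linarith
  then have "20 ^ d * ?N ^ d * arctan (?N * pi) \<le> 20 ^ d * ?N ^ d * 2" by (intro mult_left_mono) auto
  then show ?thesis by simp
 qed
 finally have "E G * mass \<le> 20 ^ d * ?N ^ d * 2" .
 then have "c * E G \<le> ?N ^ d" unfolding c_def by (simp add: field_simps)
 then have "c * E G * ?N ^ d \<le> ?N ^ d * ?N ^ d" by (rule mult_right_mono) simp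
 also have "\<dots> = ?N ^ (2 * d)" by (simp add: mult_2 flip: power_add)
 also note G1
 finally have "c * ?N ^ d * E G \<le> poly G 1" by (simp add: mult_ac)
 moreover have "degree G \<le> 2 * d * n"
 proof -
  have "degree G \<le> degree (dirichlet_poly n) * (2 * d)" unfolding G_def by (rule degree_power_le)
  also have "\<dots> \<le> n * (2 * d)" using degree_dirichlet_poly by (rule mult_right_mono) simp
  finally show ?thesis by (simp add: mult_ac)
 qed
 ultimately show "\<exists>G. degree G \<le> 2 * d * n \<and> (\<forall>t. 0 \<le> poly G t) \<and> E G > 0 \<and> c * ?N ^ d * E G \<le> poly G 1"
  using G_nn EG by blast
qed

end

section \<open>Zonal functions\<close>

text \<open>The vectors \<open>emb\<close> carry the chordal metric up to the factor k. That is
  enough to transfer measurability and isometries from a Euclidean space, and it treats spheres (k =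
  1/4) and projective spaces (k = 1/2) alike.\<close>

locale embedded_space =
 fixes Q :: "'a set" and \<theta> :: "'a \<Rightarrow> 'a \<Rightarrow> real" and \<mu> :: "'a measure"
  and emb :: "'a \<Rightarrow> 'v::euclidean_space" and k :: real
 assumes inv: "invariant_measure Q \<theta> \<mu>"
  and theta_range: "\<And>x y. x \<in> Q \<Longrightarrow> y \<in> Q \<Longrightarrow> 0 \<le> \<theta> x y \<and> \<theta> x y \<le> pi"
  and k_pos: "k > 0"
  and emb_dist: "\<And>x y. x \<in> Q \<Longrightarrow> y \<in> Q \<Longrightarrow> (sin (\<theta> x y / 2))^2 = k * (norm (emb x - emb y))^2"
begin

text \<open>Defined through \<open>emb\<close> rather than through the distance, so that symmetry
  holds without membership in Q and joint measurability follows from that of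
  \<open>emb\<close>.\<close>

definition T :: "'a \<Rightarrow> 'a \<Rightarrow> real" where "T x y = 1 - k * (norm (emb x - emb y))^2"

lemma T_eq: "x \<in> Q \<Longrightarrow> y \<in> Q \<Longrightarrow> T x y = (cos (\<theta> x y / 2))^2"
 by (simp add: T_def emb_dist[symmetric] cos_squared_eq)

lemma T_sym: "T x y = T y x" by (simp add: T_def norm_minus_commute)
lemma T_refl [simp]: "T x x = 1" by (simp add: T_def)
lemma T_ge_0: "x \<in> Q \<Longrightarrow> y \<in> Q \<Longrightarrow> 0 \<le> T x y" by (simp add: T_eq)
lemma T_le_1: "T x y \<le> 1" using k_pos by (simp add: T_def)

lemma half_theta_cos_nonneg: "x \<in> Q \<Longrightarrow> y \<in> Q \<Longrightarrow> 0 \<le> cos (\<theta> x y / 2)"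
 using theta_range[of x y] by (intro cos_ge_zero) auto

lemma sqrt_T: "x \<in> Q \<Longrightarrow> y \<in> Q \<Longrightarrow> sqrt (T x y) = cos (\<theta> x y / 2)"
 by (simp add: T_eq half_theta_cos_nonneg)

lemma theta_eq: "x \<in> Q \<Longrightarrow> y \<in> Q \<Longrightarrow> \<theta> x y = 2 * arccos (sqrt (T x y))"
 using theta_range[of x y] by (simp add: sqrt_T arccos_cos)

lemma theta_sym: "x \<in> Q \<Longrightarrow> y \<in> Q \<Longrightarrow> \<theta> x y = \<theta> y x" by (simp add: theta_eq T_sym)

lemma theta_refl: "x \<in> Q \<Longrightarrow> \<theta> x x = 0" by (simp add: theta_eq)

lemma theta_less_iff:
 assumes "x \<in> Q" "y \<in> Q" "0 \<le> r" "r \<le> pi" shows "\<theta> x y < r \<longleftrightarrow> (cos (r/2))^2 < T x y"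
proof -
 have "\<theta> x y < r \<longleftrightarrow> cos (r/2) < cos (\<theta> x y / 2)"
  using theta_range[OF assms(1,2)] assms by (subst cos_mono_less_eq) auto
 also have "\<dots> \<longleftrightarrow> (cos (r/2))^2 < (cos (\<theta> x y / 2))^2"
  using assms half_theta_cos_nonneg[OF assms(1,2)] cos_ge_zero[of "r/2"] by (auto simp: power_strict_mono intro: power2_less_imp_less)
 finally show ?thesis using assms by (simp add: T_eq)
qed

sublocale \<mu>: prob_space \<mu> using inv by (simp add: invariant_measure_def)

lemma space_\<mu> [simp]: "space \<mu> = Q" using inv by (simp add: invariant_measure_def)

definition opens :: "'a set set" where
 "opens = {U. U \<subseteq> Q \<and> (\<forall>x\<in>U. \<exists>r>0. geo_ball Q \<theta> r x \<subseteq> U)}"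

lemma sets_\<mu>: "sets \<mu> = sigma_sets Q opens"
proof -
 have "opens \<subseteq> Pow Q" by (auto simp: opens_def)
 then show ?thesis using inv by (simp add: invariant_measure_def geo_borel_def opens_def)
qed

text \<open>A chord is at most as long as its arc, so the preimage of an open set contains a
  geodesic ball around each of its points.\<close>

lemma emb_measurable [measurable]: "emb \<in> borel_measurable \<mu>"
proof (rule borel_measurableI)
 fix S :: "'v set" assume S: "open S"
 have "emb -` S \<inter> Q \<in> opens" unfolding opens_def
 proof (intro CollectI conjI ballI)
  fix x assume x: "x \<in> emb -` S \<inter> Q"
  then obtain r where r: "r > 0" "ball (emb x) r \<subseteq> S" using S openE by (metis IntD1 vimageD)
  let ?r = "2 * sqrt k * r"
  have "geo_ball Q \<theta> ?r x \<subseteq> emb -` S \<inter> Q"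
  proof
   fix y assume "y \<in> geo_ball Q \<theta> ?r x"
   then have y: "y \<in> Q" "\<theta> y x < ?r" by (auto simp: geo_ball_def)
   have "(sqrt k * norm (emb y - emb x))^2 = (sin (\<theta> y x / 2))^2"
    using emb_dist[of y x] x y k_pos by (simp add: power_mult_distrib)
   then have "sqrt k * norm (emb y - emb x) = \<bar>sin (\<theta> y x / 2)\<bar>"
    using k_pos by (metis abs_ge_zero mult_nonneg_nonneg norm_ge_zero order_less_imp_le power2_abs power2_eq_imp_eq real_sqrt_ge_0_iff)
   also have "\<dots> \<le> \<theta> y x / 2" using theta_range[of y x] x y abs_sin_x_le_abs_x[of "\<theta> y x / 2"] by simp
   also have "\<dots> < sqrt k * r" using y by simp
   finally have "norm (emb y - emb x) < r" using k_pos by simp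
   then have "emb y \<in> ball (emb x) r" by (simp add: dist_norm norm_minus_commute)
   then show "y \<in> emb -` S \<inter> Q" using r y by auto
  qed
  then show "\<exists>r>0. geo_ball Q \<theta> r x \<subseteq> emb -` S \<inter> Q" using r k_pos by (intro exI[of _ ?r]) simp
 qed auto
 then show "emb -` S \<inter> space \<mu> \<in> sets \<mu>" by (auto simp: sets_\<mu>)
qed

lemma T_measurable2 [measurable]:
 assumes [measurable]: "f \<in> measurable M \<mu>" "g \<in> measurable M \<mu>" shows "(\<lambda>x. T (f x) (g x)) \<in> borel_measurable M"
 unfolding T_def by measurable

lemma T_measurable [measurable]: "T x \<in> borel_measurable \<mu>" unfolding T_def[abs_def] by measurable

lemma geo_ball_eq: "y \<in> Q \<Longrightarrow> 0 \<le> r \<Longrightarrow> r \<le> pi \<Longrightarrow> geo_ball Q \<theta> r y = {x \<in> Q. (cos (r/2))^2 < T y x}"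
 unfolding geo_ball_def using theta_less_iff by (auto simp: T_sym theta_sym)

lemma geo_ball_sets [measurable]: "y \<in> Q \<Longrightarrow> geo_ball Q \<theta> r y \<in> sets \<mu>"
proof -
 assume y: "y \<in> Q"
 consider "r < 0" | "0 \<le> r" "r \<le> pi" | "r > pi" by linarith
 then show ?thesis
 proof cases
  case 1
  then have "geo_ball Q \<theta> r y = {}" using theta_range y by (force simp: geo_ball_def)
  then show ?thesis by simp
 next
  case 2
  have "{x \<in> space \<mu>. (cos (r/2))^2 < T y x} \<in> sets \<mu>" by measurable
  then show ?thesis using 2 y by (simp add: geo_ball_eq)
 next
  case 3
  then have "geo_ball Q \<theta> r y = space \<mu>" using theta_range y by (force simp: geo_ball_def)
  then show ?thesis by (metis sets.top)
 qed
qed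

lemma isometry_inv:
 assumes "isometry_of Q \<theta> g"
 obtains h where "isometry_of Q \<theta> h" "\<And>x. x \<in> Q \<Longrightarrow> h (g x) = x" "\<And>x. x \<in> Q \<Longrightarrow> g (h x) = x"
proof
 have b: "bij_betw g Q Q" and d: "\<And>x y. x \<in> Q \<Longrightarrow> y \<in> Q \<Longrightarrow> \<theta> (g x) (g y) = \<theta> x y"
  using assms by (auto simp: isometry_of_def)
 let ?h = "inv_into Q g"
 show 1: "?h (g x) = x" if "x \<in> Q" for x using b that by (simp add: bij_betw_def)
 show 2: "g (?h x) = x" if "x \<in> Q" for x using b that by (simp add: bij_betw_inv_into_right)
 have bh: "bij_betw ?h Q Q" by (rule bij_betw_inv_into[OF b])
 then have "?h x \<in> Q" if "x \<in> Q" for x using that by (auto simp: bij_betw_def)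
 then show "isometry_of Q \<theta> ?h" unfolding isometry_of_def using bh d 2 by metis
qed

lemma isometry_in: "isometry_of Q \<theta> g \<Longrightarrow> x \<in> Q \<Longrightarrow> g x \<in> Q" by (auto simp: isometry_of_def bij_betw_def)

lemma isometry_T: "isometry_of Q \<theta> g \<Longrightarrow> x \<in> Q \<Longrightarrow> y \<in> Q \<Longrightarrow> T (g x) (g y) = T x y"
 using isometry_in[of g] by (simp add: T_eq) (simp add: isometry_of_def)

lemma isometry_measurable [measurable]:
 assumes g: "isometry_of Q \<theta> g" shows "g \<in> measurable \<mu> \<mu>"
proof (rule measurable_sigma_sets[OF sets_\<mu>])
 show "opens \<subseteq> Pow Q" by (auto simp: opens_def)
 show "g \<in> space \<mu> \<rightarrow> Q" using isometry_in[OF g] by auto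
 fix U assume U: "U \<in> opens"
 have "g -` U \<inter> Q \<in> opens" unfolding opens_def
 proof (intro CollectI conjI ballI)
  fix x assume x: "x \<in> g -` U \<inter> Q"
  then obtain r where r: "r > 0" "geo_ball Q \<theta> r (g x) \<subseteq> U" using U by (auto simp: opens_def)
  have "geo_ball Q \<theta> r x \<subseteq> g -` U \<inter> Q"
  proof
   fix y assume "y \<in> geo_ball Q \<theta> r x"
   then have "y \<in> Q" "\<theta> y x < r" by (auto simp: geo_ball_def)
   moreover from this have "g y \<in> geo_ball Q \<theta> r (g x)" using g x isometry_in[OF g] by (simp add: geo_ball_def isometry_of_def)
   ultimately show "y \<in> g -` U \<inter> Q" using r by auto
  qed
  then show "\<exists>r>0. geo_ball Q \<theta> r x \<subseteq> g -` U \<inter> Q" using r by blast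
 qed auto
 then show "g -` U \<inter> space \<mu> \<in> sets \<mu>" by (auto simp: sets_\<mu>)
qed

text \<open>Invariance is given for images of sets; a preimage under g is an image under its
  inverse, which is again an isometry.\<close>

lemma isometry_distr:
 assumes g: "isometry_of Q \<theta> g" shows "distr \<mu> \<mu> g = \<mu>"
proof (rule measure_eqI)
 fix A assume "A \<in> sets (distr \<mu> \<mu> g)"
 then have A: "A \<in> sets \<mu>" by simp
 then have AQ: "A \<subseteq> Q" using sets.sets_into_space by fastforce
 obtain h where h: "isometry_of Q \<theta> h" "\<And>x. x \<in> Q \<Longrightarrow> h (g x) = x" "\<And>x. x \<in> Q \<Longrightarrow> g (h x) = x"
  using isometry_inv[OF g] by metis
 have "g -` A \<inter> Q = h ` A"
 proof
  show "g -` A \<inter> Q \<subseteq> h ` A"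
  proof
   fix y assume "y \<in> g -` A \<inter> Q"
   then have "y = h (g y)" "g y \<in> A" using h(2) by auto
   then show "y \<in> h ` A" by (rule image_eqI)
  qed
  show "h ` A \<subseteq> g -` A \<inter> Q" using h(3) AQ isometry_in[OF h(1)] by auto
 qed
 moreover have "emeasure \<mu> (h ` A) = emeasure \<mu> A" using inv h(1) A unfolding invariant_measure_def by blast
 ultimately show "emeasure (distr \<mu> \<mu> g) A = emeasure \<mu> A" using A isometry_measurable[OF g] by (simp add: emeasure_distr)
qed simp

lemma isometry_integral:
 fixes h :: "'a \<Rightarrow> real"
 assumes g: "isometry_of Q \<theta> g" and h: "h \<in> borel_measurable \<mu>"
 shows "(\<integral>y. h (g y) \<partial>\<mu>) = (\<integral>y. h y \<partial>\<mu>)"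
 using integral_distr[OF isometry_measurable[OF g] h] by (simp add: isometry_distr[OF g])

lemma bounded_integrable:
 fixes f :: "'a \<Rightarrow> real"
 assumes "f \<in> borel_measurable \<mu>" "\<And>y. y \<in> Q \<Longrightarrow> \<bar>f y\<bar> \<le> B" shows "integrable \<mu> f"
 using assms by (intro \<mu>.integrable_const_bound[where B=B]) auto

end

text \<open>What all models share. \<open>e\<close> is a closed geodesic, parametrised by half the
  distance. Seen from it, a point y is a positive semidefinite quadratic form with diagonal
  \<open>T (e 0) y\<close>, \<open>T (e (pi/2)) y\<close>, off-diagonal entry \<open>w y\<close> and
  trace at most 1. \<open>reflect\<close> turns the geodesic around, \<open>normal\<close> is
  two-point homogeneity. The moment identities hold the dimensions: \<open>w\<close> is one of
  \<open>d0\<close> equally distributed coordinates of an entry whose squared norm is the product of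
  the two diagonal values, and the second diagonal value is one of \<open>d / d0\<close> equally
  distributed parts of 1 minus the first.\<close>

locale two_point_space = jacobi_weight d d0 + embedded_space Q \<theta> \<mu> emb k
 for d d0 :: nat and Q :: "'a set" and \<theta> :: "'a \<Rightarrow> 'a \<Rightarrow> real" and \<mu> :: "'a measure"
  and emb :: "'a \<Rightarrow> 'v::euclidean_space" and k :: real +
 fixes e :: "real \<Rightarrow> 'a" and w :: "'a \<Rightarrow> real"
 assumes e_in [simp]: "\<And>\<phi>. e \<phi> \<in> Q" and plane_T: "\<And>y \<phi>. y \<in> Q \<Longrightarrow>
    T (e \<phi>) y = (cos \<phi>)^2 * T (e 0) y + (sin \<phi>)^2 * T (e (pi/2)) y + 2 * cos \<phi> * sin \<phi> * w y"
  and w_square_le: "\<And>y. y \<in> Q \<Longrightarrow> (w y)^2 \<le> T (e 0) y * T (e (pi/2)) y"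
  and a_b_le: "\<And>y. y \<in> Q \<Longrightarrow> T (e 0) y + T (e (pi/2)) y \<le> 1" and e_orth: "T (e (pi/2)) (e 0) = 0"
  and reflect: "\<exists>g. isometry_of Q \<theta> g \<and> (\<forall>\<phi>. g (e \<phi>) = e (- \<phi>))"
  and normal: "\<And>x z. x \<in> Q \<Longrightarrow> z \<in> Q \<Longrightarrow> \<exists>g \<phi>. isometry_of Q \<theta> g \<and> 0 \<le> \<phi> \<and> \<phi> \<le> pi/2 \<and> g x = e 0 \<and> g z = e \<phi>"
  and moment_w_T: "\<And>n. real d0 * (\<integral>y. (w y)^2 * T (e 0) y ^ n \<partial>\<mu>) = (\<integral>y. T (e (pi/2)) y * T (e 0) y ^ Suc n \<partial>\<mu>)"
  and moment_b_T: "\<And>n. real d * (\<integral>y. T (e (pi/2)) y * T (e 0) y ^ n \<partial>\<mu>) = real d0 * (\<integral>y. (1 - T (e 0) y) * T (e 0) y ^ n \<partial>\<mu>)"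
begin

abbreviation "a \<equiv> T (e 0)"
abbreviation "b \<equiv> T (e (pi/2))"

lemma abs_w_le: "y \<in> Q \<Longrightarrow> \<bar>w y\<bar> \<le> 1"
proof -
 assume y: "y \<in> Q"
 have "(w y)^2 \<le> a y * b y" by (rule w_square_le[OF y])
 also have "\<dots> \<le> 1" using y T_ge_0 T_le_1 by (intro mult_le_one) auto
 finally show ?thesis by (simp add: abs_square_le_1)
qed

text \<open>At \<open>\<phi> = pi/4\<close> the form expresses \<open>w\<close> by three values of
  T.\<close>

lemma w_measurable [measurable]: "w \<in> borel_measurable \<mu>"
proof -
 have "w y = T (e (pi/4)) y - (a y + b y) / 2" if "y \<in> Q" for y
  using plane_T[OF that, of "pi/4"] by (simp add: cos_45 sin_45 power_divide add_divide_distrib)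
 then show ?thesis by (subst measurable_cong[where g="\<lambda>y. T (e (pi/4)) y - (a y + b y) / 2"]) auto
qed

lemma zonal_integral:
 fixes f :: "real \<Rightarrow> real"
 assumes x: "x \<in> Q" and f: "f \<in> borel_measurable borel"
 shows "(\<integral>y. f (T x y) \<partial>\<mu>) = (\<integral>y. f (a y) \<partial>\<mu>)"
proof -
 note [measurable] = f
 obtain g where g: "isometry_of Q \<theta> g" "g x = e 0" using normal[OF x x] by blast
 have "(\<integral>y. f (a y) \<partial>\<mu>) = (\<integral>y. f (a (g y)) \<partial>\<mu>)"
  by (rule isometry_integral[OF g(1), symmetric]) measurable
 also have "\<dots> = (\<integral>y. f (T x y) \<partial>\<mu>)" using isometry_T[OF g(1) x] g(2) by (intro bochner_cong) auto
 finally show ?thesis by simp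
qed

text \<open>\<open>coef n i y\<close> is the coefficient of \<open>s ^ i\<close> in \<open>(a y + 2 * w y * s + b y * s^2) ^ n\<close>;
 up to the factor \<open>cos \<phi> ^ (2 * n)\<close> and with \<open>s = tan \<phi>\<close> this power is \<open>T (e \<phi>) y ^ n\<close>.\<close>
definition coef :: "nat \<Rightarrow> nat \<Rightarrow> 'a \<Rightarrow> real" where
 "coef n i y = coeff ([:a y, 2 * w y, b y:] ^ n) i"

lemma coef_0: "coef 0 i y = (if i = 0 then 1 else 0)" by (simp add: coef_def coeff_1)

lemma coef_Suc: "coef (Suc n) i y = a y * coef n i y + (if i \<ge> 1 then 2 * w y * coef n (i - 1) y else 0)
  + (if i \<ge> 2 then b y * coef n (i - 2) y else 0)"
 by (auto simp: coef_def coeff_pCons numeral_2_eq_2 split: nat.splits)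

lemma coef_measurable [measurable]: "coef n i \<in> borel_measurable \<mu>"
proof (induction n arbitrary: i)
 case 0 then show ?case by (subst measurable_cong[OF coef_0]) auto
next
 case (Suc n)
 note [measurable] = Suc
 show ?case by (subst measurable_cong[OF coef_Suc]) measurable
qed

lemma coef_bound: "y \<in> Q \<Longrightarrow> \<bar>coef n i y\<bar> \<le> 4 ^ n"
proof (induction n arbitrary: i)
 case 0 then show ?case by (simp add: coef_0)
next
 case (Suc n)
 have ab: "\<bar>a y\<bar> \<le> 1" "\<bar>b y\<bar> \<le> 1" "\<bar>2 * w y\<bar> \<le> 2"
  using T_ge_0[OF e_in Suc.prems] T_le_1 abs_w_le[OF Suc.prems] by (auto simp: abs_le_iff intro: order_trans[of _ 0])
 have m: "\<bar>x * coef n j y\<bar> \<le> c * 4 ^ n" if "\<bar>x\<bar> \<le> c" for x c j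
  unfolding abs_mult using that Suc by (intro mult_mono) (auto intro: order_trans[OF abs_ge_zero])
 have "\<bar>coef (Suc n) i y\<bar> \<le> \<bar>a y * coef n i y\<bar> + \<bar>2 * w y * coef n (i - 1) y\<bar> + \<bar>b y * coef n (i - 2) y\<bar>"
  unfolding coef_Suc by auto
 also have "\<dots> \<le> 1 * 4 ^ n + 2 * 4 ^ n + 1 * 4 ^ n" using m[OF ab(1)] m[OF ab(2)] m[OF ab(3)] by (intro add_mono)
 finally show ?case by simp
qed

lemma coef_sum: "(a y + 2 * w y * s + b y * s^2) ^ n = (\<Sum>i\<le>2*n. coef n i y * s ^ i)"
proof -
 let ?p = "[:a y, 2 * w y, b y:]"
 have "degree ?p \<le> 2" by (rule degree_le) (auto simp: coeff_pCons split: nat.splits)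
 then have deg: "degree (?p ^ n) \<le> 2 * n" using degree_power_le[of ?p n] by (meson mult_le_mono1 order_trans)
 have "(a y + 2 * w y * s + b y * s^2) ^ n = poly (?p ^ n) s" by (simp add: power2_eq_square algebra_simps)
 also have "\<dots> = (\<Sum>i\<le>2*n. coef n i y * s ^ i)" unfolding coef_def poly_altdef using deg
  by (intro sum.mono_neutral_left) (auto simp: coeff_eq_0)
 finally show ?thesis .
qed

lemma T_e_power:
 assumes "y \<in> Q" "cos \<phi> \<noteq> 0" shows "T (e \<phi>) y ^ n = (cos \<phi>) ^ (2 * n) * (\<Sum>i\<le>2*n. coef n i y * (tan \<phi>) ^ i)"
proof -
 have "T (e \<phi>) y = (cos \<phi>)^2 * (a y + 2 * w y * tan \<phi> + b y * (tan \<phi>)^2)"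
 proof -
  have s: "sin \<phi> = tan \<phi> * cos \<phi>" using assms(2) by (simp add: tan_def)
  have "c^2 * A + (t * c)^2 * B + 2 * c * (t * c) * W = c^2 * (A + 2 * W * t + B * t^2)" for c t A B W :: real
   by (simp add: power2_eq_square algebra_simps)
  then show ?thesis unfolding plane_T[OF assms(1), of \<phi>] s .
 qed
 then show ?thesis by (simp only: power_mult_distrib coef_sum power_mult)
qed

end

text \<open>The second coefficient drives the moment recursion; the top one serves the angle
  \<open>pi / 2\<close>, where no tangent is available.\<close>

lemma coeff_quadratic_power:
 fixes x z v :: real shows "coeff ([:x, 2 * z, v:] ^ n) 0 = x ^ n" and "coeff ([:x, 2 * z, v:] ^ Suc n) 1 = 2 * real (Suc n) * x ^ n * z"
  and "coeff ([:x, 2 * z, v:] ^ Suc (Suc n)) 2 =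
   real (n + 2) * x ^ Suc n * v + 2 * real (n + 2) * real (n + 1) * x ^ n * z^2"
  and "coeff ([:x, 2 * z, v:] ^ n) (2 * n) = v ^ n"
proof -
 let ?p = "[:x, 2 * z, v:]"
 have S: "coeff (?p ^ Suc n) i = x * coeff (?p ^ n) i + (if i \<ge> 1 then 2 * z * coeff (?p ^ n) (i - 1) else 0)
   + (if i \<ge> 2 then v * coeff (?p ^ n) (i - 2) else 0)" for n i
  by (auto simp: coeff_pCons numeral_2_eq_2 split: nat.splits)
 show 0: "coeff (?p ^ n) 0 = x ^ n" for n by (induction n) (simp_all only: S, simp_all)
 show 1: "coeff (?p ^ Suc n) 1 = 2 * real (Suc n) * x ^ n * z" for n
 proof (induction n)
  case (Suc n)
  have "coeff (?p ^ Suc (Suc n)) 1 = x * coeff (?p ^ Suc n) 1 + 2 * z * coeff (?p ^ Suc n) 0" by (subst S) simp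
  then show ?case unfolding Suc 0 by (simp add: algebra_simps)
 qed simp
 show "coeff (?p ^ Suc (Suc n)) 2 = real (n + 2) * x ^ Suc n * v + 2 * real (n + 2) * real (n + 1) * x ^ n * z^2"
 proof (induction n)
  case 0
  show ?case by (simp add: numeral_2_eq_2 power2_eq_square algebra_simps)
 next
  case (Suc n)
  have "coeff (?p ^ Suc (Suc (Suc n))) 2 = x * coeff (?p ^ Suc (Suc n)) 2 + 2 * z * coeff (?p ^ Suc (Suc n)) 1 + v * coeff (?p ^ Suc (Suc n)) 0"
   by (subst S) simp
  then show ?case unfolding Suc 0 1 by (simp add: algebra_simps power2_eq_square)
 qed
 have deg: "degree (?p ^ n) \<le> 2 * n" for n
 proof -
  have "degree ?p \<le> 2" by (rule degree_le) (auto simp: coeff_pCons split: nat.splits)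
  then show ?thesis using degree_power_le[of ?p n] by (meson mult_le_mono1 order_trans)
 qed
 show "coeff (?p ^ n) (2 * n) = v ^ n"
 proof (induction n)
  case (Suc n)
  have "coeff (?p ^ n) (2 * Suc n) = 0" "coeff (?p ^ n) (2 * Suc n - 1) = 0" using deg[of n] by (auto intro!: coeff_eq_0)
  then show ?case unfolding S using Suc by simp
 qed simp
qed

section \<open>The law of the distance, zonal convolutions and the Funk-Hecke formula\<close>

context two_point_space begin

lemma poly_bounded_01:
 obtains B where "\<And>t. t \<in> {0..1} \<Longrightarrow> \<bar>poly q t\<bar> \<le> (B :: real)"
proof -
 have "continuous_on {0..1} (poly q)" by (intro continuous_intros)
 then have "bounded (poly q ` {0..1})" by (intro compact_imp_bounded compact_continuous_image) auto
 then obtain B where "\<forall>x\<in>poly q ` {0..1}. norm x \<le> B" unfolding bounded_iff by blast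
 then show ?thesis by (intro that[of B]) auto
qed

lemma poly_measurable [measurable]: "poly q \<in> borel_measurable (borel :: real measure)"
 by (intro borel_measurable_continuous_onI continuous_intros)

lemma T_in [simp]: "x \<in> Q \<Longrightarrow> y \<in> Q \<Longrightarrow> T x y \<in> {0..1}" using T_ge_0 T_le_1 by auto

lemma coef_integrable:
 assumes "f \<in> borel_measurable \<mu>" "\<And>y. y \<in> Q \<Longrightarrow> \<bar>f y\<bar> \<le> B"
 shows "integrable \<mu> (\<lambda>y. f y * coef n i y)"
proof (rule bounded_integrable)
 show "(\<lambda>y. f y * coef n i y) \<in> borel_measurable \<mu>" using assms(1) by measurable
 fix y assume y: "y \<in> Q"
 show "\<bar>f y * coef n i y\<bar> \<le> B * 4 ^ n"
  unfolding abs_mult using assms(2)[OF y] coef_bound[OF y] by (intro mult_mono) (auto intro: order_trans[OF abs_ge_zero])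
qed

lemma integral_T_e_power:
 assumes "f \<in> borel_measurable \<mu>" "\<And>y. y \<in> Q \<Longrightarrow> \<bar>f y\<bar> \<le> B" "cos \<phi> \<noteq> 0"
 shows "(\<integral>y. f y * T (e \<phi>) y ^ n \<partial>\<mu>) = cos \<phi> ^ (2 * n) * (\<Sum>i\<le>2*n. (\<integral>y. f y * coef n i y \<partial>\<mu>) * tan \<phi> ^ i)"
proof -
 have "(\<integral>y. f y * T (e \<phi>) y ^ n \<partial>\<mu>) = (\<integral>y. cos \<phi> ^ (2 * n) * (\<Sum>i\<le>2*n. (f y * coef n i y) * tan \<phi> ^ i) \<partial>\<mu>)"
  by (rule bochner_cong) (auto simp: T_e_power[OF _ assms(3)] sum_distrib_left mult_ac)
 also have "\<dots> = cos \<phi> ^ (2 * n) * (\<Sum>i\<le>2*n. (\<integral>y. f y * coef n i y \<partial>\<mu>) * tan \<phi> ^ i)"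
  using coef_integrable[OF assms(1,2)] by simp
 finally show ?thesis .
qed

definition M :: "nat \<Rightarrow> real" where "M n = (\<integral>y. a y ^ n \<partial>\<mu>)"

text \<open>The mean of \<open>T (e \<phi>) ^ n\<close> does not depend on \<open>\<phi>\<close>.
  Divided by \<open>cos \<phi> ^ (2 * n)\<close>, this says in \<open>s = tan \<phi>\<close> that
  the integrated expansion equals \<open>M n * (1 + s^2) ^ n\<close> as a polynomial; the claim
  compares the coefficients of \<open>s^2\<close>.\<close>

lemma moment_rotation: "(\<integral>y. coef n 2 y \<partial>\<mu>) = real n * M n"
proof -
 let ?p = "\<Sum>i\<le>2*n. monom (\<integral>y. coef n i y \<partial>\<mu>) i"
 let ?q = "smult (M n) ([:1, 2 * 0, 1:] ^ n)"
 have "poly ?p s = poly ?q s" for s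
 proof -
  have c: "cos (arctan s) \<noteq> 0" by (metis cos_arctan_not_zero)
  have "M n = (\<integral>y. 1 * T (e (arctan s)) y ^ n \<partial>\<mu>)"
   unfolding M_def using zonal_integral[OF e_in, of "\<lambda>t. t ^ n" "arctan s"] by simp
  also have "\<dots> = cos (arctan s) ^ (2 * n) * poly ?p s"
   using c by (subst integral_T_e_power[where B=1]) (auto simp: poly_sum poly_monom tan_arctan)
  also have "cos (arctan s) ^ (2 * n) = inverse ((1 + s^2) ^ n)"
   by (simp add: power_mult cos_arctan power_divide power_inverse divide_inverse)
  finally have "M n = inverse ((1 + s^2) ^ n) * poly ?p s" .
  moreover have "1 + s^2 > 0" by (simp add: add_pos_nonneg)
  moreover have "poly ?q s = M n * (1 + s^2) ^ n" by (simp add: poly_power power2_eq_square)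
  ultimately show ?thesis by (simp add: field_simps)
 qed
 then have "?p = ?q" by (intro poly_eq_poly_eq_iff[THEN iffD1] ext)
 then have c: "coeff ?p 2 = coeff ?q 2" by (rule arg_cong)
 have "coeff ?q 2 = real n * M n"
 proof -
  consider "n = 0" | "n = 1" | m where "n = Suc (Suc m)" by (metis One_nat_def not0_implies_Suc)
  then show ?thesis
  proof cases
   case 3
   show ?thesis unfolding coeff_smult 3 coeff_quadratic_power(3) by (simp add: algebra_simps)
  qed (auto simp: coeff_1 coeff_pCons numeral_2_eq_2)
 qed
 moreover have "coeff ?p 2 = (\<integral>y. coef n 2 y \<partial>\<mu>)"
 proof (cases "n = 0")
  case True
  then show ?thesis by (simp add: coef_0)
 qed (simp add: coeff_sum)
 ultimately show ?thesis using c by linarith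
qed

lemma a_b_integrable:
 "integrable \<mu> (\<lambda>y. a y ^ i)" "integrable \<mu> (\<lambda>y. b y * a y ^ i)" "integrable \<mu> (\<lambda>y. (w y)^2 * a y ^ i)"
proof -
 have "\<bar>a y ^ i\<bar> \<le> 1" "\<bar>b y\<bar> \<le> 1" "\<bar>(w y)\<^sup>2\<bar> \<le> 1" if "y \<in> Q" for y
  using that abs_w_le[OF that] T_ge_0[OF e_in that] T_le_1
  by (auto simp: abs_le_iff abs_square_le_1 intro!: power_le_one intro: order_trans[of _ 0])
 then show "integrable \<mu> (\<lambda>y. a y ^ i)" "integrable \<mu> (\<lambda>y. b y * a y ^ i)" "integrable \<mu> (\<lambda>y. (w y)^2 * a y ^ i)"
  by (auto intro!: bounded_integrable[where B=1] simp: abs_mult intro!: mult_le_one)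
qed

text \<open>The integral of the second coefficient contains two unknown integrals, of
  \<open>b * a ^ i\<close> and of \<open>w^2 * a ^ i\<close>; the moment identities express both by
  moments of \<open>a\<close>. The outcome is the recursion of \<open>E_power\<close>.\<close>

lemma M_rec: "(real d + real d0 + 2 * real n) * M (Suc n) = (real d0 + 2 * real n) * M n"
proof -
 have mb: "real d * (\<integral>y. b y * a y ^ n \<partial>\<mu>) = real d0 * (M n - M (Suc n))" for n
 proof -
  note moment_b_T
  also have "(\<integral>y. (1 - a y) * a y ^ n \<partial>\<mu>) = (\<integral>y. a y ^ n - a y ^ Suc n \<partial>\<mu>)"
   by (simp add: algebra_simps)
  also have "\<dots> = M n - M (Suc n)" unfolding M_def by (rule Bochner_Integration.integral_diff) (rule a_b_integrable)+
  finally show ?thesis .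
 qed
 note mw = moment_w_T
 show ?thesis
 proof (cases n)
  case 0
  have "(\<integral>y. coef (Suc 0) 2 y \<partial>\<mu>) = (\<integral>y. b y * a y ^ 0 \<partial>\<mu>)"
   by (intro bochner_cong) (auto simp: coef_Suc coef_0)
  then have "(\<integral>y. b y * a y ^ 0 \<partial>\<mu>) = M (Suc 0)" using moment_rotation[of "Suc 0"] by simp
  then show ?thesis using mb[of 0] unfolding 0 by (simp add: algebra_simps)
 next
  case (Suc m)
  have "(\<integral>y. coef (Suc (Suc m)) 2 y \<partial>\<mu>) =
    (\<integral>y. real (m + 2) * (b y * a y ^ Suc m) + (2 * real (m + 2) * real (m + 1)) * ((w y)^2 * a y ^ m) \<partial>\<mu>)"
   unfolding coef_def coeff_quadratic_power(3) by (simp add: mult_ac)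
  also have "\<dots> = real (m + 2) * (\<integral>y. b y * a y ^ Suc m \<partial>\<mu>) + (2 * real (m + 2) * real (m + 1)) * (\<integral>y. (w y)^2 * a y ^ m \<partial>\<mu>)"
   by (subst Bochner_Integration.integral_add) (auto intro!: a_b_integrable integrable_mult_right simp del: power_Suc)
  finally have "real (m + 2) * ((\<integral>y. b y * a y ^ Suc m \<partial>\<mu>) + 2 * real (m + 1) * (\<integral>y. (w y)^2 * a y ^ m \<partial>\<mu>)) = real (m + 2) * M (Suc (Suc m))"
   unfolding moment_rotation by (simp add: algebra_simps)
  then have *: "(\<integral>y. b y * a y ^ Suc m \<partial>\<mu>) + 2 * real (m + 1) * (\<integral>y. (w y)^2 * a y ^ m \<partial>\<mu>) = M (Suc (Suc m))"
   by (subst (asm) mult_cancel_left) auto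
  define B where "B = (\<integral>y. b y * a y ^ Suc m \<partial>\<mu>)"
  define W where "W = (\<integral>y. (w y)^2 * a y ^ m \<partial>\<mu>)"
  have "real d0 * (B + 2 * real (m + 1) * W) = real d0 * M (Suc (Suc m))" using * unfolding B_def W_def by simp
  then have 1: "(real d0 + 2 * real (m + 1)) * B = real d0 * M (Suc (Suc m))"
  proof -
   have "real d0 * (B + 2 * real (m + 1) * W) = real d0 * B + 2 * real (m + 1) * (real d0 * W)" by (simp add: algebra_simps)
   also have "real d0 * W = B" using mw[of m] unfolding B_def W_def .
   finally show ?thesis using \<open>real d0 * (B + 2 * real (m + 1) * W) = real d0 * M (Suc (Suc m))\<close> by (simp add: algebra_simps)
  qed
  have "(real d0 + 2 * real (m + 1)) * (real d * B) = real d * (real d0 * M (Suc (Suc m)))" using 1 by (metis mult.left_commute)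
  then have "real d0 * ((real d0 + 2 * real (m + 1)) * (M (Suc m) - M (Suc (Suc m)))) = real d0 * (real d * M (Suc (Suc m)))"
   unfolding B_def mb[of "Suc m"] by (simp only: mult_ac)
  then have "(real d0 + 2 * real (m + 1)) * (M (Suc m) - M (Suc (Suc m))) = real d * M (Suc (Suc m))"
   using d0_pos by (subst (asm) mult_cancel_left) auto
  then show ?thesis unfolding Suc by (simp add: algebra_simps)
 qed
qed

lemma M_eq_E: "M n = E ([:0, 1:] ^ n)"
proof (induction n)
 case 0
 then show ?case using \<mu>.prob_space by (simp add: M_def E_1[unfolded one_pCons] one_pCons)
next
 case (Suc n)
 have "real d + real d0 + 2 * real n > 0" using d_pos by simp
 moreover have "(real d + real d0 + 2 * real n) * M (Suc n) = (real d + real d0 + 2 * real n) * E ([:0, 1:] ^ Suc n)" unfolding M_rec E_power Suc ..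
 ultimately show ?case by (metis less_irrefl mult_cancel_left)
qed

lemma theta_measurable [measurable]: "x \<in> Q \<Longrightarrow> \<theta> x \<in> borel_measurable \<mu>"
proof -
 assume x: "x \<in> Q"
 have "geo_ball Q \<theta> r x = {y \<in> space \<mu>. \<theta> x y < r}" for r using x theta_sym by (auto simp: geo_ball_def)
 then show ?thesis using geo_ball_sets[OF x] by (intro borel_measurableI_less) auto
qed

theorem distr_theta:
 assumes x: "x \<in> Q" shows "distr \<mu> borel (\<theta> x) = law"
proof (rule real_distribution_eqI_cos_moments[OF _ _ real_distribution_law AE_law])
 note [measurable] = theta_measurable[OF x]
 have "prob_space (distr \<mu> borel (\<theta> x))" by (rule \<mu>.prob_space_distr) measurable
 then show "real_distribution (distr \<mu> borel (\<theta> x))" by (simp add: real_distribution_def real_distribution_axioms_def)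
 show "AE u in distr \<mu> borel (\<theta> x). u \<in> {0..pi}" by (subst AE_distr_iff) (auto intro!: AE_I2 simp: theta_range x)
 fix n
 have "(\<integral>u. ((cos (u / 2))^2) ^ n \<partial>distr \<mu> borel (\<theta> x)) = (\<integral>y. ((cos (\<theta> x y / 2))^2) ^ n \<partial>\<mu>)"
  by (rule integral_distr) measurable
 also have "\<dots> = (\<integral>y. T x y ^ n \<partial>\<mu>)" by (rule bochner_cong) (auto simp: T_eq x)
 also have "\<dots> = M n" unfolding M_def by (rule zonal_integral[OF x]) measurable
 also have "\<dots> = (\<integral>u. ((cos (u / 2))^2) ^ n \<partial>law)" unfolding M_eq_E E_def by (simp add: poly_power)
 finally show "(\<integral>u. ((cos (u / 2))^2) ^ n \<partial>distr \<mu> borel (\<theta> x)) = (\<integral>u. ((cos (u / 2))^2) ^ n \<partial>law)" .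
qed

lemma integral_theta:
 fixes f :: "real \<Rightarrow> real"
 assumes x: "x \<in> Q" and f: "f \<in> borel_measurable borel"
 shows "(\<integral>y. f (\<theta> x y) \<partial>\<mu>) = (\<integral>u. f u \<partial>law)"
 using integral_distr[OF theta_measurable[OF x] f] by (simp add: distr_theta[OF x])

lemma integral_poly_T: "x \<in> Q \<Longrightarrow> (\<integral>y. poly q (T x y) \<partial>\<mu>) = E q"
proof -
 assume x: "x \<in> Q"
 have "(\<integral>y. poly q (T x y) \<partial>\<mu>) = (\<integral>y. poly q ((cos (\<theta> x y / 2))^2) \<partial>\<mu>)"
  by (rule bochner_cong) (auto simp: T_eq x)
 also have "\<dots> = E q" unfolding E_def by (rule integral_theta[OF x]) measurable
 finally show ?thesis .
qed

lemma T_e0_e: "T (e \<phi>) (e 0) = (cos \<phi>)^2"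
proof -
 have b0: "b (e 0) = 0" by (rule e_orth)
 then have "w (e 0) = 0" using w_square_le[OF e_in, of 0] by simp
 with b0 show ?thesis by (subst plane_T) auto
qed

text \<open>Turning the geodesic around fixes \<open>e 0\<close> and sends \<open>e (pi/2)\<close>
  to \<open>e (- (pi/2))\<close>, where T takes the same values; comparison at \<open>pi/4\<close>
  and \<open>- (pi/4)\<close> shows that \<open>w\<close> changes sign.\<close>

lemma reflection:
 obtains g where "isometry_of Q \<theta> g" "\<And>y. y \<in> Q \<Longrightarrow> a (g y) = a y" "\<And>y. y \<in> Q \<Longrightarrow> b (g y) = b y"
  "\<And>y. y \<in> Q \<Longrightarrow> w (g y) = - w y"
proof -
 obtain g where g: "isometry_of Q \<theta> g" "\<And>\<phi>. g (e \<phi>) = e (- \<phi>)" using reflect by blast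
 have T: "T (e (- \<phi>)) (g y) = T (e \<phi>) y" if "y \<in> Q" for y \<phi> using isometry_T[OF g(1) e_in that, of \<phi>] g(2) by simp
 have 1: "a (g y) = a y" if y: "y \<in> Q" for y using T[OF y, of 0] by simp
 have 2: "b (g y) = b y" if y: "y \<in> Q" for y using T[OF y, of "pi/2"] plane_T[OF isometry_in[OF g(1) y], of "- (pi/2)"] by simp
 have 3: "w (g y) = - w y" if y: "y \<in> Q" for y
  using T[OF y, of "pi/4"] plane_T[OF isometry_in[OF g(1) y], of "- (pi/4)"] plane_T[OF y, of "pi/4"] 1[OF y] 2[OF y] by (simp add: cos_45 sin_45)
 show ?thesis using that g 1 2 3 by blast
qed

text \<open>In \<open>coef n i\<close> the powers of \<open>w\<close> have the parity of i, so the
  reflection changes the sign of the integrand.\<close>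

lemma coef_odd_integral:
 fixes f :: "real \<Rightarrow> real"
 assumes f: "f \<in> borel_measurable borel" and "odd i" shows "(\<integral>y. f (a y) * coef n i y \<partial>\<mu>) = 0"
proof -
 note [measurable] = f
 obtain g where g: "isometry_of Q \<theta> g" "\<And>y. y \<in> Q \<Longrightarrow> a (g y) = a y" "\<And>y. y \<in> Q \<Longrightarrow> b (g y) = b y"
  "\<And>y. y \<in> Q \<Longrightarrow> w (g y) = - w y" using reflection by metis
 have c: "coef n i (g y) = (- 1) ^ i * coef n i y" if y: "y \<in> Q" for n i y
 proof (induction n arbitrary: i)
  case (Suc n)
  consider "i = 0" | "i = 1" | j where "i = Suc (Suc j)" by (metis One_nat_def not0_implies_Suc)
  then show ?case
  proof cases
   case 3
   show ?thesis unfolding coef_Suc Suc g(2-4)[OF y] 3 by (simp add: algebra_simps)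
  qed (simp_all add: coef_Suc Suc g(2-4)[OF y])
 qed (simp add: coef_0)
 have "(\<integral>y. f (a y) * coef n i y \<partial>\<mu>) = (\<integral>y. f (a (g y)) * coef n i (g y) \<partial>\<mu>)"
  by (rule isometry_integral[OF g(1), symmetric]) measurable
 also have "\<dots> = (\<integral>y. - (f (a y) * coef n i y) \<partial>\<mu>)"
  using \<open>odd i\<close> by (intro bochner_cong) (auto simp: c g(2))
 finally show ?thesis by simp
qed

text \<open>Move x to \<open>e 0\<close> and z to \<open>e \<phi>\<close> and expand
  \<open>T (e \<phi>) y ^ n\<close>. The odd powers of \<open>tan \<phi>\<close> integrate to 0, so
  the result is homogeneous of degree n in \<open>(cos \<phi>)^2\<close> and
  \<open>(sin \<phi>)^2 = 1 - (cos \<phi>)^2\<close>, hence a polynomial in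
  \<open>(cos \<phi>)^2 = T x z\<close>.\<close>

lemma convolution_power:
 fixes f :: "real \<Rightarrow> real"
 assumes f: "f \<in> borel_measurable borel" and B: "\<And>t. t \<in> {0..1} \<Longrightarrow> \<bar>f t\<bar> \<le> B"
 shows "\<exists>q. degree q \<le> n \<and> (\<forall>x\<in>Q. \<forall>z\<in>Q. (\<integral>y. f (T x y) * T y z ^ n \<partial>\<mu>) = poly q (T x z))"
proof -
 note [measurable] = f
 define \<beta> where "\<beta> i = (\<integral>y. f (a y) * coef n i y \<partial>\<mu>)" for i
 define q where "q = (\<Sum>j\<le>n. smult (\<beta> (2 * j)) ([:0, 1:] ^ (n - j) * [:1, -1:] ^ j))"
 have deg: "degree q \<le> n" unfolding q_def
 proof (intro degree_sum_le ballI)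
  fix j assume "j \<in> {..n}"
  have "degree ([:0, 1:] ^ (n - j) * [:1, -1::real:] ^ j) \<le> (n - j) + j"
   by (intro degree_mult_le[THEN order_trans] add_mono) (auto intro!: degree_power_le[THEN order_trans])
  then show "degree (smult (\<beta> (2 * j)) ([:0, 1:] ^ (n - j) * [:1, -1:] ^ j)) \<le> n"
   using \<open>j \<in> {..n}\<close> by (intro degree_smult_le[THEN order_trans]) auto
 qed simp
 have "(\<integral>y. f (T x y) * T y z ^ n \<partial>\<mu>) = poly q (T x z)" if xz: "x \<in> Q" "z \<in> Q" for x z
 proof -
  obtain g \<phi> where g: "isometry_of Q \<theta> g" "0 \<le> \<phi>" "\<phi> \<le> pi/2" "g x = e 0" "g z = e \<phi>" using normal[OF xz] by blast
  have Tc: "T x z = (cos \<phi>)^2" using isometry_T[OF g(1) xz] T_e0_e[of \<phi>] by (simp add: g T_sym)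
  have "(\<integral>y. f (a y) * T (e \<phi>) y ^ n \<partial>\<mu>) = (\<integral>y. f (a (g y)) * T (e \<phi>) (g y) ^ n \<partial>\<mu>)"
   by (rule isometry_integral[OF g(1), symmetric]) measurable
  also have "\<dots> = (\<integral>y. f (T x y) * T y z ^ n \<partial>\<mu>)"
   using isometry_T[OF g(1) xz(1)] isometry_T[OF g(1) xz(2)] by (intro bochner_cong) (auto simp: g T_sym)
  finally have 1: "(\<integral>y. f (T x y) * T y z ^ n \<partial>\<mu>) = (\<integral>y. f (a y) * T (e \<phi>) y ^ n \<partial>\<mu>)" by simp
  have fm: "(\<lambda>y. f (a y)) \<in> borel_measurable \<mu>" by measurable
  have q: "poly q ((cos \<phi>)^2) = (\<Sum>j\<le>n. \<beta> (2 * j) * (((cos \<phi>)^2) ^ (n - j) * ((sin \<phi>)^2) ^ j))"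
   unfolding q_def by (simp add: poly_sum poly_power sin_squared_eq)
  show ?thesis
  \<comment> \<open>At \<open>\<phi> = pi/2\<close> the expansion in the tangent breaks down, but
    there \<open>T (e \<phi>) y = b y\<close> and only the top coefficient contributes.\<close>
  proof (cases "cos \<phi> = 0")
   case True
   then have s: "(sin \<phi>)^2 = 1" by (simp add: sin_squared_eq)
   have "(\<integral>y. f (a y) * T (e \<phi>) y ^ n \<partial>\<mu>) = \<beta> (2 * n)" unfolding \<beta>_def coef_def coeff_quadratic_power(4)
    by (rule bochner_cong) (auto simp: plane_T[of _ \<phi>] True s)
   moreover have "poly q ((cos \<phi>)^2) = \<beta> (2 * n)"
   proof -
    have "(\<Sum>j\<le>n. \<beta> (2 * j) * (((cos \<phi>)^2) ^ (n - j) * ((sin \<phi>)^2) ^ j)) = (\<Sum>j\<le>n. if j = n then \<beta> (2 * n) else 0)"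
     by (rule sum.cong) (auto simp: True s)
    then show ?thesis unfolding q by simp
   qed
   ultimately show ?thesis unfolding 1 Tc by simp
  next
   case False
   have "(\<integral>y. f (a y) * T (e \<phi>) y ^ n \<partial>\<mu>) = cos \<phi> ^ (2 * n) * (\<Sum>i\<le>2*n. \<beta> i * tan \<phi> ^ i)"
    unfolding \<beta>_def by (rule integral_T_e_power[OF fm _ False, where B=B]) (rule B[OF T_in[OF e_in]])
   also have "(\<Sum>i\<le>2*n. \<beta> i * tan \<phi> ^ i) = (\<Sum>j\<le>n. \<beta> (2 * j) * tan \<phi> ^ (2 * j))"
   proof -
    have "(\<Sum>i\<le>2*n. \<beta> i * tan \<phi> ^ i) = (\<Sum>i\<in>(\<lambda>j. 2 * j) ` {..n}. \<beta> i * tan \<phi> ^ i)"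
    proof (rule sum.mono_neutral_right)
     show "\<forall>i\<in>{..2 * n} - (\<lambda>j. 2 * j) ` {..n}. \<beta> i * tan \<phi> ^ i = 0"
     proof
      fix i assume "i \<in> {..2 * n} - (\<lambda>j. 2 * j) ` {..n}"
      then have "odd i" by (auto elim!: evenE)
      then show "\<beta> i * tan \<phi> ^ i = 0" unfolding \<beta>_def using coef_odd_integral[OF f] by simp
     qed
    qed auto
    also have "\<dots> = (\<Sum>j\<le>n. \<beta> (2 * j) * tan \<phi> ^ (2 * j))" by (subst sum.reindex) (auto simp: inj_on_def)
    finally show ?thesis .
   qed
   also have "cos \<phi> ^ (2 * n) * \<dots> = poly q ((cos \<phi>)^2)" unfolding q sum_distrib_left
   proof (rule sum.cong)
    fix j assume "j \<in> {..n}"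
    then have "(cos \<phi>)\<^sup>2 ^ n = (cos \<phi>)\<^sup>2 ^ (n - j) * (cos \<phi>)\<^sup>2 ^ j" by (simp flip: power_add)
    moreover have "(cos \<phi>)\<^sup>2 ^ j * (tan \<phi>)\<^sup>2 ^ j = (sin \<phi>)\<^sup>2 ^ j"
    proof -
     have "cos \<phi> * tan \<phi> = sin \<phi>" using False by (simp add: tan_def)
     then show ?thesis by (metis power_mult_distrib)
    qed
    ultimately have "(cos \<phi>)\<^sup>2 ^ n * (\<beta> (2 * j) * (tan \<phi>)\<^sup>2 ^ j) = \<beta> (2 * j) * ((cos \<phi>)\<^sup>2 ^ (n - j) * (sin \<phi>)\<^sup>2 ^ j)"
     by (metis mult.assoc mult.left_commute)
    then show "cos \<phi> ^ (2 * n) * (\<beta> (2 * j) * tan \<phi> ^ (2 * j)) = \<beta> (2 * j) * (((cos \<phi>)^2) ^ (n - j) * ((sin \<phi>)^2) ^ j)"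
     by (simp only: power_mult)
   qed simp
   finally show ?thesis unfolding 1 Tc .
  qed
 qed
 with deg show ?thesis by blast
qed

sublocale pp: pair_prob_space \<mu> \<mu> ..

lemma integral_swap:
 fixes F :: "'a \<Rightarrow> 'a \<Rightarrow> real"
 assumes "case_prod F \<in> borel_measurable (\<mu> \<Otimes>\<^sub>M \<mu>)" and B: "\<And>x y. x \<in> Q \<Longrightarrow> y \<in> Q \<Longrightarrow> \<bar>F x y\<bar> \<le> B"
 shows "(\<integral>y. (\<integral>x. F x y \<partial>\<mu>) \<partial>\<mu>) = (\<integral>x. (\<integral>y. F x y \<partial>\<mu>) \<partial>\<mu>)"
proof (rule pp.Fubini_integral)
 show "integrable (\<mu> \<Otimes>\<^sub>M \<mu>) (case_prod F)"
  using assms by (intro pp.P.integrable_const_bound[where B=B]) (auto simp: space_pair_measure)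
qed

lemma poly_T_bounded: "\<exists>B\<ge>0. \<forall>x\<in>Q. \<forall>y\<in>Q. \<bar>poly q (T x y)\<bar> \<le> B"
proof -
 obtain B where B: "\<And>t. t \<in> {0..1} \<Longrightarrow> \<bar>poly q t\<bar> \<le> B" using poly_bounded_01 by blast
 show ?thesis by (intro exI[of _ B] conjI ballI B[OF T_in]) (use B[of 0] in auto)
qed

lemma T_measurable_left [measurable]: "(\<lambda>y. T y z) \<in> borel_measurable \<mu>" unfolding T_def by measurable

lemma zonal_product_integrable:
 fixes f :: "real \<Rightarrow> real"
 assumes f: "f \<in> borel_measurable borel" and B: "\<And>t. t \<in> {0..1} \<Longrightarrow> \<bar>f t\<bar> \<le> B" and "x \<in> Q" "z \<in> Q"
 shows "integrable \<mu> (\<lambda>y. f (T x y) * poly q (T y z))"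
proof -
 note [measurable] = f
 obtain C where C: "C \<ge> 0" "\<And>x y. x \<in> Q \<Longrightarrow> y \<in> Q \<Longrightarrow> \<bar>poly q (T x y)\<bar> \<le> C" using poly_T_bounded[of q] by blast
 show ?thesis
 proof (rule bounded_integrable)
  show "(\<lambda>y. f (T x y) * poly q (T y z)) \<in> borel_measurable \<mu>" by measurable
  fix y assume "y \<in> Q"
  then have "\<bar>f (T x y)\<bar> \<le> B" "\<bar>poly q (T y z)\<bar> \<le> C" using assms C B[OF T_in] by blast+
  then show "\<bar>f (T x y) * poly q (T y z)\<bar> \<le> B * C" unfolding abs_mult by (intro mult_mono) auto
 qed
qed

lemma convolution_poly:
 fixes f :: "real \<Rightarrow> real"
 assumes f: "f \<in> borel_measurable borel" and B: "\<And>t. t \<in> {0..1} \<Longrightarrow> \<bar>f t\<bar> \<le> B"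
 shows "\<exists>r. degree r \<le> degree q \<and> (\<forall>x\<in>Q. \<forall>z\<in>Q. (\<integral>y. f (T x y) * poly q (T y z) \<partial>\<mu>) = poly r (T x z))"
proof -
 have "\<forall>n. \<exists>r. degree r \<le> n \<and> (\<forall>x\<in>Q. \<forall>z\<in>Q. (\<integral>y. f (T x y) * T y z ^ n \<partial>\<mu>) = poly r (T x z))"
  using convolution_power[OF f B] by blast
 then obtain R where R: "\<And>n. degree (R n) \<le> n"
  "\<And>n x z. x \<in> Q \<Longrightarrow> z \<in> Q \<Longrightarrow> (\<integral>y. f (T x y) * T y z ^ n \<partial>\<mu>) = poly (R n) (T x z)"
  by metis
 define r where "r = (\<Sum>i\<le>degree q. smult (coeff q i) (R i))"
 have "degree r \<le> degree q" unfolding r_def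
 proof (intro degree_sum_le ballI)
  fix i assume "i \<in> {..degree q}"
  then show "degree (smult (coeff q i) (R i)) \<le> degree q" using R(1)[of i] by (intro degree_smult_le[THEN order_trans]) auto
 qed simp
 moreover have "(\<integral>y. f (T x y) * poly q (T y z) \<partial>\<mu>) = poly r (T x z)" if xz: "x \<in> Q" "z \<in> Q" for x z
 proof -
  have i: "integrable \<mu> (\<lambda>y. f (T x y) * T y z ^ n)" for n
   using zonal_product_integrable[OF f B xz, of "monom 1 n"] by (simp add: poly_monom)
  have "(\<integral>y. f (T x y) * poly q (T y z) \<partial>\<mu>) = (\<integral>y. (\<Sum>i\<le>degree q. coeff q i * (f (T x y) * T y z ^ i)) \<partial>\<mu>)"
   unfolding poly_altdef by (simp add: sum_distrib_left mult_ac)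
  also have "\<dots> = (\<Sum>i\<le>degree q. coeff q i * poly (R i) (T x z))" using i R(2)[OF xz] by simp
  finally show ?thesis by (simp add: r_def poly_sum)
 qed
 ultimately show ?thesis by blast
qed

lemma zonal_triple_swap:
 fixes f :: "real \<Rightarrow> real"
 assumes f: "f \<in> borel_measurable borel" and B: "\<And>t. t \<in> {0..1} \<Longrightarrow> \<bar>f t\<bar> \<le> B" and x: "x \<in> Q"
 shows "(\<integral>z. (\<integral>y. f (T x y) * poly p (T y z) \<partial>\<mu>) * poly q (T z x) \<partial>\<mu>) =
  (\<integral>y. f (T x y) * (\<integral>z. poly p (T y z) * poly q (T z x) \<partial>\<mu>) \<partial>\<mu>)"
proof -
 note [measurable] = f
 obtain C where C: "C \<ge> 0" "\<And>x y. x \<in> Q \<Longrightarrow> y \<in> Q \<Longrightarrow> \<bar>poly p (T x y)\<bar> \<le> C" using poly_T_bounded[of p] by blast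
 obtain D where D: "D \<ge> 0" "\<And>x y. x \<in> Q \<Longrightarrow> y \<in> Q \<Longrightarrow> \<bar>poly q (T x y)\<bar> \<le> D" using poly_T_bounded[of q] by blast
 let ?F = "\<lambda>z y. f (T x y) * poly p (T y z) * poly q (T z x)"
 have m: "case_prod ?F \<in> borel_measurable (\<mu> \<Otimes>\<^sub>M \<mu>)" unfolding T_sym[of _ x] by measurable
 have b: "\<bar>?F z y\<bar> \<le> B * C * D" if "z \<in> Q" "y \<in> Q" for z y
 proof -
  have "\<bar>f (T x y)\<bar> \<le> B" "\<bar>poly p (T y z)\<bar> \<le> C" "\<bar>poly q (T z x)\<bar> \<le> D" using that x C D B[OF T_in] by blast+
  then show ?thesis unfolding abs_mult by (intro mult_mono) auto
 qed
 have "(\<integral>z. (\<integral>y. f (T x y) * poly p (T y z) \<partial>\<mu>) * poly q (T z x) \<partial>\<mu>) = (\<integral>z. (\<integral>y. ?F z y \<partial>\<mu>) \<partial>\<mu>)" by simp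
 also have "\<dots> = (\<integral>y. (\<integral>z. ?F z y \<partial>\<mu>) \<partial>\<mu>)" by (rule integral_swap[OF m b, symmetric])
 also have "\<dots> = (\<integral>y. f (T x y) * (\<integral>z. poly p (T y z) * poly q (T z x) \<partial>\<mu>) \<partial>\<mu>)" by (simp add: mult.assoc)
 finally show ?thesis .
qed

text \<open>The convolution is a polynomial s in T of degree below l. In \<open>E (s * s)\<close>
  Fubini moves one factor s onto q, which leaves \<open>jac0 l\<close> against a polynomial of
  degree below l; so \<open>E (s * s) = 0\<close>.\<close>

lemma convolution_jac0_lower:
 assumes q: "degree q < l" and xz: "x \<in> Q" "z \<in> Q" shows "(\<integral>y. poly (jac0 l) (T x y) * poly q (T y z) \<partial>\<mu>) = 0"
proof -
 obtain B where B: "\<And>t. t \<in> {0..1} \<Longrightarrow> \<bar>poly (jac0 l) t\<bar> \<le> B" using poly_bounded_01 by blast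
 obtain s where s: "degree s \<le> degree q"
  "\<And>x z. x \<in> Q \<Longrightarrow> z \<in> Q \<Longrightarrow> (\<integral>y. poly (jac0 l) (T x y) * poly q (T y z) \<partial>\<mu>) = poly s (T x z)"
  using convolution_poly[OF poly_measurable B, of q] by blast
 obtain C where C: "\<And>t. t \<in> {0..1} \<Longrightarrow> \<bar>poly q t\<bar> \<le> C" using poly_bounded_01 by blast
 obtain r where r: "degree r \<le> degree s"
  "\<And>x z. x \<in> Q \<Longrightarrow> z \<in> Q \<Longrightarrow> (\<integral>y. poly q (T x y) * poly s (T y z) \<partial>\<mu>) = poly r (T x z)"
  using convolution_poly[OF poly_measurable C, of s] by blast
 have "E (s * s) = (\<integral>z. poly (s * s) (T x z) \<partial>\<mu>)" by (rule integral_poly_T[OF xz(1), symmetric])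
 also have "\<dots> = (\<integral>z. (\<integral>y. poly (jac0 l) (T x y) * poly q (T y z) \<partial>\<mu>) * poly s (T z x) \<partial>\<mu>)"
 proof (rule bochner_cong)
  fix z assume "z \<in> space \<mu>"
  then have z: "z \<in> Q" by simp
  show "poly (s * s) (T x z) = (\<integral>y. poly (jac0 l) (T x y) * poly q (T y z) \<partial>\<mu>) * poly s (T z x)"
   unfolding s(2)[OF xz(1) z] T_sym[of z x] by simp
 qed simp
 also have "\<dots> = (\<integral>y. poly (jac0 l) (T x y) * (\<integral>z. poly q (T y z) * poly s (T z x) \<partial>\<mu>) \<partial>\<mu>)"
  by (rule zonal_triple_swap[OF poly_measurable B xz(1)])
 also have "\<dots> = (\<integral>y. poly (jac0 l * r) (T x y) \<partial>\<mu>)"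
 proof (rule bochner_cong)
  fix y assume "y \<in> space \<mu>"
  then have y: "y \<in> Q" by simp
  show "poly (jac0 l) (T x y) * (\<integral>z. poly q (T y z) * poly s (T z x) \<partial>\<mu>) = poly (jac0 l * r) (T x y)"
   unfolding r(2)[OF y xz(1)] T_sym[of y x] by simp
 qed simp
 also have "\<dots> = E (jac0 l * r)" by (rule integral_poly_T[OF xz(1)])
 also have "\<dots> = 0" using jac0_orth_lower[of r l] r(1) s(1) q by linarith
 finally have "s = 0" using E_square_pos by force
 then show ?thesis using s(2)[OF xz] by simp
qed

text \<open>The convolution has degree at most l and, by Fubini and
  \<open>convolution_jac0_lower\<close>, is orthogonal to all lower degrees; only multiples of
  \<open>jac0 l\<close> remain.\<close>

lemma funk_hecke0:
 fixes f :: "real \<Rightarrow> real"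
 assumes f: "f \<in> borel_measurable borel" and B: "\<And>t. t \<in> {0..1} \<Longrightarrow> \<bar>f t\<bar> \<le> B"
 shows "\<exists>\<alpha>. \<forall>x\<in>Q. \<forall>z\<in>Q. (\<integral>y. f (T x y) * poly (jac0 l) (T y z) \<partial>\<mu>) = \<alpha> * poly (jac0 l) (T x z)"
proof -
 obtain s where s: "degree s \<le> degree (jac0 l)"
  "\<And>x z. x \<in> Q \<Longrightarrow> z \<in> Q \<Longrightarrow> (\<integral>y. f (T x y) * poly (jac0 l) (T y z) \<partial>\<mu>) = poly s (T x z)"
  using convolution_poly[OF f B, of "jac0 l"] by blast
 have "E (s * q) = 0" if q: "degree q < l" for q
 proof -
  have "E (s * q) = (\<integral>z. poly (s * q) (T (e 0) z) \<partial>\<mu>)" by (rule integral_poly_T[OF e_in, symmetric])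
  also have "\<dots> = (\<integral>z. (\<integral>y. f (T (e 0) y) * poly (jac0 l) (T y z) \<partial>\<mu>) * poly q (T z (e 0)) \<partial>\<mu>)"
  proof (rule bochner_cong)
   fix z assume "z \<in> space \<mu>"
   then have z: "z \<in> Q" by simp
   show "poly (s * q) (T (e 0) z) = (\<integral>y. f (T (e 0) y) * poly (jac0 l) (T y z) \<partial>\<mu>) * poly q (T z (e 0))"
    unfolding s(2)[OF e_in z] T_sym[of z "e 0"] by simp
  qed simp
  also have "\<dots> = (\<integral>y. f (T (e 0) y) * (\<integral>z. poly (jac0 l) (T y z) * poly q (T z (e 0)) \<partial>\<mu>) \<partial>\<mu>)"
   by (rule zonal_triple_swap[OF f B e_in])
  also have "\<dots> = (\<integral>y. 0 \<partial>\<mu>)" by (rule bochner_cong) (auto simp: convolution_jac0_lower[OF q])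
  finally show ?thesis by simp
 qed
 then obtain c where "s = smult c (jac0 l)" using eq_smult_jac0[of s l] s(1) by auto
 then show ?thesis using s(2) by auto
qed

text \<open>Convolving \<open>jac0 l\<close> with itself and putting x = z exhibits its squared norm
  as a multiple of its value at 1.\<close>

lemma jac0_at_1: "poly (jac0 l) 1 \<noteq> 0"
proof
 assume 0: "poly (jac0 l) 1 = 0"
 obtain B where B: "\<And>t. t \<in> {0..1} \<Longrightarrow> \<bar>poly (jac0 l) t\<bar> \<le> B" using poly_bounded_01 by blast
 obtain \<alpha> where "\<And>x z. x \<in> Q \<Longrightarrow> z \<in> Q \<Longrightarrow> (\<integral>y. poly (jac0 l) (T x y) * poly (jac0 l) (T y z) \<partial>\<mu>) = \<alpha> * poly (jac0 l) (T x z)"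
  using funk_hecke0[OF poly_measurable B, of l] by blast
 from this[OF e_in e_in, of 0 0] have "(\<integral>y. poly (jac0 l * jac0 l) (T (e 0) y) \<partial>\<mu>) = 0" using 0 by (simp add: T_sym)
 then have "E (jac0 l * jac0 l) = 0" unfolding integral_poly_T[OF e_in] .
 then show False using E_square_pos[OF jac0_nz[of l]] by simp
qed

text \<open>The zonal spherical functions, as polynomials in \<open>T\<close>.\<close>
definition jac :: "nat \<Rightarrow> real poly" where "jac l = smult (1 / poly (jac0 l) 1) (jac0 l)"

definition hn :: "nat \<Rightarrow> real" where "hn l = E (jac l * jac l)"

lemma jac_1 [simp]: "poly (jac l) 1 = 1" using jac0_at_1 by (simp add: jac_def)
lemma degree_jac [simp]: "degree (jac l) = l" using jac0_at_1 by (simp add: jac_def)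
lemma jac_op_jac: "jac_op (jac l) = smult (- ev l) (jac l)"
proof -
 have "jac_op (smult c q) = smult c (jac_op q)" for c q by (simp add: jac_op_def pderiv_smult smult_add_right)
 then show ?thesis by (simp add: jac_def jac_op_jac0)
qed
lemma hn_pos: "hn l > 0" unfolding hn_def by (intro E_square_pos notI) (use jac_1[of l] in \<open>simp del: jac_1\<close>)
lemma jac_orth: "j \<noteq> l \<Longrightarrow> E (jac j * jac l) = 0" by (simp add: jac_def jac0_orth E_smult)
lemma jac_0 [simp]: "jac 0 = 1"
proof -
 obtain c where c: "jac 0 = [:c:]" using degree_eq_zeroE[of "jac 0"] by auto
 then show ?thesis using jac_1[of 0] by (simp add: one_pCons)
qed

text \<open>The eigenvalue is read off at x = z, where \<open>jac l\<close> is 1.\<close>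

lemma funk_hecke:
 fixes f :: "real \<Rightarrow> real"
 assumes f: "f \<in> borel_measurable borel" and B: "\<And>t. t \<in> {0..1} \<Longrightarrow> \<bar>f t\<bar> \<le> B" and xz: "x \<in> Q" "z \<in> Q"
 shows "(\<integral>y. f (T x y) * poly (jac l) (T y z) \<partial>\<mu>) = (\<integral>y. f (a y) * poly (jac l) (a y) \<partial>\<mu>) * poly (jac l) (T x z)"
proof -
 obtain \<alpha> where \<alpha>: "\<And>x z. x \<in> Q \<Longrightarrow> z \<in> Q \<Longrightarrow> (\<integral>y. f (T x y) * poly (jac0 l) (T y z) \<partial>\<mu>) = \<alpha> * poly (jac0 l) (T x z)"
  using funk_hecke0[OF f B, of l] by blast
 have 1: "(\<integral>y. f (T x y) * poly (jac l) (T y z) \<partial>\<mu>) = \<alpha> * poly (jac l) (T x z)" if "x \<in> Q" "z \<in> Q" for x z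
 proof -
  have "(\<integral>y. f (T x y) * poly (jac l) (T y z) \<partial>\<mu>) = (\<integral>y. 1 / poly (jac0 l) 1 * (f (T x y) * poly (jac0 l) (T y z)) \<partial>\<mu>)"
   by (simp add: jac_def mult_ac)
  also have "\<dots> = 1 / poly (jac0 l) 1 * (\<alpha> * poly (jac0 l) (T x z))" by (simp only: integral_mult_right_zero \<alpha>[OF that])
  finally show ?thesis by (simp add: jac_def)
 qed
 from 1[OF e_in e_in, of 0 0] have "(\<integral>y. f (a y) * poly (jac l) (a y) \<partial>\<mu>) = \<alpha>" by (simp add: T_sym)
 with 1[OF xz] show ?thesis by simp
qed

lemma jac_convolution:
 assumes xz: "x \<in> Q" "z \<in> Q"
 shows "(\<integral>y. poly (jac j) (T x y) * poly (jac l) (T y z) \<partial>\<mu>) = (if j = l then hn l * poly (jac l) (T x z) else 0)"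
proof -
 obtain B where B: "\<And>t. t \<in> {0..1} \<Longrightarrow> \<bar>poly (jac j) t\<bar> \<le> B" using poly_bounded_01 by blast
 have "(\<integral>y. poly (jac j) (a y) * poly (jac l) (a y) \<partial>\<mu>) = E (jac j * jac l)"
  using integral_poly_T[OF e_in, of "jac j * jac l" 0] by simp
 with funk_hecke[OF poly_measurable B xz, of l] show ?thesis by (auto simp: hn_def jac_orth)
qed

text \<open>By \<open>jac_convolution\<close>, \<open>hn l\<close> times the value at t is the inner
  product of two zonal functions of squared norm \<open>hn l\<close>, so the bound is
  Cauchy-Schwarz. A point on the geodesic realises the given t.\<close>

lemma jac_bound: "t \<in> {0..1} \<Longrightarrow> \<bar>poly (jac l) t\<bar> \<le> 1"
proof -
 assume t: "t \<in> {0..1}"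
 define z where "z = e (arccos (sqrt t))"
 have "T z (e 0) = t" unfolding z_def T_e0_e using t by (subst cos_arccos) (auto intro: order_trans[of _ 0])
 obtain B where B: "\<And>t. t \<in> {0..1} \<Longrightarrow> \<bar>poly (jac l) t\<bar> \<le> B" using poly_bounded_01 by blast
 have z: "z \<in> Q" by (simp add: z_def)
 have i: "integrable \<mu> (\<lambda>y. poly (jac l) (T x y) * poly (jac l) (T y z))" if "x \<in> Q" "z \<in> Q" for x z
  using zonal_product_integrable[OF poly_measurable B that] .
 have sq: "(\<integral>y. (poly (jac l) (T x y))^2 \<partial>\<mu>) = hn l" "integrable \<mu> (\<lambda>y. (poly (jac l) (T x y))^2)" if "x \<in> Q" for x
  using jac_convolution[OF that that, of l l] i[OF that that] by (simp_all add: T_sym[of _ x] power2_eq_square)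
 have "hn l * \<bar>poly (jac l) t\<bar> = \<bar>\<integral>y. poly (jac l) (T z y) * poly (jac l) (T y (e 0)) \<partial>\<mu>\<bar>"
  using jac_convolution[OF z e_in, of l l 0] hn_pos[of l] by (simp add: \<open>T z (e 0) = t\<close> abs_mult)
 also have "\<dots> \<le> (\<integral>y. \<bar>poly (jac l) (T z y) * poly (jac l) (T y (e 0))\<bar> \<partial>\<mu>)" by (rule integral_abs_bound)
 also have "\<dots> \<le> (\<integral>y. ((poly (jac l) (T z y))^2 + (poly (jac l) (T (e 0) y))^2) / 2 \<partial>\<mu>)"
 proof (rule integral_mono)
  show "integrable \<mu> (\<lambda>y. \<bar>poly (jac l) (T z y) * poly (jac l) (T y (e 0))\<bar>)" using i[OF z e_in] by simp
  show "integrable \<mu> (\<lambda>y. ((poly (jac l) (T z y))^2 + (poly (jac l) (T (e 0) y))^2) / 2)" using sq(2)[OF z] sq(2)[OF e_in] by simp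
  fix y
  show "\<bar>poly (jac l) (T z y) * poly (jac l) (T y (e 0))\<bar> \<le> ((poly (jac l) (T z y))^2 + (poly (jac l) (T (e 0) y))^2) / 2"
   using sum_squares_bound[of "\<bar>poly (jac l) (T z y)\<bar>" "\<bar>poly (jac l) (T (e 0) y)\<bar>"] by (simp add: abs_mult T_sym)
 qed
 also have "\<dots> = hn l" using sq[OF z] sq[OF e_in] by simp
 finally show ?thesis using hn_pos[of l] by simp
qed

lemma poly_jac_expansion: "\<exists>c. q = (\<Sum>l\<le>degree q. smult (c l) (jac l))"
proof -
 obtain c where c: "q = (\<Sum>l\<le>degree q. smult (c l) (jac0 l))" using poly_jac0_expansion by blast
 have eq: "smult (c l * poly (jac0 l) 1) (jac l) = smult (c l) (jac0 l)" for l using jac0_at_1[of l] by (simp add: jac_def)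
 show ?thesis
 proof (rule exI)
  show "q = (\<Sum>l\<le>degree q. smult (c l * poly (jac0 l) 1) (jac l))" unfolding eq by (rule c)
 qed
qed

end

section \<open>Balls and the invariance principle\<close>

context jacobi_weight begin

text \<open>Integration against a weight \<open>\<eta>\<close> of the class \<open>W(d, d0)\<close> is integration of \<open>f / wt\<close> against this finite Borel measure.\<close>
definition nu :: "(real \<Rightarrow> real) \<Rightarrow> real measure" where
 "nu \<eta> = distr (density lebesgue (\<lambda>r. ennreal (indicator {0..pi} r * (wt r * \<eta> r)))) borel (\<lambda>r. r)"

lemma nu_density_measurable:
 assumes "\<eta> \<in> weight_class d d0" shows "(\<lambda>r. indicator {0..pi} r * (wt r * \<eta> r)) \<in> borel_measurable lebesgue"
  and "integrable lebesgue (\<lambda>r. indicator {0..pi} r * (wt r * \<eta> r))" and "0 \<le> indicator {0..pi} r * (wt r * \<eta> r)"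
proof -
 show i: "integrable lebesgue (\<lambda>r. indicator {0..pi} r * (wt r * \<eta> r))"
  using assms by (simp add: weight_class_def set_integrable_def wt_def)
 then show "(\<lambda>r. indicator {0..pi} r * (wt r * \<eta> r)) \<in> borel_measurable lebesgue" by (rule borel_measurable_integrable)
 show "0 \<le> indicator {0..pi} r * (wt r * \<eta> r)" using assms wt_nonneg[of r] by (auto simp: indicator_def weight_class_def)
qed

lemma id_lebesgue_measurable: "(\<lambda>r. r) \<in> measurable lebesgue (borel :: real measure)" by (rule measurable_completion) simp

lemma sets_nu [simp, measurable_cong]: "sets (nu \<eta>) = sets borel" and space_nu [simp]: "space (nu \<eta>) = UNIV" by (auto simp: nu_def)

lemma finite_measure_nu:
 assumes "\<eta> \<in> weight_class d d0" shows "finite_measure (nu \<eta>)"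
proof -
 let ?g = "\<lambda>r. indicator {0..pi} r * (wt r * \<eta> r)"
 note g = nu_density_measurable[OF assms]
 have [measurable]: "(\<lambda>r. ennreal (?g r)) \<in> borel_measurable lebesgue" using g(1) by measurable
 have "emeasure (density lebesgue (\<lambda>r. ennreal (?g r))) UNIV = (\<integral>\<^sup>+r. ennreal (?g r) \<partial>lebesgue)"
  by (subst emeasure_density) auto
 also have "\<dots> < \<infinity>" using g by (simp add: nn_integral_eq_integral)
 finally have "finite_measure (density lebesgue (\<lambda>r. ennreal (?g r)))" by (intro finite_measureI) auto
 then show ?thesis unfolding nu_def
  by (rule finite_measure.finite_measure_distr) (use id_lebesgue_measurable in \<open>simp add: measurable_def\<close>)
qed

lemma AE_interior: "AE r in lebesgue. r \<in> {0..pi} \<longrightarrow> wt r \<noteq> 0"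
proof -
 have "{0, pi} \<in> null_sets lebesgue" by (simp add: finite_imp_null_set_lborel null_sets_completionI)
 then have "AE r in lebesgue. r \<notin> {0, pi}" by (rule AE_not_in)
 then show ?thesis
 proof eventually_elim
  case (elim r)
  then show ?case using wt_pos[of r] by (auto simp: less_le)
 qed
qed

text \<open>The points 0 and pi, where \<open>wt\<close> may vanish, form a null set, so division by
  \<open>wt\<close> does no harm.\<close>

lemma integral_nu:
 assumes \<eta>: "\<eta> \<in> weight_class d d0" and f: "f \<in> borel_measurable borel"
 shows "(LINT r:{0..pi}|lebesgue. f r * \<eta> r) = (\<integral>r. f r / wt r \<partial>nu \<eta>)"
proof -
 let ?g = "\<lambda>r. indicator {0..pi} r * (wt r * \<eta> r)"
 note g = nu_density_measurable[OF \<eta>]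
 have fw: "(\<lambda>r. f r / wt r) \<in> borel_measurable borel" using f by measurable
 then have fwl: "(\<lambda>r. f r / wt r) \<in> borel_measurable lebesgue" by (intro measurable_completion) simp
 have "(\<integral>r. f r / wt r \<partial>nu \<eta>) = (\<integral>r. f r / wt r \<partial>density lebesgue (\<lambda>r. ennreal (?g r)))"
  unfolding nu_def using fw id_lebesgue_measurable by (subst integral_distr) (auto simp: measurable_def)
 also have "\<dots> = (\<integral>r. ?g r * (f r / wt r) \<partial>lebesgue)" using integral_density[OF fwl g(1)] g(3) by simp
 also have "\<dots> = (\<integral>r. indicat_real {0..pi} r *\<^sub>R (f r * \<eta> r) \<partial>lebesgue)"
 proof (rule integral_cong_AE)
  show "(\<lambda>r. ?g r * (f r / wt r)) \<in> borel_measurable lebesgue" using g(1) fwl by measurable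
  have e: "\<eta> \<in> borel_measurable (lebesgue_on {0..pi})" using \<eta> by (simp add: weight_class_def)
  then have "(\<lambda>r. indicat_real {0..pi} r *\<^sub>R \<eta> r) \<in> borel_measurable lebesgue"
   by (subst (asm) borel_measurable_restrict_space_iff) auto
  moreover have "f \<in> borel_measurable lebesgue" using f by (intro measurable_completion) simp
  ultimately have "(\<lambda>r. f r * (indicat_real {0..pi} r *\<^sub>R \<eta> r)) \<in> borel_measurable lebesgue" by measurable
  then show "(\<lambda>r. indicat_real {0..pi} r *\<^sub>R (f r * \<eta> r)) \<in> borel_measurable lebesgue" by (simp add: mult_ac)
  show "AE r in lebesgue. ?g r * (f r / wt r) = indicat_real {0..pi} r *\<^sub>R (f r * \<eta> r)"
   using AE_interior by eventually_elim (auto simp: indicator_def)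
 qed
 finally show ?thesis by (simp add: set_lebesgue_integral_def)
qed

lemma AE_nu:
 assumes \<eta>: "\<eta> \<in> weight_class d d0" and "\<And>r. r \<in> {0<..<pi} \<Longrightarrow> P r" and P: "Measurable.pred borel P"
 shows "AE r in nu \<eta>. P r"
proof -
 note g = nu_density_measurable[OF \<eta>]
 have [measurable]: "(\<lambda>r. ennreal (indicator {0..pi} r * (wt r * \<eta> r))) \<in> borel_measurable lebesgue" using g(1) by measurable
 have m: "(\<lambda>r. r) \<in> measurable (density lebesgue (\<lambda>r. ennreal (indicator {0..pi} r * (wt r * \<eta> r)))) borel"
  using id_lebesgue_measurable by (simp add: measurable_def)
 have "{0, pi} \<in> null_sets lebesgue" by (simp add: finite_imp_null_set_lborel null_sets_completionI)
 then have "AE r in lebesgue. r \<notin> {0, pi}" by (rule AE_not_in)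
 then have "AE r in lebesgue. 0 < ennreal (indicator {0..pi} r * (wt r * \<eta> r)) \<longrightarrow> P r"
 proof eventually_elim
  case (elim r)
  then show ?case using assms(2)[of r] by (auto simp: indicator_def)
 qed
 then show ?thesis unfolding nu_def using P m by (subst AE_distr_iff) (auto simp: AE_density pred_def)
qed

lemma nu_integrable:
 assumes \<eta>: "\<eta> \<in> weight_class d d0" and f: "f \<in> borel_measurable borel"
  and K: "\<And>r. r \<in> {0<..<pi} \<Longrightarrow> \<bar>f r\<bar> \<le> K * wt r" shows "integrable (nu \<eta>) (\<lambda>r. f r / wt r)"
proof -
 interpret finite_measure "nu \<eta>" by (rule finite_measure_nu[OF \<eta>])
 note [measurable] = f
 have "AE r in nu \<eta>. \<bar>f r / wt r\<bar> \<le> K"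
 proof (rule AE_nu[OF \<eta>])
  show "\<bar>f r / wt r\<bar> \<le> K" if "r \<in> {0<..<pi}" for r using K[OF that] wt_pos[OF that] by (simp add: abs_divide pos_divide_le_eq)
  show "Measurable.pred borel (\<lambda>r. \<bar>f r / wt r\<bar> \<le> K)" by measurable
 qed
 then show ?thesis by (intro integrable_const_bound[where B=K]) auto
qed

text \<open>The factor \<open>wt r\<close> is what makes differences of balls integrable against
  \<open>\<eta>\<close>. Up to \<open>pi/2\<close> the sine grows, so the shell just inside radius r
  has density at most of order \<open>wt r\<close>; beyond \<open>pi/2\<close> the cosine decreases,
  so the shell just outside has. Hence the disjunction.\<close>

lemma wt_shell:
 obtains K where "K > 0"
  "\<And>r \<delta>. r \<in> {0..pi} \<Longrightarrow> 0 \<le> \<delta> \<Longrightarrow>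
    measure law {r - \<delta>..<r} \<le> K * \<delta> * wt r \<or> measure law {r..<r + \<delta>} \<le> K * \<delta> * wt r"
proof -
 define m where "m = min (cos (pi/4) ^ (d0 - 1)) (sin (pi/4) ^ (d - 1))"
 have m: "m > 0" unfolding m_def by (simp add: cos_45 sin_45)
 define K where "K = 1 / (mass * m)"
 have K: "K > 0" unfolding K_def using m mass_pos by simp
 have meas: "measure law {\<alpha>..<\<beta>} \<le> (\<beta> - \<alpha>) * c / mass"
  if ab: "\<alpha> \<le> \<beta>" and c: "\<And>u. u \<in> {\<alpha>..<\<beta>} \<Longrightarrow> u \<in> {0..pi} \<Longrightarrow> wt u \<le> c" "0 \<le> c" for \<alpha> \<beta> c
 proof -
  have i: "integrable lborel (\<lambda>u. indicator {\<alpha>..<\<beta>} u * c)"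
   by (intro integrable_mult_left integrable_real_indicator) (simp_all add: emeasure_lborel_Ico[OF ab])
  have "measure law {\<alpha>..<\<beta>} = (\<integral>u. indicator {\<alpha>..<\<beta>} u \<partial>law)" by simp
  also have "\<dots> = (LBINT u:{0..pi}. wt u * indicator {\<alpha>..<\<beta>} u) / mass" by (rule integral_law) simp
  also have "\<dots> \<le> (\<integral>u. indicator {\<alpha>..<\<beta>} u * c \<partial>lborel) / mass"
  proof (rule divide_right_mono)
   show "(LBINT u:{0..pi}. wt u * indicator {\<alpha>..<\<beta>} u) \<le> (\<integral>u. indicator {\<alpha>..<\<beta>} u * c \<partial>lborel)"
    unfolding set_lebesgue_integral_def
   proof (rule integral_mono')
    fix u
    show "indicat_real {0..pi} u *\<^sub>R (wt u * indicator {\<alpha>..<\<beta>} u) \<le> indicator {\<alpha>..<\<beta>} u * c"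
    proof (cases "u \<in> {\<alpha>..<\<beta>} \<and> u \<in> {0..pi}")
     case True
     then have "wt u \<le> c" by (intro c(1)) auto
     with True show ?thesis by simp
    next
     case False
     with c(2) show ?thesis by (auto simp: indicator_def)
    qed
    show "0 \<le> indicator {\<alpha>..<\<beta>} u * c" using c(2) by simp
   qed (rule i)
  qed (use mass_pos in simp)
  also have "(\<integral>u. indicator {\<alpha>..<\<beta>} u * c \<partial>lborel) = (\<beta> - \<alpha>) * c" using ab by simp
  finally show ?thesis .
 qed
 have fin: "\<delta> * c / mass \<le> K * \<delta> * wt r" if "c * m \<le> wt r" "0 \<le> \<delta>" for c \<delta> r
 proof -
  have "\<delta> * c / mass = \<delta> * (c * m) / (mass * m)" using m by simp
  also have "\<dots> \<le> \<delta> * wt r / (mass * m)" using that m mass_pos by (intro divide_right_mono mult_left_mono) auto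
  finally show ?thesis unfolding K_def by simp
 qed
 show ?thesis
 proof (rule that[OF K])
  fix r \<delta> :: real assume r: "r \<in> {0..pi}" and \<delta>: "0 \<le> \<delta>"
  have sc: "0 \<le> sin (r/2)" "0 \<le> cos (r/2)" using r by (auto intro!: sin_ge_zero cos_ge_zero)
  show "measure law {r - \<delta>..<r} \<le> K * \<delta> * wt r \<or> measure law {r..<r + \<delta>} \<le> K * \<delta> * wt r"
  proof (cases "r \<le> pi / 2")
   case True
   have "wt u \<le> sin (r/2) ^ (d - 1)" if "u \<in> {r - \<delta>..<r}" "u \<in> {0..pi}" for u
   proof -
    have u: "0 \<le> sin (u/2)" "0 \<le> cos (u/2)" "sin (u/2) \<le> sin (r/2)"
     using that r True by (auto intro!: sin_ge_zero cos_ge_zero sin_monotone_2pi_le)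
    then have "wt u \<le> sin (r/2) ^ (d - 1) * 1" unfolding wt_def by (intro mult_mono power_mono power_le_one) auto
    then show ?thesis by simp
   qed
   then have "measure law {r - \<delta>..<r} \<le> (r - (r - \<delta>)) * sin (r/2) ^ (d - 1) / mass" using sc \<delta> by (intro meas) auto
   also have "\<dots> = \<delta> * sin (r/2) ^ (d - 1) / mass" by simp
   also have "\<dots> \<le> K * \<delta> * wt r"
   proof (rule fin[OF _ \<delta>])
    have "cos (pi/4) \<le> cos (r/2)" using r True by (intro cos_monotone_0_pi_le) auto
    then have "cos (pi/4) ^ (d0 - 1) \<le> cos (r/2) ^ (d0 - 1)" by (intro power_mono) (auto simp: cos_45)
    then have "m \<le> cos (r/2) ^ (d0 - 1)" unfolding m_def by simp
    then show "sin (r/2) ^ (d - 1) * m \<le> wt r" unfolding wt_def using sc by (intro mult_left_mono) auto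
   qed
   finally show ?thesis ..
  next
   case False
   have "wt u \<le> cos (r/2) ^ (d0 - 1)" if "u \<in> {r..<r + \<delta>}" "u \<in> {0..pi}" for u
   proof -
    have u: "0 \<le> sin (u/2)" "0 \<le> cos (u/2)" "cos (u/2) \<le> cos (r/2)"
     using that r False by (auto intro!: sin_ge_zero cos_ge_zero cos_monotone_0_pi_le)
    then have "wt u \<le> 1 * cos (r/2) ^ (d0 - 1)" unfolding wt_def by (intro mult_mono power_mono power_le_one) auto
    then show ?thesis by simp
   qed
   then have "measure law {r..<r + \<delta>} \<le> (r + \<delta> - r) * cos (r/2) ^ (d0 - 1) / mass" using sc \<delta> by (intro meas) auto
   also have "\<dots> = \<delta> * cos (r/2) ^ (d0 - 1) / mass" by simp
   also have "\<dots> \<le> K * \<delta> * wt r"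
   proof (rule fin[OF _ \<delta>])
    have "sin (pi/4) \<le> sin (r/2)" using r False by (intro sin_monotone_2pi_le) auto
    then have "sin (pi/4) ^ (d - 1) \<le> sin (r/2) ^ (d - 1)" by (intro power_mono) (auto simp: sin_45)
    then have "m \<le> sin (r/2) ^ (d - 1)" unfolding m_def by simp
    then have "m * cos (r/2) ^ (d0 - 1) \<le> wt r" unfolding wt_def using sc by (intro mult_right_mono) auto
    then show "cos (r/2) ^ (d0 - 1) * m \<le> wt r" by (simp add: mult.commute)
   qed
   finally show ?thesis ..
  qed
 qed
qed

end

section \<open>Triangle inequality, volumes and overlaps of balls\<close>

context two_point_space begin

text \<open>Normalise to x = \<open>e 0\<close> and z = \<open>e \<phi>\<close>, so
  \<open>\<theta> x z = 2 * \<phi>\<close>. As \<open>w^2 \<le> a * b\<close>, the form at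
  \<open>e \<phi>\<close> is at most \<open>(cos \<phi> * sqrt a + sin \<phi> * sqrt b)^2\<close>;
  with \<open>sqrt a = cos \<beta>\<close> and \<open>b \<le> 1 - a\<close> this is at most
  \<open>(cos (\<phi> - \<beta>))^2\<close>, the value for three points on one geodesic.\<close>

lemma theta_triangle_diff:
 assumes x: "x \<in> Q" and y: "y \<in> Q" and z: "z \<in> Q" shows "\<bar>\<theta> x z - \<theta> x y\<bar> \<le> \<theta> z y"
proof -
 obtain g \<phi> where g: "isometry_of Q \<theta> g" "0 \<le> \<phi>" "\<phi> \<le> pi/2" "g x = e 0" "g z = e \<phi>" using normal[OF x z] by blast
 define y' where "y' = g y"
 have y': "y' \<in> Q" unfolding y'_def by (rule isometry_in[OF g(1) y])
 define \<beta> where "\<beta> = \<theta> x y / 2"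
 have \<beta>: "0 \<le> \<beta>" "\<beta> \<le> pi/2" using theta_range[OF x y] unfolding \<beta>_def by auto
 have "T x z = (cos \<phi>)^2" using isometry_T[OF g(1) x z] T_e0_e[of \<phi>] by (simp add: g T_sym)
 then have "sqrt (T x z) = cos \<phi>" using g cos_ge_zero[of \<phi>] by simp
 then have xz: "\<theta> x z = 2 * \<phi>" using g by (simp add: theta_eq[OF x z] arccos_cos)
 have "T x y = a y'" using isometry_T[OF g(1) x y] by (simp add: g y'_def)
 then have A: "sqrt (a y') = cos \<beta>" using sqrt_T[OF x y] unfolding \<beta>_def by simp
 have "sqrt (b y') \<le> sqrt (1 - a y')" using a_b_le[OF y'] by simp
 also have "\<dots> = sqrt ((sin \<beta>)^2)"
 proof -
  have "a y' = (cos \<beta>)^2" unfolding A[symmetric] using T_ge_0[OF e_in y'] by simp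
  then show ?thesis unfolding sin_squared_eq by (simp only:)
 qed
 also have "\<dots> = sin \<beta>" using \<beta> sin_ge_zero[of \<beta>] by simp
 finally have B: "sqrt (b y') \<le> sin \<beta>" .
 have "\<bar>w y'\<bar> \<le> sqrt (a y' * b y')" by (rule real_le_rsqrt) (use w_square_le[OF y'] in simp)
 then have w: "w y' \<le> sqrt (a y') * sqrt (b y')" by (simp add: real_sqrt_mult)
 have c: "0 \<le> cos \<phi>" "0 \<le> sin \<phi>" using g by (auto intro!: cos_ge_zero sin_ge_zero)
 have sq: "a y' = (sqrt (a y'))^2" "b y' = (sqrt (b y'))^2" using T_ge_0[OF e_in y'] by simp_all
 have "T z y = T (e \<phi>) y'" using isometry_T[OF g(1) z y] by (simp add: g y'_def)
 also have "\<dots> = (cos \<phi>)^2 * a y' + (sin \<phi>)^2 * b y' + 2 * cos \<phi> * sin \<phi> * w y'" by (rule plane_T[OF y'])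
 also have "\<dots> \<le> (cos \<phi>)^2 * a y' + (sin \<phi>)^2 * b y' + 2 * cos \<phi> * sin \<phi> * (sqrt (a y') * sqrt (b y'))"
  using w c by (intro add_left_mono mult_left_mono) auto
 also have "\<dots> = (cos \<phi> * sqrt (a y') + sin \<phi> * sqrt (b y'))^2"
 proof -
  have "p^2 * X^2 + q^2 * Y^2 + 2 * p * q * (X * Y) = (p * X + q * Y)^2" for p q X Y :: real
   by (simp add: power2_eq_square algebra_simps)
  from this[of "cos \<phi>" "sqrt (a y')" "sin \<phi>" "sqrt (b y')"] show ?thesis unfolding sq[symmetric] .
 qed
 finally have "sqrt (T z y) \<le> cos \<phi> * sqrt (a y') + sin \<phi> * sqrt (b y')" using c T_ge_0[OF e_in y'] by (intro real_le_lsqrt) auto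
 also have "\<dots> \<le> cos \<phi> * cos \<beta> + sin \<phi> * sin \<beta>" unfolding A using B c by (intro add_left_mono mult_left_mono) auto
 also have "\<dots> = cos \<bar>\<phi> - \<beta>\<bar>" by (simp add: cos_diff)
 finally have "cos (\<theta> z y / 2) \<le> cos \<bar>\<phi> - \<beta>\<bar>" using sqrt_T[OF z y] by simp
 then have "\<bar>\<phi> - \<beta>\<bar> \<le> \<theta> z y / 2" using g \<beta> theta_range[OF z y] by (subst (asm) cos_mono_le_eq) auto
 then show ?thesis unfolding xz \<beta>_def abs_le_iff by linarith
qed

lemma theta_triangle: "x \<in> Q \<Longrightarrow> y \<in> Q \<Longrightarrow> z \<in> Q \<Longrightarrow> \<theta> x z \<le> \<theta> x y + \<theta> y z"
 using theta_triangle_diff[of x y z] theta_sym[of y z] by simp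

text \<open>The indicator of a ball as a function of T, so that zonal convolution applies to
  it.\<close>

definition chi :: "real \<Rightarrow> real \<Rightarrow> real" where
 "chi r t = (if (cos (r/2))^2 < t then 1 else 0)"

definition vol :: "real \<Rightarrow> real" where "vol r = (\<integral>y. chi r (a y) \<partial>\<mu>)"

definition overlap :: "real \<Rightarrow> 'a \<Rightarrow> 'a \<Rightarrow> real" where
 "overlap r x z = (\<integral>y. chi r (T x y) * chi r (T z y) \<partial>\<mu>)"

lemma chi_range [simp]: "0 \<le> chi r t" "chi r t \<le> 1" "\<bar>chi r t\<bar> \<le> 1" "chi r t * chi r t = chi r t" by (auto simp: chi_def)

lemma cos_half_measurable [measurable]: "(\<lambda>r::real. (cos (r/2))^2) \<in> borel_measurable borel"
 by (intro borel_measurable_continuous_onI continuous_intros) auto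

lemma chi_measurable2 [measurable]:
 assumes f: "f \<in> borel_measurable N" and g: "g \<in> borel_measurable N" shows "(\<lambda>x. chi (f x) (g x)) \<in> borel_measurable N"
proof -
 have [measurable]: "(\<lambda>x. (cos (f x / 2))^2) \<in> borel_measurable N" by (rule measurable_compose[OF f cos_half_measurable])
 note [measurable] = g
 show ?thesis unfolding chi_def by measurable
qed

lemma chi_measurable [measurable]: "chi r \<in> borel_measurable borel" by (rule chi_measurable2) measurable

lemma chi_theta: "x \<in> Q \<Longrightarrow> y \<in> Q \<Longrightarrow> r \<in> {0..pi} \<Longrightarrow> chi r (T x y) = (if \<theta> x y < r then 1 else 0)"
 by (simp add: chi_def theta_less_iff)

lemma integral_chi: "x \<in> Q \<Longrightarrow> (\<integral>y. chi r (T x y) \<partial>\<mu>) = vol r"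
 unfolding vol_def by (rule zonal_integral[OF _ chi_measurable])

lemma chi_integrable [simp]: "integrable \<mu> (\<lambda>y. chi r (T x y))" "integrable \<mu> (\<lambda>y. chi r (T x y) * chi r (T z y))"
proof -
 have m: "(\<lambda>y. chi r (T x y)) \<in> borel_measurable \<mu>" for x by (rule measurable_compose[OF T_measurable chi_measurable])
 show "integrable \<mu> (\<lambda>y. chi r (T x y))" by (rule bounded_integrable[where B=1]) (rule m, simp)
 have "\<bar>chi r s * chi r t\<bar> \<le> 1" for s t by (simp add: chi_def)
 then show "integrable \<mu> (\<lambda>y. chi r (T x y) * chi r (T z y))" by (intro bounded_integrable[where B=1] borel_measurable_times m)
qed

lemma geo_ball_subset: "geo_ball Q \<theta> r x \<subseteq> Q" by (auto simp: geo_ball_def)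

lemma measure_ball: "x \<in> Q \<Longrightarrow> r \<in> {0..pi} \<Longrightarrow> measure \<mu> (geo_ball Q \<theta> r x) = vol r"
proof -
 assume x: "x \<in> Q" and r: "r \<in> {0..pi}"
 have "measure \<mu> (geo_ball Q \<theta> r x) = (\<integral>y. indicator (geo_ball Q \<theta> r x) y \<partial>\<mu>)"
  using geo_ball_subset[of r x] by (simp add: Int_absorb2)
 also have "\<dots> = (\<integral>y. chi r (T x y) \<partial>\<mu>)"
  using x r by (intro bochner_cong) (auto simp: chi_theta geo_ball_def indicator_def theta_sym)
 finally show ?thesis using integral_chi[OF x] by simp
qed

lemma measure_ball_inter:
 "x \<in> Q \<Longrightarrow> z \<in> Q \<Longrightarrow> r \<in> {0..pi} \<Longrightarrow> measure \<mu> (geo_ball Q \<theta> r x \<inter> geo_ball Q \<theta> r z) = overlap r x z"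
proof -
 assume x: "x \<in> Q" and z: "z \<in> Q" and r: "r \<in> {0..pi}"
 let ?S = "geo_ball Q \<theta> r x \<inter> geo_ball Q \<theta> r z"
 have "?S \<in> sets \<mu>" using x z by (intro sets.Int geo_ball_sets)
 then have "measure \<mu> ?S = (\<integral>y. indicator ?S y \<partial>\<mu>)" using geo_ball_subset[of r x] by (simp add: Int_absorb2 le_infI1)
 also have "\<dots> = overlap r x z" unfolding overlap_def
  using x z r by (intro bochner_cong) (auto simp: chi_theta geo_ball_def indicator_def theta_sym)
 finally show ?thesis .
qed

lemma symdiff_metric_r_eq:
 assumes x: "x \<in> Q" and z: "z \<in> Q" and r: "r \<in> {0..pi}" shows "symdiff_metric_r Q \<theta> \<mu> r x z = vol r - overlap r x z"
proof -
 let ?A = "geo_ball Q \<theta> r x" and ?B = "geo_ball Q \<theta> r z"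
 have s [measurable]: "?A \<in> sets \<mu>" "?B \<in> sets \<mu>" using x z geo_ball_sets by auto
 have "measure \<mu> ((?A - ?B) \<union> (?B - ?A)) = measure \<mu> (?A - ?B) + measure \<mu> (?B - ?A)" by (rule \<mu>.finite_measure_Union) auto
 also have "measure \<mu> (?A - ?B) = measure \<mu> ?A - measure \<mu> (?A \<inter> ?B)" by (rule \<mu>.finite_measure_Diff') auto
 also have "measure \<mu> (?B - ?A) = measure \<mu> ?B - measure \<mu> (?B \<inter> ?A)" by (rule \<mu>.finite_measure_Diff') auto
 finally show ?thesis unfolding symdiff_metric_r_def
  using measure_ball[OF x r] measure_ball[OF z r] measure_ball_inter[OF x z r] by (simp add: Int_commute)
qed

text \<open>The difference of the balls around x and z lies in the shell of width
  \<open>\<theta> x z\<close> inside the first ball and also in the one outside the second;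
  whichever of the two \<open>wt_shell\<close> controls can be used. For the second claim
  \<open>v - v * v\<close> is at most both \<open>v\<close> and \<open>1 - v\<close>, and wide
  shells contain the ball and its complement.\<close>

lemma overlap_bound: "\<exists>K>0.
  (\<forall>x\<in>Q. \<forall>z\<in>Q. \<forall>r\<in>{0..pi}. 0 \<le> vol r - overlap r x z \<and> vol r - overlap r x z \<le> K * \<theta> x z * wt r) \<and>
  (\<forall>r\<in>{0..pi}. 0 \<le> vol r - vol r * vol r \<and> vol r - vol r * vol r \<le> K * pi * wt r)"
proof -
 obtain K where K: "K > 0" "\<And>r \<delta>. r \<in> {0..pi} \<Longrightarrow> 0 \<le> \<delta> \<Longrightarrow>
    measure law {r - \<delta>..<r} \<le> K * \<delta> * wt r \<or> measure law {r..<r + \<delta>} \<le> K * \<delta> * wt r"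
  using wt_shell by metis
 have Ico: "{p..<q :: real} \<in> sets borel" for p q by simp
 have lawm: "measure law S = measure \<mu> {y \<in> Q. \<theta> x y \<in> S}" if "x \<in> Q" "S \<in> sets borel" for x S
 proof -
  have "measure law S = measure \<mu> (\<theta> x -` S \<inter> space \<mu>)"
   unfolding distr_theta[OF that(1), symmetric] using that by (subst measure_distr) (auto intro: theta_measurable)
  also have "\<theta> x -` S \<inter> space \<mu> = {y \<in> Q. \<theta> x y \<in> S}" by auto
  finally show ?thesis .
 qed
 have meas: "{y \<in> Q. \<theta> x y \<in> S} \<in> sets \<mu>" if "x \<in> Q" "S \<in> sets borel" for x S
 proof -
  have "{y \<in> Q. \<theta> x y \<in> S} = \<theta> x -` S \<inter> space \<mu>" by auto
  then show ?thesis using measurable_sets[OF theta_measurable[OF that(1)] that(2)] by simp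
 qed
 have 1: "0 \<le> vol r - overlap r x z \<and> vol r - overlap r x z \<le> K * \<theta> x z * wt r"
  if xz: "x \<in> Q" "z \<in> Q" and r: "r \<in> {0..pi}" for x z r
 proof -
  let ?A = "geo_ball Q \<theta> r x" and ?B = "geo_ball Q \<theta> r z" and ?\<delta> = "\<theta> x z"
  have s [measurable]: "?A \<in> sets \<mu>" "?B \<in> sets \<mu>" using xz geo_ball_sets by auto
  have eq: "vol r - overlap r x z = measure \<mu> (?A - ?B)"
   using \<mu>.finite_measure_Diff'[OF s] measure_ball[OF xz(1) r] measure_ball_inter[OF xz r] by simp
  have \<delta>: "0 \<le> ?\<delta>" using theta_range[OF xz] by simp
  have "measure \<mu> (?A - ?B) \<le> measure law {r - ?\<delta>..<r}" unfolding lawm[OF xz(1) Ico]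
  proof (rule \<mu>.finite_measure_mono[OF subsetI meas[OF xz(1)]])
   fix y assume "y \<in> ?A - ?B"
   then have y: "y \<in> Q" "\<theta> x y < r" "r \<le> \<theta> z y" using xz theta_sym by (auto simp: geo_ball_def)
   then show "y \<in> {y \<in> Q. \<theta> x y \<in> {r - ?\<delta>..<r}}" using theta_triangle[of z x y] theta_sym[of x z] xz by auto
  qed simp
  moreover have "measure \<mu> (?A - ?B) \<le> measure law {r..<r + ?\<delta>}" unfolding lawm[OF xz(2) Ico]
  proof (rule \<mu>.finite_measure_mono[OF subsetI meas[OF xz(2)]])
   fix y assume "y \<in> ?A - ?B"
   then have y: "y \<in> Q" "\<theta> x y < r" "r \<le> \<theta> z y" using xz theta_sym by (auto simp: geo_ball_def)
   then show "y \<in> {y \<in> Q. \<theta> z y \<in> {r..<r + ?\<delta>}}" using theta_triangle[of z x y] theta_sym[of x z] xz by auto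
  qed simp
  ultimately show ?thesis unfolding eq using K(2)[OF r \<delta>] by (auto intro: order_trans)
 qed
 have v01: "0 \<le> vol r" "vol r \<le> 1" for r
 proof -
  show "0 \<le> vol r" unfolding vol_def by (intro bochner_nonneg) simp
  have "vol r \<le> (\<integral>y. 1 \<partial>\<mu>)" unfolding vol_def by (intro integral_mono) auto
  then show "vol r \<le> 1" using \<mu>.prob_space by simp
 qed
 \<comment> \<open>Shells of width \<open>2 * pi\<close>, since the half-open shell of width pi
   outside r = 0 would miss the distance pi; this costs the factor 2.\<close>
 have 2: "0 \<le> vol r - vol r * vol r \<and> vol r - vol r * vol r \<le> 2 * K * pi * wt r" if r: "r \<in> {0..pi}" for r
 proof
  show "0 \<le> vol r - vol r * vol r" using v01[of r] by (simp add: mult_left_le)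
  have pi2: "pi < r + 2 * pi" using pi_gt_zero conjunct1[OF r[unfolded atLeastAtMost_iff]] by linarith
  have "vol r = measure \<mu> (geo_ball Q \<theta> r (e 0))" using measure_ball[OF e_in r] by simp
  also have "\<dots> \<le> measure law {r - 2 * pi..<r}" unfolding lawm[OF e_in[of 0] Ico]
  proof (rule \<mu>.finite_measure_mono[OF subsetI meas[OF e_in]])
   fix y assume "y \<in> geo_ball Q \<theta> r (e 0)"
   then show "y \<in> {y \<in> Q. \<theta> (e 0) y \<in> {r - 2 * pi..<r}}"
    using theta_range[OF e_in[of 0], of y] theta_sym[OF e_in[of 0], of y] pi_gt_zero r by (auto simp: geo_ball_def)
  qed simp
  finally have v1: "vol r \<le> measure law {r - 2 * pi..<r}" .
  have "1 - vol r = measure \<mu> (space \<mu> - geo_ball Q \<theta> r (e 0))"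
   using \<mu>.prob_compl[OF geo_ball_sets[OF e_in[of 0], of r]] measure_ball[OF e_in r] by simp
  also have "\<dots> \<le> measure law {r..<r + 2 * pi}" unfolding lawm[OF e_in[of 0] Ico]
  proof (rule \<mu>.finite_measure_mono[OF subsetI meas[OF e_in]])
   fix y assume "y \<in> space \<mu> - geo_ball Q \<theta> r (e 0)"
   then show "y \<in> {y \<in> Q. \<theta> (e 0) y \<in> {r..<r + 2 * pi}}"
    using theta_range[OF e_in[of 0], of y] theta_sym[OF e_in[of 0], of y] by (auto simp: geo_ball_def intro: le_less_trans[OF _ pi2])
  qed simp
  finally have v2: "1 - vol r \<le> measure law {r..<r + 2 * pi}" .
  have "vol r - vol r * vol r \<le> vol r" using v01 by simp
  moreover have "vol r - vol r * vol r \<le> 1 - vol r"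
  proof -
   have "0 \<le> (1 - vol r) * (1 - vol r)" by simp
   then show ?thesis by (simp add: algebra_simps)
  qed
  moreover have "measure law {r - 2 * pi..<r} \<le> 2 * K * pi * wt r \<or> measure law {r..<r + 2 * pi} \<le> 2 * K * pi * wt r"
   using K(2)[OF r, of "2 * pi"] by (simp add: mult_ac)
  ultimately show "vol r - vol r * vol r \<le> 2 * K * pi * wt r" using v1 v2 by linarith
 qed
 have "K * \<theta> x z * wt r \<le> 2 * K * \<theta> x z * wt r" if "x \<in> Q" "z \<in> Q" "r \<in> {0..pi}" for x z r
  using K(1) theta_range[OF that(1,2)] wt_nonneg[of r] that by (intro mult_right_mono) auto
 then have 1: "0 \<le> vol r - overlap r x z \<and> vol r - overlap r x z \<le> 2 * K * \<theta> x z * wt r" if "x \<in> Q" "z \<in> Q" "r \<in> {0..pi}" for x z r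
  using 1[OF that] that by (meson order_trans)
 have "2 * K > 0" using K(1) by simp
 with 1 2 show ?thesis by blast
qed

lemma prob_Q [simp]: "measure \<mu> Q = 1" using \<mu>.prob_space by simp

lemma overlap_measurable_point: "overlap r x \<in> borel_measurable \<mu>"
proof -
 have 1: "(\<lambda>p. T x (snd p)) \<in> borel_measurable (\<mu> \<Otimes>\<^sub>M \<mu>)"
  by (rule measurable_compose[OF measurable_snd T_measurable])
 have 2: "(\<lambda>p. T (fst p) (snd p)) \<in> borel_measurable (\<mu> \<Otimes>\<^sub>M \<mu>)" by (rule T_measurable2) measurable
 have "case_prod (\<lambda>z y. chi r (T x y) * chi r (T z y)) \<in> borel_measurable (\<mu> \<Otimes>\<^sub>M \<mu>)"
  unfolding case_prod_beta using 1 2 by (intro borel_measurable_times chi_measurable2) auto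
 then have "(\<lambda>z. overlap r x z) \<in> borel_measurable \<mu>" unfolding overlap_def by (rule \<mu>.borel_measurable_lebesgue_integral)
 then show ?thesis by simp
qed

lemma overlap_measurable [measurable]: "(\<lambda>r. overlap r x z) \<in> borel_measurable borel"
proof -
 have [measurable]: "(\<lambda>p. T x (snd p)) \<in> borel_measurable (borel \<Otimes>\<^sub>M \<mu>)" for x
  by (rule measurable_compose[OF measurable_snd T_measurable])
 have "case_prod (\<lambda>r y. chi r (T x y) * chi r (T z y)) \<in> borel_measurable (borel \<Otimes>\<^sub>M \<mu>)"
  unfolding case_prod_beta by (intro borel_measurable_times chi_measurable2) measurable
 then show ?thesis unfolding overlap_def by (rule \<mu>.borel_measurable_lebesgue_integral)
qed

lemma vol_measurable [measurable]: "vol \<in> borel_measurable borel"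
proof -
 have "overlap r (e 0) (e 0) = vol r" for r by (simp add: overlap_def vol_def)
 then have "vol = (\<lambda>r. overlap r (e 0) (e 0))" by auto
 then show ?thesis using overlap_measurable[of "e 0" "e 0"] by simp
qed

lemma overlap_sym: "overlap r x z = overlap r z x" by (simp add: overlap_def mult.commute)

text \<open>Point sets with multiplicity are handled as finite sequences, which turns all sums into
  sums over indices.\<close>

definition pts :: "(nat \<Rightarrow> 'a) \<Rightarrow> nat \<Rightarrow> 'a multiset" where
 "pts x N = image_mset x (mset_set {..<N})"

lemma pts_in: "(\<And>i. i < N \<Longrightarrow> x i \<in> Q) \<Longrightarrow> pts x N \<in> point_sets Q N" by (auto simp: pts_def point_sets_def)

lemma point_sets_pts:
 assumes "D \<in> point_sets Q N"
 obtains x where "D = pts x N" "\<And>i. i < N \<Longrightarrow> x i \<in> Q"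
proof -
 obtain xs where xs: "mset xs = D" using ex_mset by blast
 have len: "length xs = N" using assms xs by (auto simp: point_sets_def)
 have "D = mset (map (nth xs) [0..<N])" unfolding xs[symmetric] len[symmetric] by (simp add: map_nth)
 also have "\<dots> = pts (nth xs) N" by (simp add: pts_def mset_map mset_upt atLeast0LessThan)
 finally have "D = pts (nth xs) N" .
 moreover have "xs ! i \<in> Q" if "i < N" for i using assms xs len that nth_mem[of i xs] by (auto simp: point_sets_def)
 ultimately show ?thesis by (rule that)
qed

lemma dist_sum_pts: "dist_sum f (pts x N) = (\<Sum>i<N. \<Sum>j<N. f (x i) (x j))"
 by (simp add: dist_sum_def pts_def sum_unfold_sum_mset image_mset.compositionality o_def)

lemma discrepancy_pts:
 assumes x: "\<And>i. i < N \<Longrightarrow> x i \<in> Q" and y: "y \<in> Q" and r: "r \<in> {0..pi}"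
 shows "discrepancy Q \<theta> \<mu> r y (pts x N) = (\<Sum>i<N. chi r (T (x i) y) - vol r)"
proof -
 have "{#u \<in># pts x N. u \<in> geo_ball Q \<theta> r y#} = image_mset x (mset_set {i \<in> {..<N}. x i \<in> geo_ball Q \<theta> r y})"
  by (simp add: pts_def filter_mset_image_mset filter_mset_mset_set)
 then have "real (size {#u \<in># pts x N. u \<in> geo_ball Q \<theta> r y#}) = real (card {i \<in> {..<N}. x i \<in> geo_ball Q \<theta> r y})" by simp
 also have "\<dots> = (\<Sum>i<N. chi r (T (x i) y))"
 proof -
  have "(\<Sum>i<N. chi r (T (x i) y)) = (\<Sum>i<N. if x i \<in> geo_ball Q \<theta> r y then 1 else 0)"
   using x y r by (intro sum.cong) (auto simp: chi_theta geo_ball_def)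
  then show ?thesis by (simp add: sum.If_cases Int_def)
 qed
 finally show ?thesis unfolding discrepancy_def using measure_ball[OF y r] by (simp add: pts_def sum_subtractf)
qed

lemma overlap_integral:
 assumes "x \<in> Q" "z \<in> Q"
 shows "(\<integral>y. (chi r (T x y) - vol r) * (chi r (T z y) - vol r) \<partial>\<mu>) = overlap r x z - vol r * vol r"
proof -
 have "(\<integral>y. (chi r (T x y) - vol r) * (chi r (T z y) - vol r) \<partial>\<mu>) =
   (\<integral>y. chi r (T x y) * chi r (T z y) - vol r * chi r (T x y) - vol r * chi r (T z y) + vol r * vol r \<partial>\<mu>)"
  by (simp add: algebra_simps)
 also have "\<dots> = overlap r x z - vol r * vol r - vol r * vol r + vol r * vol r"
  using assms by (simp add: overlap_def integral_chi \<mu>.prob_space)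
 finally show ?thesis by simp
qed

lemma chi_vol_integrable: "integrable \<mu> (\<lambda>y. (chi r (T x y) - vol r) * (chi r (T z y) - vol r))"
proof -
 have "(\<lambda>y. (chi r (T x y) - vol r) * (chi r (T z y) - vol r)) =
   (\<lambda>y. chi r (T x y) * chi r (T z y) - vol r * chi r (T x y) - vol r * chi r (T z y) + vol r * vol r)"
  by (simp add: algebra_simps fun_eq_iff)
 then show ?thesis by simp
qed

text \<open>Expand the square: each pair contributes \<open>overlap - vol * vol\<close>, rewritten
  as a difference of two terms that are both of order \<open>wt r\<close> and can be integrated
  separately.\<close>

lemma quad_discrepancy_r_pts:
 assumes x: "\<And>i. i < N \<Longrightarrow> x i \<in> Q" and r: "r \<in> {0..pi}" shows "quad_discrepancy_r Q \<theta> \<mu> r (pts x N) =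
   (real N)^2 * (vol r - vol r * vol r) - (\<Sum>i<N. \<Sum>j<N. vol r - overlap r (x i) (x j))"
  and "quad_discrepancy_r Q \<theta> \<mu> r (pts x N) = (\<integral>y. (\<Sum>i<N. chi r (T (x i) y) - vol r)^2 \<partial>\<mu>)"
proof -
 show "quad_discrepancy_r Q \<theta> \<mu> r (pts x N) = (\<integral>y. (\<Sum>i<N. chi r (T (x i) y) - vol r)^2 \<partial>\<mu>)"
  unfolding quad_discrepancy_r_def using x r by (intro bochner_cong) (auto simp: discrepancy_pts)
 also have "\<dots> = (\<integral>y. (\<Sum>i<N. \<Sum>j<N. (chi r (T (x i) y) - vol r) * (chi r (T (x j) y) - vol r)) \<partial>\<mu>)"
  by (simp add: power2_eq_square sum_product)
 also have "\<dots> = (\<Sum>i<N. \<Sum>j<N. (\<integral>y. (chi r (T (x i) y) - vol r) * (chi r (T (x j) y) - vol r) \<partial>\<mu>))"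
  by (simp add: chi_vol_integrable)
 also have "\<dots> = (\<Sum>i<N. \<Sum>j<N. (vol r - vol r * vol r) - (vol r - overlap r (x i) (x j)))"
  using x by (intro sum.cong) (auto simp: overlap_integral)
 finally show "quad_discrepancy_r Q \<theta> \<mu> r (pts x N) =
   (real N)^2 * (vol r - vol r * vol r) - (\<Sum>i<N. \<Sum>j<N. vol r - overlap r (x i) (x j))"
  by (simp add: sum_subtractf power2_eq_square algebra_simps)
qed

section \<open>The metric of a weight, its mean, and Stolarsky's identity\<close>

context
 fixes \<eta> :: "real \<Rightarrow> real"
 assumes \<eta>: "\<eta> \<in> weight_class d d0"
begin

interpretation nu: finite_measure "nu \<eta>" by (rule finite_measure_nu[OF \<eta>])

abbreviation "rho \<equiv> symdiff_metric Q \<theta> \<mu> \<eta>"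

definition mean_rho :: real where "mean_rho = (\<integral>r. (vol r - vol r * vol r) / wt r \<partial>nu \<eta>)"

lemma rho_eq: "x \<in> Q \<Longrightarrow> z \<in> Q \<Longrightarrow> rho x z = (\<integral>r. (vol r - overlap r x z) / wt r \<partial>nu \<eta>)"
proof -
 assume xz: "x \<in> Q" "z \<in> Q"
 have "rho x z = (LINT r:{0..pi}|lebesgue. (vol r - overlap r x z) * \<eta> r)"
  unfolding symdiff_metric_def by (rule set_lebesgue_integral_cong) (auto simp: symdiff_metric_r_eq xz)
 also have "\<dots> = (\<integral>r. (vol r - overlap r x z) / wt r \<partial>nu \<eta>)" by (rule integral_nu[OF \<eta>]) measurable
 finally show ?thesis .
qed

lemma overlap_nu_integrable:
 "x \<in> Q \<Longrightarrow> z \<in> Q \<Longrightarrow> integrable (nu \<eta>) (\<lambda>r. (vol r - overlap r x z) / wt r)"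
 "integrable (nu \<eta>) (\<lambda>r. (vol r - vol r * vol r) / wt r)"
proof -
 obtain K where K0: "K > 0"
  "\<forall>x\<in>Q. \<forall>z\<in>Q. \<forall>r\<in>{0..pi}. 0 \<le> vol r - overlap r x z \<and> vol r - overlap r x z \<le> K * \<theta> x z * wt r"
  "\<forall>r\<in>{0..pi}. 0 \<le> vol r - vol r * vol r \<and> vol r - vol r * vol r \<le> K * pi * wt r" using overlap_bound by blast
 note K = K0(1) K0(2)[rule_format] K0(3)[rule_format]
 show "integrable (nu \<eta>) (\<lambda>r. (vol r - vol r * vol r) / wt r)"
 proof (rule nu_integrable[OF \<eta>])
  show "\<bar>vol r - vol r * vol r\<bar> \<le> K * pi * wt r" if "r \<in> {0<..<pi}" for r using K(3)[of r] that by simp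
 qed measurable
 assume xz: "x \<in> Q" "z \<in> Q"
 show "integrable (nu \<eta>) (\<lambda>r. (vol r - overlap r x z) / wt r)"
 proof (rule nu_integrable[OF \<eta>])
  show "\<bar>vol r - overlap r x z\<bar> \<le> K * \<theta> x z * wt r" if "r \<in> {0<..<pi}" for r using K(2)[OF xz, of r] that by simp
 qed measurable
qed

text \<open>A Lipschitz bound by the original distance; it will control the diagonal terms of the
  random point selection.\<close>

lemma rho_bound: "\<exists>C>0. \<forall>x\<in>Q. \<forall>z\<in>Q. 0 \<le> rho x z \<and> rho x z \<le> C * \<theta> x z"
proof -
 obtain K where K0: "K > 0"
  "\<forall>x\<in>Q. \<forall>z\<in>Q. \<forall>r\<in>{0..pi}. 0 \<le> vol r - overlap r x z \<and> vol r - overlap r x z \<le> K * \<theta> x z * wt r"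
  using overlap_bound by blast
 note K = K0(1) K0(2)[rule_format]
 let ?m = "measure (nu \<eta>) UNIV"
 have "0 \<le> rho x z \<and> rho x z \<le> (K * (?m + 1)) * \<theta> x z" if xz: "x \<in> Q" "z \<in> Q" for x z
 proof
  have 1: "AE r in nu \<eta>. 0 \<le> (vol r - overlap r x z) / wt r"
  proof (rule AE_nu[OF \<eta>])
   show "0 \<le> (vol r - overlap r x z) / wt r" if "r \<in> {0<..<pi}" for r using K(2)[OF xz, of r] wt_pos[OF that] that by simp
  qed measurable
  then show "0 \<le> rho x z" unfolding rho_eq[OF xz] by (rule integral_nonneg_AE)
  have 2: "AE r in nu \<eta>. (vol r - overlap r x z) / wt r \<le> K * \<theta> x z"
  proof (rule AE_nu[OF \<eta>])
   show "(vol r - overlap r x z) / wt r \<le> K * \<theta> x z" if "r \<in> {0<..<pi}" for r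
    using K(2)[OF xz, of r] wt_pos[OF that] that by (simp add: pos_divide_le_eq)
  qed measurable
  have "rho x z \<le> (\<integral>r. K * \<theta> x z \<partial>nu \<eta>)" unfolding rho_eq[OF xz]
   by (rule integral_mono_AE[OF overlap_nu_integrable(1)[OF xz] _ 2]) simp
  also have "\<dots> = K * \<theta> x z * ?m" by simp
  also have "\<dots> \<le> K * \<theta> x z * (?m + 1)" using K(1) theta_range[OF xz] by (intro mult_left_mono) auto
  finally show "rho x z \<le> (K * (?m + 1)) * \<theta> x z" by (simp add: mult_ac)
 qed
 moreover have "K * (?m + 1) > 0" using K(1) by (intro mult_pos_pos) (auto simp: add_nonneg_pos)
 ultimately show ?thesis by blast
qed

lemma rho_sym: "x \<in> Q \<Longrightarrow> z \<in> Q \<Longrightarrow> rho x z = rho z x" by (simp add: rho_eq overlap_sym)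

lemma overlap_measurable_pair [measurable]:
 "(\<lambda>q. overlap (snd q) (fst (fst q)) (snd (fst q))) \<in> borel_measurable ((\<mu> \<Otimes>\<^sub>M \<mu>) \<Otimes>\<^sub>M nu \<eta>)"
proof -
 let ?P = "(\<mu> \<Otimes>\<^sub>M \<mu>) \<Otimes>\<^sub>M nu \<eta>"
 have [measurable]: "(\<lambda>p. T (fst (fst (fst p))) (snd p)) \<in> borel_measurable (?P \<Otimes>\<^sub>M \<mu>)"
  "(\<lambda>p. T (snd (fst (fst p))) (snd p)) \<in> borel_measurable (?P \<Otimes>\<^sub>M \<mu>)" by (rule T_measurable2; measurable)+
 have [measurable]: "(\<lambda>p. snd (fst p)) \<in> borel_measurable (?P \<Otimes>\<^sub>M \<mu>)" by measurable
 have "case_prod (\<lambda>q y. chi (snd q) (T (fst (fst q)) y) * chi (snd q) (T (snd (fst q)) y)) \<in> borel_measurable (?P \<Otimes>\<^sub>M \<mu>)"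
  unfolding case_prod_beta by (intro borel_measurable_times chi_measurable2) measurable
 then show ?thesis unfolding overlap_def by (rule \<mu>.borel_measurable_lebesgue_integral)
qed

lemma rho_measurable_pair: "case_prod rho \<in> borel_measurable (\<mu> \<Otimes>\<^sub>M \<mu>)"
proof -
 let ?P = "(\<mu> \<Otimes>\<^sub>M \<mu>) \<Otimes>\<^sub>M nu \<eta>"
 have [measurable]: "(\<lambda>q. vol (snd q)) \<in> borel_measurable ?P" "(\<lambda>q. wt (snd q)) \<in> borel_measurable ?P" by measurable
 have "case_prod (\<lambda>p r. (vol r - overlap r (fst p) (snd p)) / wt r) \<in> borel_measurable ?P" unfolding case_prod_beta by measurable
 then have m: "(\<lambda>p. \<integral>r. (vol r - overlap r (fst p) (snd p)) / wt r \<partial>nu \<eta>) \<in> borel_measurable (\<mu> \<Otimes>\<^sub>M \<mu>)"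
  by (rule nu.borel_measurable_lebesgue_integral)
 show ?thesis by (rule measurable_cong[THEN iffD2, OF _ m]) (auto simp: space_pair_measure rho_eq)
qed

lemma discrepancy_density_split:
 "((real N)^2 * (vol r - vol r * vol r) - (\<Sum>i<N. \<Sum>j<N. vol r - overlap r (x i) (x j))) / wt r =
  (real N)^2 * ((vol r - vol r * vol r) / wt r) - (\<Sum>i<N. \<Sum>j<N. (vol r - overlap r (x i) (x j)) / wt r)"
 by (subst diff_divide_distrib) (simp only: sum_divide_distrib times_divide_eq_right)

lemma quad_discrepancy_nu:
 fixes x :: "nat \<Rightarrow> 'a" and N :: nat
 defines "F \<equiv> \<lambda>r. (real N)^2 * (vol r - vol r * vol r) - (\<Sum>i<N. \<Sum>j<N. vol r - overlap r (x i) (x j))"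
 assumes x: "\<And>i. i < N \<Longrightarrow> x i \<in> Q"
 shows "quad_discrepancy Q \<theta> \<mu> \<eta> (pts x N) = (\<integral>r. F r / wt r \<partial>nu \<eta>)" and "integrable (nu \<eta>) (\<lambda>r. F r / wt r)"
proof -
 show "integrable (nu \<eta>) (\<lambda>r. F r / wt r)"
  unfolding F_def discrepancy_density_split using x by (intro Bochner_Integration.integrable_diff integrable_mult_right integral_sum2(1) overlap_nu_integrable) auto
 have "quad_discrepancy Q \<theta> \<mu> \<eta> (pts x N) = (LINT r:{0..pi}|lebesgue. F r * \<eta> r)"
  unfolding quad_discrepancy_def F_def by (rule set_lebesgue_integral_cong) (use x in \<open>auto simp: quad_discrepancy_r_pts\<close>)
 also have "\<dots> = (\<integral>r. F r / wt r \<partial>nu \<eta>)" unfolding F_def by (rule integral_nu[OF \<eta>]) measurable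
 finally show "quad_discrepancy Q \<theta> \<mu> \<eta> (pts x N) = (\<integral>r. F r / wt r \<partial>nu \<eta>)" .
qed

text \<open>The identity for each radius, integrated against \<open>nu \<eta>\<close>; every term is
  integrable by itself because it carries a factor \<open>wt r\<close>.\<close>

theorem stolarsky:
 assumes x: "\<And>i. i < N \<Longrightarrow> x i \<in> Q"
 shows "quad_discrepancy Q \<theta> \<mu> \<eta> (pts x N) = mean_rho * (real N)^2 - dist_sum rho (pts x N)"
proof -
 have "quad_discrepancy Q \<theta> \<mu> \<eta> (pts x N) = (\<integral>r. (real N)^2 * ((vol r - vol r * vol r) / wt r) - (\<Sum>i<N. \<Sum>j<N. (vol r - overlap r (x i) (x j)) / wt r) \<partial>nu \<eta>)"
  unfolding discrepancy_density_split[symmetric] by (rule quad_discrepancy_nu(1)[OF x])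
 also have "\<dots> = (\<integral>r. (real N)^2 * ((vol r - vol r * vol r) / wt r) \<partial>nu \<eta>) -
   (\<integral>r. (\<Sum>i<N. \<Sum>j<N. (vol r - overlap r (x i) (x j)) / wt r) \<partial>nu \<eta>)"
  using x by (intro Bochner_Integration.integral_diff integrable_mult_right integral_sum2(1) overlap_nu_integrable) auto
 also have "(\<integral>r. (real N)^2 * ((vol r - vol r * vol r) / wt r) \<partial>nu \<eta>) = (real N)^2 * mean_rho"
  unfolding mean_rho_def by (rule integral_mult_right_zero)
 also have "(\<integral>r. (\<Sum>i<N. \<Sum>j<N. (vol r - overlap r (x i) (x j)) / wt r) \<partial>nu \<eta>) =
   (\<Sum>i<N. \<Sum>j<N. (\<integral>r. (vol r - overlap r (x i) (x j)) / wt r \<partial>nu \<eta>))"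
  using x by (intro integral_sum2 overlap_nu_integrable) auto
 also have "\<dots> = (\<Sum>i<N. \<Sum>j<N. rho (x i) (x j))"
 proof (intro sum.cong[OF HOL.refl])
  fix i j assume "i \<in> {..<N}" "j \<in> {..<N}"
  then show "(\<integral>r. (vol r - overlap r (x i) (x j)) / wt r \<partial>nu \<eta>) = rho (x i) (x j)" using x by (simp add: rho_eq)
 qed
 finally show ?thesis by (simp add: dist_sum_pts mult.commute)
qed

text \<open>Fubini over radius and point: averaging \<open>overlap r x z\<close> over z gives
  \<open>vol r * vol r\<close>, whatever x is.\<close>

lemma integral_rho: "x \<in> Q \<Longrightarrow> (\<integral>z. rho x z \<partial>\<mu>) = mean_rho"
proof -
 assume x: "x \<in> Q"
 obtain K where K0: "K > 0"
  "\<forall>x\<in>Q. \<forall>z\<in>Q. \<forall>r\<in>{0..pi}. 0 \<le> vol r - overlap r x z \<and> vol r - overlap r x z \<le> K * \<theta> x z * wt r"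
  using overlap_bound by blast
 note K = K0(1) K0(2)[rule_format]
 interpret pr: pair_sigma_finite \<mu> "nu \<eta>" ..
 \<comment> \<open>The cut-off to the open interval gives one bound valid for all r, as
   integrability on the product requires; almost everywhere it changes nothing.\<close>
 define F where "F z r = indicator {0<..<pi} r * ((vol r - overlap r x z) / wt r)" for z r
 have "(\<lambda>q. ((x, fst q), snd q)) \<in> measurable (\<mu> \<Otimes>\<^sub>M nu \<eta>) ((\<mu> \<Otimes>\<^sub>M \<mu>) \<Otimes>\<^sub>M nu \<eta>)"
  by (intro measurable_Pair measurable_const measurable_fst measurable_snd) (use x in simp)
 from measurable_compose[OF this overlap_measurable_pair] have ov: "(\<lambda>q. overlap (snd q) x (fst q)) \<in> borel_measurable (\<mu> \<Otimes>\<^sub>M nu \<eta>)"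
  by simp
 note [measurable] = ov
 have [measurable]: "(\<lambda>q. vol (snd q)) \<in> borel_measurable (\<mu> \<Otimes>\<^sub>M nu \<eta>)" "(\<lambda>q. wt (snd q)) \<in> borel_measurable (\<mu> \<Otimes>\<^sub>M nu \<eta>)"
  "(\<lambda>q. indicator {0<..<pi} (snd q) :: real) \<in> borel_measurable (\<mu> \<Otimes>\<^sub>M nu \<eta>)" by measurable
 have m: "case_prod F \<in> borel_measurable (\<mu> \<Otimes>\<^sub>M nu \<eta>)" unfolding F_def case_prod_beta by measurable
 have b: "\<bar>F z r\<bar> \<le> K * pi" if "z \<in> Q" for z r
 proof (cases "r \<in> {0<..<pi}")
  case True
  have "0 \<le> vol r - overlap r x z \<and> vol r - overlap r x z \<le> K * \<theta> x z * wt r" using True by (intro K(2) x that) auto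
  moreover have "K * \<theta> x z * wt r \<le> K * pi * wt r"
   using theta_range[OF x that] K(1) wt_pos[OF True] by (intro mult_right_mono mult_left_mono) auto
  ultimately have "0 \<le> vol r - overlap r x z" "vol r - overlap r x z \<le> K * pi * wt r" by linarith+
  then show ?thesis using True wt_pos[OF True] by (simp add: F_def pos_divide_le_eq)
 next
  case False
  then show ?thesis using K(1) by (simp add: F_def)
 qed
 interpret f: finite_measure "\<mu> \<Otimes>\<^sub>M nu \<eta>"
  by (rule finite_measure_pair_measure[OF nu.finite_measure_axioms \<mu>.finite_measure_axioms])
 have i: "integrable (\<mu> \<Otimes>\<^sub>M nu \<eta>) (case_prod F)"
  by (rule f.integrable_const_bound[where B="K * pi"]) (use b m in \<open>auto simp: space_pair_measure\<close>)
 have AE: "AE r in nu \<eta>. r \<in> {0<..<pi}" by (rule AE_nu[OF \<eta>]) auto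
 have Fm: "F z \<in> borel_measurable borel" for z unfolding F_def by measurable
 have "(\<integral>z. rho x z \<partial>\<mu>) = (\<integral>z. (\<integral>r. F z r \<partial>nu \<eta>) \<partial>\<mu>)"
 proof (rule bochner_cong)
  fix z assume "z \<in> space \<mu>"
  then have z: "z \<in> Q" by simp
  show "rho x z = (\<integral>r. F z r \<partial>nu \<eta>)" unfolding rho_eq[OF x z]
  proof (rule integral_cong_AE)
   show "F z \<in> borel_measurable (nu \<eta>)" using Fm by measurable
   show "AE r in nu \<eta>. (vol r - overlap r x z) / wt r = F z r" using AE by eventually_elim (simp add: F_def)
  qed measurable
 qed simp
 also have "\<dots> = (\<integral>r. (\<integral>z. F z r \<partial>\<mu>) \<partial>nu \<eta>)" by (rule pr.Fubini_integral[OF i, symmetric])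
 also have "\<dots> = (\<integral>r. indicator {0<..<pi} r * ((vol r - vol r * vol r) / wt r) \<partial>nu \<eta>)"
 proof (rule bochner_cong)
  fix r
  have oi: "integrable \<mu> (\<lambda>z. overlap r x z)"
  proof (rule bounded_integrable[where B=1])
   show "overlap r x \<in> borel_measurable \<mu>" by (rule overlap_measurable_point)
   fix z assume "z \<in> Q"
   have "\<bar>overlap r x z\<bar> \<le> (\<integral>y. 1 \<partial>\<mu>)" unfolding overlap_def
    by (rule order_trans[OF integral_abs_bound]) (intro integral_mono; simp add: abs_mult mult_le_one)
   then show "\<bar>overlap r x z\<bar> \<le> 1" using \<mu>.prob_space by simp
  qed
  have "(\<integral>z. overlap r x z \<partial>\<mu>) = (\<integral>y. (\<integral>z. chi r (T x y) * chi r (T z y) \<partial>\<mu>) \<partial>\<mu>)"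
   unfolding overlap_def
  proof (rule integral_swap)
   have "(\<lambda>p. T x (fst p)) \<in> borel_measurable (\<mu> \<Otimes>\<^sub>M \<mu>)"
    by (rule measurable_compose[OF measurable_fst T_measurable])
   moreover have "(\<lambda>p. T (snd p) (fst p)) \<in> borel_measurable (\<mu> \<Otimes>\<^sub>M \<mu>)" by (rule T_measurable2) measurable
   ultimately show "case_prod (\<lambda>y z. chi r (T x y) * chi r (T z y)) \<in> borel_measurable (\<mu> \<Otimes>\<^sub>M \<mu>)"
    unfolding case_prod_beta by (intro borel_measurable_times chi_measurable2) auto
   show "\<bar>chi r (T x y) * chi r (T z y)\<bar> \<le> 1" for y z by (simp add: abs_mult mult_le_one)
  qed
  also have "\<dots> = (\<integral>y. chi r (T x y) * vol r \<partial>\<mu>)" by (rule bochner_cong) (auto simp: T_sym[of _ "y" for y] integral_chi)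
  also have "\<dots> = vol r * vol r" using integral_chi[OF x] by simp
  finally have "(\<integral>z. overlap r x z \<partial>\<mu>) = vol r * vol r" .
  then have "(\<integral>z. (vol r - overlap r x z) / wt r \<partial>\<mu>) = (vol r - vol r * vol r) / wt r"
   using oi by (simp add: \<mu>.prob_space)
  then show "(\<integral>z. F z r \<partial>\<mu>) = indicator {0<..<pi} r * ((vol r - vol r * vol r) / wt r)"
   unfolding F_def by (simp only: integral_mult_right_zero)
 qed simp
 also have "\<dots> = mean_rho" unfolding mean_rho_def
 proof (rule integral_cong_AE)
  show "AE r in nu \<eta>. indicator {0<..<pi} r * ((vol r - vol r * vol r) / wt r) = (vol r - vol r * vol r) / wt r"
   using AE by eventually_elim simp
 qed measurable
 finally show ?thesis .
qed

lemma mean_dist_rho: "mean_dist \<mu> rho = mean_rho"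
proof -
 have "mean_dist \<mu> rho = (\<integral>x. mean_rho \<partial>\<mu>)" unfolding mean_dist_def by (rule bochner_cong) (auto simp: integral_rho)
 then show ?thesis by (simp add: \<mu>.prob_space)
qed

end

end

section \<open>Lower bound for the discrepancy\<close>

lemma (in jacobi_weight) flux_smult: "flux (smult c q) u = c * flux q u" by (simp add: flux_def pderiv_smult)

lemma (in jacobi_weight) flux_square_le: "\<exists>K. \<forall>r\<in>{0<..<pi}. \<bar>(flux q r)\<^sup>2\<bar> \<le> K * wt r"
proof -
 have "continuous_on {0..1} (poly (pderiv q))" by (intro continuous_intros)
 then have "bounded (poly (pderiv q) ` {0..1})" by (intro compact_imp_bounded compact_continuous_image) auto
 then obtain B where B: "\<forall>x\<in>poly (pderiv q) ` {0..1}. norm x \<le> B" unfolding bounded_iff by blast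
 have "\<bar>(flux q r)\<^sup>2\<bar> \<le> B^2 * wt r" if r: "r \<in> {0<..<pi}" for r
 proof -
  have w: "0 \<le> wt r" "wt r \<le> 1" using wt_pos[OF r] wt_le_1[of r] r by auto
  have p: "\<bar>poly (pderiv q) ((cos (r/2))^2)\<bar> \<le> B" using B by (auto simp: abs_square_le_1)
  have "\<bar>sin (r/2) * cos (r/2)\<bar> \<le> 1" unfolding abs_mult by (intro mult_le_one) auto
  then have "\<bar>sin (r/2) * cos (r/2) * poly (pderiv q) ((cos (r/2))^2)\<bar> \<le> 1 * B"
   unfolding abs_mult[of "sin (r/2) * cos (r/2)"] using p by (intro mult_mono) auto
  then have "\<bar>flux q r\<bar> \<le> wt r * B" unfolding flux_eq_wt abs_mult[of "wt r"] using w by (simp add: mult_left_mono)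
  then have "(flux q r)^2 \<le> (wt r * B)^2" by (metis abs_ge_zero power2_abs power_mono)
  also have "\<dots> = B^2 * wt r * wt r" by (simp add: power2_eq_square)
  also have "\<dots> \<le> B^2 * wt r * 1" using w by (intro mult_left_mono) auto
  finally show ?thesis by simp
 qed
 then show ?thesis by blast
qed

lemma (in jacobi_weight) flux_measurable [measurable]: "flux q \<in> borel_measurable borel"
 unfolding flux_def[abs_def] by (intro borel_measurable_continuous_onI continuous_intros) auto

context two_point_space begin

definition ball_coeff :: "nat \<Rightarrow> real \<Rightarrow> real" where
 "ball_coeff l r = (\<integral>y. chi r (a y) * poly (jac l) (a y) \<partial>\<mu>)"

text \<open>By the law of the distance the coefficient is an integral of \<open>wt\<close> times the
  polynomial over \<open>[0, r]\<close>, which \<open>integral_wt_jac0\<close> evaluates as a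
  boundary value.\<close>

lemma ball_coeff_eq:
 assumes l: "l \<ge> 1" and r: "r \<in> {0..pi}" shows "ball_coeff l r = - flux (jac l) r / (ev l * mass)"
proof -
 let ?p = "\<lambda>u. poly (jac l) ((cos (u/2))^2)"
 let ?h = "\<lambda>u. indicator {..<r} u * ?p u"
 have "ball_coeff l r = (\<integral>y. ?h (\<theta> (e 0) y) \<partial>\<mu>)" unfolding ball_coeff_def
 proof (rule bochner_cong)
  fix y assume "y \<in> space \<mu>"
  then have y: "y \<in> Q" by simp
  show "chi r (a y) * poly (jac l) (a y) = ?h (\<theta> (e 0) y)" unfolding chi_theta[OF e_in y r] unfolding T_eq[OF e_in y] by simp
 qed simp
 also have "\<dots> = (\<integral>u. ?h u \<partial>law)" by (rule integral_theta[OF e_in]) measurable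
 also have "\<dots> = (LBINT u:{0..pi}. wt u * ?h u) / mass" by (rule integral_law) measurable
 also have "(LBINT u:{0..pi}. wt u * ?h u) = (LBINT u:{0..r}. wt u * ?p u)" unfolding set_lebesgue_integral_def
 proof (rule integral_cong_AE)
  have "AE u in lborel. u \<noteq> r" by (rule AE_lborel_singleton)
  then show "AE u in lborel. indicat_real {0..pi} u *\<^sub>R (wt u * ?h u) = indicat_real {0..r} u *\<^sub>R (wt u * ?p u)"
   by eventually_elim (use r in \<open>auto simp: indicator_def\<close>)
 qed measurable
 also have "\<dots> = (LBINT u:{0..r}. 1 / poly (jac0 l) 1 * (wt u * poly (jac0 l) ((cos (u/2))^2)))" by (simp add: jac_def)
 also have "\<dots> = 1 / poly (jac0 l) 1 * (LBINT u:{0..r}. wt u * poly (jac0 l) ((cos (u/2))^2))" by (rule set_integral_mult_right)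
 also have "\<dots> = - flux (jac l) r / ev l" using integral_wt_jac0[OF l, of r] r by (simp add: jac_def flux_smult)
 finally show ?thesis by simp
qed

lemma ball_coeff_0: "(\<integral>y. poly (jac l) (T y z) \<partial>\<mu>) = 0" if "l \<ge> 1" "z \<in> Q"
proof -
 have "(\<integral>y. poly (jac l) (T y z) \<partial>\<mu>) = (\<integral>y. poly (jac l) (T z y) \<partial>\<mu>)" by (simp add: T_sym)
 also have "\<dots> = E (jac 0 * jac l)" using integral_poly_T[OF that(2)] by simp
 finally show ?thesis using jac_orth[of 0 l] that by simp
qed

definition jac_sum :: "(nat \<Rightarrow> 'a) \<Rightarrow> nat \<Rightarrow> nat \<Rightarrow> real" where
 "jac_sum x N l = (\<Sum>i<N. \<Sum>j<N. poly (jac l) (T (x i) (x j)))"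

section \<open>The local discrepancy against zonal sums over the points\<close>

context
 fixes x :: "nat \<Rightarrow> 'a" and N :: nat
 assumes x: "\<And>i. i < N \<Longrightarrow> x i \<in> Q"
begin

text \<open>Up to the factor \<open>hn l\<close>, the projection of the point masses onto the space
  of zonal degree l.\<close>

definition wave :: "nat \<Rightarrow> 'a \<Rightarrow> real" where
 "wave l y = (\<Sum>i<N. poly (jac l) (T y (x i)))"

lemma jac_T_integrable:
 assumes "u \<in> Q" "z \<in> Q" shows "integrable \<mu> (\<lambda>y. poly p (T u y) * poly q (T y z))"
proof -
 obtain B where B: "\<And>t. t \<in> {0..1} \<Longrightarrow> \<bar>poly p t\<bar> \<le> B" using poly_bounded_01 by blast
 show ?thesis by (rule zonal_product_integrable[OF poly_measurable B assms])
qed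

lemma chi_jac_integrable:
 assumes "u \<in> Q" "z \<in> Q" shows "integrable \<mu> (\<lambda>y. (chi r (T u y) - vol r) * poly q (T y z))"
proof -
 have "(\<lambda>t. chi r t - vol r) \<in> borel_measurable borel" by measurable
 moreover have "\<bar>chi r t - vol r\<bar> \<le> 1 + \<bar>vol r\<bar>" for t using chi_range(3)[of r t] by linarith
 ultimately show ?thesis using zonal_product_integrable[of "\<lambda>t. chi r t - vol r" "1 + \<bar>vol r\<bar>" u z q] assms by blast
qed

lemma wave_product: "(\<integral>y. wave j y * wave l y \<partial>\<mu>) = (if j = l then hn l * jac_sum x N l else 0)"
 and wave_product_integrable: "integrable \<mu> (\<lambda>y. wave j y * wave l y)"
proof -
 have eq: "wave j y * wave l y = (\<Sum>i<N. \<Sum>i'<N. poly (jac j) (T (x i) y) * poly (jac l) (T y (x i')))" for y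
  unfolding wave_def by (simp add: sum_product T_sym[of _ "x i" for i])
 have i: "integrable \<mu> (\<lambda>y. poly (jac j) (T (x i) y) * poly (jac l) (T y (x i')))" if "i \<in> {..<N}" "i' \<in> {..<N}" for i i'
  using that by (intro jac_T_integrable x) auto
 show "integrable \<mu> (\<lambda>y. wave j y * wave l y)" unfolding eq by (rule integral_sum2(1)[OF i])
 have "(\<integral>y. wave j y * wave l y \<partial>\<mu>) = (\<Sum>i<N. \<Sum>i'<N. (\<integral>y. poly (jac j) (T (x i) y) * poly (jac l) (T y (x i')) \<partial>\<mu>))"
  unfolding eq by (rule integral_sum2(2)[OF i])
 also have "\<dots> = (\<Sum>i<N. \<Sum>i'<N. if j = l then hn l * poly (jac l) (T (x i) (x i')) else 0)"
  by (intro sum.cong HOL.refl jac_convolution x) auto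
 also have "\<dots> = (if j = l then hn l * jac_sum x N l else 0)" by (simp add: jac_sum_def sum_distrib_left)
 finally show "(\<integral>y. wave j y * wave l y \<partial>\<mu>) = (if j = l then hn l * jac_sum x N l else 0)" .
qed

text \<open>Up to the factor \<open>hn l\<close>, the sum is the squared norm of
  \<open>wave l\<close>.\<close>

lemma jac_sum_nonneg: "0 \<le> jac_sum x N l"
proof -
 have "0 \<le> (\<integral>y. wave l y * wave l y \<partial>\<mu>)" by (intro bochner_nonneg) simp
 then have "0 \<le> hn l * jac_sum x N l" by (simp add: wave_product)
 then show ?thesis using hn_pos[of l] by (simp add: zero_le_mult_iff)
qed

definition disc :: "real \<Rightarrow> 'a \<Rightarrow> real" where "disc r y = (\<Sum>i<N. chi r (T (x i) y) - vol r)"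

text \<open>The constant \<open>vol r\<close> is orthogonal to the degrees \<open>l \<ge> 1\<close>,
  and Funk-Hecke evaluates the convolution with the ball.\<close>

lemma disc_wave:
 assumes l: "l \<ge> 1" shows "(\<integral>y. disc r y * wave l y \<partial>\<mu>) = ball_coeff l r * jac_sum x N l"
  and "integrable \<mu> (\<lambda>y. disc r y * wave l y)"
proof -
 have eq: "disc r y * wave l y = (\<Sum>i<N. \<Sum>j<N. (chi r (T (x i) y) - vol r) * poly (jac l) (T y (x j)))" for y
  unfolding wave_def disc_def by (simp add: sum_product)
 have i: "integrable \<mu> (\<lambda>y. (chi r (T (x i) y) - vol r) * poly (jac l) (T y (x j)))" if "i \<in> {..<N}" "j \<in> {..<N}" for i j
  using that by (intro chi_jac_integrable x) auto
 show "integrable \<mu> (\<lambda>y. disc r y * wave l y)" unfolding eq by (rule integral_sum2(1)[OF i])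
 have one: "(\<integral>y. (chi r (T u y) - vol r) * poly (jac l) (T y z) \<partial>\<mu>) = ball_coeff l r * poly (jac l) (T u z)"
  if uz: "u \<in> Q" "z \<in> Q" for u z
 proof -
  have i1: "integrable \<mu> (\<lambda>y. chi r (T u y) * poly (jac l) (T y z))"
   by (rule zonal_product_integrable[OF chi_measurable chi_range(3) uz])
  have i2: "integrable \<mu> (\<lambda>y. vol r * poly (jac l) (T y z))" using jac_T_integrable[OF uz, of 1 "jac l"] by simp
  have "(\<integral>y. (chi r (T u y) - vol r) * poly (jac l) (T y z) \<partial>\<mu>) =
   (\<integral>y. chi r (T u y) * poly (jac l) (T y z) - vol r * poly (jac l) (T y z) \<partial>\<mu>)" by (simp add: left_diff_distrib)
  also have "\<dots> = (\<integral>y. chi r (T u y) * poly (jac l) (T y z) \<partial>\<mu>) - (\<integral>y. vol r * poly (jac l) (T y z) \<partial>\<mu>)"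
   by (rule Bochner_Integration.integral_diff[OF i1 i2])
  also have "(\<integral>y. vol r * poly (jac l) (T y z) \<partial>\<mu>) = 0" using ball_coeff_0[OF l uz(2)] by simp
  also have "(\<integral>y. chi r (T u y) * poly (jac l) (T y z) \<partial>\<mu>) = ball_coeff l r * poly (jac l) (T u z)"
   unfolding ball_coeff_def by (rule funk_hecke[OF chi_measurable chi_range(3) uz])
  finally show ?thesis by simp
 qed
 have "(\<integral>y. disc r y * wave l y \<partial>\<mu>) = (\<Sum>i<N. \<Sum>j<N. (\<integral>y. (chi r (T (x i) y) - vol r) * poly (jac l) (T y (x j)) \<partial>\<mu>))"
  unfolding eq by (rule integral_sum2(2)[OF i])
 also have "\<dots> = (\<Sum>i<N. \<Sum>j<N. ball_coeff l r * poly (jac l) (T (x i) (x j)))" by (intro sum.cong HOL.refl one x) auto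
 finally show "(\<integral>y. disc r y * wave l y \<partial>\<mu>) = ball_coeff l r * jac_sum x N l" by (simp add: jac_sum_def sum_distrib_left)
qed

lemma disc_square_integrable: "integrable \<mu> (\<lambda>y. disc r y * disc r y)"
proof -
 have "disc r y * disc r y = (\<Sum>i<N. \<Sum>j<N. (chi r (T (x i) y) - vol r) * (chi r (T (x j) y) - vol r))" for y
  unfolding disc_def by (simp add: sum_product)
 then show ?thesis by (simp add: chi_vol_integrable)
qed

text \<open>Bessel's inequality for the projections of the local discrepancy onto the spaces of zonal degree \<open>1, \<dots>, L\<close>.\<close>
lemma disc_bessel:
 "(\<Sum>l\<in>{1..L}. (ball_coeff l r)^2 * jac_sum x N l / hn l) \<le> (\<integral>y. disc r y * disc r y \<partial>\<mu>)"
proof -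
 define h where "h y = (\<Sum>l\<in>{1..L}. ball_coeff l r / hn l * wave l y)" for y
 have dh_eq: "disc r y * h y = (\<Sum>l\<in>{1..L}. ball_coeff l r / hn l * (disc r y * wave l y))" for y
  unfolding h_def by (simp add: sum_distrib_left mult_ac)
 have hh_eq: "h y * h y = (\<Sum>l\<in>{1..L}. \<Sum>j\<in>{1..L}. (ball_coeff l r / hn l * (ball_coeff j r / hn j)) * (wave l y * wave j y))" for y
  unfolding h_def by (simp add: sum_product mult_ac)
 have dh: "(\<integral>y. disc r y * h y \<partial>\<mu>) = (\<Sum>l\<in>{1..L}. (ball_coeff l r)^2 * jac_sum x N l / hn l)"
 proof -
  have "(\<integral>y. disc r y * h y \<partial>\<mu>) = (\<Sum>l\<in>{1..L}. (\<integral>y. ball_coeff l r / hn l * (disc r y * wave l y) \<partial>\<mu>))"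
   unfolding dh_eq by (intro bochner_sum integrable_mult_right disc_wave(2)) auto
  also have "\<dots> = (\<Sum>l\<in>{1..L}. ball_coeff l r / hn l * (ball_coeff l r * jac_sum x N l))"
  proof (rule sum.cong[OF HOL.refl])
   fix l assume "l \<in> {1..L}"
   then have l: "l \<ge> 1" by simp
   show "(\<integral>y. ball_coeff l r / hn l * (disc r y * wave l y) \<partial>\<mu>) = ball_coeff l r / hn l * (ball_coeff l r * jac_sum x N l)"
    unfolding integral_mult_right_zero disc_wave(1)[OF l] ..
  qed
  finally show ?thesis by (simp add: power2_eq_square mult_ac)
 qed
 have dhi: "integrable \<mu> (\<lambda>y. disc r y * h y)"
  unfolding dh_eq by (intro Bochner_Integration.integrable_sum integrable_mult_right disc_wave(2)) auto
 note hh_sum = integral_sum2[OF integrable_mult_right[OF wave_product_integrable]]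
 have hhi: "integrable \<mu> (\<lambda>y. h y * h y)" unfolding hh_eq by (rule hh_sum)
 have hh: "(\<integral>y. h y * h y \<partial>\<mu>) = (\<Sum>l\<in>{1..L}. (ball_coeff l r)^2 * jac_sum x N l / hn l)"
 proof -
  have "(\<integral>y. h y * h y \<partial>\<mu>) = (\<Sum>l\<in>{1..L}. \<Sum>j\<in>{1..L}. (\<integral>y. (ball_coeff l r / hn l * (ball_coeff j r / hn j)) * (wave l y * wave j y) \<partial>\<mu>))"
   unfolding hh_eq by (rule hh_sum)
  also have "\<dots> = (\<Sum>l\<in>{1..L}. \<Sum>j\<in>{1..L}. if l = j then (ball_coeff l r / hn l * (ball_coeff j r / hn j)) * (hn j * jac_sum x N j) else 0)"
   unfolding integral_mult_right_zero wave_product by (intro sum.cong) auto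
  also have "\<dots> = (\<Sum>l\<in>{1..L}. (ball_coeff l r / hn l * (ball_coeff l r / hn l)) * (hn l * jac_sum x N l))" by (simp add: sum.delta)
  also have "\<dots> = (\<Sum>l\<in>{1..L}. (ball_coeff l r)^2 * jac_sum x N l / hn l)"
   using hn_pos by (intro sum.cong) (auto simp: power2_eq_square less_imp_neq[symmetric])
  finally show ?thesis .
 qed
 have "0 \<le> (\<integral>y. (disc r y - h y) * (disc r y - h y) \<partial>\<mu>)" by (intro bochner_nonneg) simp
 also have "\<dots> = (\<integral>y. disc r y * disc r y - 2 * (disc r y * h y) + h y * h y \<partial>\<mu>)" by (simp add: algebra_simps)
 also have "\<dots> = (\<integral>y. disc r y * disc r y \<partial>\<mu>) - 2 * (\<integral>y. disc r y * h y \<partial>\<mu>) + (\<integral>y. h y * h y \<partial>\<mu>)"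
  using dhi hhi disc_square_integrable[of r] by simp
 finally show ?thesis unfolding dh hh by simp
qed

text \<open>Expand G in the polynomials \<open>jac l\<close> and sum over all pairs of points. As G
  is nonnegative, the sum is at least its diagonal part \<open>N * poly G 1\<close>. As
  \<open>jac l \<le> 1\<close>, each coefficient is at most \<open>E G / hn l\<close>, and because
  the Jacobi sums are nonnegative, every coefficient may be replaced by this bound. Degree 0
  contributes the subtracted \<open>N^2\<close>.\<close>

lemma jac_sum_bump:
 assumes G: "degree G \<le> L" "\<And>t. 0 \<le> poly G t" "E G > 0"
 shows "real N * poly G 1 / E G - (real N)^2 \<le> (\<Sum>l\<in>{1..L}. jac_sum x N l / hn l)"
proof -
 obtain c where c: "G = (\<Sum>l\<le>degree G. smult (c l) (jac l))" using poly_jac_expansion by blast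
 have cl: "c l * hn l = E (G * jac l)" if "l \<le> degree G" for l
 proof -
  have "E (G * jac l) = (\<Sum>j\<le>degree G. c j * E (jac j * jac l))" by (subst c) (simp add: sum_distrib_right E_sum E_smult)
  also have "\<dots> = (\<Sum>j\<le>degree G. if j = l then c l * hn l else 0)" by (intro sum.cong) (auto simp: jac_orth hn_def)
  finally show ?thesis using that by simp
 qed
 have cle: "c l \<le> E G / hn l" if l: "l \<le> degree G" for l
 proof -
  have "E (G * jac l) \<le> E G"
  proof -
   have "0 \<le> E (G - G * jac l)"
   proof (rule E_nonneg)
    fix t :: real assume "t \<in> {0..1}"
    then have "poly (jac l) t \<le> 1" using jac_bound[of t l] by (simp add: abs_le_iff)
    then have "poly G t * poly (jac l) t \<le> poly G t" using G(2)[of t] by (rule mult_left_le)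
    then show "0 \<le> poly (G - G * jac l) t" by simp
   qed
   then show ?thesis by (simp add: E_diff)
  qed
  then show ?thesis using cl[OF l] hn_pos[of l] by (simp add: pos_le_divide_eq)
 qed
 have S0: "jac_sum x N 0 = (real N)^2" by (simp add: jac_sum_def power2_eq_square)
 have h0: "hn 0 = 1" by (simp add: hn_def)
 have "real N * poly G 1 = (\<Sum>i<N. poly G (T (x i) (x i)))" by simp
 also have "\<dots> \<le> (\<Sum>i<N. \<Sum>j<N. poly G (T (x i) (x j)))" by (intro sum_mono member_le_sum) (auto simp: G(2))
 also have "\<dots> = (\<Sum>l\<le>degree G. c l * jac_sum x N l)"
 proof -
  have "poly G t = (\<Sum>l\<le>degree G. c l * poly (jac l) t)" for t by (subst c) (simp add: poly_sum)
  then have "(\<Sum>i<N. \<Sum>j<N. poly G (T (x i) (x j))) = (\<Sum>i<N. \<Sum>j<N. \<Sum>l\<le>degree G. c l * poly (jac l) (T (x i) (x j)))" by simp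
  also have "\<dots> = (\<Sum>i<N. \<Sum>l\<le>degree G. \<Sum>j<N. c l * poly (jac l) (T (x i) (x j)))" by (intro sum.cong HOL.refl sum.swap)
  also have "\<dots> = (\<Sum>l\<le>degree G. \<Sum>i<N. \<Sum>j<N. c l * poly (jac l) (T (x i) (x j)))" by (rule sum.swap)
  finally show ?thesis by (simp add: jac_sum_def sum_distrib_left)
 qed
 also have "\<dots> \<le> (\<Sum>l\<le>degree G. E G / hn l * jac_sum x N l)" using cle jac_sum_nonneg by (intro sum_mono mult_right_mono) auto
 also have "\<dots> \<le> (\<Sum>l\<le>L. E G / hn l * jac_sum x N l)"
  using G(1,3) jac_sum_nonneg hn_pos by (intro sum_mono2) (auto intro!: mult_nonneg_nonneg divide_nonneg_pos)
 also have "\<dots> = E G * (\<Sum>l\<le>L. jac_sum x N l / hn l)" by (simp add: sum_distrib_left)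
 also have "(\<Sum>l\<le>L. jac_sum x N l / hn l) = (real N)^2 + (\<Sum>l\<in>{1..L}. jac_sum x N l / hn l)"
 proof -
  have "{..L} = insert 0 {1..L}" by auto
  then show ?thesis by (simp add: S0 h0)
 qed
 finally have "real N * poly G 1 / E G \<le> (real N)^2 + (\<Sum>l\<in>{1..L}. jac_sum x N l / hn l)"
  using G(3) by (simp add: pos_divide_le_eq mult.commute)
 then show ?thesis by simp
qed

end

text \<open>The exponent is \<open>3 - d\<close> from \<open>flux\<close> less 4 from the squared
  eigenvalue, and \<open>sqrt (ev l)\<close> is of order l.\<close>

lemma flux_weight_lower:
 assumes \<eta>: "\<eta> \<in> weight_class d d0" and nz: "\<not> (AE r in lebesgue_on {0..pi}. \<eta> r = 0)"
 shows "\<exists>c>0. \<forall>l\<ge>1. c * real l powr (- (real d + 1)) \<le> (\<integral>r. (flux (jac l) r / (ev l * mass))^2 / wt r \<partial>nu \<eta>)"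
proof -
 obtain c where c: "c > 0" "\<forall>l\<ge>1. c * sqrt (ev l) powr (3 - real d) \<le> (LINT r:{0..pi}|lebesgue. (flux (jac l) r)^2 * \<eta> r)"
  using flux_weighted_lower_bound[OF \<eta> nz jac_op_jac jac_1 jac_bound] by auto
 let ?D = "sqrt (real d + real d0)"
 have D: "?D > 0" using d_pos by simp
 define c' where "c' = c / mass^2 * ?D powr (- (real d + 1))"
 have "c' * real l powr (- (real d + 1)) \<le> (\<integral>r. (flux (jac l) r / (ev l * mass))^2 / wt r \<partial>nu \<eta>)" if l: "l \<ge> 1" for l
 proof -
  have ev: "ev l > 0" using ev_ge[of l] l by (metis less_le_trans of_nat_0_less_iff zero_less_one zero_less_power)
  define s where "s = sqrt (ev l)"
  have s: "s > 0" "ev l = s powr 2" using ev by (auto simp: s_def)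
  have sD: "s \<le> ?D * real l" unfolding s_def using ev_le[of l] by (simp add: real_sqrt_mult[symmetric] real_le_lsqrt power_mult_distrib)
  have "(\<integral>r. (flux (jac l) r / (ev l * mass))^2 / wt r \<partial>nu \<eta>) = (\<integral>r. (1 / (ev l * mass)^2) * ((flux (jac l) r)^2 / wt r) \<partial>nu \<eta>)"
   by (simp add: power_divide)
  also have "\<dots> = (1 / (ev l * mass)^2) * (\<integral>r. (flux (jac l) r)^2 / wt r \<partial>nu \<eta>)" by (rule integral_mult_right_zero)
  also have "(\<integral>r. (flux (jac l) r)^2 / wt r \<partial>nu \<eta>) = (LINT r:{0..pi}|lebesgue. (flux (jac l) r)^2 * \<eta> r)"
   by (rule integral_nu[OF \<eta>, symmetric]) measurable
  finally have I: "(\<integral>r. (flux (jac l) r / (ev l * mass))^2 / wt r \<partial>nu \<eta>) = (1 / (ev l * mass)^2) * (LINT r:{0..pi}|lebesgue. (flux (jac l) r)^2 * \<eta> r)" .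
  have "c' * real l powr (- (real d + 1)) = c / mass^2 * (?D * real l) powr (- (real d + 1))"
   unfolding c'_def using D l by (simp add: powr_mult)
  also have "\<dots> \<le> c / mass^2 * s powr (- (real d + 1))" using c(1) s(1) sD by (intro mult_left_mono powr_mono2') auto
  also have "s powr (- (real d + 1)) = s powr (3 - real d) / (ev l)^2"
  proof -
   have "(ev l)^2 = s powr 4" unfolding s(2) using s(1) by (simp add: powr_powr[symmetric] powr_numeral)
   moreover have "s powr (3 - real d) / s powr 4 = s powr (3 - real d - 4)" by (rule powr_diff[symmetric])
   ultimately show ?thesis by (simp add: algebra_simps)
  qed
  also have "c / mass^2 * (s powr (3 - real d) / (ev l)^2) = (1 / (ev l * mass)^2) * (c * s powr (3 - real d))"
   by (simp add: power_mult_distrib)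
  also have "\<dots> \<le> (1 / (ev l * mass)^2) * (LINT r:{0..pi}|lebesgue. (flux (jac l) r)^2 * \<eta> r)"
   using c(2) l unfolding s_def by (intro mult_left_mono) auto
  finally show ?thesis unfolding I .
 qed
 moreover have "c' > 0" unfolding c'_def using c(1) mass_pos D by simp
 ultimately show ?thesis by blast
qed

text \<open>Bessel's inequality at each radius, divided by \<open>wt r\<close> and integrated
  against \<open>nu \<eta>\<close>.\<close>

lemma quad_discrepancy_lower:
 assumes \<eta>: "\<eta> \<in> weight_class d d0" and x: "\<And>i. i < N \<Longrightarrow> x i \<in> Q"
 shows "(\<Sum>l\<in>{1..L}. (\<integral>r. (flux (jac l) r / (ev l * mass))^2 / wt r \<partial>nu \<eta>) * (jac_sum x N l / hn l))
  \<le> quad_discrepancy Q \<theta> \<mu> \<eta> (pts x N)"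
proof -
 let ?F = "\<lambda>r. (real N)^2 * (vol r - vol r * vol r) - (\<Sum>i<N. \<Sum>j<N. vol r - overlap r (x i) (x j))"
 let ?g = "\<lambda>l r. (flux (jac l) r / (ev l * mass))^2 / wt r"
 have gi: "integrable (nu \<eta>) (?g l)" for l
 proof -
  obtain K where K: "\<forall>r\<in>{0<..<pi}. \<bar>(flux (jac l) r)\<^sup>2\<bar> \<le> K * wt r" using flux_square_le by blast
  have "integrable (nu \<eta>) (\<lambda>r. (flux (jac l) r)^2 / wt r)" by (rule nu_integrable[OF \<eta>, where K=K]) (use K in auto)
  then have "integrable (nu \<eta>) (\<lambda>r. (1 / (ev l * mass)^2) * ((flux (jac l) r)^2 / wt r))" by (rule integrable_mult_right)
  then show ?thesis by (simp add: power_divide)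
 qed
 have Fi: "integrable (nu \<eta>) (\<lambda>r. ?F r / wt r)" by (rule quad_discrepancy_nu(2)[OF \<eta> x])
 have pointwise: "(\<Sum>l\<in>{1..L}. ?g l r * (jac_sum x N l / hn l)) \<le> ?F r / wt r" if r: "r \<in> {0<..<pi}" for r
 proof -
  have r': "r \<in> {0..pi}" using r by simp
  have w: "wt r > 0" by (rule wt_pos[OF r])
  have "(\<Sum>l\<in>{1..L}. (ball_coeff l r)^2 * jac_sum x N l / hn l) \<le> (\<integral>y. disc x N r y * disc x N r y \<partial>\<mu>)"
   by (rule disc_bessel[OF x])
  also have "\<dots> = (\<integral>y. (\<Sum>i<N. chi r (T (x i) y) - vol r)^2 \<partial>\<mu>)" using disc_def[OF x] by (simp add: power2_eq_square)
  also have "\<dots> = ?F r" using quad_discrepancy_r_pts[OF x r'] by simp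
  finally have "(\<Sum>l\<in>{1..L}. (ball_coeff l r)^2 * jac_sum x N l / hn l) / wt r \<le> ?F r / wt r" using w by (intro divide_right_mono) auto
  moreover have "(\<Sum>l\<in>{1..L}. (ball_coeff l r)^2 * jac_sum x N l / hn l) / wt r = (\<Sum>l\<in>{1..L}. ?g l r * (jac_sum x N l / hn l))"
   unfolding sum_divide_distrib using r' by (intro sum.cong) (auto simp: ball_coeff_eq power_divide)
  ultimately show ?thesis by simp
 qed
 have "(\<Sum>l\<in>{1..L}. (\<integral>r. ?g l r \<partial>nu \<eta>) * (jac_sum x N l / hn l)) = (\<integral>r. (\<Sum>l\<in>{1..L}. ?g l r * (jac_sum x N l / hn l)) \<partial>nu \<eta>)"
  using gi by (subst bochner_sum) (auto intro!: integrable_mult_left simp only: integral_mult_left_zero)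
 also have "\<dots> \<le> (\<integral>r. ?F r / wt r \<partial>nu \<eta>)"
 proof (rule integral_mono_AE[OF _ Fi])
  show si: "integrable (nu \<eta>) (\<lambda>r. \<Sum>l\<in>{1..L}. ?g l r * (jac_sum x N l / hn l))"
   using gi by (intro Bochner_Integration.integrable_sum integrable_mult_left)
  have pm: "Measurable.pred borel (\<lambda>r. (\<Sum>l\<in>{1..L}. ?g l r * (jac_sum x N l / hn l)) \<le> ?F r / wt r)"
   using borel_measurable_le[OF borel_measurable_integrable[OF si] borel_measurable_integrable[OF Fi]]
   by (simp only: pred_def sets_nu space_nu space_borel)
  show "AE r in nu \<eta>. (\<Sum>l\<in>{1..L}. ?g l r * (jac_sum x N l / hn l)) \<le> ?F r / wt r" by (rule AE_nu[OF \<eta> _ pm]) (rule pointwise)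
 qed
 also have "\<dots> = quad_discrepancy Q \<theta> \<mu> \<eta> (pts x N)" by (rule quad_discrepancy_nu(1)[OF \<eta> x, symmetric])
 finally show ?thesis .
qed

theorem discrepancy_lower_bound:
 assumes \<eta>: "\<eta> \<in> weight_class d d0" and nz: "\<not> (AE r in lebesgue_on {0..pi}. \<eta> r = 0)"
 shows "\<exists>c>0. \<forall>N\<ge>1. \<forall>D\<in>point_sets Q N. c * real N powr (1 - 1 / real d) \<le> quad_discrepancy Q \<theta> \<mu> \<eta> D"
proof -
 obtain c where c0: "c > 0" "\<forall>l\<ge>1. c * real l powr (- (real d + 1)) \<le> (\<integral>r. (flux (jac l) r / (ev l * mass))^2 / wt r \<partial>nu \<eta>)"
  using flux_weight_lower[OF \<eta> nz] by blast
 note c = c0(1) c0(2)[rule_format]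
 obtain b where b: "b > 0"
  "\<And>n. n \<ge> 1 \<Longrightarrow> \<exists>G. degree G \<le> 2 * d * n \<and> (\<forall>t. 0 \<le> poly G t) \<and> E G > 0 \<and> b * real n ^ d * E G \<le> poly G 1"
  by (rule bump_polynomial) (rule that)
 have d: "d > 0" using d_pos by simp
 \<comment> \<open>The summand 1 pays for rounding R up to n, as
   \<open>N powr (1 / d) \<ge> 1\<close>.\<close>
 define \<kappa> where "\<kappa> = (2 / b) powr (1 / real d) + 1"
 have \<kappa>: "\<kappa> > 0" unfolding \<kappa>_def by (simp add: add_nonneg_pos)
 define c1 where "c1 = c * (2 * real d * \<kappa>) powr (- (real d + 1))"
 have "c1 * real N powr (1 - 1 / real d) \<le> quad_discrepancy Q \<theta> \<mu> \<eta> D" if N: "N \<ge> 1" and D: "D \<in> point_sets Q N" for N D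
 proof -
  obtain x where x: "D = pts x N" "\<And>i. i < N \<Longrightarrow> x i \<in> Q" by (rule point_sets_pts[OF D]) (rule that)
  \<comment> \<open>R solves \<open>b * R powr d = 2 * N\<close>: the bump then yields
    \<open>2 * N^2\<close>, and one \<open>N^2\<close> is left after degree 0 is removed.\<close>
  define R where "R = (2 * real N / b) powr (1 / real d)"
  have R: "R > 0" "R powr real d = 2 * real N / b" unfolding R_def using N b(1) d by (auto simp: powr_powr)
  define n where "n = nat \<lceil>R\<rceil>"
  have n: "R \<le> real n" "real n \<le> R + 1" "n \<ge> 1" unfolding n_def using R(1) by linarith+
  have N1: "1 \<le> real N powr (1 / real d)" using N by (intro ge_one_powr_ge_zero) auto
  have R': "R = (2 / b) powr (1 / real d) * real N powr (1 / real d)" unfolding R_def using b(1) by (simp add: powr_mult[symmetric])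
  have nk: "real n \<le> \<kappa> * real N powr (1 / real d)" using n(2) N1 unfolding R' \<kappa>_def by (simp add: distrib_right)
  define L where "L = 2 * d * n"
  have L: "L \<ge> 1" unfolding L_def using n(3) d by simp
  obtain G where G: "degree G \<le> L" "\<forall>t. 0 \<le> poly G t" "E G > 0" "b * real n ^ d * E G \<le> poly G 1"
   using b(2)[OF n(3)] unfolding L_def by blast
  have S: "(real N)^2 \<le> (\<Sum>l\<in>{1..L}. jac_sum x N l / hn l)"
  proof -
   have "2 * real N \<le> b * real n ^ d"
   proof -
    have "2 * real N = b * R powr real d" using R b by simp
    also have "\<dots> \<le> b * real n powr real d" using n(1) R(1) b(1) by (intro mult_left_mono powr_mono2) auto
    finally show ?thesis using n(3) by (simp add: powr_realpow)
   qed
   also have "\<dots> \<le> poly G 1 / E G" using G(3,4) by (simp add: pos_le_divide_eq)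
   finally have "real N * (2 * real N) \<le> real N * (poly G 1 / E G)" by (intro mult_left_mono) auto
   then have "2 * (real N)^2 \<le> real N * poly G 1 / E G" by (simp add: power2_eq_square)
   moreover have "real N * poly G 1 / E G - (real N)^2 \<le> (\<Sum>l\<in>{1..L}. jac_sum x N l / hn l)"
    using G(2) by (intro jac_sum_bump[OF x(2) G(1) _ G(3)]) auto
   ultimately show ?thesis by linarith
  qed
  have Sn: "0 \<le> jac_sum x N l / hn l" for l by (intro divide_nonneg_pos hn_pos jac_sum_nonneg x(2))
  have "c1 * real N powr (1 - 1 / real d) = c * (2 * real d * (\<kappa> * real N powr (1 / real d))) powr (- (real d + 1)) * (real N)^2"
  proof -
   have "(2 * real d * (\<kappa> * real N powr (1 / real d))) powr (- (real d + 1)) = (2 * real d * \<kappa>) powr (- (real d + 1)) * (real N powr (1 / real d)) powr (- (real d + 1))"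
    using \<kappa> by (simp add: powr_mult[symmetric] mult.assoc)
   also have "(real N powr (1 / real d)) powr (- (real d + 1)) = real N powr (- 1 - 1 / real d)"
    using d by (simp add: powr_powr add_divide_distrib diff_divide_distrib)
   finally have "c * (2 * real d * (\<kappa> * real N powr (1 / real d))) powr (- (real d + 1)) * (real N)^2 = c1 * (real N powr (- 1 - 1 / real d) * real N powr 2)"
    unfolding c1_def using N by (simp add: powr_numeral)
   also have "real N powr (- 1 - 1 / real d) * real N powr 2 = real N powr (1 - 1 / real d)" by (subst powr_add[symmetric]) simp
   finally show ?thesis by simp
  qed
  also have "\<dots> \<le> c * real L powr (- (real d + 1)) * (real N)^2"
  proof -
   have "real L \<le> 2 * real d * (\<kappa> * real N powr (1 / real d))" unfolding L_def using nk by (simp add: mult_left_mono mult.assoc)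
   then show ?thesis using c(1) L by (intro mult_right_mono mult_left_mono powr_mono2') auto
  qed
  also have "\<dots> \<le> c * real L powr (- (real d + 1)) * (\<Sum>l\<in>{1..L}. jac_sum x N l / hn l)"
   using S c(1) by (intro mult_left_mono) auto
  also have "\<dots> = (\<Sum>l\<in>{1..L}. c * real L powr (- (real d + 1)) * (jac_sum x N l / hn l))" by (rule sum_distrib_left)
  also have "\<dots> \<le> (\<Sum>l\<in>{1..L}. (\<integral>r. (flux (jac l) r / (ev l * mass))^2 / wt r \<partial>nu \<eta>) * (jac_sum x N l / hn l))"
  proof (intro sum_mono mult_right_mono Sn)
   fix l assume l: "l \<in> {1..L}"
   \<comment> \<open>The lower bounds decrease in l, so the one at L serves all degrees up to
     L.\<close>
   have "c * real L powr (- (real d + 1)) \<le> c * real l powr (- (real d + 1))" using l c(1) by (intro mult_left_mono powr_mono2') auto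
   also have "\<dots> \<le> (\<integral>r. (flux (jac l) r / (ev l * mass))^2 / wt r \<partial>nu \<eta>)" using l by (intro c(2)) auto
   finally show "c * real L powr (- (real d + 1)) \<le> (\<integral>r. (flux (jac l) r / (ev l * mass))^2 / wt r \<partial>nu \<eta>)" .
  qed
  also have "\<dots> \<le> quad_discrepancy Q \<theta> \<mu> \<eta> (pts x N)" by (rule quad_discrepancy_lower[OF \<eta> x(2)])
  finally show ?thesis using x(1) by simp
 qed
 moreover have "c1 > 0" unfolding c1_def using c(1) \<kappa> d by simp
 ultimately show ?thesis by blast
qed

end

section \<open>Upper bound for the discrepancy\<close>

text \<open>\<open>f i\<close> is the amount handed from vertex i to its parent. The last vertex is
  a leaf: it hands over the fractional part of its mass and is removed. What remains at the root is
  an integer because the total is.\<close>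

lemma tree_flow:
 fixes m :: "nat \<Rightarrow> real" and p :: "nat \<Rightarrow> nat"
 assumes "(\<Sum>i\<le>K. m i) \<in> \<int>" "\<And>i. 0 < i \<Longrightarrow> i \<le> K \<Longrightarrow> p i < i"
 shows "\<exists>f. (\<forall>i. 0 \<le> f i \<and> f i < 1) \<and> f 0 = 0 \<and>
  (\<forall>j\<le>K. m j - f j + (\<Sum>i\<le>K. if p i = j then f i else 0) \<in> \<int>)"
 using assms
proof (induction K arbitrary: m)
 case 0
 then show ?case by (intro exI[of _ "\<lambda>_. 0"]) auto
next
 case (Suc K)
 define t where "t = frac (m (Suc K))"
 define m' where "m' = m(p (Suc K) := m (p (Suc K)) + t)"
 have pK: "p (Suc K) \<le> K" using Suc.prems(2)[of "Suc K"] by simp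
 have "(\<Sum>i\<le>K. m' i) = (\<Sum>i\<le>K. m i + (if i = p (Suc K) then t else 0))" by (intro sum.cong) (auto simp: m'_def)
 also have "\<dots> = (\<Sum>i\<le>K. m i) + t" using pK by (simp add: sum.distrib)
 also have "\<dots> = (\<Sum>i\<le>Suc K. m i) - of_int \<lfloor>m (Suc K)\<rfloor>" by (simp add: t_def frac_def)
 also have "\<dots> \<in> \<int>" using Suc.prems(1) by (intro Ints_diff) auto
 finally have "(\<Sum>i\<le>K. m' i) \<in> \<int>" .
 then have "\<exists>f. (\<forall>i. 0 \<le> f i \<and> f i < 1) \<and> f 0 = 0 \<and>
   (\<forall>j\<le>K. m' j - f j + (\<Sum>i\<le>K. if p i = j then f i else 0) \<in> \<int>)"
  by (rule Suc.IH) (use Suc.prems(2) in auto)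
 then obtain f where f: "\<forall>i. 0 \<le> f i \<and> f i < 1" "f 0 = 0"
   "\<forall>j\<le>K. m' j - f j + (\<Sum>i\<le>K. if p i = j then f i else 0) \<in> \<int>" by blast
 define f' where "f' = f(Suc K := t)"
 have s: "(\<Sum>i\<le>Suc K. if p i = j then f' i else 0) = (\<Sum>i\<le>K. if p i = j then f i else 0) + (if p (Suc K) = j then t else 0)" for j
 proof -
  have "(\<Sum>i\<le>K. if p i = j then f' i else 0) = (\<Sum>i\<le>K. if p i = j then f i else 0)" by (intro sum.cong) (auto simp: f'_def)
  then show ?thesis by (simp add: f'_def)
 qed
 have "m j - f' j + (\<Sum>i\<le>Suc K. if p i = j then f' i else 0) \<in> \<int>" if j: "j \<le> Suc K" for j
 proof (cases "j = Suc K")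
  case True
  \<comment> \<open>\<open>p 0\<close> is arbitrary and might equal j; the value
    \<open>f 0 = 0\<close> excludes a contribution of the root.\<close>
  have "(if p i = j then f i else 0) = 0" if "i \<le> K" for i using Suc.prems(2)[of i] f(2) that True by (cases "i = 0") auto
  then have "(\<Sum>i\<le>K. if p i = j then f i else 0) = 0" by (intro sum.neutral) auto
  then show ?thesis unfolding s using True pK by (simp add: f'_def t_def frac_def)
 next
  case False
  then have j: "j \<le> K" using j by simp
  have "m j - f' j + (\<Sum>i\<le>Suc K. if p i = j then f' i else 0) = m' j - f j + (\<Sum>i\<le>K. if p i = j then f i else 0)"
   unfolding s using False by (simp add: f'_def m'_def)
  then show ?thesis using f(3) j by simp
 qed
 moreover have "\<forall>i. 0 \<le> f' i \<and> f' i < 1" using f(1) by (auto simp: f'_def t_def frac_lt_1)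
 moreover have "f' 0 = 0" using f(2) by (simp add: f'_def)
 ultimately show ?case by blast
qed

text \<open>Growth of a spanning tree: as long as the listed vertices are not all of C, the
  connectivity hypothesis gives an edge that leaves them. So each parent is listed before its
  children.\<close>

lemma tree_order:
 assumes C: "finite C" "c0 \<in> C"
  and R: "\<And>S. S \<subseteq> C \<Longrightarrow> S \<noteq> {} \<Longrightarrow> S \<noteq> C \<Longrightarrow> \<exists>x\<in>S. \<exists>y\<in>C - S. R x y"
 shows "\<exists>c p. bij_betw c {..card C - 1} C \<and> (\<forall>i. 0 < i \<and> i \<le> card C - 1 \<longrightarrow> p i < i \<and> R (c (p i)) (c i))"
proof -
 have seq: "n < card C \<Longrightarrow> \<exists>c p. inj_on c {..n} \<and> c ` {..n} \<subseteq> C \<and> (\<forall>i. 0 < i \<and> i \<le> n \<longrightarrow> p i < i \<and> R (c (p i)) (c i))" for n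
 proof (induction n)
  case 0
  then show ?case using C by (intro exI[of _ "\<lambda>_. c0"] exI) auto
 next
  case (Suc n)
  then obtain c p where c: "inj_on c {..n}" "c ` {..n} \<subseteq> C" "\<forall>i. 0 < i \<and> i \<le> n \<longrightarrow> p i < i \<and> R (c (p i)) (c i)" by auto
  have "card (c ` {..n}) = Suc n" using c(1) by (simp add: card_image)
  then have "c ` {..n} \<noteq> C" using Suc.prems by auto
  then obtain j y where j: "j \<le> n" "y \<in> C" "y \<notin> c ` {..n}" "R (c j) y" using R[OF c(2)] by fastforce
  define c' where "c' = c(Suc n := y)"
  define p' where "p' = p(Suc n := j)"
  have c'c: "c' i = c i" if "i \<le> n" for i using that by (simp add: c'_def)
  have im: "c' ` {..n} = c ` {..n}" using c'c by (intro image_cong) auto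
  have "inj_on c' {..n}" using c(1) c'c by (auto simp: inj_on_def)
  then have "inj_on c' {..Suc n}" unfolding atMost_Suc inj_on_insert using j(3) im by (auto simp: c'_def)
  moreover have "c' ` {..Suc n} \<subseteq> C" unfolding atMost_Suc image_insert im using c(2) j(2) by (simp add: c'_def)
  moreover have "p' i < i \<and> R (c' (p' i)) (c' i)" if i: "0 < i" "i \<le> Suc n" for i
  proof (cases "i = Suc n")
   case True
   then show ?thesis using j c'c[OF j(1)] by (simp add: p'_def c'_def)
  next
   case False
   then have "i \<le> n" using i by simp
   then have "p i < i" "R (c (p i)) (c i)" using c(3) i by auto
   then show ?thesis using \<open>i \<le> n\<close> by (simp add: p'_def c'c)
  qed
  ultimately show ?case by blast
 qed
 have cC: "card C > 0" using C card_gt_0_iff by blast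
 then have "card C - 1 < card C" by simp
 from seq[OF this] obtain c p where c: "inj_on c {..card C - 1}" "c ` {..card C - 1} \<subseteq> C"
  "\<forall>i. 0 < i \<and> i \<le> card C - 1 \<longrightarrow> p i < i \<and> R (c (p i)) (c i)" by blast
 have "card (c ` {..card C - 1}) = card C" using c(1) cC by (simp add: card_image)
 then have "c ` {..card C - 1} = C" using c(2) C(1) by (simp add: card_subset_eq)
 then show ?thesis using c unfolding bij_betw_def by blast
qed

lemma sum_symmetric_square:
 fixes f :: "nat \<Rightarrow> nat \<Rightarrow> real"
 assumes "\<And>i j. i < N \<Longrightarrow> j < N \<Longrightarrow> f i j = f j i"
 shows "(\<Sum>i<N. \<Sum>j<N. f i j) = 2 * (\<Sum>i<N. \<Sum>j<i. f i j) + (\<Sum>i<N. f i i)" using assms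
proof (induction N)
 case (Suc N)
 have "(\<Sum>i<Suc N. \<Sum>j<Suc N. f i j) = (\<Sum>i<N. \<Sum>j<N. f i j) + (\<Sum>i<N. f i N) + (\<Sum>j<N. f N j) + f N N"
  by (simp add: sum.distrib)
 also have "(\<Sum>i<N. f i N) = (\<Sum>j<N. f N j)" using Suc.prems by (intro sum.cong) auto
 finally show ?case using Suc by simp
qed simp

section \<open>Volumes of small balls, nets and densities with small support\<close>

context two_point_space begin

text \<open>It suffices to integrate over \<open>[r/4, r/2)\<close>: there the angle stays below
  \<open>pi/2\<close>, which bounds the cosine factor below, and \<open>sin (u/2)\<close> is at
  least \<open>r / (4 * pi)\<close>.\<close>

lemma vol_lower: "\<exists>c>0. \<forall>r\<in>{0..pi}. c * r ^ d \<le> vol r"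
proof -
 define m where "m = cos (pi/4) ^ (d0 - 1) * (1 / (4 * pi)) ^ (d - 1) / 4 / mass"
 have m: "m > 0" unfolding m_def using mass_pos by (simp add: cos_45)
 have "m * r ^ d \<le> vol r" if r: "r \<in> {0..pi}" for r
 proof -
  let ?g = "\<lambda>u. wt u * indicator {..<r} u"
  let ?B = "cos (pi/4) ^ (d0 - 1) * (r / (4 * pi)) ^ (d - 1)"
  have "vol r = (\<integral>y. indicator {..<r} (\<theta> (e 0) y) \<partial>\<mu>)"
   unfolding vol_def by (rule bochner_cong) (use r in \<open>auto simp: chi_theta\<close>)
  also have "\<dots> = (\<integral>u. indicator {..<r} u \<partial>law)" by (rule integral_theta) auto
  also have "\<dots> = (LBINT u:{0..pi}. ?g u) / mass" by (rule integral_law) measurable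
  finally have v: "vol r = (LBINT u:{0..pi}. ?g u) / mass" .
  have B: "?B \<ge> 0" using r by (simp add: cos_45)
  have le: "(\<integral>u. indicator {r/4..<r/2} u * ?B \<partial>lborel) \<le> (LBINT u:{0..pi}. ?g u)" unfolding set_lebesgue_integral_def
  proof (rule integral_mono')
   have "continuous_on {0..pi} wt" by (rule wt_continuous)
   then have "set_integrable lborel {0..pi} wt" by (rule borel_integrable_atLeastAtMost')
   then have "set_integrable lborel ({0..pi} \<inter> {..<r}) wt" by (rule set_integrable_subset) auto
   then show "integrable lborel (\<lambda>u. indicat_real {0..pi} u *\<^sub>R ?g u)"
    unfolding set_integrable_def by (rule Bochner_Integration.integrable_cong[THEN iffD1, rotated -1]) (auto simp: indicator_def)
   fix u
   show "0 \<le> indicat_real {0..pi} u *\<^sub>R ?g u" using wt_nonneg[of u] by (auto simp: indicator_def)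
   show "indicator {r/4..<r/2} u * ?B \<le> indicat_real {0..pi} u *\<^sub>R ?g u"
   proof (cases "u \<in> {r/4..<r/2}")
    case True
    then have u: "u \<in> {0..pi}" "u < r" "u \<le> pi/2" "r/4 \<le> u" using r by auto
    have "r / (4 * pi) \<le> u / pi" using u by (simp add: field_simps)
    also have "\<dots> \<le> sin (u/2)" using sin_ge_linear[of "u/2"] u by simp
    finally have "(r / (4 * pi)) ^ (d - 1) \<le> sin (u/2) ^ (d - 1)" using r by (intro power_mono) auto
    moreover have "cos (pi/4) ^ (d0 - 1) \<le> cos (u/2) ^ (d0 - 1)" using u by (intro power_mono cos_monotone_0_pi_le) (auto simp: cos_45)
    moreover have "0 \<le> cos (pi/4) ^ (d0 - 1)" "0 \<le> sin (u/2) ^ (d-1)" using u by (auto simp: cos_45 intro!: zero_le_power sin_ge_zero)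
    ultimately have "?B \<le> wt u" unfolding wt_def using r by (subst mult.commute) (intro mult_mono; simp)
    then show ?thesis using True u by simp
   qed (use wt_nonneg[of u] in \<open>auto simp: indicator_def\<close>)
  qed
  have eq: "(\<integral>u. indicator {r/4..<r/2} u * ?B \<partial>lborel) = (r/2 - r/4) * ?B" using r by simp
  have "(r/2 - r/4) * ?B / mass \<le> vol r" unfolding v eq[symmetric] by (intro divide_right_mono le) (use mass_pos in simp)
  moreover have "(r/2 - r/4) * ?B / mass = m * r ^ d"
  proof -
   have "r ^ d = r * r ^ (d - 1)" using d_pos by (cases d) auto
   then show ?thesis unfolding m_def by (simp add: power_divide power_mult_distrib mult_ac)
  qed
  ultimately show ?thesis by simp
 qed
 then show ?thesis using m by blast
qed

text \<open>At a point \<open>e t\<close> of the geodesic the form is the rank one form of the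
  vector \<open>(cos t, sin t)\<close>. \<open>w_square_le\<close> only bounds its off-diagonal
  entry; \<open>T (e t) (e t) = 1\<close> determines it.\<close>

lemma T_e_e: "T (e s) (e t) = (cos (s - t))^2"
proof -
 have a: "a (e u) = (cos u)^2" for u using T_e0_e[of u] by (simp add: T_sym[of "e 0"])
 have wh: "w (e (pi/2)) = 0" using w_square_le[OF e_in, of "pi/2"] a[of "pi/2"] by simp
 have b: "b (e t) = (sin t)^2" using plane_T[OF e_in[of "pi/2"], of t] wh a[of "pi/2"] by (simp add: T_sym[of "e t"])
 have w: "w (e t) = cos t * sin t"
 proof (cases "cos t * sin t = 0")
  case True
  then show ?thesis using w_square_le[OF e_in, of t] a[of t] b by (auto simp: power_mult_distrib[symmetric])
 next
  case False
  have c: "(cos t)^2 = 1 - (sin t)^2" by (simp add: cos_squared_eq)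
  have "1 = (cos t)^2 * (cos t)^2 + (sin t)^2 * (sin t)^2 + 2 * cos t * sin t * w (e t)"
   using plane_T[OF e_in[of t], of t] a[of t] b by simp
  also have "(cos t)^2 * (cos t)^2 + (sin t)^2 * (sin t)^2 = 1 - 2 * (cos t * sin t) * (cos t * sin t)"
  proof -
   have "(cos t * sin t) * (cos t * sin t) = (1 - (sin t)^2) * (sin t)^2" unfolding c[symmetric] by (simp add: power2_eq_square)
   then show ?thesis unfolding c by (simp add: power2_eq_square algebra_simps)
  qed
  finally have "(cos t * sin t) * w (e t) = (cos t * sin t) * (cos t * sin t)" by simp
  then show ?thesis using False by (simp only: mult_cancel_left) simp
 qed
 show ?thesis unfolding plane_T[OF e_in[of t], of s] a b w cos_diff by (simp add: power2_eq_square algebra_simps)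
qed

lemma theta_e_e: "0 \<le> t - s \<Longrightarrow> t - s \<le> pi / 2 \<Longrightarrow> \<theta> (e s) (e t) = 2 * (t - s)"
proof -
 assume st: "0 \<le> t - s" "t - s \<le> pi / 2"
 have "cos (s - t) = cos (t - s)" by (metis cos_minus minus_diff_eq)
 then have "T (e s) (e t) = (cos (t - s))^2" by (simp add: T_e_e)
 moreover have "cos (t - s) \<ge> 0" using st by (intro cos_ge_zero) auto
 ultimately show ?thesis using st by (simp add: theta_eq arccos_cos)
qed

text \<open>Subdivide the geodesic from \<open>e 0\<close> to \<open>e \<phi>\<close> and pull it
  back; its length \<open>2 * \<phi>\<close> is at most pi, so more than
  \<open>pi / \<delta>\<close> pieces suffice.\<close>

lemma chain:
 assumes "x \<in> Q" "z \<in> Q" "\<delta> > 0"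
 shows "\<exists>n y. y 0 = x \<and> y n = z \<and> (\<forall>i\<le>n. y i \<in> Q) \<and> (\<forall>i<n. \<theta> (y i) (y (Suc i)) \<le> \<delta>)"
proof -
 obtain g \<phi> where g: "isometry_of Q \<theta> g" "0 \<le> \<phi>" "\<phi> \<le> pi/2" "g x = e 0" "g z = e \<phi>" using normal[OF assms(1,2)] by blast
 have bij: "bij_betw g Q Q" using g(1) by (simp add: isometry_of_def)
 obtain n :: nat where n: "pi / \<delta> < real n" using reals_Archimedean2 by blast
 have n0: "n > 0" using n assms(3) by (cases n) (auto simp: divide_less_0_iff not_less)
 define y where "y i = inv_into Q g (e (real i * (\<phi> / real n)))" for i
 have img: "g ` Q = Q" using bij by (simp add: bij_betw_def)
 have y: "y i \<in> Q" "g (y i) = e (real i * (\<phi> / real n))" for i unfolding y_def by (auto intro!: inv_into_into f_inv_into_f simp: img)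
 have inj: "u = v" if "g u = g v" "u \<in> Q" "v \<in> Q" for u v using bij_betw_imp_inj_on[OF bij] that by (rule inj_onD)
 have "y 0 = x" by (rule inj) (use y[of 0] g(4) assms in auto)
 moreover have "y n = z" by (rule inj) (use y[of n] g(5) n0 assms in auto)
 moreover have "\<theta> (y i) (y (Suc i)) \<le> \<delta>" if "i < n" for i
 proof -
  have d: "real (Suc i) * (\<phi> / real n) - real i * (\<phi> / real n) = \<phi> / real n" by (simp add: algebra_simps add_divide_distrib)
  have "\<phi> / real n \<le> \<phi> / 1" using g(2) n0 by (intro divide_left_mono) auto
  then have pn: "\<phi> / real n \<le> pi/2" using g(3) by (metis div_by_1 order_trans)
  have "\<theta> (y i) (y (Suc i)) = \<theta> (g (y i)) (g (y (Suc i)))" using g(1) y(1) unfolding isometry_of_def by simp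
  also have "\<dots> = 2 * (\<phi> / real n)" unfolding y using pn g(2) d by (subst theta_e_e) auto
  also have "\<dots> \<le> pi / real n" using g(3) by (simp add: divide_right_mono)
  also have "\<dots> \<le> \<delta>" using n n0 assms(3) by (simp add: field_simps)
  finally show ?thesis .
 qed
 ultimately show ?thesis using y(1) by blast
qed

text \<open>A separated set of maximal cardinality. The balls of radius r around its points are
  disjoint, so the assumption on \<open>vol r\<close> bounds the cardinality by N, and maximality
  makes the balls of radius \<open>2 * r\<close> cover.\<close>

lemma separated_net:
 assumes r: "0 < r" "r \<le> pi" and N: "1 \<le> real N * vol r"
 shows "\<exists>C. finite C \<and> C \<subseteq> Q \<and> C \<noteq> {} \<and> (\<forall>x\<in>C. \<forall>y\<in>C. x \<noteq> y \<longrightarrow> 2 * r \<le> \<theta> x y) \<and> (\<forall>y\<in>Q. \<exists>c\<in>C. \<theta> c y < 2 * r)"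
proof -
 define sep where "sep C \<longleftrightarrow> finite C \<and> C \<subseteq> Q \<and> (\<forall>x\<in>C. \<forall>y\<in>C. x \<noteq> y \<longrightarrow> 2 * r \<le> \<theta> x y)" for C
 have bound: "card C \<le> N" if C: "sep C" for C
 proof -
  have v: "vol r > 0" using N by (metis less_eq_real_def linorder_not_le mult_nonneg_nonpos of_nat_0_le_iff zero_less_one order.strict_trans1)
  have disj: "disjoint_family_on (\<lambda>x. geo_ball Q \<theta> r x) C" unfolding disjoint_family_on_def
  proof (intro ballI impI equals0I)
   fix x y z assume xy: "x \<in> C" "y \<in> C" "x \<noteq> y" and z: "z \<in> geo_ball Q \<theta> r x \<inter> geo_ball Q \<theta> r y"
   then have "x \<in> Q" "y \<in> Q" "z \<in> Q" "\<theta> z x < r" "\<theta> z y < r" "2 * r \<le> \<theta> x y"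
    using C by (auto simp: sep_def geo_ball_def)
   then show False using theta_triangle[of x z y] theta_sym[of x z] by simp
  qed
  have "real (card C) * vol r = (\<Sum>x\<in>C. measure \<mu> (geo_ball Q \<theta> r x))" using C r by (simp add: sep_def measure_ball subset_iff)
  also have "\<dots> = measure \<mu> (\<Union>x\<in>C. geo_ball Q \<theta> r x)"
   using C disj by (intro \<mu>.finite_measure_finite_Union[symmetric]) (auto simp: sep_def)
  also have "\<dots> \<le> real N * vol r" using \<mu>.prob_le_1 N by (rule order_trans)
  finally show ?thesis using v by simp
 qed
 define P where "P n \<longleftrightarrow> (\<exists>C. sep C \<and> card C = n)" for n
 have P1: "P 1" unfolding P_def sep_def by (intro exI[of _ "{e 0}"]) auto
 define n where "n = (GREATEST n. P n)"
 have Pn: "P n" unfolding n_def by (rule GreatestI_nat[where b=N, of P, OF P1]) (auto simp: P_def bound)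
 have max: "m \<le> n" if "P m" for m unfolding n_def by (rule Greatest_le_nat[where b=N, of P, OF that]) (auto simp: P_def bound)
 obtain C where C: "sep C" "card C = n" using Pn P_def by blast
 have "C \<noteq> {}" using max[OF P1] C by auto
 moreover have "\<exists>c\<in>C. \<theta> c y < 2 * r" if y: "y \<in> Q" for y
 proof (rule ccontr)
  assume far: "\<not> ?thesis"
  then have "y \<notin> C" using theta_refl[OF y] r by force
  moreover have "sep (insert y C)" using C(1) y far theta_sym by (force simp: sep_def not_less subset_iff)
  ultimately have "P (Suc n)" unfolding P_def using C by (intro exI[of _ "insert y C"]) (auto simp: sep_def)
  then show False using max by force
 qed
 ultimately show ?thesis using C(1) unfolding sep_def by (intro exI[of _ C]) auto
qed

text \<open>Follow a chain with steps of at most \<open>2 * r\<close> from S to a net point outside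
  S. Unless that end point is itself near S, there is a first chain point that no point of S covers;
  it is covered by a net point outside S and its predecessor by one in S, which adds up three
  distances of at most \<open>2 * r\<close>.\<close>

lemma net_connected:
 assumes r: "0 < r" and C: "C \<subseteq> Q" "\<forall>y\<in>Q. \<exists>c\<in>C. \<theta> c y < 2 * r" and S: "S \<subseteq> C" "S \<noteq> {}" "S \<noteq> C"
 shows "\<exists>x\<in>S. \<exists>y\<in>C - S. \<theta> x y \<le> 6 * r"
proof -
 obtain x z where xz: "x \<in> S" "z \<in> C - S" using S by blast
 then have Q: "x \<in> Q" "z \<in> Q" using S C by auto
 have "2 * r > 0" using r by simp
 from chain[OF Q this] obtain n y where y: "y 0 = x" "y n = z" "\<forall>i\<le>n. y i \<in> Q" "\<forall>i<n. \<theta> (y i) (y (Suc i)) \<le> 2 * r"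
  by blast
 define P where "P i \<longleftrightarrow> (\<exists>c\<in>S. \<theta> c (y i) < 2 * r)" for i
 have P0: "P 0" unfolding P_def using xz y Q theta_refl r by (intro bexI[of _ x]) auto
 show ?thesis
 proof (cases "P n")
  case True
  then obtain c where "c \<in> S" "\<theta> c z < 2 * r" using y P_def by auto
  then show ?thesis using xz r by (intro bexI[of _ c] bexI[of _ z]) auto
 next
  case False
  define i where "i = (LEAST i. \<not> P i)"
  have i: "\<not> P i" "i \<le> n"
   unfolding i_def using LeastI[of "\<lambda>i. \<not> P i", OF False] Least_le[of "\<lambda>i. \<not> P i", OF False] by auto
  then obtain j where j: "i = Suc j" using P0 by (cases i) auto
  have Pj: "P j" using not_less_Least[of j "\<lambda>i. \<not> P i"] j unfolding i_def by auto
  then obtain c where c: "c \<in> S" "\<theta> c (y j) < 2 * r" unfolding P_def by blast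
  have yQ: "y j \<in> Q" "y (Suc j) \<in> Q" using y i j by auto
  obtain c' where c': "c' \<in> C" "\<theta> c' (y (Suc j)) < 2 * r" using C yQ by blast
  have "c' \<notin> S" using i j c' unfolding P_def by blast
  have cQ: "c \<in> Q" "c' \<in> Q" using c c' S C by auto
  have "\<theta> (y j) (y (Suc j)) \<le> 2 * r" using y(4) i j by simp
  then have "\<theta> c c' \<le> 6 * r"
   using theta_triangle[OF cQ(1) yQ(1) cQ(2)] theta_triangle[OF yQ cQ(2)] theta_sym[OF cQ(2) yQ(2)] c(2) c'(2) by linarith
  then show ?thesis using c c' \<open>c' \<notin> S\<close> by blast
 qed
qed

text \<open>A substitute for a partition of \<open>Q\<close> into \<open>N\<close> cells of equal measure: the excess mass of each
 Voronoi cell over an integer multiple of \<open>1 / N\<close> is handed on to the parent cell in a tree.\<close>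
lemma small_densities:
 assumes r: "0 < r" "r \<le> pi" and N: "1 \<le> real N * vol r"
 shows "\<exists>h :: nat \<Rightarrow> 'a \<Rightarrow> real. (\<forall>t<N. h t \<in> borel_measurable \<mu> \<and> (\<forall>y\<in>Q. 0 \<le> h t y) \<and> (\<integral>y. h t y \<partial>\<mu>) = 1 \<and>
   (\<forall>y\<in>Q. \<forall>z\<in>Q. h t y \<noteq> 0 \<longrightarrow> h t z \<noteq> 0 \<longrightarrow> \<theta> y z \<le> 16 * r)) \<and> (\<forall>y\<in>Q. (\<Sum>t<N. h t y) = real N)"
proof -
 obtain C where C: "finite C" "C \<subseteq> Q" "C \<noteq> {}" "\<forall>x\<in>C. \<forall>y\<in>C. x \<noteq> y \<longrightarrow> 2 * r \<le> \<theta> x y" "\<forall>y\<in>Q. \<exists>c\<in>C. \<theta> c y < 2 * r"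
  using separated_net[OF r N] by (elim exE conjE) (rule that)
 obtain c0 where c0: "c0 \<in> C" using C by blast
 define K where "K = card C - 1"
 have "\<exists>x\<in>S. \<exists>y\<in>C - S. \<theta> x y \<le> 6 * r" if "S \<subseteq> C" "S \<noteq> {}" "S \<noteq> C" for S
  by (rule net_connected[OF r(1) C(2,5) that])
 from tree_order[OF C(1) c0 this] obtain c p where c: "bij_betw c {..K} C"
  and p: "\<forall>i. 0 < i \<and> i \<le> K \<longrightarrow> p i < i \<and> \<theta> (c (p i)) (c i) \<le> 6 * r" unfolding K_def by blast
 have cC: "c i \<in> C" if "i \<le> K" for i using c that by (auto simp: bij_betw_def)
 have cQ: "c i \<in> Q" if "i \<le> K" for i using cC[OF that] C by auto
 have csep: "2 * r \<le> \<theta> (c i) (c j)" if "i \<le> K" "j \<le> K" "i \<noteq> j" for i j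
 proof -
  have "c i \<noteq> c j" using inj_onD[OF bij_betw_imp_inj_on[OF c], of i j] that by auto
  then show ?thesis using C(4) cC that by blast
 qed
 \<comment> \<open>Ties between nearest centres are broken by the smallest index, which makes the
   cells disjoint and the assignment measurable.\<close>
 define A where "A y = (LEAST i. i \<le> K \<and> (\<forall>j\<in>{..K}. \<theta> (c i) y \<le> \<theta> (c j) y))" for y
 have A: "A y \<le> K" and Ale: "j \<le> K \<Longrightarrow> \<theta> (c (A y)) y \<le> \<theta> (c j) y" for y j
 proof -
  have "\<exists>i. i \<le> K \<and> (\<forall>j\<in>{..K}. \<theta> (c i) y \<le> \<theta> (c j) y)"
   using ex_is_arg_min_if_finite[of "{..K}" "\<lambda>i. \<theta> (c i) y"] by (auto simp: is_arg_min_linorder)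
  from LeastI_ex[OF this] show "A y \<le> K" "j \<le> K \<Longrightarrow> \<theta> (c (A y)) y \<le> \<theta> (c j) y" unfolding A_def by auto
 qed
 define V where "V i = {y \<in> Q. A y = i}" for i
 have Vm: "V i \<in> sets \<mu>" for i
 proof -
  have "Measurable.pred \<mu> (\<lambda>y. i \<le> K \<and> (\<forall>j\<in>{..K}. \<theta> (c i) y \<le> \<theta> (c j) y))" for i
  proof (cases "i \<le> K")
   case True
   have "{y \<in> space \<mu>. \<forall>j\<in>{..K}. \<theta> (c i) y \<le> \<theta> (c j) y} \<in> sets \<mu>"
    using True by (intro sets.sets_Collect_finite_All borel_measurable_le theta_measurable cQ) auto
   then show ?thesis using True by (simp add: pred_def)
  qed simp
  then have "A \<in> measurable \<mu> (count_space UNIV)" unfolding A_def[abs_def] by (rule measurable_Least)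
  then have "A -` {i} \<inter> space \<mu> \<in> sets \<mu>" by (rule measurable_sets) simp
  moreover have "A -` {i} \<inter> space \<mu> = V i" by (auto simp: V_def)
  ultimately show ?thesis by simp
 qed
 have VQ: "V i \<inter> Q = V i" for i by (auto simp: V_def)
 have Vsum: "(\<Sum>i\<le>K. indicator (V i) y :: real) = 1" if "y \<in> Q" for y
 proof -
  have "(\<Sum>i\<le>K. indicator (V i) y :: real) = (\<Sum>i\<le>K. if i = A y then 1 else 0)"
   using that by (intro sum.cong) (auto simp: V_def indicator_def)
  then show ?thesis using A by simp
 qed
 have Vnear: "\<theta> (c i) y < 2 * r" if "y \<in> V i" "i \<le> K" for i y
 proof -
  obtain c' where c': "c' \<in> C" "\<theta> c' y < 2 * r" using C(5) \<open>y \<in> V i\<close> unfolding V_def by blast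
  then obtain j where "j \<in> {..K}" "c' = c j" using bij_betw_imp_surj_on[OF c] by blast
  then show ?thesis using c' that(1) Ale[of j y] by (simp add: V_def)
 qed
 have Vball: "geo_ball Q \<theta> r (c i) \<subseteq> V i" if i: "i \<le> K" for i
 proof
  fix y assume "y \<in> geo_ball Q \<theta> r (c i)"
  then have y: "y \<in> Q" "\<theta> (c i) y < r" using theta_sym cQ[OF i] by (auto simp: geo_ball_def)
  have "A y = i"
  proof (rule ccontr)
   assume "A y \<noteq> i"
   then have "2 * r \<le> \<theta> (c (A y)) (c i)" using csep[OF A i] by simp
   then show False using theta_triangle[OF cQ[OF A] y(1) cQ[OF i], of y] theta_sym[OF y(1) cQ[OF i]] y(2) Ale[OF i, of y] by linarith
  qed
  then show "y \<in> V i" unfolding V_def using y(1) by simp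
 qed
 define m where "m i = real N * measure \<mu> (V i)" for i
 \<comment> \<open>Each cell contains the ball of radius r around its centre, so it holds at least
   one unit of mass and can always give away less than one.\<close>
 have m: "m i \<ge> 1" if i: "i \<le> K" for i
 proof -
  have "vol r \<le> measure \<mu> (V i)" using measure_ball[OF cQ[OF i], of r] r \<mu>.finite_measure_mono[OF Vball[OF i] Vm] by simp
  then have "real N * vol r \<le> m i" unfolding m_def by (intro mult_left_mono) auto
  then show ?thesis using N by simp
 qed
 have "(\<Sum>i\<le>K. measure \<mu> (V i)) = (\<Sum>i\<le>K. (\<integral>y. indicator (V i) y \<partial>\<mu>))" by (simp add: VQ)
 also have "\<dots> = (\<integral>y. (\<Sum>i\<le>K. indicator (V i) y) \<partial>\<mu>)"
  using Vm by (intro bochner_sum[symmetric] integrable_real_indicator) (auto simp: \<mu>.emeasure_eq_measure)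
 also have "\<dots> = (\<integral>y. 1 \<partial>\<mu>)" by (rule bochner_cong) (auto simp: Vsum)
 finally have msum: "(\<Sum>i\<le>K. m i) = real N" by (simp add: m_def sum_distrib_left[symmetric] \<mu>.prob_space)
 then have "(\<Sum>i\<le>K. m i) \<in> \<int>" by simp
 then have "\<exists>f. (\<forall>i. 0 \<le> f i \<and> f i < 1) \<and> f 0 = 0 \<and>
  (\<forall>j\<le>K. m j - f j + (\<Sum>i\<le>K. if p i = j then f i else 0) \<in> \<int>)" by (rule tree_flow) (use p in auto)
 then obtain f where f: "\<forall>i. 0 \<le> f i \<and> f i < 1" "f 0 = 0"
  "\<forall>j\<le>K. m j - f j + (\<Sum>i\<le>K. if p i = j then f i else 0) \<in> \<int>" by blast
 \<comment> \<open>The share of cell j assigned to vertex i: the fraction \<open>f j / m j\<close>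
   goes to the parent, the rest stays.\<close>
 define w where "w i j = (if j = i then 1 - f j / m j else 0) + (if p j = i then f j / m j else 0)" for i j
 have w0: "0 \<le> w i j" if "j \<le> K" for i j
 proof -
  have "f j / m j \<le> 1" "0 \<le> f j / m j" using m[OF that] f(1)[rule_format, of j] by simp_all
  then show ?thesis unfolding w_def by (auto simp del: divide_le_eq_1_pos)
 qed
 have w1: "(\<Sum>i\<le>K. w i j) = 1" if "j \<le> K" for j using f(2) p[rule_format, of j] that by (cases "j = 0") (auto simp: w_def sum.distrib)
 define g where "g i y = real N * (\<Sum>j\<le>K. w i j * indicator (V j) y)" for i y
 define n where "n i = nat \<lfloor>\<Sum>j\<le>K. w i j * m j\<rfloor>" for i
 have n_eq: "real (n i) = (\<Sum>j\<le>K. w i j * m j)" and n_pos: "n i > 0" if i: "i \<le> K" for i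
 proof -
  have "w i j * m j = (if j = i then m j - f j else 0) + (if p j = i then f j else 0)" if "j \<le> K" for j
   using m[OF that] by (cases "j = i") (simp_all add: w_def field_simps)
  then have s: "(\<Sum>j\<le>K. w i j * m j) = m i - f i + (\<Sum>j\<le>K. if p j = i then f j else 0)" using i by (simp add: sum.distrib)
  have "(\<Sum>j\<le>K. if p j = i then f j else 0) \<ge> 0" using f(1) by (intro sum_nonneg) auto
  then have pos: "(\<Sum>j\<le>K. w i j * m j) > 0" using m[OF i] f(1)[rule_format, of i] s by linarith
  moreover obtain z where "(\<Sum>j\<le>K. w i j * m j) = of_int z" using f(3) i s by (metis Ints_cases)
  ultimately show "real (n i) = (\<Sum>j\<le>K. w i j * m j)" unfolding n_def by simp
  with pos show "n i > 0" by (metis of_nat_0_less_iff)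
 qed
 have gm: "g i \<in> borel_measurable \<mu>" for i
  unfolding g_def[abs_def] using Vm by (intro borel_measurable_times borel_measurable_sum borel_measurable_const borel_measurable_indicator) auto
 have g_nonneg: "0 \<le> g i y" for i y unfolding g_def using w0 by (intro mult_nonneg_nonneg sum_nonneg) auto
 have g_int: "(\<integral>y. g i y \<partial>\<mu>) = real (n i)" if i: "i \<le> K" for i
 proof -
  have ii: "integrable \<mu> (indicat_real (V j))" for j using Vm by (intro integrable_real_indicator) (auto simp: \<mu>.emeasure_eq_measure)
  have "(\<integral>y. g i y \<partial>\<mu>) = real N * (\<integral>y. (\<Sum>j\<le>K. w i j * indicator (V j) y) \<partial>\<mu>)"
   unfolding g_def by (rule integral_mult_right_zero)
  also have "(\<integral>y. (\<Sum>j\<le>K. w i j * indicator (V j) y) \<partial>\<mu>) = (\<Sum>j\<le>K. \<integral>y. w i j * indicator (V j) y \<partial>\<mu>)"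
   by (rule bochner_sum) (intro integrable_mult_right ii)
  finally show ?thesis by (simp add: VQ n_eq[OF i] m_def sum_distrib_left mult.left_commute)
 qed
 have g_sum: "(\<Sum>i\<le>K. g i y) = real N" if y: "y \<in> Q" for y
 proof -
  have "(\<Sum>i\<le>K. \<Sum>j\<le>K. w i j * indicator (V j) y) = (\<Sum>j\<le>K. (\<Sum>i\<le>K. w i j) * indicator (V j) y)"
   by (subst sum.swap) (simp add: sum_distrib_right)
  also have "\<dots> = 1" using Vsum[OF y] w1 by simp
  finally show ?thesis unfolding g_def by (simp add: sum_distrib_left[symmetric])
 qed
 \<comment> \<open>Mass at y comes from the vertex's own cell or from the cell of a child, whose
   centre is within \<open>6 * r\<close>; a further \<open>2 * r\<close> leads from that centre to
   y.\<close>
 have g_near: "\<theta> (c i) y \<le> 8 * r" if i: "i \<le> K" and y: "y \<in> Q" "g i y \<noteq> 0" for i y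
 proof -
  have "(\<Sum>j\<le>K. w i j * indicator (V j) y) \<noteq> 0" using y unfolding g_def by auto
  then obtain j where j0: "j \<in> {..K}" "w i j * indicat_real (V j) y \<noteq> 0" by (rule sum.not_neutral_contains_not_neutral)
  then have j: "j \<le> K" "y \<in> V j" by (auto simp: indicator_def split: if_splits)
  have "j = i \<or> 0 < j \<and> p j = i" using j0(2) f(2) by (cases "j = 0") (auto simp: w_def split: if_splits)
  then have "j = i \<or> \<theta> (c i) (c j) \<le> 6 * r" "\<theta> (c j) y < 2 * r" using p[rule_format, of j] Vnear j by auto
  then show ?thesis using theta_triangle[OF cQ[OF i] cQ[OF j(1)] y(1)] r by auto
 qed
 \<comment> \<open>Vertex i now holds the integer mass \<open>n i\<close>; its density is used
   \<open>n i\<close> times, each copy divided by \<open>n i\<close>.\<close>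
 define I where "I = Sigma {..K} (\<lambda>i. {..<n i})"
 have "real (card I) = (\<Sum>i\<le>K. real (n i))" unfolding I_def by simp
 also have "\<dots> = (\<Sum>i\<le>K. \<Sum>j\<le>K. w i j * m j)" using n_eq by simp
 also have "\<dots> = (\<Sum>j\<le>K. (\<Sum>i\<le>K. w i j) * m j)" by (subst sum.swap) (simp add: sum_distrib_right)
 also have "\<dots> = (\<Sum>j\<le>K. m j)" using w1 by simp
 finally have cardI: "card I = N" using msum by simp
 have "finite I" unfolding I_def by simp
 then obtain b where b: "bij_betw b {..<N} I" using ex_bij_betw_nat_finite[of I] cardI by (auto simp: atLeast0LessThan)
 define h where "h t y = g (fst (b t)) y / real (n (fst (b t)))" for t y
 have bK: "fst (b t) \<le> K" if "t < N" for t
 proof -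
  have "b t \<in> I" using bij_betwE[OF b] that by blast
  then show ?thesis by (auto simp: I_def)
 qed
 have "(\<Sum>t<N. h t y) = real N" if y: "y \<in> Q" for y
 proof -
  have "(\<Sum>t<N. h t y) = (\<Sum>q\<in>I. g (fst q) y / real (n (fst q)))" unfolding h_def by (rule sum.reindex_bij_betw[OF b])
  also have "\<dots> = (\<Sum>i\<le>K. \<Sum>j<n i. g i y / real (n i))" unfolding I_def by (subst sum.Sigma) (auto simp: case_prod_beta)
  also have "\<dots> = (\<Sum>i\<le>K. g i y)" using n_pos by (intro sum.cong) auto
  finally show ?thesis using g_sum[OF y] by simp
 qed
 moreover have "h t \<in> borel_measurable \<mu> \<and> (\<forall>y\<in>Q. 0 \<le> h t y) \<and> (\<integral>y. h t y \<partial>\<mu>) = 1 \<and>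
   (\<forall>y\<in>Q. \<forall>z\<in>Q. h t y \<noteq> 0 \<longrightarrow> h t z \<noteq> 0 \<longrightarrow> \<theta> y z \<le> 16 * r)" if t: "t < N" for t
 proof (intro conjI ballI impI)
  note [measurable] = gm
  show "h t \<in> borel_measurable \<mu>" unfolding h_def[abs_def] by measurable
  show "0 \<le> h t y" for y unfolding h_def using g_nonneg by simp
  show "(\<integral>y. h t y \<partial>\<mu>) = 1" unfolding h_def using g_int[OF bK[OF t]] n_pos[OF bK[OF t]] by simp
  fix y z assume yz: "y \<in> Q" "z \<in> Q" "h t y \<noteq> 0" "h t z \<noteq> 0"
  then have "\<theta> (c (fst (b t))) y \<le> 8 * r" "\<theta> (c (fst (b t))) z \<le> 8 * r" using g_near[OF bK[OF t]] unfolding h_def by auto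
  then show "\<theta> y z \<le> 16 * r" using theta_triangle[OF yz(1) cQ[OF bK[OF t]] yz(2)] theta_sym[OF yz(1) cQ[OF bK[OF t]]] by linarith
 qed
 ultimately show ?thesis by (intro exI[of _ h] conjI allI impI ballI) blast+
qed

section \<open>Selection of points at least as good as the average\<close>

definition average :: "('a \<Rightarrow> 'a \<Rightarrow> real) \<Rightarrow> ('a \<Rightarrow> real) \<Rightarrow> 'a \<Rightarrow> real" where
 "average f h y = (\<integral>z. f y z * h z \<partial>\<mu>)"

text \<open>Otherwise u lies below its average A on all of Q, so \<open>(A - u) * h\<close> is
  nonnegative with integral 0; then \<open>h = 0\<close> almost everywhere, against its integral
  1.\<close>

lemma exists_ge_average:
 fixes u h :: "'a \<Rightarrow> real"
 assumes u: "u \<in> borel_measurable \<mu>" "\<forall>y\<in>Q. \<bar>u y\<bar> \<le> U"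
  and h: "h \<in> borel_measurable \<mu>" "\<forall>y\<in>Q. 0 \<le> h y \<and> h y \<le> H" "(\<integral>y. h y \<partial>\<mu>) = 1"
 shows "\<exists>y\<in>Q. (\<integral>y. u y * h y \<partial>\<mu>) \<le> u y"
proof (rule ccontr)
 define A where "A = (\<integral>y. u y * h y \<partial>\<mu>)"
 assume "\<not> ?thesis"
 then have less: "u y < A" if "y \<in> Q" for y using that unfolding A_def by (meson not_le)
 have hi: "integrable \<mu> h" by (rule bounded_integrable[OF h(1), of H]) (use h(2) in auto)
 have uhi: "integrable \<mu> (\<lambda>y. u y * h y)"
 proof (rule bounded_integrable[where B="U * H"])
  show "\<bar>u y * h y\<bar> \<le> U * H" if "y \<in> Q" for y
   unfolding abs_mult using u(2) h(2) that by (intro mult_mono) (auto intro: order_trans[OF abs_ge_zero])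
 qed (use u(1) h(1) in measurable)
 have "(\<integral>y. A * h y - u y * h y \<partial>\<mu>) = A * (\<integral>y. h y \<partial>\<mu>) - (\<integral>y. u y * h y \<partial>\<mu>)"
  using hi uhi by simp
 then have "(\<integral>y. A * h y - u y * h y \<partial>\<mu>) = 0" using h(3) by (simp add: A_def)
 moreover have "AE y in \<mu>. 0 \<le> A * h y - u y * h y"
 proof (rule AE_I2)
  fix y assume "y \<in> space \<mu>"
  then have "0 \<le> (A - u y) * h y" using less[of y] h(2) by (intro mult_nonneg_nonneg) auto
  then show "0 \<le> A * h y - u y * h y" by (simp add: left_diff_distrib)
 qed
 ultimately have "AE y in \<mu>. A * h y - u y * h y = 0" using hi uhi by (subst (asm) integral_nonneg_eq_0_iff_AE) auto
 moreover have "h y = 0" if "y \<in> Q" "A * h y - u y * h y = 0" for y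
 proof -
  have "(A - u y) * h y = 0" using that(2) by (simp add: left_diff_distrib)
  then show ?thesis using less[OF that(1)] by simp
 qed
 ultimately have "AE y in \<mu>. h y = 0" using AE_space[of \<mu>] by (auto elim!: eventually_elim2)
 then have "(\<integral>y. h y \<partial>\<mu>) = (\<integral>y. 0 \<partial>\<mu>)" using h(1) by (intro integral_cong_AE) auto
 then show False using h(3) by simp
qed

lemma average_props:
 assumes f: "case_prod f \<in> borel_measurable (\<mu> \<Otimes>\<^sub>M \<mu>)" "\<forall>x\<in>Q. \<forall>y\<in>Q. \<bar>f x y\<bar> \<le> B"
  and h: "h \<in> borel_measurable \<mu>" "\<forall>y\<in>Q. 0 \<le> h y \<and> h y \<le> H" "(\<integral>y. h y \<partial>\<mu>) = 1"
 shows "average f h \<in> borel_measurable \<mu>" "\<forall>y\<in>Q. \<bar>average f h y\<bar> \<le> B"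
  and "x \<in> Q \<Longrightarrow> integrable \<mu> (\<lambda>y. f x y * h y)"
proof -
 note [measurable] = h(1)
 have "case_prod (\<lambda>y z. f y z * h z) = (\<lambda>p. case_prod f p * h (snd p))" by auto
 also have "\<dots> \<in> borel_measurable (\<mu> \<Otimes>\<^sub>M \<mu>)" using f(1) by measurable
 finally show "average f h \<in> borel_measurable \<mu>" unfolding average_def[abs_def] by (rule \<mu>.borel_measurable_lebesgue_integral)
 have hi: "integrable \<mu> h" by (rule bounded_integrable[OF h(1), of H]) (use h(2) in auto)
 have fm: "f x \<in> borel_measurable \<mu>" if "x \<in> Q" for x using measurable_Pair2[OF f(1), of x] that by simp
 have fb: "\<bar>f x y * h y\<bar> \<le> B * h y" if "x \<in> Q" "y \<in> Q" for x y using f(2) h(2) that by (simp add: abs_mult mult_right_mono)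
 have i: "integrable \<mu> (\<lambda>y. f x y * h y)" if x: "x \<in> Q" for x
 proof (rule Bochner_Integration.integrable_bound[where f="\<lambda>y. B * h y"])
  show "(\<lambda>y. f x y * h y) \<in> borel_measurable \<mu>" using fm[OF x] by measurable
  show "AE y in \<mu>. norm (f x y * h y) \<le> norm (B * h y)"
   by (rule AE_I2) (use fb[OF x] in \<open>auto intro: order_trans[OF _ abs_ge_self]\<close>)
 qed (use hi in simp)
 show "integrable \<mu> (\<lambda>y. f x y * h y)" if "x \<in> Q" by (rule i[OF that])
 show "\<forall>y\<in>Q. \<bar>average f h y\<bar> \<le> B"
 proof
  fix y assume y: "y \<in> Q"
  have "\<bar>average f h y\<bar> \<le> (\<integral>z. \<bar>f y z * h z\<bar> \<partial>\<mu>)" unfolding average_def by (rule integral_abs_bound)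
  also have "\<dots> \<le> (\<integral>z. B * h z \<partial>\<mu>)" using fb[OF y] i[OF y] hi by (intro integral_mono) auto
  finally show "\<bar>average f h y\<bar> \<le> B" using h(3) by simp
 qed
qed

text \<open>The method of conditional expectations. The point of largest index is chosen first, at
  least as good as its average while the others are still random; its interaction with the others is
  then added to the linear term. That is why a general u is carried through the induction.\<close>

lemma choose_points:
 fixes h :: "nat \<Rightarrow> 'a \<Rightarrow> real"
 assumes f: "case_prod f \<in> borel_measurable (\<mu> \<Otimes>\<^sub>M \<mu>)" "\<forall>x\<in>Q. \<forall>y\<in>Q. \<bar>f x y\<bar> \<le> B"
  and h: "\<And>t. t < N \<Longrightarrow> h t \<in> borel_measurable \<mu>" "\<And>t. t < N \<Longrightarrow> \<forall>y\<in>Q. 0 \<le> h t y \<and> h t y \<le> H"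
   "\<And>t. t < N \<Longrightarrow> (\<integral>y. h t y \<partial>\<mu>) = 1"
  and u: "u \<in> borel_measurable \<mu>" "\<forall>y\<in>Q. \<bar>u y\<bar> \<le> U" shows "\<exists>x. (\<forall>i<N. x i \<in> Q) \<and>
  (\<Sum>i<N. \<integral>y. u y * h i y \<partial>\<mu>) + (\<Sum>i<N. \<Sum>j<i. \<integral>y. average f (h j) y * h i y \<partial>\<mu>) \<le>
  (\<Sum>i<N. u (x i)) + (\<Sum>i<N. \<Sum>j<i. f (x i) (x j))"
 using assms(3-)
proof (induction N arbitrary: u U)
 case (Suc N)
 note av = average_props[OF f Suc.prems(1-3)]
 let ?u = "\<lambda>y. u y + (\<Sum>j<N. average f (h j) y)"
 have avm: "(\<lambda>y. \<Sum>j<N. average f (h j) y) \<in> borel_measurable \<mu>" using av(1) by (intro borel_measurable_sum) auto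
 have hN: "h N \<in> borel_measurable \<mu>" "\<forall>y\<in>Q. 0 \<le> h N y \<and> h N y \<le> H" "(\<integral>y. h N y \<partial>\<mu>) = 1" using Suc.prems by auto
 have bd: "\<bar>?u y\<bar> \<le> U + real N * B" if y: "y \<in> Q" for y
 proof -
  have "\<bar>\<Sum>j<N. average f (h j) y\<bar> \<le> (\<Sum>j<N. B)" using av(2) y by (intro order_trans[OF sum_abs] sum_mono) auto
  then show ?thesis using Suc.prems(5) y by (force intro: order_trans[OF abs_triangle_ineq] add_mono)
 qed
 have "\<exists>y\<in>Q. (\<integral>y. ?u y * h N y \<partial>\<mu>) \<le> ?u y"
  by (rule exists_ge_average[OF _ _ hN, of _ "U + real N * B"]) (use avm Suc.prems(4) bd in auto)
 then obtain y where y: "y \<in> Q" "(\<integral>y. ?u y * h N y \<partial>\<mu>) \<le> ?u y" by blast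
 have int: "integrable \<mu> (\<lambda>y. v y * h i y)" if "v \<in> borel_measurable \<mu>" "\<forall>y\<in>Q. \<bar>v y\<bar> \<le> V" "i \<le> N" for v V i
 proof (rule bounded_integrable[where B="V * H"])
  have "h i \<in> borel_measurable \<mu>" using Suc.prems(1) that(3) by simp
  then show "(\<lambda>y. v y * h i y) \<in> borel_measurable \<mu>" using that(1) by measurable
  show "\<bar>v z * h i z\<bar> \<le> V * H" if "z \<in> Q" for z
   unfolding abs_mult using \<open>\<forall>y\<in>Q. \<bar>v y\<bar> \<le> V\<close> Suc.prems(2)[of i] \<open>i \<le> N\<close> that
   by (intro mult_mono) (auto intro: order_trans[OF abs_ge_zero])
 qed
 have lin: "(\<integral>y. ?u y * h N y \<partial>\<mu>) = (\<integral>y. u y * h N y \<partial>\<mu>) + (\<Sum>j<N. \<integral>y. average f (h j) y * h N y \<partial>\<mu>)"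
 proof -
  have i1: "integrable \<mu> (\<lambda>y. u y * h N y)" by (rule int[OF Suc.prems(4,5)]) simp
  have i2: "integrable \<mu> (\<lambda>y. average f (h j) y * h N y)" if "j < N" for j by (rule int[OF av(1,2)]) (use that in auto)
  have "(\<integral>y. ?u y * h N y \<partial>\<mu>) = (\<integral>y. u y * h N y + (\<Sum>j<N. average f (h j) y * h N y) \<partial>\<mu>)"
   by (simp add: distrib_right sum_distrib_right)
  also have "\<dots> = (\<integral>y. u y * h N y \<partial>\<mu>) + (\<integral>y. (\<Sum>j<N. average f (h j) y * h N y) \<partial>\<mu>)"
   using i1 i2 by (intro Bochner_Integration.integral_add Bochner_Integration.integrable_sum) auto
  also have "(\<integral>y. (\<Sum>j<N. average f (h j) y * h N y) \<partial>\<mu>) = (\<Sum>j<N. \<integral>y. average f (h j) y * h N y \<partial>\<mu>)"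
   using i2 by (intro bochner_sum) auto
  finally show ?thesis .
 qed
 have fy: "f y \<in> borel_measurable \<mu>" using measurable_Pair2[OF f(1), of y] y(1) by simp
 let ?v = "\<lambda>z. u z + f y z"
 have "\<exists>x. (\<forall>i<N. x i \<in> Q) \<and>
  (\<Sum>i<N. \<integral>z. ?v z * h i z \<partial>\<mu>) + (\<Sum>i<N. \<Sum>j<i. \<integral>y. average f (h j) y * h i y \<partial>\<mu>) \<le>
  (\<Sum>i<N. ?v (x i)) + (\<Sum>i<N. \<Sum>j<i. f (x i) (x j))"
 proof (rule Suc.IH)
  show "?v \<in> borel_measurable \<mu>" using fy Suc.prems(4) by measurable
  show "\<forall>z\<in>Q. \<bar>?v z\<bar> \<le> U + B" using f(2) y(1) Suc.prems(5) by (auto intro!: order_trans[OF abs_triangle_ineq] add_mono)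
 qed (use Suc.prems(1-3) in auto)
 then obtain x where x: "\<forall>i<N. x i \<in> Q"
  "(\<Sum>i<N. \<integral>z. ?v z * h i z \<partial>\<mu>) + (\<Sum>i<N. \<Sum>j<i. \<integral>y. average f (h j) y * h i y \<partial>\<mu>) \<le>
  (\<Sum>i<N. ?v (x i)) + (\<Sum>i<N. \<Sum>j<i. f (x i) (x j))" by blast
 have split: "(\<integral>z. ?v z * h i z \<partial>\<mu>) = (\<integral>z. u z * h i z \<partial>\<mu>) + average f (h i) y" if "i < N" for i
  unfolding average_def distrib_right by (rule Bochner_Integration.integral_add[OF int[OF Suc.prems(4,5)] av(3)[OF _ _ _ y(1)]]) (use that in auto)
 define x' where "x' = x(N := y)"
 have eq: "(\<Sum>i<Suc N. u (x' i)) = (\<Sum>i<N. u (x i)) + u y"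
  "(\<Sum>i<Suc N. \<Sum>j<i. f (x' i) (x' j)) = (\<Sum>i<N. \<Sum>j<i. f (x i) (x j)) + (\<Sum>j<N. f y (x j))" by (simp_all add: x'_def)
 have "\<forall>i<Suc N. x' i \<in> Q" using x(1) y(1) by (simp add: x'_def less_Suc_eq)
 moreover have "(\<Sum>i<Suc N. \<integral>y. u y * h i y \<partial>\<mu>) + (\<Sum>i<Suc N. \<Sum>j<i. \<integral>y. average f (h j) y * h i y \<partial>\<mu>) \<le>
  (\<Sum>i<Suc N. u (x' i)) + (\<Sum>i<Suc N. \<Sum>j<i. f (x' i) (x' j))"
  using x(2) y(2) unfolding eq lin by (simp add: split sum.distrib)
 ultimately show ?case by blast
qed simp

text \<open>For independent points with the densities \<open>h i\<close>, the expectation over all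
  index pairs, with two independent copies on the diagonal, is exactly the mean times
  \<open>N^2\<close>, because the densities add up to N. Only the diagonal part
  \<open>en i i\<close> is not realised by actual points, and it is at most
  \<open>16 * R * r\<close> by the size of the supports.\<close>

theorem distance_sum_lower_bound:
 assumes \<eta>: "\<eta> \<in> weight_class d d0" shows "\<exists>C>0. \<forall>N\<ge>1. \<exists>D\<in>point_sets Q N.
  mean_rho \<eta> * (real N)^2 - C * real N powr (1 - 1 / real d) \<le> dist_sum (symdiff_metric Q \<theta> \<mu> \<eta>) D"
proof -
 let ?r = "symdiff_metric Q \<theta> \<mu> \<eta>"
 obtain R where R: "R > 0" "\<forall>x\<in>Q. \<forall>z\<in>Q. 0 \<le> ?r x z \<and> ?r x z \<le> R * \<theta> x z" using rho_bound[OF \<eta>] by blast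
 obtain v where v: "v > 0" "\<forall>r\<in>{0..pi}. v * r ^ d \<le> vol r" using vol_lower by blast
 have d: "d > 0" using d_pos by simp
 have rb: "\<forall>x\<in>Q. \<forall>z\<in>Q. \<bar>?r x z\<bar> \<le> R * pi"
 proof (intro ballI)
  fix x z assume xz: "x \<in> Q" "z \<in> Q"
  have "?r x z \<le> R * \<theta> x z" "0 \<le> ?r x z" using R xz by auto
  moreover have "R * \<theta> x z \<le> R * pi" using R(1) theta_range[OF xz] by (intro mult_left_mono) auto
  ultimately show "\<bar>?r x z\<bar> \<le> R * pi" by simp
 qed
 have mr: "0 \<le> mean_rho \<eta>" using integral_rho[OF \<eta> e_in[of 0]] R(2) by (metis bochner_nonneg e_in space_\<mu>)
 define \<kappa> where "\<kappa> = v powr (- 1 / real d)"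
 \<comment> \<open>A bound for those N for which r exceeds pi; for them the constant C alone makes
   the left side nonpositive.\<close>
 define N0 where "N0 = 1 / (v * pi ^ d)"
 define C where "C = N0^2 * mean_rho \<eta> + 16 * R * \<kappa>"
 have \<kappa>: "\<kappa> > 0" unfolding \<kappa>_def using v by simp
 have C1: "N0^2 * mean_rho \<eta> \<le> C" "16 * R * \<kappa> \<le> C" "C > 0" unfolding C_def using R(1) \<kappa> mr by (auto intro: add_nonneg_pos)
 have "\<exists>D\<in>point_sets Q N. mean_rho \<eta> * (real N)^2 - C * real N powr (1 - 1 / real d) \<le> dist_sum ?r D" if N: "N \<ge> 1" for N
 proof -
  \<comment> \<open>Chosen so that \<open>N * v * r ^ d = 1\<close>; if \<open>r \<le> pi\<close>,
    balls of this radius have measure at least \<open>1 / N\<close>.\<close>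
  define r where "r = \<kappa> * real N powr (- 1 / real d)"
  have r0: "r > 0" unfolding r_def using \<kappa> N by simp
  have rd: "v * r ^ d = 1 / real N"
  proof -
   have "r ^ d = (v powr (- 1 / real d)) ^ d * (real N powr (- 1 / real d)) ^ d" unfolding r_def \<kappa>_def by (rule power_mult_distrib)
   also have "\<dots> = v powr (- 1) * real N powr (- 1)" using d v(1) N by (simp add: powr_realpow[symmetric] powr_powr)
   finally show ?thesis using v(1) N by (simp add: powr_minus divide_inverse)
  qed
  have Npow: "real N * r = \<kappa> * real N powr (1 - 1 / real d)" unfolding r_def using N powr_add[of "real N" 1 "- 1 / real d"] by simp
  show ?thesis
  proof (cases "r \<le> pi")
   case False
   have "v * pi ^ d \<le> v * r ^ d" using False v(1) by (intro mult_left_mono power_mono) auto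
   then have "v * pi ^ d \<le> 1 / real N" using rd by simp
   then have "real N \<le> N0" unfolding N0_def using N v(1) by (simp add: field_simps)
   then have "(real N)^2 \<le> N0^2" by (intro power_mono) auto
   then have "mean_rho \<eta> * (real N)^2 \<le> mean_rho \<eta> * N0^2" using mr by (intro mult_left_mono)
   also have "\<dots> \<le> C * 1" using C1(1) by (simp add: mult.commute)
   also have "\<dots> \<le> C * real N powr (1 - 1 / real d)" using C1(3) N d by (intro mult_left_mono ge_one_powr_ge_zero) auto
   finally have le: "mean_rho \<eta> * (real N)^2 - C * real N powr (1 - 1 / real d) \<le> 0" by simp
   have "0 \<le> dist_sum ?r (pts (\<lambda>_. e 0) N)" unfolding dist_sum_pts using R(2) by (intro sum_nonneg) auto
   then show ?thesis using le pts_in[of N "\<lambda>_. e 0"] by (meson e_in order_trans)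
  next
   case True
   have "1 = real N * (v * r ^ d)" using rd N by simp
   also have "\<dots> \<le> real N * vol r" using v(2) True r0 by (intro mult_left_mono) auto
   finally have "1 \<le> real N * vol r" .
   from small_densities[OF r0 True this] obtain h :: "nat \<Rightarrow> 'a \<Rightarrow> real" where
    h: "\<forall>t<N. h t \<in> borel_measurable \<mu> \<and> (\<forall>y\<in>Q. 0 \<le> h t y) \<and> (\<integral>y. h t y \<partial>\<mu>) = 1 \<and>
     (\<forall>y\<in>Q. \<forall>z\<in>Q. h t y \<noteq> 0 \<longrightarrow> h t z \<noteq> 0 \<longrightarrow> \<theta> y z \<le> 16 * r)"
    and hs: "\<forall>y\<in>Q. (\<Sum>t<N. h t y) = real N" by (elim exE conjE) (rule that)
   have h1: "\<And>t. t < N \<Longrightarrow> h t \<in> borel_measurable \<mu>" and h3: "\<And>t. t < N \<Longrightarrow> (\<integral>y. h t y \<partial>\<mu>) = 1"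
    and h0: "\<And>t y. t < N \<Longrightarrow> y \<in> Q \<Longrightarrow> 0 \<le> h t y"
    and h4: "\<And>t y z. t < N \<Longrightarrow> y \<in> Q \<Longrightarrow> z \<in> Q \<Longrightarrow> h t y \<noteq> 0 \<Longrightarrow> h t z \<noteq> 0 \<Longrightarrow> \<theta> y z \<le> 16 * r" using h by blast+
   have h2: "\<forall>y\<in>Q. 0 \<le> h t y \<and> h t y \<le> real N" if t: "t < N" for t
   proof (intro ballI conjI)
    fix y assume y: "y \<in> Q"
    show "0 \<le> h t y" by (rule h0[OF t y])
    have "h t y \<le> (\<Sum>t<N. h t y)" using t h0 y by (intro member_le_sum) auto
    then show "h t y \<le> real N" using hs y by simp
   qed
   note rm = rho_measurable_pair[OF \<eta>]
   have av: "average ?r (h t) \<in> borel_measurable \<mu>" "\<forall>y\<in>Q. \<bar>average ?r (h t) y\<bar> \<le> R * pi"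
    "y \<in> Q \<Longrightarrow> integrable \<mu> (\<lambda>z. ?r y z * h t z)" if "t < N" for t y
    using average_props[OF rm rb h1[OF that] h2[OF that] h3[OF that]] by blast+
   have hi: "integrable \<mu> (h t)" if "t < N" for t by (rule bounded_integrable[OF h1[OF that], of "real N"]) (use h2[OF that] in auto)
   have ai: "integrable \<mu> (\<lambda>y. average ?r (h j) y * h i y)" if "i < N" "j < N" for i j
   proof (rule bounded_integrable[where B="R * pi * real N"])
    show "(\<lambda>y. average ?r (h j) y * h i y) \<in> borel_measurable \<mu>" using av(1) h1 that by measurable
    show "\<bar>average ?r (h j) y * h i y\<bar> \<le> R * pi * real N" if "y \<in> Q" for y
     unfolding abs_mult using av(2)[OF \<open>j < N\<close>] h2[OF \<open>i < N\<close>] that R(1) by (intro mult_mono) auto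
   qed
   define en where "en i j = (\<integral>y. average ?r (h j) y * h i y \<partial>\<mu>)" for i j
   have "\<exists>x. (\<forall>i<N. x i \<in> Q) \<and> (\<Sum>i<N. \<integral>y. 0 * h i y \<partial>\<mu>) + (\<Sum>i<N. \<Sum>j<i. en i j) \<le>
     (\<Sum>i<N. 0) + (\<Sum>i<N. \<Sum>j<i. ?r (x i) (x j))"
    unfolding en_def by (rule choose_points[OF rm rb h1 h2 h3, where u="\<lambda>_. 0" and U=0]) auto
   then obtain x where x: "\<forall>i<N. x i \<in> Q" "(\<Sum>i<N. \<Sum>j<i. en i j) \<le> (\<Sum>i<N. \<Sum>j<i. ?r (x i) (x j))" by auto
   have sym: "en i j = en j i" if ij: "i < N" "j < N" for i j
   proof -
    have "en i j = (\<integral>y. \<integral>z. ?r y z * h j z * h i y \<partial>\<mu> \<partial>\<mu>)" unfolding en_def average_def by simp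
    also have "\<dots> = (\<integral>z. \<integral>y. ?r y z * h j z * h i y \<partial>\<mu> \<partial>\<mu>)"
    proof (rule integral_swap[symmetric])
     note [measurable] = h1[OF ij(1)] h1[OF ij(2)]
     have "case_prod (\<lambda>y z. ?r y z * h j z * h i y) = (\<lambda>p. case_prod ?r p * h j (snd p) * h i (fst p))" by auto
     also have "\<dots> \<in> borel_measurable (\<mu> \<Otimes>\<^sub>M \<mu>)" using rm by measurable
     finally show "case_prod (\<lambda>y z. ?r y z * h j z * h i y) \<in> borel_measurable (\<mu> \<Otimes>\<^sub>M \<mu>)" .
     show "\<bar>?r y z * h j z * h i y\<bar> \<le> R * pi * real N * real N" if "y \<in> Q" "z \<in> Q" for y z
      unfolding abs_mult using rb h2[OF ij(1)] h2[OF ij(2)] that R(1) by (intro mult_mono) auto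
    qed
    also have "\<dots> = (\<integral>z. \<integral>y. ?r z y * h i y * h j z \<partial>\<mu> \<partial>\<mu>)"
     by (intro bochner_cong) (auto simp: rho_sym[OF \<eta>] mult_ac)
    also have "\<dots> = en j i" unfolding en_def average_def by simp
    finally show ?thesis .
   qed
   have row: "(\<Sum>j<N. en i j) = real N * mean_rho \<eta>" if i: "i < N" for i
   proof -
    have avs: "(\<Sum>j<N. average ?r (h j) y) = real N * mean_rho \<eta>" if y: "y \<in> Q" for y
    proof -
     have "(\<Sum>j<N. average ?r (h j) y) = (\<integral>z. (\<Sum>j<N. ?r y z * h j z) \<partial>\<mu>)"
      unfolding average_def using av(3)[OF _ y] by (intro bochner_sum[symmetric]) auto
     also have "\<dots> = (\<integral>z. real N * ?r y z \<partial>\<mu>)"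
      by (rule bochner_cong) (use hs in \<open>auto simp: sum_distrib_left[symmetric]\<close>)
     finally show ?thesis using integral_rho[OF \<eta> y] by simp
    qed
    have "(\<Sum>j<N. en i j) = (\<integral>y. (\<Sum>j<N. average ?r (h j) y * h i y) \<partial>\<mu>)"
     unfolding en_def using ai[OF i] by (intro bochner_sum[symmetric]) auto
    also have "\<dots> = (\<integral>y. real N * mean_rho \<eta> * h i y \<partial>\<mu>)"
     by (rule bochner_cong) (auto simp: sum_distrib_right[symmetric] avs)
    finally show ?thesis using h3[OF i] by simp
   qed
   have diag: "en i i \<le> 16 * R * r" if i: "i < N" for i
   proof -
    have hh: "average ?r (h i) y * h i y \<le> 16 * R * r * h i y" if y: "y \<in> Q" for y
    proof (cases "h i y = 0")
     case False
     have "average ?r (h i) y \<le> (\<integral>z. 16 * R * r * h i z \<partial>\<mu>)" unfolding average_def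
     proof (rule integral_mono[OF av(3)[OF i y]])
      show "?r y z * h i z \<le> 16 * R * r * h i z" if "z \<in> space \<mu>" for z
      proof (cases "h i z = 0")
       case nz: False
       have z: "z \<in> Q" using that by simp
       have "?r y z \<le> R * \<theta> y z" using R(2) y z by blast
       also have "\<dots> \<le> R * (16 * r)" using h4[OF i y z False nz] R(1) by (intro mult_left_mono) auto
       finally show ?thesis using h0[OF i z] by (intro mult_right_mono) auto
      qed simp
     qed (use hi[OF i] in simp)
     then have "average ?r (h i) y \<le> 16 * R * r" using h3[OF i] by simp
     then show ?thesis using h0[OF i y] by (intro mult_right_mono)
    qed simp
    have "en i i \<le> (\<integral>y. 16 * R * r * h i y \<partial>\<mu>)" unfolding en_def
     using ai[OF i i] hh hi[OF i] by (intro integral_mono) auto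
    then show ?thesis using h3[OF i] by simp
   qed
   have "(\<Sum>i<N. \<Sum>j<N. en i j) = 2 * (\<Sum>i<N. \<Sum>j<i. en i j) + (\<Sum>i<N. en i i)" using sym by (rule sum_symmetric_square)
   moreover have "(\<Sum>i<N. \<Sum>j<N. en i j) = mean_rho \<eta> * (real N)^2" by (simp add: row power2_eq_square)
   moreover have "(\<Sum>i<N. en i i) \<le> real N * (16 * R * r)"
    using sum_mono[of "{..<N}" "\<lambda>i. en i i" "\<lambda>_. 16 * R * r"] diag by simp
   moreover have "(\<Sum>i<N. \<Sum>j<N. ?r (x i) (x j)) = 2 * (\<Sum>i<N. \<Sum>j<i. ?r (x i) (x j)) + (\<Sum>i<N. ?r (x i) (x i))"
    using x(1) by (intro sum_symmetric_square) (simp add: rho_sym[OF \<eta>])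
   moreover have "0 \<le> (\<Sum>i<N. ?r (x i) (x i))" using x(1) R(2) by (intro sum_nonneg) auto
   ultimately have "mean_rho \<eta> * (real N)^2 - real N * (16 * R * r) \<le> dist_sum ?r (pts x N)"
    using x(2) unfolding dist_sum_pts by linarith
   moreover have "real N * (16 * R * r) \<le> C * real N powr (1 - 1 / real d)"
   proof -
    have "real N * (16 * R * r) = 16 * R * (real N * r)" by simp
    also have "\<dots> = 16 * R * \<kappa> * real N powr (1 - 1 / real d)" unfolding Npow by simp
    also have "\<dots> \<le> C * real N powr (1 - 1 / real d)" using C1(2) by (intro mult_right_mono) auto
    finally show ?thesis .
   qed
   ultimately have "mean_rho \<eta> * (real N)^2 - C * real N powr (1 - 1 / real d) \<le> dist_sum ?r (pts x N)" by linarith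
   moreover have "pts x N \<in> point_sets Q N" using x(1) by (intro pts_in) auto
   ultimately show ?thesis by blast
  qed
 qed
 then show ?thesis using C1(3) by blast
qed

end

section \<open>The chordal metric\<close>

context two_point_space begin

text \<open>The bridge between two metrics: it is a multiple of the chordal metric and also equals
  the symmetric difference metric of the weight sin.\<close>

definition gap :: "'a \<Rightarrow> 'a \<Rightarrow> real" where "gap x z = (\<integral>y. \<bar>T x y - T z y\<bar> \<partial>\<mu>)"

lemma gap_isometry:
 assumes g: "isometry_of Q \<theta> g" and xz: "x \<in> Q" "z \<in> Q" shows "gap (g x) (g z) = gap x z"
proof -
 have "gap (g x) (g z) = (\<integral>y. \<bar>T (g x) (g y) - T (g z) (g y)\<bar> \<partial>\<mu>)"
  unfolding gap_def by (rule isometry_integral[OF g, symmetric]) measurable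
 also have "\<dots> = gap x z" unfolding gap_def using isometry_T[OF g xz(1)] isometry_T[OF g xz(2)] by (intro bochner_cong) auto
 finally show ?thesis .
qed

text \<open>The difference of the rank one forms of the unit vectors at the angles 0 and
  \<open>\<phi>\<close> has eigenvalues \<open>sin \<phi>\<close> and \<open>- sin \<phi>\<close>,
  with eigenvectors at the angles \<open>\<psi>\<close> and \<open>\<psi> + pi/2\<close>. So
  \<open>T (e 0) - T (e \<phi>)\<close> is \<open>sin \<phi>\<close> times the same difference for
  an orthogonal pair, and orthogonal pairs are all equivalent under isometries.\<close>

lemma gap_eq:
 assumes xz: "x \<in> Q" "z \<in> Q" shows "gap x z = gap (e 0) (e (pi/2)) * sin (\<theta> x z / 2)"
proof -
 obtain g \<phi> where g: "isometry_of Q \<theta> g" "0 \<le> \<phi>" "\<phi> \<le> pi/2" "g x = e 0" "g z = e \<phi>" using normal[OF xz] by blast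
 define \<psi> where "\<psi> = (\<phi> - pi/2) / 2"
 have "2 * \<psi> = \<phi> - pi/2" by (simp add: \<psi>_def)
 then have c2: "cos (2 * \<psi>) = sin \<phi>" "sin (2 * \<psi>) = - cos \<phi>" by (simp_all add: cos_diff sin_diff)
 obtain g' \<phi>' where g': "isometry_of Q \<theta> g'" "0 \<le> \<phi>'" "\<phi>' \<le> pi/2" "g' (e \<psi>) = e 0" "g' (e (\<psi> + pi/2)) = e \<phi>'"
  using normal[OF e_in e_in] by blast
 have "(cos \<phi>')^2 = T (e \<psi>) (e (\<psi> + pi/2))"
  using isometry_T[OF g'(1) e_in e_in, of \<psi> "\<psi> + pi/2"] unfolding g' T_e_e by simp
 also have "\<dots> = 0" by (simp add: T_e_e)
 finally have "cos \<phi>' = 0" by simp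
 then have ph: "\<phi>' = pi/2" using g'(2,3) cos_gt_zero_pi[of \<phi>'] by force
 have rot: "gap (e \<psi>) (e (\<psi> + pi/2)) = gap (e 0) (e (pi/2))"
  using gap_isometry[OF g'(1) e_in e_in, of \<psi> "\<psi> + pi/2"] unfolding g'(4,5) ph by simp
 have pointwise: "a y - T (e \<phi>) y = sin \<phi> * (T (e \<psi>) y - T (e (\<psi> + pi/2)) y)" if y: "y \<in> Q" for y
 proof -
  have "T (e \<psi>) y - T (e (\<psi> + pi/2)) y = cos (2 * \<psi>) * (a y - b y) + 2 * sin (2 * \<psi>) * w y"
   unfolding plane_T[OF y, of \<psi>] plane_T[OF y, of "\<psi> + pi/2"] cos_double sin_double by (simp add: cos_add sin_add algebra_simps)
  then have "sin \<phi> * (T (e \<psi>) y - T (e (\<psi> + pi/2)) y) = sin \<phi> * (sin \<phi> * (a y - b y) + 2 * (- cos \<phi>) * w y)"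
   unfolding c2 by simp
  also have "\<dots> = (sin \<phi>)^2 * (a y - b y) - 2 * cos \<phi> * sin \<phi> * w y" by (simp add: power2_eq_square algebra_simps)
  also have "\<dots> = a y - T (e \<phi>) y" unfolding plane_T[OF y, of \<phi>] by (simp add: cos_squared_eq algebra_simps)
  finally show ?thesis by simp
 qed
 have s: "sin \<phi> \<ge> 0" using g(2,3) by (intro sin_ge_zero) auto
 have "gap x z = gap (e 0) (e \<phi>)" using gap_isometry[OF g(1) xz] g by simp
 also have "\<dots> = (\<integral>y. sin \<phi> * \<bar>T (e \<psi>) y - T (e (\<psi> + pi/2)) y\<bar> \<partial>\<mu>)"
  unfolding gap_def using pointwise s by (intro bochner_cong) (auto simp: abs_mult)
 also have "\<dots> = sin \<phi> * gap (e \<psi>) (e (\<psi> + pi/2))" unfolding gap_def by (rule integral_mult_right_zero)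
 finally have "gap x z = sin \<phi> * gap (e 0) (e (pi/2))" unfolding rot .
 moreover have "sin (\<theta> x z / 2) = sin \<phi>"
 proof -
  have "T x z = (cos \<phi>)^2" using isometry_T[OF g(1) xz] g T_e_e[of 0 \<phi>] by simp
  then have "(sin (\<theta> x z / 2))^2 = (sin \<phi>)^2" using T_eq[OF xz] by (simp add: cos_squared_eq)
  moreover have "sin (\<theta> x z / 2) \<ge> 0" using theta_range[OF xz] by (intro sin_ge_zero) auto
  ultimately show ?thesis using s by (simp add: power2_eq_iff_nonneg)
 qed
 ultimately show ?thesis by simp
qed

text \<open>Otherwise \<open>T (e \<phi>)\<close> would be almost everywhere the same for all
  \<open>\<phi>\<close>, so \<open>a = b\<close> and \<open>w = 0\<close>; the first moment identity
  then gives \<open>M 2 = 0\<close>, against the moment recursion.\<close>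

lemma gap_pos: "gap (e 0) (e (pi/2)) > 0"
proof (rule ccontr)
 assume "\<not> ?thesis"
 moreover have "gap (e 0) (e (pi/2)) \<ge> 0" unfolding gap_def by simp
 ultimately have "gap (e 0) (e \<phi>) = 0" for \<phi> using gap_eq[OF e_in e_in, of 0 \<phi>] by simp
 moreover have "integrable \<mu> (\<lambda>y. \<bar>a y - T (e \<phi>) y\<bar>)" for \<phi>
 proof (rule bounded_integrable[where B=1])
  show "\<bar>\<bar>a y - T (e \<phi>) y\<bar>\<bar> \<le> 1" if "y \<in> Q" for y
   using T_ge_0[OF e_in[of 0] that] T_ge_0[OF e_in[of \<phi>] that] T_le_1[of "e 0" y] T_le_1[of "e \<phi>" y] by linarith
 qed measurable
 ultimately have AE: "AE y in \<mu>. \<bar>a y - T (e \<phi>) y\<bar> = 0" for \<phi>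
  unfolding gap_def by (subst (asm) integral_nonneg_eq_0_iff_AE) auto
 have "AE y in \<mu>. a y = b y \<and> w y = 0" using AE[of "pi/4"] AE[of "pi/2"] AE_space
 proof eventually_elim
  case (elim y)
  then have y: "y \<in> Q" by simp
  show ?case using elim plane_T[OF y, of "pi/4"] by (simp add: cos_45 sin_45 power_divide)
 qed
 then have 1: "AE y in \<mu>. (w y)^2 * a y ^ 0 = 0" and 2: "AE y in \<mu>. b y * a y ^ Suc 0 = a y ^ 2"
  by (eventually_elim; simp add: power2_eq_square)+
 have "(\<integral>y. (w y)^2 * a y ^ 0 \<partial>\<mu>) = (\<integral>y. 0 \<partial>\<mu>)" by (rule integral_cong_AE[OF _ _ 1]) measurable
 moreover have "(\<integral>y. b y * a y ^ Suc 0 \<partial>\<mu>) = M 2" unfolding M_def by (rule integral_cong_AE[OF _ _ 2]) measurable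
 ultimately have "M 2 = 0" using moment_w_T[of 0] by simp
 moreover have "M 0 = 1" by (simp add: M_def \<mu>.prob_space)
 ultimately show False using M_rec[of 0] M_rec[of 1] d_pos d0_pos by (simp add: numeral_2_eq_2)
qed

lemma chi_square_integral:
 assumes "\<alpha> \<in> {0..pi}" "\<beta> \<in> {0..pi}" "\<alpha> \<le> \<beta>"
 shows "(\<integral>r. indicator {0..pi} r * (((if \<alpha> < r then 1 else 0) - (if \<beta> < r then 1 else 0))^2 * sin r) \<partial>lborel) = cos \<alpha> - cos \<beta>"
proof -
 have "(\<integral>r. indicator {0..pi} r * (((if \<alpha> < r then 1 else 0) - (if \<beta> < r then 1 else 0))^2 * sin r) \<partial>lborel) =
  (\<integral>r. sin r * indicator {\<alpha>..\<beta>} r \<partial>lborel)"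
 proof (rule integral_cong_AE)
  show "AE r in lborel. indicator {0..pi} r * (((if \<alpha> < r then 1 else 0) - (if \<beta> < r then 1 else 0))^2 * sin r) = sin r * indicator {\<alpha>..\<beta>} r"
   using AE_lborel_singleton[of \<alpha>] by eventually_elim (use assms in \<open>auto simp: indicator_def\<close>)
 qed measurable
 also have "\<dots> = - cos \<beta> - - cos \<alpha>" by (rule integral_FTC_Icc_real[OF assms(3)]) (auto intro!: derivative_eq_intros)
 finally show ?thesis by simp
qed

text \<open>As functions of r, the two indicators differ just between \<open>\<theta> x y\<close>
  and \<open>\<theta> z y\<close>, and the sine integrates there to the difference of the cosines,
  which is twice the difference of T.\<close>

lemma chi_square_integral_abs:
 assumes "x \<in> Q" "z \<in> Q" "y \<in> Q"
 shows "(\<integral>r. indicator {0..pi} r * ((chi r (T x y) - chi r (T z y))^2 * sin r) \<partial>lborel) = 2 * \<bar>T x y - T z y\<bar>"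
proof -
 have *: "(\<integral>r. indicator {0..pi} r * ((chi r (T x y) - chi r (T z y))^2 * sin r) \<partial>lborel) = 2 * (T x y - T z y)"
  if xz: "x \<in> Q" "z \<in> Q" and le: "\<theta> x y \<le> \<theta> z y" for x z
 proof -
  let ?i = "\<lambda>u r. if u < r then 1 else 0 :: real"
  have "(\<integral>r. indicator {0..pi} r * ((chi r (T x y) - chi r (T z y))^2 * sin r) \<partial>lborel) =
   (\<integral>r. indicator {0..pi} r * ((?i (\<theta> x y) r - ?i (\<theta> z y) r)^2 * sin r) \<partial>lborel)"
  proof (rule bochner_cong)
   fix r
   show "indicator {0..pi} r * ((chi r (T x y) - chi r (T z y))^2 * sin r) = indicator {0..pi} r * ((?i (\<theta> x y) r - ?i (\<theta> z y) r)^2 * sin r)"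
    by (cases "r \<in> {0..pi}") (simp_all only: chi_theta[OF xz(1) assms(3)] chi_theta[OF xz(2) assms(3)], simp_all)
  qed simp
  also have "\<dots> = cos (\<theta> x y) - cos (\<theta> z y)" by (rule chi_square_integral) (use theta_range xz assms(3) le in auto)
  also have "\<dots> = 2 * (T x y - T z y)"
   using cos_double_cos[of "\<theta> x y / 2"] cos_double_cos[of "\<theta> z y / 2"] by (simp add: T_eq xz assms(3))
  finally show ?thesis .
 qed
 have mono: "T z y \<le> T x y" if "x \<in> Q" "z \<in> Q" "\<theta> x y \<le> \<theta> z y" for x z
 proof -
  have "cos (\<theta> z y / 2) \<le> cos (\<theta> x y / 2)"
   using theta_range[OF that(1) assms(3)] theta_range[OF that(2) assms(3)] that(3) by (intro cos_monotone_0_pi_le) auto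
  then show ?thesis unfolding T_eq[OF that(1) assms(3)] T_eq[OF that(2) assms(3)]
   using half_theta_cos_nonneg[OF that(2) assms(3)] by (intro power_mono)
 qed
 show ?thesis
 proof (cases "\<theta> x y \<le> \<theta> z y")
  case True
  show ?thesis using *[OF assms(1,2) True] mono[OF assms(1,2) True] by simp
 next
  case False
  then have le: "\<theta> z y \<le> \<theta> x y" by simp
  show ?thesis using *[OF assms(2,1) le] mono[OF assms(2,1) le] by (simp add: power2_commute[of "chi _ (T x y)"])
 qed
qed

text \<open>\<open>vol r - overlap r x z\<close> is half the mean squared difference of the
  indicators. With the weight sin the radial integral of that square is linear in the difference of
  T, so Fubini gives the claim.\<close>

lemma symdiff_metric_sin:
 assumes xz: "x \<in> Q" "z \<in> Q" shows "symdiff_metric Q \<theta> \<mu> sin x z = gap x z"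
proof -
 let ?s = "\<lambda>r y. (chi r (T x y) - chi r (T z y))^2"
 let ?F = "\<lambda>r y. indicator {0..pi} r * (?s r y * sin r)"
 interpret pr: pair_sigma_finite lborel \<mu> ..
 have half: "vol r - overlap r x z = (\<integral>y. ?s r y \<partial>\<mu>) / 2" for r
 proof -
  have "(\<integral>y. ?s r y \<partial>\<mu>) = (\<integral>y. chi r (T x y) + chi r (T z y) - 2 * (chi r (T x y) * chi r (T z y)) \<partial>\<mu>)"
   unfolding power2_eq_square left_diff_distrib right_diff_distrib chi_range(4) by (simp add: algebra_simps)
  also have "\<dots> = vol r + vol r - 2 * overlap r x z" using xz by (simp add: integral_chi overlap_def)
  finally show ?thesis by simp
 qed
 have [measurable]: "(\<lambda>p. T u (snd p)) \<in> borel_measurable (lborel \<Otimes>\<^sub>M \<mu>)" for u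
  by (rule measurable_compose[OF measurable_snd T_measurable])
 have [measurable]: "(\<lambda>p. chi (fst p) (T u (snd p))) \<in> borel_measurable (lborel \<Otimes>\<^sub>M \<mu>)" for u
  by (rule chi_measurable2) measurable
 have m: "case_prod ?F \<in> borel_measurable (lborel \<Otimes>\<^sub>M \<mu>)" unfolding case_prod_beta by measurable
 have i: "integrable (lborel \<Otimes>\<^sub>M \<mu>) (case_prod ?F)"
 proof (rule integrableI_bounded_set[where A="{0..pi} \<times> space \<mu>" and B=1])
  show "emeasure (lborel \<Otimes>\<^sub>M \<mu>) ({0..pi} \<times> space \<mu>) < \<infinity>"
   by (subst \<mu>.emeasure_pair_measure_Times) (auto simp del: space_\<mu> simp: \<mu>.emeasure_space_1)
  have "\<bar>?s r y * sin r\<bar> \<le> 1" for r y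
  proof -
   have "\<bar>chi r (T x y) - chi r (T z y)\<bar> \<le> 1"
    using chi_range(1,2)[of r "T x y"] chi_range(1,2)[of r "T z y"] unfolding abs_le_iff by (intro conjI; linarith)
   then have "?s r y \<le> 1" by (simp add: abs_square_le_1)
   then show ?thesis unfolding abs_mult by (intro mult_le_one) auto
  qed
  then show "AE p in lborel \<Otimes>\<^sub>M \<mu>. p \<in> {0..pi} \<times> space \<mu> \<longrightarrow> norm (case_prod ?F p) \<le> 1" by (auto simp: indicator_def)
  show "AE p in lborel \<Otimes>\<^sub>M \<mu>. p \<notin> {0..pi} \<times> space \<mu> \<longrightarrow> case_prod ?F p = 0"
   using AE_space by eventually_elim (auto simp: space_pair_measure indicator_def)
  show "{0..pi} \<times> space \<mu> \<in> sets (lborel \<Otimes>\<^sub>M \<mu>)" by (intro pair_measureI sets.top) simp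
 qed (rule m)
 have "symdiff_metric Q \<theta> \<mu> sin x z = (LINT r:{0..pi}|lebesgue. (vol r - overlap r x z) * sin r)"
  unfolding symdiff_metric_def by (rule set_lebesgue_integral_cong) (auto simp: symdiff_metric_r_eq xz)
 also have "\<dots> = (\<integral>r. indicat_real {0..pi} r *\<^sub>R ((vol r - overlap r x z) * sin r) \<partial>lborel)"
  unfolding set_lebesgue_integral_def by (rule integral_completion) measurable
 also have "\<dots> = (\<integral>r. (\<integral>y. ?F r y / 2 \<partial>\<mu>) \<partial>lborel)" unfolding half by (simp add: mult_ac)
 also have "\<dots> = (\<integral>r. (\<integral>y. ?F r y \<partial>\<mu>) \<partial>lborel) / 2" by simp
 also have "(\<integral>r. (\<integral>y. ?F r y \<partial>\<mu>) \<partial>lborel) = (\<integral>y. (\<integral>r. ?F r y \<partial>lborel) \<partial>\<mu>)"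
  by (rule pr.Fubini_integral[OF i, symmetric])
 also have "\<dots> = (\<integral>y. 2 * \<bar>T x y - T z y\<bar> \<partial>\<mu>)" by (rule bochner_cong) (auto simp: chi_square_integral_abs xz)
 finally show ?thesis by (simp add: gap_def)
qed

lemma symdiff_metric_sin_chordal:
 "x \<in> Q \<Longrightarrow> z \<in> Q \<Longrightarrow> symdiff_metric Q \<theta> \<mu> sin x z = gap (e 0) (e (pi/2)) * chordal_metric \<theta> x z"
 unfolding symdiff_metric_sin chordal_metric_def by (rule gap_eq)

section \<open>The weight sin and the assembly of the bounds\<close>

lemma sin_weight_class: "sin \<in> weight_class d d0"
proof -
 have "set_integrable lborel {0..pi} (\<lambda>r::real. sin (r / 2) ^ (d - 1) * cos (r / 2) ^ (d0 - 1) * sin r)"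
  by (rule borel_integrable_atLeastAtMost') (intro continuous_intros; simp)
 then have "set_integrable lebesgue {0..pi} (\<lambda>r::real. sin (r / 2) ^ (d - 1) * cos (r / 2) ^ (d0 - 1) * sin r)"
  unfolding set_integrable_def by (subst integrable_completion) (auto intro: borel_measurable_integrable)
 moreover have "(sin :: real \<Rightarrow> real) \<in> borel_measurable (lebesgue_on {0..pi})"
  by (intro measurable_restrict_space1 measurable_completion) simp
 ultimately show ?thesis by (auto simp: weight_class_def intro!: sin_ge_zero)
qed

lemma sin_not_AE_zero: "\<not> (AE r in lebesgue_on {0..pi}. sin r = (0::real))"
proof
 assume "AE r in lebesgue_on {0..pi}. sin r = (0::real)"
 then have "AE r in lebesgue. r \<in> {0..pi} \<longrightarrow> sin r = (0::real)" by (subst (asm) AE_restrict_space_iff) auto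
 moreover have "{0, pi} \<in> null_sets lebesgue" by (simp add: finite_imp_null_set_lborel null_sets_completionI)
 then have "AE r in lebesgue. r \<notin> {0, pi}" by (rule AE_not_in)
 ultimately have "AE r in lebesgue. r \<notin> {0..pi}"
 proof eventually_elim
  case (elim r)
  then show ?case using sin_gt_zero[of r] by force
 qed
 then have "{0..pi} \<in> null_sets lebesgue" by (subst (asm) AE_iff_null_sets[symmetric]) auto
 then show False by (simp add: null_sets_def)
qed

text \<open>Stolarsky's identity exchanges the supremum and the infimum; halving A and adding 1 to B
  turn the bounds into strict ones.\<close>

lemma extremal_bounds:
 assumes \<eta>: "\<eta> \<in> weight_class d d0" and nz: "\<not> (AE r in lebesgue_on {0..pi}. \<eta> r = 0)"
 shows "\<exists>A B. 0 < A \<and> 0 < B \<and> (\<forall>N\<ge>1.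
  mean_dist \<mu> (symdiff_metric Q \<theta> \<mu> \<eta>) * real N ^ 2 - A * real N powr (1 - 1 / real d) > max_dist_sum Q (symdiff_metric Q \<theta> \<mu> \<eta>) N \<and>
  max_dist_sum Q (symdiff_metric Q \<theta> \<mu> \<eta>) N > mean_dist \<mu> (symdiff_metric Q \<theta> \<mu> \<eta>) * real N ^ 2 - B * real N powr (1 - 1 / real d) \<and>
  A * real N powr (1 - 1 / real d) < min_discrepancy Q \<theta> \<mu> \<eta> N \<and>
  min_discrepancy Q \<theta> \<mu> \<eta> N < B * real N powr (1 - 1 / real d))"
proof -
 let ?r = "symdiff_metric Q \<theta> \<mu> \<eta>"
 obtain A where A: "A > 0" "\<forall>N\<ge>1. \<forall>D\<in>point_sets Q N. A * real N powr (1 - 1 / real d) \<le> quad_discrepancy Q \<theta> \<mu> \<eta> D"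
  using discrepancy_lower_bound[OF \<eta> nz] by (elim exE conjE) (rule that)
 obtain B where B: "B > 0" "\<forall>N\<ge>1. \<exists>D\<in>point_sets Q N.
  mean_rho \<eta> * (real N)^2 - B * real N powr (1 - 1 / real d) \<le> dist_sum ?r D"
  using distance_sum_lower_bound[OF \<eta>] by (elim exE conjE) (rule that)
 have stol: "quad_discrepancy Q \<theta> \<mu> \<eta> D = mean_rho \<eta> * (real N)^2 - dist_sum ?r D" if D: "D \<in> point_sets Q N" for D N
 proof -
  obtain x where x: "D = pts x N" "\<And>i. i < N \<Longrightarrow> x i \<in> Q" by (rule point_sets_pts[OF D]) (rule that)
  show ?thesis unfolding x(1) by (rule stolarsky[OF \<eta> x(2)])
 qed
 have main: "mean_rho \<eta> * real N ^ 2 - (A / 2) * real N powr (1 - 1 / real d) > max_dist_sum Q ?r N \<and>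
  max_dist_sum Q ?r N > mean_rho \<eta> * real N ^ 2 - (B + 1) * real N powr (1 - 1 / real d) \<and>
  (A / 2) * real N powr (1 - 1 / real d) < min_discrepancy Q \<theta> \<mu> \<eta> N \<and>
  min_discrepancy Q \<theta> \<mu> \<eta> N < (B + 1) * real N powr (1 - 1 / real d)" if N: "N \<ge> 1" for N
 proof -
  define p where "p = real N powr (1 - 1 / real d)"
  have p: "p > 0" unfolding p_def using N by simp
  have lo: "A * p \<le> quad_discrepancy Q \<theta> \<mu> \<eta> D" if "D \<in> point_sets Q N" for D unfolding p_def using A N that by blast
  have up: "dist_sum ?r D \<le> mean_rho \<eta> * real N ^ 2 - A * p" if "D \<in> point_sets Q N" for D using lo[OF that] stol[OF that] by simp
  obtain D0 where D0: "D0 \<in> point_sets Q N" "mean_rho \<eta> * (real N)^2 - B * p \<le> dist_sum ?r D0" unfolding p_def using B N by blast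
  have ne: "point_sets Q N \<noteq> {}" using D0 by blast
  have Ap: "A / 2 * p < A * p" using A p by simp
  have Bp: "B * p < (B + 1) * p" using p by simp
  have 1: "max_dist_sum Q ?r N \<le> mean_rho \<eta> * real N ^ 2 - A * p" unfolding max_dist_sum_def by (rule cSUP_least[OF ne up])
  have "bdd_above (dist_sum ?r ` point_sets Q N)" by (rule bdd_aboveI2) (rule up)
  then have "dist_sum ?r D0 \<le> (SUP D\<in>point_sets Q N. dist_sum ?r D)" by (rule cSUP_upper[OF D0(1)])
  then have 2: "mean_rho \<eta> * (real N)^2 - B * p \<le> max_dist_sum Q ?r N" unfolding max_dist_sum_def using D0(2) by simp
  have 3: "A * p \<le> min_discrepancy Q \<theta> \<mu> \<eta> N" unfolding min_discrepancy_def by (rule cINF_greatest[OF ne lo])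
  have "bdd_below (quad_discrepancy Q \<theta> \<mu> \<eta> ` point_sets Q N)" by (rule bdd_belowI2) (rule lo)
  then have "min_discrepancy Q \<theta> \<mu> \<eta> N \<le> quad_discrepancy Q \<theta> \<mu> \<eta> D0"
   unfolding min_discrepancy_def by (rule cINF_lower[OF _ D0(1)])
  then have 4: "min_discrepancy Q \<theta> \<mu> \<eta> N \<le> B * p" using D0(2) stol[OF D0(1)] by simp
  show ?thesis unfolding p_def[symmetric] using 1 2 3 4 Ap Bp by linarith
 qed
 show ?thesis unfolding mean_dist_rho[OF \<eta>]
 proof (rule exI[of _ "A / 2"], rule exI[of _ "B + 1"], rule conjI, goal_cases)
  case 2
  show ?case
  proof (rule conjI, goal_cases)
   case 2
   show ?case by (intro allI impI main)
  qed (use B(1) in simp)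
 qed (use A(1) in simp)
qed

lemma chordal_scaling:
 defines "\<gamma> \<equiv> gap (e 0) (e (pi/2))"
 shows "mean_dist \<mu> (symdiff_metric Q \<theta> \<mu> sin) = \<gamma> * mean_dist \<mu> (chordal_metric \<theta>)"
  and "max_dist_sum Q (symdiff_metric Q \<theta> \<mu> sin) N = \<gamma> * max_dist_sum Q (chordal_metric \<theta>) N"
proof -
 let ?r = "symdiff_metric Q \<theta> \<mu> sin" and ?c = "chordal_metric \<theta>"
 have "mean_dist \<mu> ?r = (\<integral>x. \<gamma> * (\<integral>y. ?c x y \<partial>\<mu>) \<partial>\<mu>)"
  unfolding mean_dist_def integral_mult_right_zero[symmetric] \<gamma>_def by (intro bochner_cong) (auto simp: symdiff_metric_sin_chordal)
 then show "mean_dist \<mu> ?r = \<gamma> * mean_dist \<mu> ?c" by (simp add: mean_dist_def)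
 have ds: "dist_sum ?r D = \<gamma> * dist_sum ?c D" if D: "D \<in> point_sets Q N" for D
 proof -
  obtain x where x: "D = pts x N" "\<And>i. i < N \<Longrightarrow> x i \<in> Q" by (rule point_sets_pts[OF D]) (rule that)
  show ?thesis unfolding x(1) dist_sum_pts sum_distrib_left \<gamma>_def using x(2) by (intro sum.cong) (auto simp: symdiff_metric_sin_chordal)
 qed
 have \<gamma>: "\<gamma> > 0" unfolding \<gamma>_def by (rule gap_pos)
 have ne: "point_sets Q N \<noteq> {}" using pts_in[of N "\<lambda>_. e 0"] by auto
 have bd: "bdd_above (dist_sum ?c ` point_sets Q N)"
 proof (rule bdd_aboveI2)
  fix D assume "D \<in> point_sets Q N"
  then obtain x where x: "D = pts x N" "\<And>i. i < N \<Longrightarrow> x i \<in> Q" by (rule point_sets_pts) (rule that)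
  show "dist_sum ?c D \<le> (\<Sum>i<N. \<Sum>j<N. 1)" unfolding x(1) dist_sum_pts by (intro sum_mono) (simp add: chordal_metric_def)
 qed
 show "max_dist_sum Q ?r N = \<gamma> * max_dist_sum Q ?c N"
 proof (rule antisym)
  show "max_dist_sum Q ?r N \<le> \<gamma> * max_dist_sum Q ?c N" unfolding max_dist_sum_def
   by (rule cSUP_least[OF ne]) (use \<gamma> ds bd in \<open>auto intro!: mult_left_mono cSUP_upper\<close>)
  have "max_dist_sum Q ?c N \<le> max_dist_sum Q ?r N / \<gamma>" unfolding max_dist_sum_def
  proof (rule cSUP_least[OF ne])
   fix D assume D: "D \<in> point_sets Q N"
   have "bdd_above (dist_sum ?r ` point_sets Q N)"
   proof -
    obtain K where K: "\<And>D. D \<in> point_sets Q N \<Longrightarrow> dist_sum ?c D \<le> K" using bd unfolding bdd_above_def by blast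
    show ?thesis by (rule bdd_aboveI2[of _ _ "\<gamma> * K"]) (use ds K \<gamma> in auto)
   qed
   then have "dist_sum ?r D \<le> (SUP D\<in>point_sets Q N. dist_sum ?r D)" by (rule cSUP_upper[OF D])
   then show "dist_sum ?c D \<le> (SUP D\<in>point_sets Q N. dist_sum ?r D) / \<gamma>"
    using \<gamma> ds[OF D] by (simp add: pos_le_divide_eq mult.commute)
  qed
  then show "\<gamma> * max_dist_sum Q ?c N \<le> max_dist_sum Q ?r N" using \<gamma> by (simp add: pos_le_divide_eq mult.commute)
 qed
qed

theorem two_point_space_bounds:
 "\<exists>c C c1 C1 :: (real \<Rightarrow> real) \<Rightarrow> real.
  (\<forall>\<eta>\<in>weight_class d d0. \<not> (AE r in lebesgue_on {0..pi}. \<eta> r = 0) \<longrightarrow>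
    0 < c \<eta> \<and> 0 < C \<eta> \<and> 0 < c1 \<eta> \<and> 0 < C1 \<eta> \<and> (\<forall>N::nat. N \<ge> 1 \<longrightarrow>
     mean_dist \<mu> (symdiff_metric Q \<theta> \<mu> \<eta>) * real N ^ 2 - c \<eta> * real N powr (1 - 1 / real d)
      > max_dist_sum Q (symdiff_metric Q \<theta> \<mu> \<eta>) N \<and>
     max_dist_sum Q (symdiff_metric Q \<theta> \<mu> \<eta>) N
      > mean_dist \<mu> (symdiff_metric Q \<theta> \<mu> \<eta>) * real N ^ 2
       - C \<eta> * real N powr (1 - 1 / real d) \<and>
     c1 \<eta> * real N powr (1 - 1 / real d) < min_discrepancy Q \<theta> \<mu> \<eta> N \<and>
     min_discrepancy Q \<theta> \<mu> \<eta> N < C1 \<eta> * real N powr (1 - 1 / real d))) \<and>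
  0 < c sin \<and> 0 < C sin \<and> (\<forall>N::nat. N \<ge> 1 \<longrightarrow>
    mean_dist \<mu> (chordal_metric \<theta>) * real N ^ 2 - c sin * real N powr (1 - 1 / real d)
     > max_dist_sum Q (chordal_metric \<theta>) N \<and>
    max_dist_sum Q (chordal_metric \<theta>) N
     > mean_dist \<mu> (chordal_metric \<theta>) * real N ^ 2 - C sin * real N powr (1 - 1 / real d))"
proof -
 let ?p = "\<lambda>N. real N powr (1 - 1 / real d)"
 let ?r = "\<lambda>\<eta>. symdiff_metric Q \<theta> \<mu> \<eta>"
 define S where "S = {\<eta> \<in> weight_class d d0. \<not> (AE r in lebesgue_on {0..pi}. \<eta> r = 0)}"
 define P where "P \<eta> A B \<longleftrightarrow> 0 < A \<and> 0 < B \<and> (\<forall>N\<ge>1.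
  mean_dist \<mu> (?r \<eta>) * real N ^ 2 - A * ?p N > max_dist_sum Q (?r \<eta>) N \<and>
  max_dist_sum Q (?r \<eta>) N > mean_dist \<mu> (?r \<eta>) * real N ^ 2 - B * ?p N \<and>
  A * ?p N < min_discrepancy Q \<theta> \<mu> \<eta> N \<and> min_discrepancy Q \<theta> \<mu> \<eta> N < B * ?p N)" for \<eta> A B
 have "\<forall>\<eta>\<in>S. \<exists>A B. P \<eta> A B"
 proof
  fix \<eta> assume "\<eta> \<in> S"
  then have "\<eta> \<in> weight_class d d0" "\<not> (AE r in lebesgue_on {0..pi}. \<eta> r = 0)" unfolding S_def by blast+
  then show "\<exists>A B. P \<eta> A B" unfolding P_def by (rule extremal_bounds)
 qed
 then obtain A where "\<forall>\<eta>\<in>S. \<exists>B. P \<eta> (A \<eta>) B" by (rule bchoice[THEN exE])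
 then obtain B where AB: "\<forall>\<eta>\<in>S. P \<eta> (A \<eta>) (B \<eta>)" by (rule bchoice[THEN exE])
 have "sin \<in> S" unfolding S_def using sin_weight_class sin_not_AE_zero by blast
 with AB have "P sin (A sin) (B sin)" by blast
 note Ps = this[unfolded P_def]
 define \<gamma> where "\<gamma> = gap (e 0) (e (pi/2))"
 have \<gamma>: "\<gamma> > 0" unfolding \<gamma>_def by (rule gap_pos)
 \<comment> \<open>One value \<open>c sin\<close> has to serve both the metric of the weight sin and
   the chordal metric, which differ by the factor \<open>\<gamma>\<close>.\<close>
 define c where "c = A(sin := min (A sin) (A sin / \<gamma>))"
 define C where "C = B(sin := max (B sin) (B sin / \<gamma>))"
 have cA: "c \<eta> \<le> A \<eta>" and CB: "B \<eta> \<le> C \<eta>" for \<eta> unfolding c_def C_def by auto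
 have cpos: "0 < c \<eta>" if "0 < A \<eta>" for \<eta> unfolding c_def using that \<gamma> by auto
 have Cpos: "0 < C \<eta>" if "0 < B \<eta>" for \<eta> using CB[of \<eta>] that by simp
 show ?thesis
 proof (rule exI[of _ c], rule exI[of _ C], rule exI[of _ A], rule exI[of _ B], intro conjI ballI impI allI)
  fix \<eta> assume \<eta>: "\<eta> \<in> weight_class d d0" "\<not> (AE r in lebesgue_on {0..pi}. \<eta> r = 0)"
  then have "\<eta> \<in> S" unfolding S_def by blast
  with AB have "P \<eta> (A \<eta>) (B \<eta>)" by blast
  note P\<eta> = this[unfolded P_def]
  show "0 < A \<eta>" "0 < B \<eta>" "0 < c \<eta>" "0 < C \<eta>" using P\<eta> cpos Cpos by blast+
  fix N :: nat assume N: "1 \<le> N"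
  have p: "?p N \<ge> 0" by simp
  have "c \<eta> * ?p N \<le> A \<eta> * ?p N" "B \<eta> * ?p N \<le> C \<eta> * ?p N" using cA CB p by (auto intro!: mult_right_mono)
  moreover have "mean_dist \<mu> (?r \<eta>) * real N ^ 2 - A \<eta> * ?p N > max_dist_sum Q (?r \<eta>) N"
   "max_dist_sum Q (?r \<eta>) N > mean_dist \<mu> (?r \<eta>) * real N ^ 2 - B \<eta> * ?p N" using P\<eta> N by blast+
  ultimately show "max_dist_sum Q (?r \<eta>) N < mean_dist \<mu> (?r \<eta>) * real N ^ 2 - c \<eta> * ?p N"
   "mean_dist \<mu> (?r \<eta>) * real N ^ 2 - C \<eta> * ?p N < max_dist_sum Q (?r \<eta>) N" by linarith+
  show "A \<eta> * ?p N < min_discrepancy Q \<theta> \<mu> \<eta> N" "min_discrepancy Q \<theta> \<mu> \<eta> N < B \<eta> * ?p N" using P\<eta> N by blast+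
 next
  show "0 < c sin" "0 < C sin" using Ps cpos Cpos by blast+
  fix N :: nat assume N: "1 \<le> N"
  let ?m = "mean_dist \<mu> (chordal_metric \<theta>)" and ?x = "max_dist_sum Q (chordal_metric \<theta>) N"
  have "\<gamma> * ?x < \<gamma> * ?m * real N ^ 2 - A sin * ?p N" "\<gamma> * ?m * real N ^ 2 - B sin * ?p N < \<gamma> * ?x"
   using Ps N unfolding chordal_scaling \<gamma>_def[symmetric] by blast+
  then have "?x < ?m * real N ^ 2 - A sin / \<gamma> * ?p N" "?m * real N ^ 2 - B sin / \<gamma> * ?p N < ?x"
   using \<gamma> by (simp_all add: field_simps)
  moreover have "c sin * ?p N \<le> A sin / \<gamma> * ?p N" "B sin / \<gamma> * ?p N \<le> C sin * ?p N"
   by (intro mult_right_mono; simp add: c_def C_def)+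
  ultimately show "?x < ?m * real N ^ 2 - c sin * ?p N" "?m * real N ^ 2 - C sin * ?p N < ?x" by linarith+
 qed
qed

end

section \<open>Spheres\<close>

text \<open>G is conjugated by the labelling F; the assumption \<open>det\<close> says that the
  distance is a function of the norm of the difference.\<close>

lemma isometry_transport:
 fixes F :: "'a \<Rightarrow> 'v::real_normed_vector"
 assumes F: "bij_betw F Q P" and G: "bij_betw G P P"
  and dist: "\<And>A B. A \<in> P \<Longrightarrow> B \<in> P \<Longrightarrow> norm (G A - G B) = norm (A - B)"
  and det: "\<And>x y x' y'. x \<in> Q \<Longrightarrow> y \<in> Q \<Longrightarrow> x' \<in> Q \<Longrightarrow> y' \<in> Q \<Longrightarrow>
   norm (F x - F y) = norm (F x' - F y') \<Longrightarrow> \<theta> x y = \<theta> x' y'"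
 shows "\<exists>g. isometry_of Q \<theta> g \<and> (\<forall>x\<in>Q. F (g x) = G (F x))"
proof -
 define g where "g = (inv_into Q F \<circ> G) \<circ> F"
 have b: "bij_betw g Q Q" unfolding g_def by (rule bij_betw_trans[OF F bij_betw_trans[OF G bij_betw_inv_into[OF F]]])
 have FP: "F x \<in> P" if "x \<in> Q" for x using F that by (rule bij_betwE[rule_format])
 have GP: "G A \<in> P" if "A \<in> P" for A using G that by (rule bij_betwE[rule_format])
 have gF: "F (g x) = G (F x)" if "x \<in> Q" for x unfolding g_def comp_def by (rule bij_betw_inv_into_right[OF F GP[OF FP[OF that]]])
 have gQ: "g x \<in> Q" if "x \<in> Q" for x using b that by (rule bij_betwE[rule_format])
 have "\<theta> (g x) (g y) = \<theta> x y" if "x \<in> Q" "y \<in> Q" for x y using that by (intro det gQ) (simp_all add: gF dist FP)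
 then show ?thesis using b gF unfolding isometry_of_def by blast
qed

lemma half_angle_eqI:
 assumes "0 \<le> \<alpha>" "\<alpha> \<le> pi" "0 \<le> \<beta>" "\<beta> \<le> pi" "(sin (\<alpha> / 2))^2 = (sin (\<beta> / 2))^2"
 shows "\<alpha> = \<beta>"
proof -
 have "0 \<le> sin (\<alpha> / 2)" "0 \<le> sin (\<beta> / 2)" using assms by (auto intro!: sin_ge_zero)
 then have "sin (\<alpha> / 2) = sin (\<beta> / 2)" using assms(5) by (simp add: power2_eq_iff_nonneg)
 then show ?thesis using sin_inj_pi[of "\<alpha> / 2" "\<beta> / 2"] assms by auto
qed

context embedded_space begin

lemma isometry_exists:
 assumes F: "bij_betw emb Q P" and G: "bij_betw G P P"
  and dist: "\<And>A B. A \<in> P \<Longrightarrow> B \<in> P \<Longrightarrow> norm (G A - G B) = norm (A - B)"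
 shows "\<exists>g. isometry_of Q \<theta> g \<and> (\<forall>x\<in>Q. emb (g x) = G (emb x))"
proof (rule isometry_transport[OF F G dist])
 fix x y x' y' assume Q: "x \<in> Q" "y \<in> Q" "x' \<in> Q" "y' \<in> Q" and n: "norm (emb x - emb y) = norm (emb x' - emb y')"
 show "\<theta> x y = \<theta> x' y'"
 proof (rule half_angle_eqI)
  show "(sin (\<theta> x y / 2))^2 = (sin (\<theta> x' y' / 2))^2" unfolding emb_dist[OF Q(1,2)] emb_dist[OF Q(3,4)] n ..
 qed (use theta_range[OF Q(1,2)] theta_range[OF Q(3,4)] in simp_all)
qed

end

lemma orthogonal_isometry_sphere:
 fixes h :: "'v::euclidean_space \<Rightarrow> 'v"
 assumes "orthogonal_transformation h" shows "bij_betw h (sphere 0 1) (sphere 0 1)" "norm (h x - h y) = norm (x - y)"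
proof -
 have n: "norm (h v) = norm v" for v using assms by (simp add: orthogonal_transformation)
 have l: "linear h" using assms by (simp add: orthogonal_transformation)
 show "norm (h x - h y) = norm (x - y)" using n[of "x - y"] linear_diff[OF l] by simp
 have bij: "bij h" using assms by (rule orthogonal_transformation_bij)
 have "h ` sphere 0 1 = sphere 0 1"
 proof
  show "sphere 0 1 \<subseteq> h ` sphere 0 1"
  proof
   fix y :: 'v assume y: "y \<in> sphere 0 1"
   obtain x where "y = h x" using bij by (metis bij_pointE)
   then show "y \<in> h ` sphere 0 1" using y n[of x] by simp
  qed
 qed (auto simp: n)
 then show "bij_betw h (sphere 0 1) (sphere 0 1)" unfolding bij_betw_def using bij_is_inj[OF bij] inj_on_subset by blast
qed

definition reflection_along :: "'v::euclidean_space \<Rightarrow> 'v \<Rightarrow> 'v" where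
 "reflection_along v x = x - (2 * (v \<bullet> x)) *\<^sub>R v"

lemma orthogonal_reflection_along:
 assumes "norm v = 1" shows "orthogonal_transformation (reflection_along v)"
proof -
 have v: "v \<bullet> v = 1" using assms by (simp add: norm_eq_1)
 have "linear (reflection_along v)" unfolding reflection_along_def by (rule linearI) (simp_all add: inner_add_right algebra_simps)
 moreover have "reflection_along v x \<bullet> reflection_along v y = x \<bullet> y" for x y
  unfolding reflection_along_def using inner_commute[of x v] v by (simp add: inner_diff_left inner_diff_right algebra_simps)
 ultimately show ?thesis unfolding orthogonal_transformation_def by blast
qed

text \<open>Two vectors of equal length are exchanged by the reflection in the hyperplane that
  bisects them.\<close>

lemma reflection_along_diff:
 assumes "norm x = norm y" "x \<noteq> y" shows "reflection_along ((x - y) /\<^sub>R norm (x - y)) x = y"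
proof -
 let ?n = "norm (x - y)"
 have n: "?n \<noteq> 0" using assms by simp
 have xx: "x \<bullet> x = y \<bullet> y" using assms(1) by (simp add: norm_eq)
 then have "?n^2 = 2 * ((x - y) \<bullet> x)" unfolding power2_norm_eq_inner using inner_commute[of x y] by (simp add: inner_diff_left inner_diff_right)
 then have "2 * ((x - y) \<bullet> x) / (?n * ?n) = 1" using n by (metis divide_self_if mult_eq_0_iff power2_eq_square)
 then show ?thesis unfolding reflection_along_def by (simp add: divide_inverse mult_ac)
qed

text \<open>On the sphere \<open>T x y = (1 + f x \<bullet> f y) / 2\<close>. First moment identity:
  the coordinates orthogonal to the axis u are equally distributed given the coordinate along u, and
  their squares add up to four times the product of the two diagonal values of the form. The second
  holds because the two diagonal values add up to 1 and both dimensions agree.\<close>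

theorem sphere_two_point_space:
 fixes f :: "'a \<Rightarrow> real^'n"
 assumes card: "CARD('n) \<ge> 2" and model: "sphere_model f Q \<theta>" and inv: "invariant_measure Q \<theta> \<mu>"
 shows "\<exists>e w. two_point_space (CARD('n) - 1) (CARD('n) - 1) Q \<theta> \<mu> f (1/4) e w"
proof -
 have bij: "bij_betw f Q (sphere 0 1)" and th: "\<And>x y. x \<in> Q \<Longrightarrow> y \<in> Q \<Longrightarrow> 0 \<le> \<theta> x y \<and> \<theta> x y \<le> pi \<and> cos (\<theta> x y) = f x \<bullet> f y"
  using model by (auto simp: sphere_model_def)
 have f1: "f x \<bullet> f x = 1" if "x \<in> Q" for x using bij_betwE[OF bij] that by (simp add: norm_eq_1)
 have nf: "(norm (f x - f y))^2 = 2 - 2 * (f x \<bullet> f y)" if "x \<in> Q" "y \<in> Q" for x y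
  using f1[OF that(1)] f1[OF that(2)] inner_commute[of "f x" "f y"] by (simp add: power2_norm_eq_inner inner_diff_left inner_diff_right)
 interpret embedded_space Q \<theta> \<mu> f "1/4"
 proof
  show "invariant_measure Q \<theta> \<mu>" by (rule inv)
  fix x y assume xy: "x \<in> Q" "y \<in> Q"
  show "0 \<le> \<theta> x y \<and> \<theta> x y \<le> pi" using th[OF xy] by simp
  have "cos (\<theta> x y) = f x \<bullet> f y" using th[OF xy] by simp
  moreover have "cos (\<theta> x y) = 1 - 2 * (sin (\<theta> x y / 2))^2" using cos_double_sin[of "\<theta> x y / 2"] by simp
  ultimately have "(sin (\<theta> x y / 2))^2 = (1 - f x \<bullet> f y) / 2" by simp
  then show "(sin (\<theta> x y / 2))^2 = 1/4 * (norm (f x - f y))^2" unfolding nf[OF xy] by (simp add: algebra_simps)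
 qed simp
 have T: "T x y = (1 + f x \<bullet> f y) / 2" if "x \<in> Q" "y \<in> Q" for x y
  unfolding T_def nf[OF that] by (simp add: right_diff_distrib add_divide_distrib)
 have iso: "\<exists>g. isometry_of Q \<theta> g \<and> (\<forall>x\<in>Q. f (g x) = h (f x))" if "orthogonal_transformation h" for h
  by (rule isometry_exists[OF bij orthogonal_isometry_sphere[OF that]])
 have inj: "x = y" if "f x = f y" "x \<in> Q" "y \<in> Q" for x y using bij_betw_imp_inj_on[OF bij] that by (rule inj_onD)
 obtain I :: "'n set" where "card I = 2" using card ex_card[of 2 "UNIV :: 'n set"] by auto
 then obtain i j :: 'n where ij: "i \<noteq> j" by (auto simp: card_2_iff)
 define u v :: "real^'n" where "u = axis i 1" and "v = axis j 1"
 have uv: "u \<bullet> u = 1" "v \<bullet> v = 1" "u \<bullet> v = 0" "v \<bullet> u = 0" using ij by (auto simp: u_def v_def inner_axis_axis)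
 \<comment> \<open>The angle on the sphere is twice the parameter, because T is the squared cosine
   of half the distance.\<close>
 define e where "e \<phi> = inv_into Q f (cos (2 * \<phi>) *\<^sub>R u + sin (2 * \<phi>) *\<^sub>R v)" for \<phi>
 have "cos (2 * \<phi>) *\<^sub>R u + sin (2 * \<phi>) *\<^sub>R v \<in> sphere 0 1" for \<phi>
  by (simp add: norm_eq_1 inner_add_left inner_add_right uv power2_eq_square[symmetric])
 then have img: "cos (2 * \<phi>) *\<^sub>R u + sin (2 * \<phi>) *\<^sub>R v \<in> f ` Q" for \<phi> using bij by (simp add: bij_betw_def)
 have e: "e \<phi> \<in> Q" "f (e \<phi>) = cos (2 * \<phi>) *\<^sub>R u + sin (2 * \<phi>) *\<^sub>R v" for \<phi>
  unfolding e_def by (rule inv_into_into[OF img], rule f_inv_into_f[OF img])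
 define w where "w y = (v \<bullet> f y) / 2" for y
 have Te: "T (e \<phi>) y = (1 + cos (2 * \<phi>) * (u \<bullet> f y) + sin (2 * \<phi>) * (v \<bullet> f y)) / 2" if "y \<in> Q" for \<phi> y
  unfolding T[OF e(1) that] e(2) by (simp add: inner_add_left)
 have Ta: "T (e 0) y = (1 + u \<bullet> f y) / 2" and Tb: "T (e (pi/2)) y = (1 - u \<bullet> f y) / 2" if "y \<in> Q" for y
  by (simp_all add: Te[OF that])
 have uvle: "(u \<bullet> f y)^2 + (v \<bullet> f y)^2 \<le> 1" if y: "y \<in> Q" for y
 proof -
  have "(f y $ i)^2 + (f y $ j)^2 = (\<Sum>l\<in>{i, j}. (f y $ l)^2)" using ij by simp
  also have "\<dots> \<le> (\<Sum>l\<in>UNIV. (f y $ l)^2)" by (intro sum_mono2) auto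
  also have "\<dots> = 1" using f1[OF y] by (simp add: inner_vec_def power2_eq_square)
  finally show ?thesis by (simp add: u_def v_def inner_axis')
 qed
 have refl_along: "\<exists>g. isometry_of Q \<theta> g \<and> (\<forall>x\<in>Q. f (g x) = reflection_along z (f x))" if "norm z = 1" for z
  by (rule iso[OF orthogonal_reflection_along[OF that]])
 \<comment> \<open>Such an h also fixes everything orthogonal to \<open>x - y\<close>, so a second
   one can be applied without undoing what the first achieved.\<close>
 have to: "\<exists>h. orthogonal_transformation h \<and> h x = y \<and> (\<forall>z. z \<bullet> (x - y) = 0 \<longrightarrow> h z = z)" if "norm x = norm y" for x y :: "real^'n"
 proof (cases "x = y")
  case True
  then show ?thesis by (intro exI[of _ id]) (simp add: orthogonal_transformation_def linear_id)
 next
  case False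
  define v where "v = (x - y) /\<^sub>R norm (x - y)"
  have "norm v = 1" using False by (simp add: v_def)
  moreover have "reflection_along v z = z" if "z \<bullet> (x - y) = 0" for z
   using that by (simp add: reflection_along_def v_def inner_commute[of "x - y"])
  ultimately show ?thesis using reflection_along_diff[OF that False] orthogonal_reflection_along[of v] unfolding v_def[symmetric] by blast
 qed
 have "two_point_space_axioms (CARD('n) - 1) (CARD('n) - 1) Q \<theta> \<mu> f (1/4) e w"
 proof
  show "e \<phi> \<in> Q" for \<phi> by (rule e)
  show "T (e (pi/2)) (e 0) = 0" by (simp add: Tb e uv)
  fix y assume y: "y \<in> Q"
  show "T (e \<phi>) y = (cos \<phi>)^2 * T (e 0) y + (sin \<phi>)^2 * T (e (pi / 2)) y + 2 * cos \<phi> * sin \<phi> * w y" for \<phi>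
  proof -
   have "4 * (cos \<phi>)^2 + 4 * (sin \<phi>)^2 = 4" using sin_cos_squared_add[of \<phi>] by linarith
   then show ?thesis unfolding Te[OF y] w_def cos_double sin_double by (simp add: field_simps)
  qed
  have "(u \<bullet> f y)^2 + (v \<bullet> f y)^2 \<le> 1" by (rule uvle[OF y])
  then show "(w y)^2 \<le> T (e 0) y * T (e (pi / 2)) y" unfolding w_def Ta[OF y] Tb[OF y]
   by (simp add: power_divide power2_eq_square algebra_simps)
  show "T (e 0) y + T (e (pi / 2)) y \<le> 1" unfolding Ta[OF y] Tb[OF y] by (simp add: field_simps)
 next
  obtain g where g: "isometry_of Q \<theta> g" "\<forall>x\<in>Q. f (g x) = reflection_along v (f x)" using refl_along[of v] uv by (auto simp: norm_eq_1)
  have "g (e \<phi>) = e (- \<phi>)" for \<phi>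
  proof (rule inj)
   have "f (g (e \<phi>)) = cos (2 * \<phi>) *\<^sub>R u + (sin (2 * \<phi>) *\<^sub>R v - (2 * sin (2 * \<phi>)) *\<^sub>R v)"
    using g(2) e uv by (simp add: reflection_along_def inner_add_right)
   also have "\<dots> = f (e (- \<phi>))" unfolding scaleR_diff_left[symmetric] e by simp
   finally show "f (g (e \<phi>)) = f (e (- \<phi>))" .
  qed (use isometry_in[OF g(1)] e in auto)
  then show "\<exists>g. isometry_of Q \<theta> g \<and> (\<forall>\<phi>. g (e \<phi>) = e (- \<phi>))" using g(1) by blast
 next
  fix x z assume xz: "x \<in> Q" "z \<in> Q"
  obtain h where h: "orthogonal_transformation h" "h (f x) = u" using to[of "f x" u] f1[OF xz(1)] uv(1) by (auto simp: norm_eq)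
  define y where "y = h (f z)"
  have yn: "y \<bullet> y = 1" using h(1) f1[OF xz(2)] by (simp add: y_def orthogonal_transformation_def)
  \<comment> \<open>The part of y orthogonal to u. Moving it onto the direction v fixes u and leaves
    y in the plane of u and v, with nonnegative second coordinate.\<close>
  define t where "t = y - (u \<bullet> y) *\<^sub>R u"
  have ut: "u \<bullet> t = 0" by (simp add: t_def inner_diff_right uv)
  have tt: "t \<bullet> t = 1 - (u \<bullet> y)^2" using inner_commute[of u y]
   by (simp add: t_def inner_diff_right inner_diff_left uv yn power2_eq_square)
  obtain h' where h': "orthogonal_transformation h'" "h' t = norm t *\<^sub>R v" "\<forall>z. z \<bullet> (t - norm t *\<^sub>R v) = 0 \<longrightarrow> h' z = z"
   using to[of t "norm t *\<^sub>R v"] uv(2) by (auto simp: norm_eq_1)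
  have h'u: "h' u = u" using h'(3) by (simp add: inner_diff_right ut uv)
  have l': "linear h'" using h'(1) by (simp add: orthogonal_transformation)
  have "y = (u \<bullet> y) *\<^sub>R u + t" by (simp add: t_def)
  then have "h' y = (u \<bullet> y) *\<^sub>R u + norm t *\<^sub>R v" using h'(2) h'u linear_add[OF l'] linear_cmul[OF l'] by metis
  moreover have uy: "\<bar>u \<bullet> y\<bar> \<le> 1" using Cauchy_Schwarz_ineq2[of u y] uv(1) yn by (simp add: norm_eq_sqrt_inner)
  define \<phi> where "\<phi> = arccos (u \<bullet> y) / 2"
  have \<phi>: "0 \<le> \<phi>" "\<phi> \<le> pi/2" "cos (2 * \<phi>) = u \<bullet> y" "sin (2 * \<phi>) = norm t"
   using uy arccos_lbound[of "u \<bullet> y"] arccos_ubound[of "u \<bullet> y"] tt by (auto simp: \<phi>_def sin_arccos_abs norm_eq_sqrt_inner)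
  ultimately have h'y: "h' y = cos (2 * \<phi>) *\<^sub>R u + sin (2 * \<phi>) *\<^sub>R v" by simp
  obtain g where g: "isometry_of Q \<theta> g" "\<forall>x\<in>Q. f (g x) = (h' \<circ> h) (f x)"
   using iso[OF orthogonal_transformation_compose[OF h'(1) h(1)]] by blast
  have "g x = e 0" by (rule inj) (use isometry_in[OF g(1)] g(2) e xz h h'u in auto)
  moreover have "g z = e \<phi>" by (rule inj) (use isometry_in[OF g(1)] g(2) e xz h'y in \<open>auto simp: y_def\<close>)
  ultimately show "\<exists>g \<phi>. isometry_of Q \<theta> g \<and> 0 \<le> \<phi> \<and> \<phi> \<le> pi / 2 \<and> g x = e 0 \<and> g z = e \<phi>"
   using g(1) \<phi>(1,2) by blast
 next
  fix n :: nat
  have [measurable]: "(\<lambda>y. f y $ l) \<in> borel_measurable \<mu>" for l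
   using measurable_compose[OF emb_measurable borel_measurable_continuous_onI[of "\<lambda>y. y $ l"]] by (simp add: continuous_on_component)
  define I where "I l = (\<integral>y. (f y $ l)^2 * T (e 0) y ^ n \<partial>\<mu>)" for l
  have Ta': "T (e 0) y = (1 + f y $ i) / 2" if "y \<in> Q" for y using Ta[OF that] by (simp add: u_def inner_axis')
  have swap: "I l = I j" if l: "l \<noteq> i" for l
  proof (cases "l = j")
   case False
   obtain h where h: "orthogonal_transformation h" "h (axis l 1) = (axis j 1 :: real^'n)"
    "\<forall>z. z \<bullet> (axis l 1 - axis j 1) = 0 \<longrightarrow> h z = z" using to[of "axis l 1" "axis j 1"] by (auto simp: norm_axis_1)
   obtain g where g: "isometry_of Q \<theta> g" "\<forall>x\<in>Q. f (g x) = h (f x)" using iso[OF h(1)] by blast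
   have hi: "h (axis i 1) = axis i 1" using h(3) l ij by (simp add: inner_diff_right inner_axis_axis)
   have comp: "h x $ j = x $ l" "h x $ i = x $ i" for x
   proof -
    have "h x \<bullet> h (axis l 1) = x \<bullet> axis l 1" "h x \<bullet> h (axis i 1) = x \<bullet> axis i 1"
     using h(1) by (auto simp: orthogonal_transformation_def)
    then show "h x $ j = x $ l" "h x $ i = x $ i" unfolding h(2) hi by (simp_all add: inner_axis)
   qed
   have "I j = (\<integral>y. (f (g y) $ j)^2 * T (e 0) (g y) ^ n \<partial>\<mu>)"
    unfolding I_def by (rule isometry_integral[OF g(1), symmetric]) measurable
   also have "\<dots> = I l" unfolding I_def by (rule bochner_cong) (use g isometry_in[OF g(1)] in \<open>auto simp: comp Ta'\<close>)
   finally show ?thesis by simp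
  qed simp
  have bd: "integrable \<mu> (\<lambda>y. (f y $ l)^2 * T (e 0) y ^ n)" for l
  proof (rule bounded_integrable[where B=1])
   fix y assume y: "y \<in> Q"
   have "\<bar>f y $ l\<bar> \<le> norm (f y)" by (rule component_le_norm_cart)
   then have "(f y $ l)^2 \<le> 1" using f1[OF y] by (simp add: norm_eq_sqrt_inner abs_square_le_1)
   then show "\<bar>(f y $ l)^2 * T (e 0) y ^ n\<bar> \<le> 1"
    using T_ge_0[OF e(1) y, of 0] T_le_1[of "e 0" y] by (auto simp: abs_mult intro!: mult_le_one power_le_one)
  qed measurable
  have "real (CARD('n) - 1) * I j = (\<Sum>l\<in>UNIV - {i}. I l)" using swap by (simp add: card_Diff_singleton)
  also have "\<dots> = (\<integral>y. (\<Sum>l\<in>UNIV - {i}. (f y $ l)^2 * T (e 0) y ^ n) \<partial>\<mu>)"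
   unfolding I_def using bd by (intro bochner_sum[symmetric])
  also have "\<dots> = (\<integral>y. 4 * (T (e (pi/2)) y * T (e 0) y ^ Suc n) \<partial>\<mu>)"
  proof (rule bochner_cong)
   fix y assume "y \<in> space \<mu>"
   then have y: "y \<in> Q" by simp
   have "(\<Sum>l\<in>UNIV - {i}. (f y $ l)^2) = 1 - (f y $ i)^2"
    using f1[OF y] by (simp add: inner_vec_def power2_eq_square sum_diff1)
   also have "\<dots> = 4 * (T (e (pi/2)) y * T (e 0) y)"
    unfolding Ta[OF y] Tb[OF y] u_def by (simp add: inner_axis' power2_eq_square algebra_simps)
   finally show "(\<Sum>l\<in>UNIV - {i}. (f y $ l)^2 * T (e 0) y ^ n) = 4 * (T (e (pi/2)) y * T (e 0) y ^ Suc n)"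
    by (simp add: sum_distrib_right[symmetric])
  qed simp
  finally have "real (CARD('n) - 1) * I j = 4 * (\<integral>y. T (e (pi/2)) y * T (e 0) y ^ Suc n \<partial>\<mu>)" by simp
  moreover have "(\<integral>y. (w y)^2 * T (e 0) y ^ n \<partial>\<mu>) = I j / 4"
   unfolding I_def w_def v_def by (simp add: inner_axis' power_divide)
  ultimately show "real (CARD('n) - 1) * (\<integral>y. (w y)^2 * T (e 0) y ^ n \<partial>\<mu>) = (\<integral>y. T (e (pi/2)) y * T (e 0) y ^ Suc n \<partial>\<mu>)"
   by (simp only: times_divide_eq_right)
  show "real (CARD('n) - 1) * (\<integral>y. T (e (pi/2)) y * T (e 0) y ^ n \<partial>\<mu>) = real (CARD('n) - 1) * (\<integral>y. (1 - T (e 0) y) * T (e 0) y ^ n \<partial>\<mu>)"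
   by (intro arg_cong[where f="(*) (real (CARD('n) - 1))"] bochner_cong) (auto simp: Ta Tb field_simps)
 qed
 moreover have "jacobi_weight (CARD('n) - 1) (CARD('n) - 1)" using card by unfold_locales auto
 ultimately have "two_point_space (CARD('n) - 1) (CARD('n) - 1) Q \<theta> \<mu> f (1/4) e w" by (intro two_point_space.intro embedded_space_axioms)
 then show ?thesis by blast
qed

section \<open>Projective spaces\<close>

text \<open>Nested pairs of complex numbers, multiplied below by the doubling formula of
  \<open>cayley_dickson\<close>; as a product type they form a Euclidean space, with the inner
  product and the topology that the embedding needs.\<close>

type_synonym oct = "(complex \<times> complex) \<times> (complex \<times> complex)"

definition qmul :: "complex \<times> complex \<Rightarrow> complex \<times> complex \<Rightarrow> complex \<times> complex" where
 "qmul x y = (fst x * fst y - cnj (snd y) * snd x, snd y * fst x + snd x * cnj (fst y))"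
definition qcnj :: "complex \<times> complex \<Rightarrow> complex \<times> complex" where "qcnj x = (cnj (fst x), - snd x)"
definition omul :: "oct \<Rightarrow> oct \<Rightarrow> oct" where
 "omul x y = (qmul (fst x) (fst y) - qmul (qcnj (snd y)) (snd x), qmul (snd y) (fst x) + qmul (snd x) (qcnj (fst y)))"
definition ocnj :: "oct \<Rightarrow> oct" where "ocnj x = (qcnj (fst x), - snd x)"
definition oone :: oct where "oone = ((1, 0), 0)"

lemmas oct_defs = omul_def ocnj_def oone_def qmul_def qcnj_def

interpretation om: bounded_bilinear omul
proof (rule bilinear_conv_bounded_bilinear[THEN iffD1])
 show "bilinear omul" unfolding bilinear_def by (auto intro!: linearI simp: oct_defs prod_eq_iff algebra_simps scaleR_conv_of_real)
qed

lemma linear_ocnj: "linear ocnj" by (rule linearI) (auto simp: oct_defs)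

lemma ocnj_ocnj [simp]: "ocnj (ocnj x) = x" and ocnj_oone [simp]: "ocnj oone = oone" by (simp_all add: oct_defs)
lemma ocnj_omul: "ocnj (omul x y) = omul (ocnj y) (ocnj x)" by (simp add: oct_defs prod_eq_iff algebra_simps)
lemma omul_oone [simp]: "omul oone x = x" "omul x oone = x" by (simp_all add: oct_defs prod_eq_iff)
lemma norm_oone [simp]: "norm oone = 1" by (simp add: oone_def norm_Pair)
lemma norm_ocnj [simp]: "norm (ocnj x) = norm x" by (simp add: oct_defs norm_Pair norm_prod_def)
lemma inner_ocnj_oone [simp]: "ocnj x \<bullet> oone = x \<bullet> oone" by (simp add: oct_defs inner_prod_def inner_complex_def)
lemma ocnj_fixed: "ocnj x = x \<Longrightarrow> x = (x \<bullet> oone) *\<^sub>R oone"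
 by (auto simp: oct_defs prod_eq_iff inner_prod_def inner_complex_def complex_eq_iff)
lemma omul_ocnj: "omul x (ocnj x) = (x \<bullet> x) *\<^sub>R oone" "omul (ocnj x) x = (x \<bullet> x) *\<^sub>R oone"
 by (simp_all add: oct_defs prod_eq_iff inner_prod_def inner_complex_def complex_eq_iff algebra_simps)
text \<open>A component along a unit u is thereby the real part of a product, so an isometry that
  multiplies an entry by \<open>ocnj u\<close> carries one component into another.\<close>

lemma inner_omul_oone: "omul (ocnj u) x \<bullet> oone = u \<bullet> x" by (simp add: oct_defs inner_prod_def inner_complex_def algebra_simps)
lemma inner_omul_left: "omul u x \<bullet> y = x \<bullet> omul (ocnj u) y" by (simp add: oct_defs inner_prod_def inner_complex_def algebra_simps)
lemma omul_alternative: "omul (ocnj u) (omul u x) = (u \<bullet> u) *\<^sub>R x" "omul (omul x u) (ocnj u) = (u \<bullet> u) *\<^sub>R x"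
 by (simp_all add: oct_defs prod_eq_iff inner_prod_def inner_complex_def complex_eq_iff algebra_simps)
lemma norm_omul: "norm (omul x y) = norm x * norm y" by (simp add: norm_eq_sqrt_inner inner_omul_left omul_alternative real_sqrt_mult)
text \<open>Flexibility and the Moufang identities, checked in complex coordinates; they stand in
  for associativity when entries are multiplied by units.\<close>

lemma omul_flexible: "omul u (omul x u) = omul (omul u x) u" by (simp add: oct_defs prod_eq_iff algebra_simps)
lemma moufang_middle: "omul (omul u x) (omul y u) = omul u (omul (omul x y) u)" by (simp add: oct_defs prod_eq_iff algebra_simps)
lemma moufang_right: "omul z (omul v (omul y v)) = omul (omul (omul z v) y) v" by (simp add: oct_defs prod_eq_iff algebra_simps)

section \<open>Hermitian idempotents with octonionic entries and real reflections\<close>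

definition star :: "oct^'n^'n \<Rightarrow> oct^'n^'n" where "star X = (\<chi> k l. ocnj (X$l$k))"
definition mm :: "oct^'n^'n \<Rightarrow> oct^'n^'n \<Rightarrow> oct^'n::finite^'n" where "mm X Y = (\<chi> k l. \<Sum>m\<in>UNIV. omul (X$k$m) (Y$m$l))"
definition tr :: "oct^'n::finite^'n \<Rightarrow> oct" where "tr X = (\<Sum>k\<in>UNIV. X$k$k)"
text \<open>The entries are confined to a set S, so that the real, complex, quaternionic and
  octonionic families become instances of one definition.\<close>

definition proj :: "oct set \<Rightarrow> (oct^'n::finite^'n) set" where
 "proj S = {A. (\<forall>k l. A$k$l \<in> S) \<and> star A = A \<and> mm A A = A \<and> tr A = oone}"
definition weight :: "oct^'n^'n \<Rightarrow> 'n \<Rightarrow> real" where "weight A k = A$k$k \<bullet> oone"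

text \<open>\<open>hl v\<close> and \<open>hr v\<close> multiply by the real Householder matrix \<open>1 - 2 v v\<^sup>T\<close> from the left and from the right.\<close>
definition hl :: "real^'n \<Rightarrow> oct^'n^'n \<Rightarrow> oct^'n::finite^'n" where
 "hl v X = (\<chi> k l. X$k$l - (2 * v$k) *\<^sub>R (\<Sum>p\<in>UNIV. v$p *\<^sub>R X$p$l))"
definition hr :: "real^'n \<Rightarrow> oct^'n^'n \<Rightarrow> oct^'n::finite^'n" where
 "hr v X = (\<chi> k l. X$k$l - (2 * v$l) *\<^sub>R (\<Sum>p\<in>UNIV. v$p *\<^sub>R X$k$p))"

lemma inner_oone [simp]: "oone \<bullet> oone = 1" by (simp add: oone_def inner_prod_def)

lemma star_star [simp]: "star (star X) = X" by (simp add: star_def vec_eq_iff)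
lemma star_mm: "star (mm X Y) = mm (star Y) (star X)" by (simp add: star_def mm_def vec_eq_iff linear_sum[OF linear_ocnj] ocnj_omul)
lemma star_hl: "star (hl v X) = hr v (star X)"
 by (simp add: star_def hl_def hr_def vec_eq_iff linear_sum[OF linear_ocnj] linear_diff[OF linear_ocnj] linear_cmul[OF linear_ocnj])
lemma star_hr: "star (hr v X) = hl v (star X)"
proof -
 have "star (star (hl v (star X))) = star (hr v X)" by (simp only: star_hl star_star)
 then show ?thesis by simp
qed
text \<open>Real coefficients associate with all octonions, so a real matrix can be moved out of a
  product although \<open>mm\<close> is not associative. The rule for the right factor follows by
  \<open>star\<close>.\<close>

lemma mm_hl: "mm (hl v X) Y = hl v (mm X Y)"
proof -
 have "(\<Sum>m\<in>UNIV. \<Sum>p\<in>UNIV. v$p *\<^sub>R omul (X$p$m) (Y$m$l)) = (\<Sum>p\<in>UNIV. \<Sum>m\<in>UNIV. v$p *\<^sub>R omul (X$p$m) (Y$m$l))" for l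
  by (rule sum.swap)
 then show ?thesis by (simp add: hl_def mm_def vec_eq_iff om.diff_left om.scaleR_left om.sum_left sum_subtractf scaleR_sum_right[symmetric])
qed
lemma mm_hr: "mm X (hr v Y) = hr v (mm X Y)"
proof -
 have "star (mm X (hr v Y)) = hl v (star (mm X Y))" by (simp add: star_mm star_hr mm_hl)
 then have "star (star (mm X (hr v Y))) = star (hl v (star (mm X Y)))" by simp
 then show ?thesis by (simp only: star_star star_hl)
qed
lemma mm_hr_hl: "mm (hr v X) Y = mm X (hl v Y)"
proof -
 have "(\<Sum>m\<in>UNIV. \<Sum>p\<in>UNIV. (2 * v$m) *\<^sub>R v$p *\<^sub>R omul (X$k$p) (Y$m$l)) = (\<Sum>p\<in>UNIV. \<Sum>m\<in>UNIV. (2 * v$m) *\<^sub>R v$p *\<^sub>R omul (X$k$p) (Y$m$l))" for k l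
  by (rule sum.swap)
 then show ?thesis by (simp add: hl_def hr_def mm_def vec_eq_iff om.diff_left om.diff_right om.scaleR_left om.scaleR_right
    om.sum_left om.sum_right sum_subtractf scaleR_sum_right mult_ac)
qed
lemma tr_hl: "tr (hl v X) = tr (hr v X)"
proof -
 have "(\<Sum>k\<in>UNIV. \<Sum>p\<in>UNIV. (2 * v$k) *\<^sub>R v$p *\<^sub>R X$p$k) = (\<Sum>p\<in>UNIV. \<Sum>k\<in>UNIV. (2 * v$k) *\<^sub>R v$p *\<^sub>R X$p$k)" by (rule sum.swap)
 then show ?thesis by (simp add: tr_def hl_def hr_def sum_subtractf scaleR_sum_right mult_ac)
qed
lemma linear_hl: "linear (hl v)" by (rule linearI) (simp_all add: hl_def vec_eq_iff scaleR_add_right sum.distrib scaleR_sum_right algebra_simps)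
lemma linear_hr: "linear (hr v)" by (rule linearI) (simp_all add: hr_def vec_eq_iff scaleR_add_right sum.distrib scaleR_sum_right algebra_simps)
lemma hl_hr: "hl v (hr v X) = hr v (hl v X)"
proof -
 have "(\<Sum>m\<in>UNIV. \<Sum>p\<in>UNIV. (v$k * (v$l * (v$m * (v$p * 4)))) *\<^sub>R X$m$p) = (\<Sum>p\<in>UNIV. \<Sum>m\<in>UNIV. (v$k * (v$l * (v$m * (v$p * 4)))) *\<^sub>R X$m$p)" for k l
  by (rule sum.swap)
 then show ?thesis by (simp add: hl_def hr_def vec_eq_iff scaleR_diff_right sum_subtractf scaleR_sum_right mult_ac)
qed
lemma inner_hl: "hl v X \<bullet> Y = X \<bullet> hl v Y"
proof -
 have "(\<Sum>k\<in>UNIV. \<Sum>l\<in>UNIV. \<Sum>p\<in>UNIV. v$k * (v$p * (X$p$l \<bullet> Y$k$l))) = (\<Sum>k\<in>UNIV. \<Sum>p\<in>UNIV. \<Sum>l\<in>UNIV. v$k * (v$p * (X$p$l \<bullet> Y$k$l)))"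
  by (intro sum.cong HOL.refl sum.swap)
 also have "\<dots> = (\<Sum>p\<in>UNIV. \<Sum>k\<in>UNIV. \<Sum>l\<in>UNIV. v$k * (v$p * (X$p$l \<bullet> Y$k$l)))" by (rule sum.swap)
 also have "\<dots> = (\<Sum>p\<in>UNIV. \<Sum>l\<in>UNIV. \<Sum>k\<in>UNIV. v$p * (v$k * (X$p$l \<bullet> Y$k$l)))"
  unfolding mult.left_commute[of "v$_" "v$_"] by (intro sum.cong HOL.refl sum.swap)
 finally show ?thesis
  by (simp add: hl_def inner_vec_def inner_diff_left inner_diff_right sum_subtractf inner_sum_left inner_sum_right sum_distrib_left[symmetric] mult.assoc)
qed
lemma norm_star [simp]: "norm (star X) = norm X"
proof -
 have "(\<Sum>k\<in>UNIV. \<Sum>l\<in>UNIV. (norm (X$l$k))^2) = (\<Sum>l\<in>UNIV. \<Sum>k\<in>UNIV. (norm (X$l$k))^2)" by (rule sum.swap)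
 then show ?thesis by (simp add: star_def norm_vec_def L2_set_def sum_nonneg)
qed

definition householder :: "real^'n \<Rightarrow> oct^'n^'n \<Rightarrow> oct^'n::finite^'n" where "householder v X = hl v (hr v X)"

context
 fixes v :: "real^'n::finite"
 assumes v: "v \<bullet> v = 1"
begin

lemma hl_hl: "hl v (hl v X) = X"
proof -
 have vv: "(\<Sum>p\<in>UNIV. v$p * v$p) = 1" using v by (simp add: inner_vec_def)
 have "(\<Sum>p\<in>UNIV. v$p *\<^sub>R hl v X$p$l) = - (\<Sum>p\<in>UNIV. v$p *\<^sub>R X$p$l)" for l
 proof -
  let ?s = "\<Sum>p\<in>UNIV. v$p *\<^sub>R X$p$l"
  have "(\<Sum>p\<in>UNIV. v$p *\<^sub>R hl v X$p$l) = ?s - (\<Sum>p\<in>UNIV. (2 * (v$p * v$p)) *\<^sub>R ?s)"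
   by (simp add: hl_def scaleR_diff_right sum_subtractf mult_ac)
  also have "(\<Sum>p\<in>UNIV. (2 * (v$p * v$p)) *\<^sub>R ?s) = (2 * (\<Sum>p\<in>UNIV. v$p * v$p)) *\<^sub>R ?s"
   by (simp add: scaleR_sum_left sum_distrib_left)
  also have "?s - (2 * (\<Sum>p\<in>UNIV. v$p * v$p)) *\<^sub>R ?s = - ?s" unfolding vv by (simp add: scaleR_2)
  finally show ?thesis .
 qed
 then show ?thesis by (subst hl_def) (simp add: vec_eq_iff, simp add: hl_def)
qed

lemma hr_hr: "hr v (hr v X) = X"
proof -
 have "star (hl v (hl v (star X))) = X" by (simp add: hl_hl)
 then show ?thesis by (simp only: star_hl star_star)
qed

lemma norm_householder: "norm (householder v X) = norm X"
proof -
 have n: "norm (hl v Y) = norm Y" for Y :: "oct^'n^'n" by (simp add: norm_eq_sqrt_inner inner_hl hl_hl)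
 have "norm (hr v X) = norm (star (hr v X))" by simp
 also have "\<dots> = norm X" unfolding star_hr n by simp
 finally show ?thesis by (simp add: householder_def n)
qed

lemma householder_householder: "householder v (householder v X) = X"
proof -
 have "hr v (hl v (hr v X)) = hl v (hr v (hr v X))" by (rule hl_hr[symmetric])
 then show ?thesis by (simp only: householder_def hr_hr hl_hl)
qed

lemma householder_diff: "householder v (X - Y) = householder v X - householder v Y"
 unfolding householder_def by (simp add: linear_diff[OF linear_hr] linear_diff[OF linear_hl])

text \<open>For the real symmetric reflection H the computation
  \<open>(H A H) (H A H) = H (A A) H = H A H\<close> moves only real factors past a product, which
  is legitimate for octonionic entries.\<close>

lemma householder_proj:
 assumes S: "subspace S" and A: "A \<in> proj S" shows "householder v A \<in> proj S"
proof -
 have A': "\<And>k l. A$k$l \<in> S" "star A = A" "mm A A = A" "tr A = oone" using A by (auto simp: proj_def)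
 have hlS: "hl v X$k$l \<in> S" if "\<And>k l. X$k$l \<in> S" for X k l
  unfolding hl_def using that by (simp add: subspace_diff[OF S] subspace_scale[OF S] subspace_sum[OF S])
 have hrS: "hr v X$k$l \<in> S" if "\<And>k l. X$k$l \<in> S" for X k l
  unfolding hr_def using that by (simp add: subspace_diff[OF S] subspace_scale[OF S] subspace_sum[OF S])
 have "mm (householder v A) (householder v A) = householder v A" by (simp only: householder_def mm_hl mm_hr_hl hl_hl mm_hr A')
 moreover have "tr (householder v A) = oone" unfolding householder_def tr_hl hr_hr by (rule A')
 moreover have "star (householder v A) = householder v A" by (simp only: householder_def star_hl star_hr A'(2) hl_hr)
 ultimately show ?thesis unfolding proj_def householder_def using hlS[OF hrS[OF A'(1)]] by simp
qed

end

text \<open>A vector supported on two indices reduces the sums to two terms, so that the effect on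
  the diagonal can be computed explicitly.\<close>

lemma householder_support:
 assumes "\<And>p. p \<noteq> i \<Longrightarrow> p \<noteq> j \<Longrightarrow> v$p = 0" "i \<noteq> (j::'n::finite)"
 shows "householder v X$k$k = (let B = \<lambda>p. X$p$k - (2 * v$k) *\<^sub>R (v$i *\<^sub>R X$p$i + v$j *\<^sub>R X$p$j) in
  B k - (2 * v$k) *\<^sub>R (v$i *\<^sub>R B i + v$j *\<^sub>R B j))"
proof -
 have "(\<Sum>p\<in>UNIV. v$p *\<^sub>R g p) = v$i *\<^sub>R g i + v$j *\<^sub>R g j" for g :: "'n \<Rightarrow> oct"
 proof -
  have "(\<Sum>p\<in>UNIV. v$p *\<^sub>R g p) = (\<Sum>p\<in>{i, j}. v$p *\<^sub>R g p)" using assms(1) by (intro sum.mono_neutral_right) auto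
  then show ?thesis using assms(2) by simp
 qed
 then show ?thesis by (simp add: householder_def hl_def hr_def Let_def)
qed

section \<open>Entries of a projection of trace one\<close>

context
 fixes A :: "oct^'n::finite^'n" and S
 assumes A: "A \<in> proj S"
begin

lemma proj_entry: "A$l$k = ocnj (A$k$l)" using A by (auto simp: proj_def star_def vec_eq_iff)

lemma proj_sum: "(\<Sum>m\<in>UNIV. omul (A$k$m) (A$m$l)) = A$k$l" using A by (auto simp: proj_def mm_def vec_eq_iff)

lemma proj_diag: "A$k$k = weight A k *\<^sub>R oone" unfolding weight_def by (rule ocnj_fixed) (rule proj_entry[symmetric])

text \<open>The diagonal of \<open>A A = A\<close>: by hermiticity each product in it is an entry
  times its conjugate.\<close>

lemma weight_row: "weight A k = (\<Sum>m\<in>UNIV. (norm (A$k$m))^2)"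
proof -
 have "A$k$k = (\<Sum>m\<in>UNIV. (A$k$m \<bullet> A$k$m) *\<^sub>R oone)"
  unfolding proj_sum[of k k, symmetric] by (intro sum.cong HOL.refl) (metis proj_entry omul_ocnj(1))
 then have "weight A k = (\<Sum>m\<in>UNIV. A$k$m \<bullet> A$k$m)" unfolding weight_def by (simp add: inner_sum_left)
 then show ?thesis by (simp add: power2_norm_eq_inner)
qed

lemma weight_nonneg: "0 \<le> weight A k" unfolding weight_row by (intro sum_nonneg) simp

lemma weight_sum: "(\<Sum>k\<in>UNIV. weight A k) = 1"
proof -
 have "(\<Sum>k\<in>UNIV. weight A k) = tr A \<bullet> oone" by (simp add: tr_def weight_def inner_sum_left)
 then show ?thesis using A by (simp add: proj_def)
qed

text \<open>This is rank one. Norms in \<open>A A = A\<close> with Cauchy-Schwarz give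
  \<open>\<le>\<close>; summed over all k and l both sides become 1 because the trace is 1, so
  equality holds for each entry. The argument uses only that the norm is multiplicative.\<close>

lemma norm_entry: "(norm (A$k$l))^2 = weight A k * weight A l"
proof -
 have le: "(norm (A$k$l))^2 \<le> weight A k * weight A l" for k l
 proof -
  have "norm (A$k$l) \<le> (\<Sum>m\<in>UNIV. norm (A$k$m) * norm (A$l$m))"
  proof -
   have "norm (A$k$l) \<le> (\<Sum>m\<in>UNIV. norm (omul (A$k$m) (A$m$l)))" unfolding proj_sum[of k l, symmetric] by (rule norm_sum)
   also have "\<dots> = (\<Sum>m\<in>UNIV. norm (A$k$m) * norm (A$l$m))"
    unfolding norm_omul by (intro sum.cong HOL.refl) (metis proj_entry norm_ocnj)
   finally show ?thesis .
  qed
  then have "(norm (A$k$l))^2 \<le> (\<Sum>m\<in>UNIV. norm (A$k$m) * norm (A$l$m))^2" by (rule power_mono) simp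
  also have "\<dots> \<le> weight A k * weight A l" unfolding weight_row by (rule Cauchy_Schwarz_ineq_sum)
  finally show ?thesis .
 qed
 have "(\<Sum>k\<in>UNIV. \<Sum>l\<in>UNIV. weight A k * weight A l - (norm (A$k$l))^2) = (\<Sum>k\<in>UNIV. weight A k) * (\<Sum>l\<in>UNIV. weight A l) - (\<Sum>k\<in>UNIV. weight A k)"
  unfolding sum_subtractf sum_product weight_row[symmetric] ..
 then have "(\<Sum>k\<in>UNIV. \<Sum>l\<in>UNIV. weight A k * weight A l - (norm (A$k$l))^2) = 0" by (simp add: weight_sum)
 then have "(\<Sum>l\<in>UNIV. weight A k * weight A l - (norm (A$k$l))^2) = 0"
  using le by (subst (asm) sum_nonneg_eq_0_iff) (auto intro!: sum_nonneg)
 then have "weight A k * weight A l - (norm (A$k$l))^2 = 0" using le by (subst (asm) sum_nonneg_eq_0_iff) auto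
 then show ?thesis by simp
qed

lemma norm_proj: "norm A = 1"
proof -
 have "(norm A)^2 = (\<Sum>k\<in>UNIV. \<Sum>l\<in>UNIV. (norm (A$k$l))^2)" by (simp add: power2_norm_eq_inner inner_vec_def)
 also have "\<dots> = 1" by (simp add: weight_row[symmetric] weight_sum)
 finally show ?thesis by (simp add: power2_eq_1_iff) (metis norm_ge_zero not_one_le_zero neg_0_le_iff_le)
qed

lemma entry_0: "weight A k = 0 \<or> weight A l = 0 \<Longrightarrow> A$k$l = 0" using norm_entry[of k l] by auto

end

text \<open>Entrywise changes of the off-diagonal coordinates; for associative entries these are the conjugations
 by diagonal unit matrices, for octonionic \<open>3 \<times> 3\<close> matrices they come from Moufang's identities.\<close>
locale unit_system =
 fixes S :: "oct set" and \<phi> :: "'n::finite \<Rightarrow> 'n \<Rightarrow> oct \<Rightarrow> oct"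
 assumes lin: "\<And>x y. linear (\<phi> x y)" and nm: "\<And>x y a. norm (\<phi> x y a) = norm a"
  and cl: "\<And>x y a. a \<in> S \<Longrightarrow> \<phi> x y a \<in> S" and cj: "\<And>x y a. a \<in> S \<Longrightarrow> \<phi> y x (ocnj a) = ocnj (\<phi> x y a)"
  and one: "\<And>x. \<phi> x x oone = oone"
  and mu: "\<And>x m y a b. x \<noteq> m \<Longrightarrow> m \<noteq> y \<Longrightarrow> x \<noteq> y \<Longrightarrow> a \<in> S \<Longrightarrow> b \<in> S \<Longrightarrow>
   omul (\<phi> x m a) (\<phi> m y b) = \<phi> x y (omul a b)"
begin

text \<open>Three distinct indices are covered by the axiom \<open>mu\<close>; when two of them
  coincide, a factor is real or the product is a squared norm, and linearity with \<open>cj\<close>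
  suffices.\<close>

lemma apply_proj:
 assumes A: "A \<in> proj S" shows "(\<chi> x y. \<phi> x y (A$x$y)) \<in> proj S"
proof -
 let ?B = "\<chi> x y. \<phi> x y (A$x$y)"
 have AS: "A$x$y \<in> S" for x y using A by (simp add: proj_def)
 have diag: "\<phi> x x (A$x$x) = A$x$x" for x by (subst (1 2) proj_diag[OF A]) (simp add: linear_cmul[OF lin] one)
 have each: "omul (\<phi> x m (A$x$m)) (\<phi> m y (A$m$y)) = \<phi> x y (omul (A$x$m) (A$m$y))" for x m y
 proof -
  consider "x = m" | "m = y" | "x = y" | "x \<noteq> m" "m \<noteq> y" "x \<noteq> y" by blast
  then show ?thesis
  proof cases
   case 1
   then show ?thesis unfolding 1 diag by (subst (1 2) proj_diag[OF A]) (simp add: om.scaleR_left linear_cmul[OF lin])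
  next
   case 2
   then show ?thesis unfolding 2 diag by (subst (1 2) proj_diag[OF A]) (simp add: om.scaleR_right linear_cmul[OF lin])
  next
   case 3
   have "omul (\<phi> y m (A$y$m)) (ocnj (\<phi> y m (A$y$m))) = \<phi> y y (omul (A$y$m) (ocnj (A$y$m)))"
    unfolding omul_ocnj linear_cmul[OF lin] one by (simp add: power2_norm_eq_inner[symmetric] nm)
   then show ?thesis unfolding 3 proj_entry[OF A, of m y] cj[OF AS] .
  next
   case 4
   then show ?thesis by (intro mu AS)
  qed
 qed
 have "mm ?B ?B = ?B" by (simp add: mm_def vec_eq_iff each linear_sum[OF lin, symmetric] proj_sum[OF A])
 moreover have "star ?B = ?B" by (simp add: star_def vec_eq_iff cj[OF AS, symmetric] proj_entry[OF A, symmetric])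
 moreover have "tr ?B = oone" using A by (simp add: tr_def diag proj_def)
 ultimately show ?thesis by (simp add: proj_def cl AS)
qed

end

lemma norm_matrix_cong:
 fixes X Y :: "oct^'n::finite^'n"
 assumes "\<And>k l. norm (X$k$l) = norm (Y$k$l)" shows "norm X = norm Y" using assms by (simp add: norm_vec_def L2_set_def sum_nonneg)

locale octonionic_plane =
 fixes S U :: "oct set" and Q :: "'a set" and \<theta> :: "'a \<Rightarrow> 'a \<Rightarrow> real" and \<mu> :: "'a measure"
  and F :: "'a \<Rightarrow> oct^'n::finite^'n"
 assumes S: "subspace S" and S_mul: "\<And>a b. a \<in> S \<Longrightarrow> b \<in> S \<Longrightarrow> omul a b \<in> S" and S_cnj: "\<And>a. a \<in> S \<Longrightarrow> ocnj a \<in> S"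
  and S_one: "oone \<in> S"
  and assoc: "CARD('n) = 3 \<or> (\<forall>a\<in>S. \<forall>b\<in>S. \<forall>c\<in>S. omul (omul a b) c = omul a (omul b c))"
  and U: "finite U" "U \<noteq> {}" "U \<subseteq> S" "\<And>u. u \<in> U \<Longrightarrow> norm u = 1" "\<And>q. q \<in> S \<Longrightarrow> (\<Sum>u\<in>U. (u \<bullet> q)^2) = (norm q)^2"
  and card: "CARD('n) \<ge> 3" and inv: "invariant_measure Q \<theta> \<mu>" and F: "bij_betw F Q (proj S)"
  and range: "\<And>x y. x \<in> Q \<Longrightarrow> y \<in> Q \<Longrightarrow> 0 \<le> \<theta> x y \<and> \<theta> x y \<le> pi"
  and dist: "\<And>x y. x \<in> Q \<Longrightarrow> y \<in> Q \<Longrightarrow> sin (\<theta> x y / 2) = 1 / sqrt 2 * norm (F x - F y)"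
begin

sublocale embedded_space Q \<theta> \<mu> F "1/2" by unfold_locales (auto simp: inv range dist power_mult_distrib power_divide)

text \<open>Wanted are maps that multiply the (i, j) entry by the unit u from the left and respect
  norms and products. For associative S, conjugation by the diagonal matrix with u at place i does
  this. For three by three octonionic matrices, left, right and two-sided multiplications at the
  three off-diagonal places fit together by Moufang's identities.\<close>

lemma unit_exists:
 assumes ij: "(i :: 'n) \<noteq> j" and u: "u \<in> S" "norm u = 1"
 shows "\<exists>\<phi> \<psi>. unit_system S \<phi> \<and> unit_system S \<psi> \<and> (\<forall>x y. \<forall>a\<in>S. \<phi> x y (\<psi> x y a) = a) \<and> (\<forall>a. \<phi> i j a = omul u a)"
proof -
 have uu: "u \<bullet> u = 1" "ocnj u \<in> S" "norm (ocnj u) = 1" "ocnj u \<bullet> ocnj u = 1" using u S_cnj[OF u(1)] norm_eq_1[of u] norm_eq_1[of "ocnj u"] by simp_all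
 have lin: "linear (\<lambda>a. omul (omul p a) q)" "linear (\<lambda>a. omul p a)" "linear (\<lambda>a. omul a q)" for p q
  by (rule linearI; simp add: om.add_left om.add_right om.scaleR_left om.scaleR_right)+
 have alternative: "omul (ocnj u) (omul u a) = a" "omul u (omul (ocnj u) a) = a" "omul (omul a u) (ocnj u) = a" "omul (omul a (ocnj u)) u = a"
  if "norm u = 1" for u a using that norm_eq_1[of u] norm_eq_1[of "ocnj u"] omul_alternative(1)[of u a] omul_alternative(1)[of "ocnj u" a]
   omul_alternative(2)[of a u] omul_alternative(2)[of a "ocnj u"] by simp_all
 show ?thesis
 proof (cases "\<forall>a\<in>S. \<forall>b\<in>S. \<forall>c\<in>S. omul (omul a b) c = omul a (omul b c)")
  case True
  then have as: "omul (omul a b) c = omul a (omul b c)" if "a \<in> S" "b \<in> S" "c \<in> S" for a b c using that by blast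
  define D where "D u x = (if x = i then u else oone)" for u and x :: 'n
  define \<phi> where "\<phi> u x y a = omul (omul (D u x) a) (ocnj (D u y))" for u x y a
  have sys: "unit_system S (\<phi> u)" if u: "u \<in> S" "norm u = 1" for u
  proof -
   have D: "D u x \<in> S" "norm (D u x) = 1" "omul (D u x) (ocnj (D u x)) = oone" "omul (ocnj (D u x)) (D u x) = oone" for x
    using u S_one omul_ocnj[of u] by (auto simp: D_def norm_eq_1)
   have "omul (omul (omul (D u x) a) (ocnj (D u m))) (omul (omul (D u m) b) (ocnj (D u y))) =
     omul (omul (D u x) (omul a b)) (ocnj (D u y))" if ab: "a \<in> S" "b \<in> S" for x m y a b
   proof -
    have "omul (omul (omul (D u x) a) (ocnj (D u m))) (omul (omul (D u m) b) (ocnj (D u y))) =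
      omul (D u x) (omul a (omul (omul (ocnj (D u m)) (D u m)) (omul b (ocnj (D u y)))))"
     using ab D(1) by (simp add: as S_mul S_cnj)
    then show ?thesis unfolding D(4) using ab D(1) by (simp add: as S_mul S_cnj)
   qed
   note mu = this
   show ?thesis
   proof (rule unit_system.intro)
    show "linear (\<phi> u x y)" for x y using lin(1)[of "D u x" "ocnj (D u y)"] by (simp add: \<phi>_def[abs_def])
    show "norm (\<phi> u x y a) = norm a" for x y a using D(2) by (simp add: \<phi>_def norm_omul)
    show "\<phi> u x y a \<in> S" if "a \<in> S" for x y a using that D(1) by (simp add: \<phi>_def S_mul S_cnj)
    show "\<phi> u y x (ocnj a) = ocnj (\<phi> u x y a)" if "a \<in> S" for x y a
     using that D(1) by (simp add: \<phi>_def ocnj_omul as S_mul S_cnj)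
    show "\<phi> u x x oone = oone" for x unfolding \<phi>_def omul_oone by (rule D(3))
    show "omul (\<phi> u x m a) (\<phi> u m y b) = \<phi> u x y (omul a b)" if "a \<in> S" "b \<in> S" for x m y a b
     unfolding \<phi>_def by (rule mu[OF that])
   qed
  qed
  have "\<phi> u x y (\<phi> (ocnj u) x y a) = a" if a: "a \<in> S" for x y a
  proof -
   have D: "D u x \<in> S" "D (ocnj u) x \<in> S" "ocnj (D (ocnj u) x) = D u x" for x using u uu S_one by (auto simp: D_def)
   have DD: "omul (D u x) (D (ocnj u) x) = oone" for x using omul_ocnj(1)[of u] uu by (simp add: D_def)
   have "\<phi> u x y (\<phi> (ocnj u) x y a) = omul (omul (D u x) (D (ocnj u) x)) (omul a (omul (D u y) (ocnj (D u y))))"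
    unfolding \<phi>_def D(3) using a D by (simp add: as S_mul S_cnj)
   moreover have "omul (D u y) (ocnj (D u y)) = oone" using omul_ocnj(1)[of u] uu by (simp add: D_def)
   ultimately show ?thesis by (simp add: DD)
  qed
  moreover have "\<phi> u i j a = omul u a" for a using ij by (simp add: \<phi>_def D_def)
  ultimately show ?thesis using sys[OF u] sys[OF uu(2,3)] by blast
 next
  case False
  then have c3: "CARD('n) = 3" using assoc by blast
  \<comment> \<open>With k the third index, the places (i, j), (j, k), (i, k) get
    \<open>u a\<close>, \<open>a u\<close>, \<open>u a u\<close>, and the transposed places the
    conjugate maps. Then \<open>(u a) (b u) = u (a b) u\<close> is the middle Moufang identity;
    \<open>right\<close> and \<open>left\<close> serve the products that mix one-sided and two-sided
    multiplications.\<close>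
  define \<phi> where "\<phi> u x y a = (if x = y then a else if x = i then (if y = j then omul u a else omul (omul u a) u)
   else if y = i then (if x = j then omul a (ocnj u) else omul (omul (ocnj u) a) (ocnj u))
   else if x = j then omul a u else if y = j then omul (ocnj u) a else a)" for u x y a
  have sys: "unit_system S (\<phi> u)" if u: "u \<in> S" "norm u = 1" for u
  proof -
   have uu: "u \<bullet> u = 1" "ocnj u \<in> S" "ocnj u \<bullet> ocnj u = 1" using u S_cnj[OF u(1)] norm_eq_1[of u] norm_eq_1[of "ocnj u"] by simp_all
   note alt = alternative[OF u(2)]
   \<comment> \<open>The right Moufang identity for \<open>z = a v\<close> and the factor
     \<open>ocnj v\<close>, where \<open>(a v) (ocnj v) = a\<close>; \<open>left\<close> is its
     conjugate.\<close>
   have right: "omul (omul a v) (omul (omul (ocnj v) b) (ocnj v)) = omul (omul a b) (ocnj v)" if "omul (omul a v) (ocnj v) = a" for a b v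
    using moufang_right[of "omul a v" "ocnj v" b] that by (simp add: omul_flexible)
   have left: "omul (omul (omul (ocnj v) a) (ocnj v)) (omul v b) = omul (ocnj v) (omul a b)" if "\<And>a. omul (omul a (ocnj v)) v = a" for a b v
    using arg_cong[OF right[of "ocnj b" "ocnj v" "ocnj a"], of ocnj] that by (simp add: ocnj_omul omul_flexible)
   show ?thesis
   proof (rule unit_system.intro)
    fix x y :: 'n
    show "linear (\<phi> u x y)" using lin linear_ident
     by (cases "x = y"; cases "x = i"; cases "y = i"; cases "x = j"; cases "y = j") (auto simp: \<phi>_def[abs_def])
    show "norm (\<phi> u x y a) = norm a" for a using u by (simp add: \<phi>_def norm_omul)
    show "\<phi> u x y a \<in> S" if "a \<in> S" for a using that u uu by (simp add: \<phi>_def S_mul)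
    show "\<phi> u y x (ocnj a) = ocnj (\<phi> u x y a)" for a using ij by (simp add: \<phi>_def ocnj_omul omul_flexible)
    show "\<phi> u x x oone = oone" by (simp add: \<phi>_def)
    fix m a b assume ne: "x \<noteq> m" "m \<noteq> y" "x \<noteq> y"
    have "card {x, m, y} = CARD('n)" using ne c3 by simp
    then have "{x, m, y} = UNIV" by (intro card_subset_eq) auto
    then have "i \<in> {x, m, y}" "j \<in> {x, m, y}" by auto
    then show "omul (\<phi> u x m a) (\<phi> u m y b) = \<phi> u x y (omul a b)"
     using ne ij moufang_middle[of u a b] moufang_middle[of "ocnj u" a b]
      right[of a u b] right[of a "ocnj u" b] left[of u a b] left[of "ocnj u" a b] alt by (auto simp: \<phi>_def omul_flexible)
   qed
  qed
  have "\<phi> u x y (\<phi> (ocnj u) x y a) = a" for x y a using alternative[OF u(2)] by (simp add: \<phi>_def omul_flexible[symmetric])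
  moreover have "\<phi> u i j a = omul u a" for a using ij by (simp add: \<phi>_def)
  ultimately show ?thesis using sys[OF u] sys[OF uu(2,3)] by blast
 qed
qed

section \<open>Isometries of the projective spaces and two-point homogeneity\<close>

lemma F_proj [simp]: "x \<in> Q \<Longrightarrow> F x \<in> proj S" using F by (rule bij_betwE[rule_format])

lemma F_inj: "F x = F y \<Longrightarrow> x \<in> Q \<Longrightarrow> y \<in> Q \<Longrightarrow> x = y"
 using bij_betw_imp_inj_on[OF F] by (rule inj_onD)

lemma unit_isometry:
 assumes ij: "i \<noteq> j" and u: "u \<in> S" "norm u = 1"
 shows "\<exists>g. isometry_of Q \<theta> g \<and> (\<forall>x\<in>Q. \<forall>k. weight (F (g x)) k = weight (F x) k) \<and> (\<forall>x\<in>Q. F (g x)$i$j = omul u (F x$i$j))"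
proof -
 obtain \<phi> \<psi> where us: "unit_system S \<phi>" "unit_system S \<psi>" and inv: "\<forall>x y. \<forall>a\<in>S. \<phi> x y (\<psi> x y a) = a" and \<phi>: "\<forall>a. \<phi> i j a = omul u a"
  using unit_exists[OF ij u] by blast
 interpret \<phi>: unit_system S \<phi> by (rule us)
 interpret \<psi>: unit_system S \<psi> by (rule us)
 let ?G = "\<lambda>A :: oct^'n^'n. \<chi> x y. \<phi> x y (A$x$y)"
 have n: "norm (?G A - ?G B) = norm (A - B)" for A B by (rule norm_matrix_cong) (simp add: linear_diff[OF \<phi>.lin, symmetric] \<phi>.nm)
 have "bij_betw ?G (proj S) (proj S)"
 proof (rule bij_betwI')
  show "?G A = ?G B \<longleftrightarrow> A = B" for A B using n[of A B] by auto
  show "?G A \<in> proj S" if "A \<in> proj S" for A by (rule \<phi>.apply_proj[OF that])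
  fix A :: "oct^'n^'n" assume A: "A \<in> proj S"
  then have "A = ?G (\<chi> x y. \<psi> x y (A$x$y))" using inv by (simp add: vec_eq_iff proj_def)
  then show "\<exists>B\<in>proj S. A = ?G B" using \<psi>.apply_proj[OF A] by blast
 qed
 from isometry_exists[OF F this n] obtain g where g: "isometry_of Q \<theta> g" "\<forall>x\<in>Q. F (g x) = ?G (F x)" by blast
 have "weight (F (g x)) k = weight (F x) k" if x: "x \<in> Q" for x k
 proof -
  have "F (g x)$k$k = \<phi> k k (weight (F x) k *\<^sub>R oone)" using g(2) x proj_diag[OF F_proj[OF x], of k] by simp
  then show ?thesis by (simp add: weight_def[of "F (g x)"] linear_cmul[OF \<phi>.lin] \<phi>.one)
 qed
 moreover have "F (g x)$i$j = omul u (F x$i$j)" if "x \<in> Q" for x using g(2) that \<phi>[rule_format, of "F x$i$j"] by simp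
 ultimately show ?thesis using g(1) by blast
qed

lemma householder_isometry:
 assumes v: "v \<bullet> v = 1" shows "\<exists>g. isometry_of Q \<theta> g \<and> (\<forall>x\<in>Q. F (g x) = householder v (F x))"
proof (rule isometry_exists[OF F])
 show "norm (householder v A - householder v B) = norm (A - B)" for A B by (simp add: householder_diff[OF v, symmetric] norm_householder[OF v])
 show "bij_betw (householder v) (proj S) (proj S)" by (rule bij_betw_byWitness[where f'="householder v"])
    (auto simp: householder_householder[OF v] householder_proj[OF v S])
qed

text \<open>The normalised conjugate of q; for q = 0 any unit will do.\<close>

lemma unit_multiplier:
 assumes "q \<in> S" shows "\<exists>u\<in>S. norm u = 1 \<and> omul u q = norm q *\<^sub>R oone"
proof (intro bexI conjI)
 show "(if q = 0 then oone else ocnj q /\<^sub>R norm q) \<in> S" using assms S_one S_cnj subspace_scale[OF S] by simp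
qed (auto simp: om.scaleR_left om.zero_right omul_ocnj power2_norm_eq_inner[symmetric] power2_eq_square)

text \<open>One elimination step. A unit makes the (i, k) entry real; by \<open>norm_entry\<close>
  the block at i and k is then the rank one matrix of a real vector
  \<open>(\<alpha>, \<beta>)\<close>, and a Householder reflection in these two coordinates moves
  all its weight to i.\<close>

lemma concentrate_step:
 assumes ik: "i \<noteq> k" and x: "x \<in> Q"
 shows "\<exists>g. isometry_of Q \<theta> g \<and> weight (F (g x)) k = 0 \<and> (\<forall>y\<in>Q. \<forall>l. l \<noteq> i \<longrightarrow> l \<noteq> k \<longrightarrow> weight (F (g y)) l = weight (F y) l)"
proof (cases "weight (F x) k = 0")
 case True
 then show ?thesis by (intro exI[of _ "\<lambda>x. x"]) (simp add: isometry_of_def bij_betw_def)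
next
 case False
 note nonneg = weight_nonneg[OF F_proj[OF x]]
 define q where "q = F x$i$k"
 have "q \<in> S" unfolding q_def using F_proj[OF x] by (simp add: proj_def)
 from unit_multiplier[OF this] obtain u where u: "u \<in> S" "norm u = 1" "omul u q = norm q *\<^sub>R oone" by blast
 obtain g where g: "isometry_of Q \<theta> g" "\<forall>y\<in>Q. \<forall>l. weight (F (g y)) l = weight (F y) l" "\<forall>y\<in>Q. F (g y)$i$k = omul u (F y$i$k)"
  using unit_isometry[OF ik u(1,2)] by blast
 define \<alpha> \<beta> \<rho> where "\<alpha> = sqrt (weight (F x) i)" and "\<beta> = sqrt (weight (F x) k)" and "\<rho> = sqrt (weight (F x) i + weight (F x) k)"
 have ab: "0 \<le> \<alpha>" "0 \<le> \<beta>" "\<alpha> * \<alpha> = weight (F x) i" "\<beta> * \<beta> = weight (F x) k" using nonneg[of i] nonneg[of k] by (auto simp: \<alpha>_def \<beta>_def)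
 have \<rho>: "\<rho> > 0" "\<rho> * \<rho> = \<alpha> * \<alpha> + \<beta> * \<beta>" using nonneg[of i] nonneg[of k] False unfolding ab by (auto simp: \<rho>_def add_nonneg_pos)
 have "norm q = \<alpha> * \<beta>" using norm_entry[OF F_proj[OF x], of i k] nonneg[of i] nonneg[of k] unfolding q_def \<alpha>_def \<beta>_def
  by (simp add: real_sqrt_mult[symmetric]) (metis norm_ge_zero real_sqrt_unique)
 then have ent: "F (g x)$i$k = (\<alpha> * \<beta>) *\<^sub>R oone" using g(3) x u(3) by (simp add: q_def)
 have gx: "g x \<in> Q" by (rule isometry_in[OF g(1) x])
 have ent': "F (g x)$k$i = (\<alpha> * \<beta>) *\<^sub>R oone"
  unfolding proj_entry[OF F_proj[OF gx], of k i] ent by (simp add: linear_cmul[OF linear_ocnj])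
 have dg: "F (g x)$i$i = (\<alpha> * \<alpha>) *\<^sub>R oone" "F (g x)$k$k = (\<beta> * \<beta>) *\<^sub>R oone"
  using proj_diag[OF F_proj[OF gx]] g(2) x by (metis ab(3), metis ab(4))
 text \<open>The Householder vector that maps the unit vector \<open>(\<alpha>, \<beta>) / \<rho>\<close> to \<open>(-1, 0)\<close>.\<close>
 define s where "s = sqrt (2 * \<rho> * (\<rho> + \<alpha>))"
 have s: "s > 0" "s * s = 2 * \<rho> * (\<rho> + \<alpha>)" using \<rho>(1) ab(1) by (auto simp: s_def add_pos_nonneg)
 define v :: "real^'n" where "v = (\<chi> p. if p = i then (\<rho> + \<alpha>) / s else if p = k then \<beta> / s else 0)"
 have vc: "v$i = (\<rho> + \<alpha>) / s" "v$k = \<beta> / s" "\<And>p. p \<noteq> i \<Longrightarrow> p \<noteq> k \<Longrightarrow> v$p = 0" using ik by (auto simp: v_def)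
 have "v \<bullet> v = (\<Sum>p\<in>{i, k}. v$p * v$p)" unfolding inner_vec_def using vc(3) by (intro sum.mono_neutral_cong_right) auto
 also have "\<dots> = ((\<rho> + \<alpha>) * (\<rho> + \<alpha>) + \<beta> * \<beta>) / (s * s)" using ik by (simp add: vc add_divide_distrib[of "(\<rho> + \<alpha>) * (\<rho> + \<alpha>)"])
 also have "(\<rho> + \<alpha>) * (\<rho> + \<alpha>) + \<beta> * \<beta> = s * s" unfolding s(2) using \<rho>(2) by (simp add: algebra_simps)
 finally have "v \<bullet> v = 1" using s(1) by simp
 from householder_isometry[OF this] obtain h where h: "isometry_of Q \<theta> h" "\<forall>y\<in>Q. F (h y) = householder v (F y)" by blast
 have hs: "householder v X$l$l = (let B = \<lambda>p. X$p$l - (2 * v$l) *\<^sub>R (v$i *\<^sub>R X$p$i + v$k *\<^sub>R X$p$k) in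
  B l - (2 * v$l) *\<^sub>R (v$i *\<^sub>R B i + v$k *\<^sub>R B k))" for X l
  by (rule householder_support[OF _ ik]) (rule vc(3))
 \<comment> \<open>The second coordinate of the reflected vector is \<open>\<beta>\<close> minus the
   left side, hence 0.\<close>
 have z: "2 * (v$k * (v$i * \<alpha> + v$k * \<beta>)) = \<beta>"
 proof -
  have "2 * (v$k * (v$i * \<alpha> + v$k * \<beta>)) = \<beta> * (2 * (\<rho> * \<alpha> + (\<alpha> * \<alpha> + \<beta> * \<beta>))) / (s * s)"
   using s(1) by (simp add: vc field_simps)
  also have "2 * (\<rho> * \<alpha> + (\<alpha> * \<alpha> + \<beta> * \<beta>)) = s * s" unfolding s(2) \<rho>(2)[symmetric] by (simp add: algebra_simps)
  finally show ?thesis using s(1) by simp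
 qed
 have row: "(c * \<beta>) *\<^sub>R oone - (2 * v$k) *\<^sub>R (v$i *\<^sub>R (c * \<alpha>) *\<^sub>R oone + v$k *\<^sub>R (c * \<beta>) *\<^sub>R oone) = 0" for c
 proof -
  have "(c * \<beta>) *\<^sub>R oone - (2 * v$k) *\<^sub>R (v$i *\<^sub>R (c * \<alpha>) *\<^sub>R oone + v$k *\<^sub>R (c * \<beta>) *\<^sub>R oone) =
   (c * (\<beta> - 2 * (v$k * (v$i * \<alpha> + v$k * \<beta>)))) *\<^sub>R oone" by (simp add: algebra_simps)
  also have "\<dots> = 0" unfolding z by simp
  finally show ?thesis .
 qed
 have "householder v (F (g x))$k$k = 0"
  unfolding hs Let_def ent ent' dg row[of \<alpha>] row[of \<beta>, unfolded mult.commute[of \<beta> \<alpha>]] by simp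
 then have "weight (F (h (g x))) k = 0" using h(2) gx by (simp add: weight_def)
 moreover have "weight (F (h (g y))) l = weight (F y) l" if y: "y \<in> Q" and l: "l \<noteq> i" "l \<noteq> k" for y l
 proof -
  have "householder v (F (g y))$l$l = F (g y)$l$l" unfolding hs Let_def vc(3)[OF l] by simp
  then show ?thesis using h(2) isometry_in[OF g(1) y] g(2) y by (simp add: weight_def)
 qed
 moreover have "isometry_of Q \<theta> (h \<circ> g)" using g(1) h(1) isometry_in[OF g(1)] unfolding isometry_of_def by (auto intro: bij_betw_trans)
 ultimately show ?thesis by (intro exI[of _ "h \<circ> g"]) simp
qed

lemma isometry_comp: "isometry_of Q \<theta> g \<Longrightarrow> isometry_of Q \<theta> h \<Longrightarrow> isometry_of Q \<theta> (h \<circ> g)"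
 using isometry_in[of g] unfolding isometry_of_def by (auto intro: bij_betw_trans)

text \<open>The elimination step repeated over K. Weights outside K and i are kept for every point
  of Q, because another point already in position has to stay there.\<close>

lemma concentrate:
 assumes "finite K" "i \<notin> K" "x \<in> Q"
 shows "\<exists>g. isometry_of Q \<theta> g \<and> (\<forall>k\<in>K. weight (F (g x)) k = 0) \<and> (\<forall>y\<in>Q. \<forall>l. l \<noteq> i \<longrightarrow> l \<notin> K \<longrightarrow> weight (F (g y)) l = weight (F y) l)"
 using assms(1,2)
proof (induction K rule: finite_induct)
 case empty
 then show ?case by (intro exI[of _ "\<lambda>x. x"]) (simp add: isometry_of_def bij_betw_def)
next
 case (insert k K)
 then obtain g where g: "isometry_of Q \<theta> g" "\<forall>k\<in>K. weight (F (g x)) k = 0"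
  "\<forall>y\<in>Q. \<forall>l. l \<noteq> i \<longrightarrow> l \<notin> K \<longrightarrow> weight (F (g y)) l = weight (F y) l" by auto
 have gQ: "g y \<in> Q" if "y \<in> Q" for y by (rule isometry_in[OF g(1) that])
 have "i \<noteq> k" using insert.prems by simp
 from concentrate_step[OF this gQ[OF assms(3)]] obtain h where h: "isometry_of Q \<theta> h" "weight (F (h (g x))) k = 0"
  "\<forall>y\<in>Q. \<forall>l. l \<noteq> i \<longrightarrow> l \<noteq> k \<longrightarrow> weight (F (h y)) l = weight (F y) l" by blast
 have "weight (F (h (g x))) l = 0" if "l \<in> insert k K" for l
 proof (cases "l = k")
  case False
  then have "l \<in> K" "l \<noteq> i" using that insert.prems by auto
  then show ?thesis using h(3) gQ[OF assms(3)] g(2) False by simp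
 qed (use h(2) in simp)
 moreover have "weight (F (h (g y))) l = weight (F y) l" if "y \<in> Q" "l \<noteq> i" "l \<notin> insert k K" for y l
  using g(3) h(3) gQ that by simp
 ultimately show ?case using isometry_comp[OF g(1) h(1)] by (intro exI[of _ "h \<circ> g"]) (simp add: o_def)
qed

text \<open>The geodesic consists of the real projections onto
  \<open>(cos \<phi>, sin \<phi>)\<close> in the coordinates i and j, and \<open>T x y\<close> is
  the inner product of the matrices. The first moment identity is Parseval over U, whose components
  are equally distributed by unit isometries; the second comes from the sum of the weights, which
  reflections exchange.\<close>

theorem octonionic_two_point_space:
 "\<exists>e w. two_point_space ((CARD('n) - 1) * card U) (card U) Q \<theta> \<mu> F (1/2) e w"
proof -
 obtain I :: "'n set" where "card I = 2" using card ex_card[of 2 "UNIV :: 'n set"] by auto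
 then obtain i j :: 'n where ij: "i \<noteq> j" by (auto simp: card_2_iff)
 define P :: "real \<Rightarrow> 'n \<Rightarrow> real" where "P \<phi> k = (if k = i then cos \<phi> else if k = j then sin \<phi> else 0)" for \<phi> k
 define E :: "real \<Rightarrow> oct^'n^'n" where "E \<phi> = (\<chi> k l. (P \<phi> k * P \<phi> l) *\<^sub>R oone)" for \<phi>
 have P: "P \<phi> i = cos \<phi>" "P \<phi> j = sin \<phi>" "\<And>k. k \<noteq> i \<Longrightarrow> k \<noteq> j \<Longrightarrow> P \<phi> k = 0" for \<phi> using ij by (auto simp: P_def)
 have Psum: "(\<Sum>k\<in>UNIV. P \<phi> k *\<^sub>R f k) = cos \<phi> *\<^sub>R f i + sin \<phi> *\<^sub>R f j" for \<phi> and f :: "'n \<Rightarrow> 'v::real_vector"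
 proof -
  have "(\<Sum>k\<in>UNIV. P \<phi> k *\<^sub>R f k) = (\<Sum>k\<in>{i, j}. P \<phi> k *\<^sub>R f k)" using P(3) by (intro sum.mono_neutral_right) auto
  then show ?thesis using ij by (simp add: P)
 qed
 have PP: "(\<Sum>k\<in>UNIV. P \<phi> k * P \<phi> k) = 1" for \<phi> using Psum[of \<phi> "P \<phi>"] by (simp add: P flip: power2_eq_square)
 have "E \<phi> \<in> proj S" for \<phi>
 proof -
  have "mm (E \<phi>) (E \<phi>) = E \<phi>"
  proof -
   have "(\<Sum>m\<in>UNIV. (P \<phi> m * P \<phi> l * (P \<phi> k * P \<phi> m)) *\<^sub>R oone) = ((P \<phi> k * P \<phi> l) * (\<Sum>m\<in>UNIV. P \<phi> m * P \<phi> m)) *\<^sub>R oone" for k l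
    by (simp add: scaleR_sum_left sum_distrib_left mult_ac)
   then show ?thesis by (simp add: mm_def E_def vec_eq_iff om.scaleR_left om.scaleR_right PP)
  qed
  moreover have "tr (E \<phi>) = oone" by (simp add: tr_def E_def scaleR_sum_left[symmetric] PP)
  moreover have "star (E \<phi>) = E \<phi>" by (simp add: star_def E_def vec_eq_iff linear_cmul[OF linear_ocnj] mult.commute)
  ultimately show ?thesis by (simp add: proj_def, simp add: E_def subspace_scale[OF S S_one])
 qed
 then have img: "E \<phi> \<in> F ` Q" for \<phi> using F by (simp add: bij_betw_def)
 define e where "e \<phi> = inv_into Q F (E \<phi>)" for \<phi>
 have e: "e \<phi> \<in> Q" "F (e \<phi>) = E \<phi>" for \<phi> unfolding e_def by (rule inv_into_into[OF img], rule f_inv_into_f[OF img])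
 define w where "w y = F y$i$j \<bullet> oone" for y
 have T: "T x y = F x \<bullet> F y" if "x \<in> Q" "y \<in> Q" for x y
 proof -
  have "F x \<bullet> F x = 1" "F y \<bullet> F y = 1" using norm_proj[OF F_proj[OF that(1)]] norm_proj[OF F_proj[OF that(2)]] by (simp_all add: norm_eq_1)
  then show ?thesis using inner_commute[of "F x" "F y"]
   by (simp add: T_def power2_norm_eq_inner inner_diff_left inner_diff_right diff_divide_distrib)
 qed
 have Te: "T (e \<phi>) y = (cos \<phi>)^2 * weight (F y) i + (sin \<phi>)^2 * weight (F y) j + 2 * cos \<phi> * sin \<phi> * w y" if y: "y \<in> Q" for \<phi> y
 proof -
  have "F y$j$i \<bullet> oone = F y$i$j \<bullet> oone" unfolding proj_entry[OF F_proj[OF y], of j i] by simp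
  moreover have "T (e \<phi>) y = (\<Sum>k\<in>UNIV. P \<phi> k *\<^sub>R (\<Sum>l\<in>UNIV. P \<phi> l *\<^sub>R (F y$k$l \<bullet> oone)))"
   unfolding T[OF e(1) y] e(2) by (simp add: inner_vec_def E_def sum_distrib_left mult.assoc inner_commute[of oone])
  ultimately show ?thesis unfolding Psum by (simp add: weight_def w_def power2_eq_square algebra_simps)
 qed
 have Ta: "T (e 0) y = weight (F y) i" and Tb: "T (e (pi/2)) y = weight (F y) j" if "y \<in> Q" for y by (simp_all add: Te[OF that])
 have wE: "weight (E \<phi>) k = (P \<phi> k)^2" for \<phi> k by (simp add: weight_def E_def power2_eq_square)
 note nonneg = weight_nonneg[OF F_proj]
 \<comment> \<open>A projection supported on i and j is determined by its two weights and its (i, j)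
   entry; all other entries vanish by \<open>entry_0\<close>.\<close>
 have det: "x = e \<phi>" if x: "x \<in> Q" and k: "\<And>k. k \<noteq> i \<Longrightarrow> k \<noteq> j \<Longrightarrow> weight (F x) k = 0"
  and r: "weight (F x) i = (cos \<phi>)^2" "weight (F x) j = (sin \<phi>)^2" "F x$i$j = (cos \<phi> * sin \<phi>) *\<^sub>R oone" for x \<phi>
 proof (rule F_inj[OF _ x e(1)])
  have "F x$p$q = E \<phi>$p$q" for p q
  proof (cases "p \<in> {i, j} \<and> q \<in> {i, j}")
   case True
   then consider "p = i" "q = i" | "p = j" "q = j" | "p = i" "q = j" | "p = j" "q = i" by blast
   then show ?thesis
   proof cases
    case 4
    then show ?thesis using proj_entry[OF F_proj[OF x], of j i] r(3) by (simp add: E_def P linear_cmul[OF linear_ocnj] mult.commute)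
   qed (use proj_diag[OF F_proj[OF x], of i] proj_diag[OF F_proj[OF x], of j] r in \<open>simp_all add: E_def P power2_eq_square\<close>)
  next
   case False
   then have "weight (F x) p = 0 \<or> weight (F x) q = 0" using k by auto
   then have "F x$p$q = 0" by (rule entry_0[OF F_proj[OF x]])
   moreover have "P \<phi> p = 0 \<or> P \<phi> q = 0" using False P(3) by auto
   ultimately show ?thesis by (auto simp: E_def)
  qed
  then show "F x = F (e \<phi>)" by (simp add: e(2) vec_eq_iff)
 qed
 have e0: "x = e 0" if x: "x \<in> Q" and k: "\<And>k. k \<noteq> i \<Longrightarrow> weight (F x) k = 0" for x
 proof (rule det[OF x])
  have "(\<Sum>k\<in>UNIV. weight (F x) k) = (\<Sum>k\<in>{i}. weight (F x) k)" using k by (intro sum.mono_neutral_right) auto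
  then show "weight (F x) i = (cos 0)^2" using weight_sum[OF F_proj[OF x]] by simp
  show "F x$i$j = (cos 0 * sin 0) *\<^sub>R oone" using entry_0[OF F_proj[OF x], of i j] k ij by simp
 qed (use k ij in auto)
 have fix0: "g (e 0) = e 0" if g: "isometry_of Q \<theta> g" and w: "\<And>k. k \<noteq> i \<Longrightarrow> weight (F (g (e 0))) k = weight (F (e 0)) k" for g
  by (rule e0[OF isometry_in[OF g e(1)]]) (simp add: w e(2) wE P_def)
 have "two_point_space_axioms ((CARD('n) - 1) * card U) (card U) Q \<theta> \<mu> F (1/2) e w"
 proof
  show "e \<phi> \<in> Q" for \<phi> by (rule e)
  show "T (e (pi/2)) (e 0) = 0" using ij by (simp add: Tb[OF e(1)] e wE P_def)
  fix y assume y: "y \<in> Q"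
  show "T (e \<phi>) y = (cos \<phi>)^2 * T (e 0) y + (sin \<phi>)^2 * T (e (pi / 2)) y + 2 * cos \<phi> * sin \<phi> * w y" for \<phi>
   unfolding Ta[OF y] Tb[OF y] by (rule Te[OF y])
  have "\<bar>w y\<bar> \<le> norm (F y$i$j)" unfolding w_def using Cauchy_Schwarz_ineq2[of "F y$i$j" oone] by simp
  then have "(w y)^2 \<le> (norm (F y$i$j))^2" by (metis abs_ge_zero power2_abs power_mono)
  then show "(w y)^2 \<le> T (e 0) y * T (e (pi / 2)) y" unfolding norm_entry[OF F_proj[OF y]] Ta[OF y] Tb[OF y] .
  have "(\<Sum>k\<in>{i, j}. weight (F y) k) \<le> (\<Sum>k\<in>UNIV. weight (F y) k)" using nonneg[OF y] by (intro sum_mono2) auto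
  then show "T (e 0) y + T (e (pi / 2)) y \<le> 1" using ij weight_sum[OF F_proj[OF y]] by (simp add: Ta[OF y] Tb[OF y])
 next
  have "- oone \<in> S" "norm (- oone) = 1" using subspace_neg[OF S S_one] by auto
  from unit_isometry[OF ij this] obtain g where g: "isometry_of Q \<theta> g" "\<forall>x\<in>Q. \<forall>k. weight (F (g x)) k = weight (F x) k"
   "\<forall>x\<in>Q. F (g x)$i$j = omul (- oone) (F x$i$j)" by blast
  have "g (e \<phi>) = e (- \<phi>)" for \<phi>
  proof (rule det[OF isometry_in[OF g(1) e(1)]])
   show "F (g (e \<phi>))$i$j = (cos (- \<phi>) * sin (- \<phi>)) *\<^sub>R oone" using g(3) e by (simp add: E_def P om.minus_left)
  qed (use g(2) e in \<open>simp_all add: wE P\<close>)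
  then show "\<exists>g. isometry_of Q \<theta> g \<and> (\<forall>\<phi>. g (e \<phi>) = e (- \<phi>))" using g(1) by blast
 next
  fix x z assume xz: "x \<in> Q" "z \<in> Q"
  \<comment> \<open>First x is concentrated at i. The weights of z outside i are then collected at j
    by isometries that leave the weight at i alone, so that \<open>e 0\<close> stays in place; a
    unit finally makes the (i, j) entry real.\<close>
  obtain g1 where g1: "isometry_of Q \<theta> g1" "\<forall>k\<in>UNIV - {i}. weight (F (g1 x)) k = 0"
   using concentrate[of "UNIV - {i}" i x] xz(1) by auto
  have x1: "g1 x = e 0" by (rule e0[OF isometry_in[OF g1(1) xz(1)]]) (use g1(2) in auto)
  have z1: "g1 z \<in> Q" by (rule isometry_in[OF g1(1) xz(2)])
  obtain g2 where g2: "isometry_of Q \<theta> g2" "\<forall>k\<in>UNIV - {i, j}. weight (F (g2 (g1 z))) k = 0"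
   "\<forall>y\<in>Q. \<forall>l. l \<noteq> j \<longrightarrow> l \<notin> UNIV - {i, j} \<longrightarrow> weight (F (g2 y)) l = weight (F y) l"
   using concentrate[of "UNIV - {i, j}" j "g1 z"] z1 by auto
  \<comment> \<open>Weight 1 at i leaves no weight elsewhere, which identifies the image of
    \<open>e 0\<close>.\<close>
  have "weight (F (g2 (e 0))) i = 1" using g2(3) e ij by (simp add: wE P)
  moreover have "(\<Sum>k\<in>UNIV. weight (F (g2 (e 0))) k) = weight (F (g2 (e 0))) i + (\<Sum>k\<in>UNIV - {i}. weight (F (g2 (e 0))) k)"
   by (rule sum.remove) auto
  ultimately have "(\<Sum>k\<in>UNIV - {i}. weight (F (g2 (e 0))) k) = 0" using weight_sum[OF F_proj[OF isometry_in[OF g2(1) e(1)]], of 0] by simp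
  then have "weight (F (g2 (e 0))) k = 0" if "k \<noteq> i" for k
   using nonneg[OF isometry_in[OF g2(1) e(1)], of 0] that by (subst (asm) sum_nonneg_eq_0_iff) auto
  then have x2: "g2 (e 0) = e 0" by (intro e0 isometry_in[OF g2(1) e(1)])
  define z2 where "z2 = g2 (g1 z)"
  have z2: "z2 \<in> Q" "\<And>k. k \<noteq> i \<Longrightarrow> k \<noteq> j \<Longrightarrow> weight (F z2) k = 0" using g2 isometry_in[OF g2(1) z1] by (auto simp: z2_def)
  define q where "q = F z2$i$j"
  have "q \<in> S" unfolding q_def using F_proj[OF z2(1)] by (simp add: proj_def)
  from unit_multiplier[OF this] obtain u where u: "u \<in> S" "norm u = 1" "omul u q = norm q *\<^sub>R oone" by blast
  from unit_isometry[OF ij u(1,2)] obtain g3 where g3: "isometry_of Q \<theta> g3" "\<forall>x\<in>Q. \<forall>k. weight (F (g3 x)) k = weight (F x) k"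
   "\<forall>x\<in>Q. F (g3 x)$i$j = omul u (F x$i$j)" by blast
  have x3: "g3 (e 0) = e 0" by (rule fix0[OF g3(1)]) (use g3(2) e in simp)
  have "(\<Sum>k\<in>UNIV. weight (F z2) k) = (\<Sum>k\<in>{i, j}. weight (F z2) k)" using z2(2) by (intro sum.mono_neutral_right) auto
  then have sum: "weight (F z2) i + weight (F z2) j = 1" using weight_sum[OF F_proj[OF z2(1)]] ij by simp
  define \<alpha> where "\<alpha> = sqrt (weight (F z2) i)"
  have \<alpha>: "0 \<le> \<alpha>" "\<alpha> \<le> 1" "\<alpha>^2 = weight (F z2) i"
   using nonneg[OF z2(1), of i] nonneg[OF z2(1), of j] sum by (auto simp: \<alpha>_def)
  define \<phi> where "\<phi> = arccos \<alpha>"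
  have \<phi>: "cos \<phi> = \<alpha>" "0 \<le> \<phi>" "\<phi> \<le> pi / 2" using \<alpha> arccos_le_pi2[of \<alpha>] arccos_lbound[of \<alpha>] by (auto simp: \<phi>_def)
  have sn: "(sin \<phi>)^2 = weight (F z2) j" "sin \<phi> \<ge> 0" using \<phi> \<alpha>(3) sum by (auto simp: sin_squared_eq intro!: sin_ge_zero)
  have "norm q = cos \<phi> * sin \<phi>"
  proof (rule power2_eq_imp_eq)
   show "(norm q)^2 = (cos \<phi> * sin \<phi>)^2"
    unfolding q_def norm_entry[OF F_proj[OF z2(1)]] power_mult_distrib \<phi>(1) \<alpha>(3) sn(1) ..
  qed (use \<alpha> \<phi> sn in auto)
  then have "g3 z2 = e \<phi>"
   by (intro det isometry_in[OF g3(1) z2(1)]) (use g3(2,3) z2 \<alpha>(3) \<phi>(1) sn u(3) in \<open>simp_all add: q_def\<close>)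
  then have "(g3 \<circ> (g2 \<circ> g1)) x = e 0 \<and> (g3 \<circ> (g2 \<circ> g1)) z = e \<phi>" using x1 x2 x3 by (simp add: z2_def)
  then show "\<exists>g \<phi>. isometry_of Q \<theta> g \<and> 0 \<le> \<phi> \<and> \<phi> \<le> pi / 2 \<and> g x = e 0 \<and> g z = e \<phi>"
   using isometry_comp[OF isometry_comp[OF g1(1) g2(1)] g3(1)] \<phi>(2,3) by blast
 next
  fix n :: nat
  have [measurable]: "(\<lambda>y. F y$k$l \<bullet> u) \<in> borel_measurable \<mu>" for k l u
   using measurable_compose[OF emb_measurable borel_measurable_continuous_onI[of "\<lambda>A. A$k$l \<bullet> u"]] by (simp add: continuous_intros)
  have [measurable]: "w \<in> borel_measurable \<mu>" unfolding w_def[abs_def] by measurable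
  have bd: "integrable \<mu> (\<lambda>y. f y * T (e 0) y ^ n)" if "f \<in> borel_measurable \<mu>" "\<And>y. y \<in> Q \<Longrightarrow> \<bar>f y\<bar> \<le> 1" for f
  proof (rule bounded_integrable[where B=1])
   show "\<bar>f y * T (e 0) y ^ n\<bar> \<le> 1" if "y \<in> Q" for y
    using T_ge_0[OF e(1) that, of 0] T_le_1[of "e 0" y] \<open>\<And>y. y \<in> Q \<Longrightarrow> \<bar>f y\<bar> \<le> 1\<close>[OF that]
    by (auto simp: abs_mult intro!: mult_le_one power_le_one)
  qed (use that(1) in measurable)
  have wle: "weight (F y) k \<le> 1" if "y \<in> Q" for y k
   using weight_sum[OF F_proj[OF that]] member_le_sum[of k UNIV "weight (F y)"] nonneg[OF that] by simp
  \<comment> \<open>Multiplication by \<open>ocnj u\<close> turns the component along u into the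
    real part \<open>w\<close> and keeps the weights.\<close>
  have unit: "(\<integral>y. (F y$i$j \<bullet> u)^2 * T (e 0) y ^ n \<partial>\<mu>) = (\<integral>y. (w y)^2 * T (e 0) y ^ n \<partial>\<mu>)" if u: "u \<in> U" for u
  proof -
   have "ocnj u \<in> S" "norm (ocnj u) = 1" using subsetD[OF U(3) u] U(4)[OF u] S_cnj by simp_all
   from unit_isometry[OF ij this] obtain g where g: "isometry_of Q \<theta> g" "\<forall>x\<in>Q. \<forall>k. weight (F (g x)) k = weight (F x) k"
    "\<forall>x\<in>Q. F (g x)$i$j = omul (ocnj u) (F x$i$j)" by blast
   have "(\<integral>y. (w y)^2 * T (e 0) y ^ n \<partial>\<mu>) = (\<integral>y. (w (g y))^2 * T (e 0) (g y) ^ n \<partial>\<mu>)"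
    by (rule isometry_integral[OF g(1), symmetric]) measurable
   also have "\<dots> = (\<integral>y. (F y$i$j \<bullet> u)^2 * T (e 0) y ^ n \<partial>\<mu>)" by (rule bochner_cong)
     (use g isometry_in[OF g(1)] in \<open>auto simp: w_def inner_omul_oone Ta inner_commute[of u]\<close>)
   finally show ?thesis by simp
  qed
  have "real (card U) * (\<integral>y. (w y)^2 * T (e 0) y ^ n \<partial>\<mu>) = (\<Sum>u\<in>U. \<integral>y. (F y$i$j \<bullet> u)^2 * T (e 0) y ^ n \<partial>\<mu>)"
   by (simp add: unit)
  also have "\<dots> = (\<integral>y. (\<Sum>u\<in>U. (F y$i$j \<bullet> u)^2 * T (e 0) y ^ n) \<partial>\<mu>)"
  proof (rule bochner_sum[symmetric], rule bd)
   fix u y assume u: "u \<in> U" and y: "y \<in> Q"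
   have "(norm (F y$i$j))^2 \<le> 1^2" unfolding norm_entry[OF F_proj[OF y]] using wle[OF y] nonneg[OF y] by (simp add: mult_le_one)
   then have "norm (F y$i$j) \<le> 1" by (rule power2_le_imp_le) simp
   then have "\<bar>F y$i$j \<bullet> u\<bar> \<le> 1" using Cauchy_Schwarz_ineq2[of "F y$i$j" u] U(4)[OF u] by simp
   then show "\<bar>(F y$i$j \<bullet> u)\<^sup>2\<bar> \<le> 1" by (simp add: abs_square_le_1)
  qed measurable
  also have "\<dots> = (\<integral>y. T (e (pi/2)) y * T (e 0) y ^ Suc n \<partial>\<mu>)"
  proof (rule bochner_cong)
   fix y assume "y \<in> space \<mu>"
   then have y: "y \<in> Q" by simp
   have "(\<Sum>u\<in>U. (F y$i$j \<bullet> u)^2) = (norm (F y$i$j))^2"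
    using U(5)[of "F y$i$j"] F_proj[OF y] by (simp add: proj_def inner_commute)
   then show "(\<Sum>u\<in>U. (F y$i$j \<bullet> u)^2 * T (e 0) y ^ n) = T (e (pi/2)) y * T (e 0) y ^ Suc n"
    unfolding sum_distrib_right[symmetric] norm_entry[OF F_proj[OF y]] Ta[OF y] Tb[OF y] by simp
  qed simp
  finally show "real (card U) * (\<integral>y. (w y)^2 * T (e 0) y ^ n \<partial>\<mu>) = (\<integral>y. T (e (pi/2)) y * T (e 0) y ^ Suc n \<partial>\<mu>)" .
  have wm [measurable]: "(\<lambda>y. weight (F y) k) \<in> borel_measurable \<mu>" for k unfolding weight_def by measurable
  have swap: "(\<integral>y. weight (F y) l * T (e 0) y ^ n \<partial>\<mu>) = (\<integral>y. T (e (pi/2)) y * T (e 0) y ^ n \<partial>\<mu>)" if l: "l \<noteq> i" for l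
  proof (cases "l = j")
   case True
   then show ?thesis by (intro bochner_cong) (auto simp: Tb)
  next
   case False
   \<comment> \<open>The reflection along this vector transposes the coordinates j and l.\<close>
   define v :: "real^'n" where "v = (\<chi> p. if p = j then 1 / sqrt 2 else if p = l then - 1 / sqrt 2 else 0)"
   have v: "v$j = 1 / sqrt 2" "v$l = - 1 / sqrt 2" "\<And>p. p \<noteq> j \<Longrightarrow> p \<noteq> l \<Longrightarrow> v$p = 0" using False by (auto simp: v_def)
   have "v \<bullet> v = (\<Sum>p\<in>{j, l}. v$p * v$p)" unfolding inner_vec_def using v(3) by (intro sum.mono_neutral_cong_right) auto
   also have "\<dots> = 1" using False by (simp add: v)
   finally have "v \<bullet> v = 1" .
   from householder_isometry[OF this] obtain g where g: "isometry_of Q \<theta> g" "\<forall>y\<in>Q. F (g y) = householder v (F y)" by blast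
   have hs: "householder v X$k$k = (let B = \<lambda>p. X$p$k - (2 * v$k) *\<^sub>R (v$j *\<^sub>R X$p$j + v$l *\<^sub>R X$p$l) in
     B k - (2 * v$k) *\<^sub>R (v$j *\<^sub>R B j + v$l *\<^sub>R B l))" for X k
    by (rule householder_support[OF _ False[symmetric]]) (rule v(3))
   have half: "(2 * (1 / sqrt 2)) *\<^sub>R ((1 / sqrt 2) *\<^sub>R x + (- 1 / sqrt 2) *\<^sub>R y) = x - y" for x y :: oct
    by (simp add: scaleR_diff_right)
   have "householder v X$j$j = X$l$l" "householder v X$i$i = X$i$i" for X unfolding hs Let_def v half using v(3)[of i] ij l by simp_all
   then have wg: "weight (F (g y)) j = weight (F y) l" "weight (F (g y)) i = weight (F y) i" if "y \<in> Q" for y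
    using g(2) that by (simp_all add: weight_def)
   have "(\<integral>y. T (e (pi/2)) y * T (e 0) y ^ n \<partial>\<mu>) = (\<integral>y. T (e (pi/2)) (g y) * T (e 0) (g y) ^ n \<partial>\<mu>)"
    by (rule isometry_integral[OF g(1), symmetric]) measurable
   also have "\<dots> = (\<integral>y. weight (F y) l * T (e 0) y ^ n \<partial>\<mu>)"
    by (rule bochner_cong) (use isometry_in[OF g(1)] in \<open>auto simp: wg Ta Tb\<close>)
   finally show ?thesis by simp
  qed
  have "real (CARD('n) - 1) * (\<integral>y. T (e (pi/2)) y * T (e 0) y ^ n \<partial>\<mu>) = (\<Sum>l\<in>UNIV - {i}. \<integral>y. weight (F y) l * T (e 0) y ^ n \<partial>\<mu>)"
   using swap by (simp add: card_Diff_singleton)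
  also have "\<dots> = (\<integral>y. (\<Sum>l\<in>UNIV - {i}. weight (F y) l * T (e 0) y ^ n) \<partial>\<mu>)"
   by (intro bochner_sum[symmetric] bd wm) (use wle nonneg in \<open>simp add: abs_le_iff order_trans[of _ 0]\<close>)
  also have "\<dots> = (\<integral>y. (1 - T (e 0) y) * T (e 0) y ^ n \<partial>\<mu>)"
  proof (rule bochner_cong)
   fix y assume "y \<in> space \<mu>"
   then have y: "y \<in> Q" by simp
   have "(\<Sum>l\<in>UNIV - {i}. weight (F y) l) = 1 - T (e 0) y" using weight_sum[OF F_proj[OF y]] by (simp add: sum_diff1 Ta[OF y])
   then show "(\<Sum>l\<in>UNIV - {i}. weight (F y) l * T (e 0) y ^ n) = (1 - T (e 0) y) * T (e 0) y ^ n"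
    by (simp add: sum_distrib_right[symmetric])
  qed simp
  finally show "real ((CARD('n) - 1) * card U) * (\<integral>y. T (e (pi/2)) y * T (e 0) y ^ n \<partial>\<mu>) =
    real (card U) * (\<integral>y. (1 - T (e 0) y) * T (e 0) y ^ n \<partial>\<mu>)" by (simp only: of_nat_mult mult_ac)
 qed
 moreover have "jacobi_weight ((CARD('n) - 1) * card U) (card U)"
 proof
  have "card U > 0" using U(1,2) by (simp add: card_gt_0_iff)
  then show "1 \<le> card U" "1 \<le> (CARD('n) - 1) * card U" using card by auto
 qed
 ultimately have "two_point_space ((CARD('n) - 1) * card U) (card U) Q \<theta> \<mu> F (1/2) e w"
  by (intro two_point_space.intro embedded_space_axioms)
 then show ?thesis by blast
qed

end

text \<open>Transport along an embedding \<open>\<iota>\<close> of the coefficient algebra into the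
  octonions: it respects sums, products, conjugation and norms, so Hermitian idempotents of trace 1
  and their distances correspond on both sides.\<close>

lemma projective_two_point_space:
 fixes f :: "'a \<Rightarrow> ('f::conjugation_algebra)^'n::finite^'n" and \<iota> :: "'f \<Rightarrow> oct"
 assumes model: "projective_model f Q \<theta>" and inv: "invariant_measure Q \<theta> \<mu>" and card: "CARD('n) \<ge> 3"
  and inj: "inj \<iota>" and add: "\<And>x y. \<iota> (x + y) = \<iota> x + \<iota> y" and mul: "\<And>x y. \<iota> (x * y) = omul (\<iota> x) (\<iota> y)"
  and one: "\<iota> 1 = oone" and cj: "\<And>x. \<iota> (conjugate x) = ocnj (\<iota> x)" and nm: "\<And>x. norm (\<iota> x) = modulus x"
  and scale: "\<And>c x. \<exists>y. c *\<^sub>R \<iota> x = \<iota> y"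
  and assoc: "CARD('n) = 3 \<or> (\<forall>x y z. omul (omul (\<iota> x) (\<iota> y)) (\<iota> z) = omul (\<iota> x) (omul (\<iota> y) (\<iota> z)))"
  and U: "finite U" "U \<noteq> {}" "U \<subseteq> range \<iota>" "\<And>u. u \<in> U \<Longrightarrow> norm u = 1" "\<And>x. (\<Sum>u\<in>U. (u \<bullet> \<iota> x)^2) = (norm (\<iota> x))^2"
 shows "\<exists>(F :: 'a \<Rightarrow> oct^'n^'n) e w. two_point_space ((CARD('n) - 1) * card U) (card U) Q \<theta> \<mu> F (1/2) e w"
proof -
 define G :: "'f^'n^'n \<Rightarrow> oct^'n^'n" where "G B = (\<chi> k l. \<iota> (B$k$l))" for B
 define F where "F x = G (f x)" for x
 have i_eq: "\<iota> x = \<iota> y \<longleftrightarrow> x = y" for x y using inj by (auto dest: injD)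
 have zero: "\<iota> 0 = 0" using add[of 0 0] by simp
 have diff: "\<iota> (x - y) = \<iota> x - \<iota> y" for x y using add[of "x - y" y] by simp
 have sm: "\<iota> (\<Sum>k\<in>K. h k) = (\<Sum>k\<in>K. \<iota> (h k))" for h :: "'n \<Rightarrow> 'f" and K
  by (induction K rule: infinite_finite_induct) (simp_all add: zero add)
 have G_proj: "G B \<in> proj (range \<iota>) \<longleftrightarrow> B \<in> projective_space" for B
 proof -
  have "star (G B) = G B \<longleftrightarrow> (\<forall>k l. B$l$k = conjugate (B$k$l))"
   by (simp add: star_def G_def vec_eq_iff cj[symmetric] i_eq) metis
  moreover have "mm (G B) (G B) = G B \<longleftrightarrow> (\<forall>k l. (\<Sum>m\<in>UNIV. B$k$m * B$m$l) = B$k$l)"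
   by (simp add: mm_def G_def vec_eq_iff mul[symmetric] sm[symmetric] i_eq)
  moreover have "tr (G B) = oone \<longleftrightarrow> (\<Sum>k\<in>UNIV. B$k$k) = 1" by (simp add: tr_def G_def sm[symmetric] one[symmetric] i_eq)
  ultimately show ?thesis by (simp add: proj_def projective_space_def) (simp add: G_def)
 qed
 have "bij_betw G projective_space (proj (range \<iota>))"
 proof (rule bij_betwI')
  show "G A = G B \<longleftrightarrow> A = B" for A B by (auto simp: G_def vec_eq_iff i_eq)
  show "G A \<in> proj (range \<iota>)" if "A \<in> projective_space" for A using that by (simp add: G_proj)
  fix A :: "oct^'n^'n" assume A: "A \<in> proj (range \<iota>)"
  then have "A = G (\<chi> k l. inv_into UNIV \<iota> (A$k$l))" by (simp add: G_def vec_eq_iff proj_def f_inv_into_f)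
  then show "\<exists>B\<in>projective_space. A = G B" using A G_proj by metis
 qed
 then have F: "bij_betw F Q (proj (range \<iota>))"
  using model bij_betw_trans[of f Q projective_space G] unfolding projective_model_def F_def[abs_def] comp_def by blast
 have frob: "norm (F x - F y) = frobenius_norm (f x - f y)" for x y
  by (simp add: F_def G_def frobenius_norm_def norm_vec_def L2_set_def sum_nonneg diff[symmetric] nm)
 have "octonionic_plane (range \<iota>) U Q \<theta> \<mu> F"
 proof
  have "c *\<^sub>R \<iota> x \<in> range \<iota>" for c x using scale[of c x] by auto
  then show "subspace (range \<iota>)" unfolding subspace_def using zero[symmetric] add[symmetric] by (auto intro: range_eqI)
  show "CARD('n) = 3 \<or> (\<forall>a\<in>range \<iota>. \<forall>b\<in>range \<iota>. \<forall>c\<in>range \<iota>. omul (omul a b) c = omul a (omul b c))" using assoc by blast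
  show "omul a b \<in> range \<iota>" if "a \<in> range \<iota>" "b \<in> range \<iota>" for a b using that mul[symmetric] by auto
  show "ocnj a \<in> range \<iota>" if "a \<in> range \<iota>" for a using that cj[symmetric] by auto
  show "(\<Sum>u\<in>U. (u \<bullet> q)^2) = (norm q)^2" if "q \<in> range \<iota>" for q using that U(5) by blast
  show "oone \<in> range \<iota>" using one[symmetric] by simp
  fix x y assume "x \<in> Q" "y \<in> Q"
  then show "0 \<le> \<theta> x y \<and> \<theta> x y \<le> pi" "sin (\<theta> x y / 2) = 1 / sqrt 2 * norm (F x - F y)"
   using model unfolding frob projective_model_def by blast+
 qed (use U(1-4) F inv card in simp_all)
 then show ?thesis by (intro exI[of _ F] octonionic_plane.octonionic_two_point_space)
qed

lemmas embedding_defs = oct_defs zero_prod_def inner_prod_def inner_complex_def norm_Pair cmod_def power2_eq_square algebra_simps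

section \<open>The four coefficient algebras inside the octonions\<close>

lemma real_projective:
 fixes f :: "'a \<Rightarrow> real^'n::finite^'n"
 assumes "projective_model f Q \<theta>" "invariant_measure Q \<theta> \<mu>" "CARD('n) \<ge> 3"
 shows "\<exists>(F :: 'a \<Rightarrow> oct^'n^'n) e w. two_point_space ((CARD('n) - 1) * 1) 1 Q \<theta> \<mu> F (1/2) e w"
proof -
 let ?U = "{((1, 0), 0)} :: oct set" and ?i = "\<lambda>r. ((complex_of_real r, 0), 0) :: oct"
 have "\<exists>(F :: 'a \<Rightarrow> oct^'n^'n) e w. two_point_space ((CARD('n) - 1) * card ?U) (card ?U) Q \<theta> \<mu> F (1/2) e w"
 proof (rule projective_two_point_space[OF assms, where \<iota> = ?i])
  show "\<exists>y. c *\<^sub>R ?i x = ?i y" for c x by (intro exI[of _ "c * x"]) (simp add: scaleR_conv_of_real)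
 qed (auto simp: embedding_defs conjugate_real_def modulus_real_def inj_def intro: range_eqI[of _ _ 1])
 then show ?thesis by simp
qed

lemma complex_projective:
 fixes f :: "'a \<Rightarrow> complex^'n::finite^'n"
 assumes "projective_model f Q \<theta>" "invariant_measure Q \<theta> \<mu>" "CARD('n) \<ge> 3"
 shows "\<exists>(F :: 'a \<Rightarrow> oct^'n^'n) e w. two_point_space ((CARD('n) - 1) * 2) 2 Q \<theta> \<mu> F (1/2) e w"
proof -
 let ?U = "{((1, 0), 0), ((\<i>, 0), 0)} :: oct set" and ?i = "\<lambda>z. ((z, 0), 0) :: oct"
 have c: "card ?U = 2" by (simp add: complex_eq_iff)
 have "\<exists>(F :: 'a \<Rightarrow> oct^'n^'n) e w. two_point_space ((CARD('n) - 1) * card ?U) (card ?U) Q \<theta> \<mu> F (1/2) e w"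
 proof (rule projective_two_point_space[OF assms, where \<iota> = ?i])
  show "\<exists>y. c *\<^sub>R ?i x = ?i y" for c x by (intro exI[of _ "c *\<^sub>R x"]) simp
 qed (auto simp: embedding_defs conjugate_complex_def modulus_complex_def inj_def complex_eq_iff)
 then show ?thesis unfolding c .
qed

lemma quaternionic_projective:
 fixes f :: "'a \<Rightarrow> quaternion^'n::finite^'n"
 assumes "projective_model f Q \<theta>" "invariant_measure Q \<theta> \<mu>" "CARD('n) \<ge> 3"
 shows "\<exists>(F :: 'a \<Rightarrow> oct^'n^'n) e w. two_point_space ((CARD('n) - 1) * 4) 4 Q \<theta> \<mu> F (1/2) e w"
proof -
 let ?U = "{((1, 0), 0), ((\<i>, 0), 0), ((0, 1), 0), ((0, \<i>), 0)} :: oct set" and ?i = "\<lambda>q. ((cd1 q, cd2 q), 0) :: oct"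
 have c: "card ?U = 4" by (simp add: complex_eq_iff)
 have "\<exists>(F :: 'a \<Rightarrow> oct^'n^'n) e w. two_point_space ((CARD('n) - 1) * card ?U) (card ?U) Q \<theta> \<mu> F (1/2) e w"
 proof (rule projective_two_point_space[OF assms, where \<iota> = ?i])
  show "\<exists>y. c *\<^sub>R ?i x = ?i y" for c x by (intro exI[of _ "CD (c *\<^sub>R cd1 x) (c *\<^sub>R cd2 x)"]) simp
  have "((x, y), 0) \<in> range ?i" for x y by (rule range_eqI[of _ _ "CD x y"]) simp
  then show "?U \<subseteq> range ?i" by blast
  show "norm (?i x) = modulus x" for x by (simp add: norm_Pair modulus_cayley_dickson_def modulus_complex_def)
 qed (auto simp: embedding_defs conjugate_complex_def conjugate_cayley_dickson_def
    times_cayley_dickson_def plus_cayley_dickson_def one_cayley_dickson_def inj_def intro: cayley_dickson.expand)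
 then show ?thesis unfolding c .
qed

lemma octonionic_projective:
 fixes f :: "'a \<Rightarrow> octonion^'n::finite^'n"
 assumes "projective_model f Q \<theta>" "invariant_measure Q \<theta> \<mu>" "CARD('n) = 3"
 shows "\<exists>(F :: 'a \<Rightarrow> oct^'n^'n) e w. two_point_space ((CARD('n) - 1) * 8) 8 Q \<theta> \<mu> F (1/2) e w"
proof -
 let ?B = "{((1, 0), 0), ((\<i>, 0), 0), ((0, 1), 0), ((0, \<i>), 0)} \<union> {(0, (1, 0)), (0, (\<i>, 0)), (0, (0, 1)), (0, (0, \<i>))} :: oct set"
 let ?i = "\<lambda>q. ((cd1 (cd1 q), cd2 (cd1 q)), (cd1 (cd2 q), cd2 (cd2 q))) :: oct"
 have c: "card ?B = 8" by (simp add: complex_eq_iff zero_prod_def)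
 have "\<exists>(F :: 'a \<Rightarrow> oct^'n^'n) e w. two_point_space ((CARD('n) - 1) * card ?B) (card ?B) Q \<theta> \<mu> F (1/2) e w"
 proof (rule projective_two_point_space[OF assms(1,2), where \<iota> = ?i])
  show "\<exists>y. c *\<^sub>R ?i x = ?i y" for c x
   by (intro exI[of _ "CD (CD (c *\<^sub>R cd1 (cd1 x)) (c *\<^sub>R cd2 (cd1 x))) (CD (c *\<^sub>R cd1 (cd2 x)) (c *\<^sub>R cd2 (cd2 x)))"]) simp
  have "x \<in> range ?i" for x by (rule range_eqI[of _ _ "CD (CD (fst (fst x)) (snd (fst x))) (CD (fst (snd x)) (snd (snd x)))"]) simp
  then show "?B \<subseteq> range ?i" by blast
  show "norm (?i x) = modulus x" for x by (simp add: norm_Pair modulus_cayley_dickson_def modulus_complex_def)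
  show "inj ?i" by (auto simp: inj_def intro: cayley_dickson.expand)
  show "(\<Sum>u\<in>?B. (u \<bullet> ?i x)^2) = (norm (?i x))^2" for x
   unfolding power2_norm_eq_inner by (simp add: inner_prod_def inner_complex_def complex_eq_iff zero_prod_def power2_eq_square)
 qed (use assms(3) in \<open>auto simp: oct_defs norm_Pair zero_prod_def conjugate_complex_def conjugate_cayley_dickson_def
    times_cayley_dickson_def plus_cayley_dickson_def one_cayley_dickson_def zero_cayley_dickson_def
    minus_cayley_dickson_def uminus_cayley_dickson_def algebra_simps\<close>)
 then show ?thesis unfolding c .
qed

theorem theorem2p2:
 fixes Q :: "'a set" and \<theta> :: "'a \<Rightarrow> 'a \<Rightarrow> real" and \<mu> :: "'a measure" and d d0 :: nat
 assumes "two_point_homogeneous_space TYPE('n::finite) d d0 Q \<theta>"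
  and "invariant_measure Q \<theta> \<mu>"
 shows "\<exists>c C c1 C1 :: (real \<Rightarrow> real) \<Rightarrow> real.
  (\<forall>\<eta>\<in>weight_class d d0. \<not> (AE r in lebesgue_on {0..pi}. \<eta> r = 0) \<longrightarrow>
    0 < c \<eta> \<and> 0 < C \<eta> \<and> 0 < c1 \<eta> \<and> 0 < C1 \<eta> \<and>
    (\<forall>N::nat. N \<ge> 1 \<longrightarrow>
     mean_dist \<mu> (symdiff_metric Q \<theta> \<mu> \<eta>) * real N ^ 2 - c \<eta> * real N powr (1 - 1 / real d)
      > max_dist_sum Q (symdiff_metric Q \<theta> \<mu> \<eta>) N \<and>
     max_dist_sum Q (symdiff_metric Q \<theta> \<mu> \<eta>) N
      > mean_dist \<mu> (symdiff_metric Q \<theta> \<mu> \<eta>) * real N ^ 2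
       - C \<eta> * real N powr (1 - 1 / real d) \<and>
     c1 \<eta> * real N powr (1 - 1 / real d) < min_discrepancy Q \<theta> \<mu> \<eta> N \<and>
     min_discrepancy Q \<theta> \<mu> \<eta> N < C1 \<eta> * real N powr (1 - 1 / real d))) \<and>
  0 < c sin \<and> 0 < C sin \<and>
  (\<forall>N::nat. N \<ge> 1 \<longrightarrow>
    mean_dist \<mu> (chordal_metric \<theta>) * real N ^ 2 - c sin * real N powr (1 - 1 / real d)
     > max_dist_sum Q (chordal_metric \<theta>) N \<and>
    max_dist_sum Q (chordal_metric \<theta>) N
     > mean_dist \<mu> (chordal_metric \<theta>) * real N ^ 2 - C sin * real N powr (1 - 1 / real d))"
 using assms(1) unfolding two_point_homogeneous_space_def
proof (elim disjE conjE exE)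
 fix f :: "'a \<Rightarrow> real^'n"
 assume "CARD('n) \<ge> 2" "d0 = d" "d = CARD('n) - 1" "sphere_model f Q \<theta>"
 then have "\<exists>e w. two_point_space d d0 Q \<theta> \<mu> f (1/4) e w" using sphere_two_point_space[OF _ _ assms(2), of f] by simp
 then show ?thesis by (elim exE) (rule two_point_space.two_point_space_bounds)
next
 fix f :: "'a \<Rightarrow> real^'n^'n"
 assume "CARD('n) \<ge> 3" "d0 = 1" "d = (CARD('n) - 1) * d0" "projective_model f Q \<theta>"
 then have "\<exists>(F :: 'a \<Rightarrow> oct^'n^'n) e w. two_point_space d d0 Q \<theta> \<mu> F (1/2) e w" using real_projective[OF _ assms(2), of f] by simp
 then show ?thesis by (elim exE) (rule two_point_space.two_point_space_bounds)
next
 fix f :: "'a \<Rightarrow> complex^'n^'n"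
 assume "CARD('n) \<ge> 3" "d0 = 2" "d = (CARD('n) - 1) * d0" "projective_model f Q \<theta>"
 then have "\<exists>(F :: 'a \<Rightarrow> oct^'n^'n) e w. two_point_space d d0 Q \<theta> \<mu> F (1/2) e w" using complex_projective[OF _ assms(2), of f] by simp
 then show ?thesis by (elim exE) (rule two_point_space.two_point_space_bounds)
next
 fix f :: "'a \<Rightarrow> quaternion^'n^'n"
 assume "CARD('n) \<ge> 3" "d0 = 4" "d = (CARD('n) - 1) * d0" "projective_model f Q \<theta>"
 then have "\<exists>(F :: 'a \<Rightarrow> oct^'n^'n) e w. two_point_space d d0 Q \<theta> \<mu> F (1/2) e w" using quaternionic_projective[OF _ assms(2), of f] by simp
 then show ?thesis by (elim exE) (rule two_point_space.two_point_space_bounds)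
next
 fix f :: "'a \<Rightarrow> octonion^'n^'n"
 assume "CARD('n) = 3" "d0 = 8" "d = (CARD('n) - 1) * d0" "projective_model f Q \<theta>"
 then have "\<exists>(F :: 'a \<Rightarrow> oct^'n^'n) e w. two_point_space d d0 Q \<theta> \<mu> F (1/2) e w" using octonionic_projective[OF _ assms(2), of f] by simp
 then show ?thesis by (elim exE) (rule two_point_space.two_point_space_bounds)
qed

end
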